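(* Let $\beta\in(0,2)$, $\alpha>0$, $\gamma\in\mathbb{R}$ with $\alpha\beta>2$ and $\gamma>-1/\beta$. Let $L=(L_t)_{t\in\mathbb{R}}$ be a two-sided Lévy process with $L_0=0$ a.s., no Gaussian component, and Lévy measure $\nu$ having a density $\kappa$ such that, for some constant $C_0>0$, $\kappa(x)\le C_0|x|^{-1-\beta}$ for all $x\in\mathbb{R}\setminus\{0\}$. Let $g:\mathbb{R}\to\mathbb{R}$ be a measurable function such that the stochastic integrals $X_t=\int_{-\infty}^t g(t-s)\,dL_s$, $t\in\mathbb{R}$, exist, and such that for some finite constant $K>0$ $$|g(x)|\le K\big(x^{\gamma}\mathbf{1}_{\{0<x<1\}}+x^{-\alpha}\mathbf{1}_{\{x\ge 1\}}\big)\qquad\text{for all }x>0 .$$ Let $f\in C_b^2(\mathbb{R})$, and for $n\in\mathbb{N}$ put $$V_n=\frac{1}{\sqrt n}\sum_{t=1}^n\big(f(X_t)-\mathbb{E}[f(X_1)]\big),\qquad v_n=\sqrt{\mathrm{var}(V_n)} .$$ Let $Z\sim\mathcal{N}(0,1)$. Then the series $$v^2=\sum_{j\in\mathbb{Z}}\mathrm{cov}\big(f(X_0),f(X_j)\big)$$ converges absolutely, $v^2\ge 0$, and $v_n\to v$ as $n\to\infty$, where $v\ge 0$ is the square root of $v^2$. Suppose moreover that $v>0$. Then $v_n^{-1}V_n$ converges in distribution to $\mathcal{N}(0,1)$ as $n\to\infty$. Moreover, there is a constant $C>0$ that does not depend on $n$ such that, for each $n\in\mathbb{N}$ with $v_n>0$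 (and $n\ge 2$ in the cases containing $\log(n)$), $$d_W\left(v_n^{-1}V_n,Z\right)\le C\begin{cases} n^{-1/2} & \text{if }\alpha\beta>3,\\ n^{-1/2}\log(n) & \text{if }\alpha\beta=3,\\ n^{(2-\alpha\beta)/2} & \text{if }2<\alpha\beta<3,\end{cases}$$ and $$d_K\left(v_n^{-1}V_n,Z\right)\le C\begin{cases} n^{-1/2} & \text{if }\alpha\beta>4,\\ n^{-1/2}\log(n) & \text{if }\alpha\beta=4,\\ n^{(2-\alpha\beta)/4} & \text{if }2<\alpha\beta<4.\end{cases}$$
   Context: $C_b^2(\mathbb{R})$ is the space of twice continuously differentiable $f:\mathbb{R}\to\mathbb{R}$ with $f,f',f''$ bounded. That $L$ has no Gaussian component and Lévy measure $\nu$ means $\mathbb{E}[e^{i\theta L_1}]=\exp\big(\int_{\mathbb{R}}(e^{i\theta x}-1-i\theta x\chi(x))\,\nu(dx)+ib\theta\big)$ for all $\theta\in\mathbb{R}$, where $b\in\mathbb{R}$ and $\chi$ is a truncation function (bounded, measurable, $\chi(x)=1+o(|x|)$ as $x\to0$, $\chi(x)=O(|x|^{-1})$ as $|x|\to\infty$). Stochastic integrals of deterministic functions with respect to $L$ are understood in the usual sense of Rajput and Rosiński. The Wasserstein distance is $d_W(F,G)=\sup_h|\mathbb{E}[h(F)]-\mathbb{E}[h(G)]|$, the supremum being over all functions $h:\mathbb{R}\to\mathbb{R}$ that are Lipschitz with constant at most $1$. The Kolmogorov distance is $d_K(F,G)=\sup_{x\in\mathbb{R}}|\mathbb{P}(F\le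 x)-\mathbb{P}(G\le x)|$. *)

theory Defs
  imports "HOL-Probability.Probability" "HOL-Library.Landau_Symbols"
begin

definition cadlag :: "(real \<Rightarrow> real) \<Rightarrow> bool" where
  "cadlag x \<longleftrightarrow>
     (\<forall>t. continuous (at_right t) x \<and> (\<exists>l. (x \<longlongrightarrow> l) (at_left t)))"

definition tendsto_in_prob ::
    "'a measure \<Rightarrow> ('i \<Rightarrow> 'a \<Rightarrow> real) \<Rightarrow> ('a \<Rightarrow> real) \<Rightarrow> 'i filter \<Rightarrow> bool" where
  "tendsto_in_prob M Y Y' F \<longleftrightarrow>
     (\<forall>\<epsilon>>0. ((\<lambda>i. measure M {\<omega>\<in>space M. \<epsilon> < \<bar>Y i \<omega> - Y' \<omega>\<bar>}) \<longlongrightarrow> 0) F)"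

definition two_sided_levy_process :: "'a measure \<Rightarrow> (real \<Rightarrow> 'a \<Rightarrow> real) \<Rightarrow> bool" where
  "two_sided_levy_process M L \<longleftrightarrow>
     (\<forall>t. L t \<in> borel_measurable M) \<and>
     (AE \<omega> in M. L 0 \<omega> = 0) \<and>
     (\<forall>n (\<tau> :: nat \<Rightarrow> real). strict_mono_on {..n} \<tau> \<longrightarrow>
        prob_space.indep_vars M (\<lambda>_. borel)
          (\<lambda>i \<omega>. L (\<tau> (Suc i)) \<omega> - L (\<tau> i) \<omega>) {..<n}) \<and>
     (\<forall>s t h. s \<le> t \<longrightarrow>
        distr M borel (\<lambda>\<omega>. L (t + h) \<omega> - L (s + h) \<omega>) =
        distr M borel (\<lambda>\<omega>. L t \<omega> - L s \<omega>)) \<and>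
     (\<forall>t. tendsto_in_prob M L (L t) (at t)) \<and>
     (AE \<omega> in M. cadlag (\<lambda>t. L t \<omega>))"

definition levy_measure :: "real measure \<Rightarrow> bool" where
  "levy_measure \<nu> \<longleftrightarrow>
     sets \<nu> = sets borel \<and> emeasure \<nu> {0} = 0 \<and>
     (\<integral>\<^sup>+ x. ennreal (min 1 (x\<^sup>2)) \<partial>\<nu>) < \<infinity>"

definition truncation_function :: "(real \<Rightarrow> real) \<Rightarrow> bool" where
  "truncation_function h \<longleftrightarrow>
     bounded (range h) \<and> h \<in> borel_measurable borel \<and>
     (\<lambda>x. h x - 1) \<in> o[at 0](\<lambda>x. \<bar>x\<bar>) \<and>
     h \<in> O[at_infinity](\<lambda>x. inverse \<bar>x\<bar>)"

definition no_gaussian_with_levy_measure ::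
    "'a measure \<Rightarrow> (real \<Rightarrow> 'a \<Rightarrow> real) \<Rightarrow> real measure \<Rightarrow> bool" where
  "no_gaussian_with_levy_measure M L \<nu> \<longleftrightarrow>
     levy_measure \<nu> \<and>
     (\<exists>h b. truncation_function h \<and>
        (\<forall>\<theta>. char (distr M borel (L 1)) \<theta> =
           exp ((\<integral>x. (iexp (\<theta> * x) - 1 - \<i> * complex_of_real (\<theta> * x * h x)) \<partial>\<nu>)
                + \<i> * complex_of_real (b * \<theta>))))"

definition bounded_borel :: "real set set" where
  "bounded_borel = {A \<in> sets borel. bounded A}"

definition independently_scattered ::
    "'a measure \<Rightarrow> (real set \<Rightarrow> 'a \<Rightarrow> real) \<Rightarrow> bool" where
  "independently_scattered M \<Lambda> \<longleftrightarrow>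
     (\<forall>A\<in>bounded_borel. \<Lambda> A \<in> borel_measurable M) \<and>
     (\<forall>A :: nat \<Rightarrow> real set. disjoint_family A \<and> range A \<subseteq> bounded_borel \<longrightarrow>
        prob_space.indep_vars M (\<lambda>_. borel) (\<lambda>n. \<Lambda> (A n)) UNIV \<and>
        ((\<Union>n. A n) \<in> bounded_borel \<longrightarrow>
           (AE \<omega> in M. (\<lambda>n. \<Lambda> (A n) \<omega>) sums \<Lambda> (\<Union>n. A n) \<omega>)))"

text \<open>A Levy process determines such a random measure up to almost sure equality of each
  of the variables \<open>\<Lambda> A\<close>.\<close>

definition levy_random_measure ::
    "'a measure \<Rightarrow> (real \<Rightarrow> 'a \<Rightarrow> real) \<Rightarrow> (real set \<Rightarrow> 'a \<Rightarrow> real) \<Rightarrow> bool" where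
  "levy_random_measure M L \<Lambda> \<longleftrightarrow>
     independently_scattered M \<Lambda> \<and>
     (\<forall>s t. s \<le> t \<longrightarrow> (AE \<omega> in M. \<Lambda> {s<..t} \<omega> = L t \<omega> - L s \<omega>))"

definition simple_integrand :: "(real \<Rightarrow> real) \<Rightarrow> bool" where
  "simple_integrand \<phi> \<longleftrightarrow> simple_function borel \<phi> \<and> bounded {x. \<phi> x \<noteq> 0}"

definition simple_stoch_integral ::
    "(real set \<Rightarrow> 'a \<Rightarrow> real) \<Rightarrow> real set \<Rightarrow> (real \<Rightarrow> real) \<Rightarrow> 'a \<Rightarrow> real" where
  "simple_stoch_integral \<Lambda> A \<phi> \<omega> = (\<Sum>y\<in>range \<phi> - {0}. y * \<Lambda> (A \<inter> \<phi> -` {y}) \<omega>)"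

text \<open>\<open>has_levy_integral M L \<phi> Y\<close>: the function \<open>\<phi>\<close> is integrable with respect to \<open>L\<close> and
  \<open>Y\<close> is a version of its integral over the real line, in the sense of Rajput and Rosinski.  By stationarity of the increments
  the control measure of the random measure is a multiple of Lebesgue measure, so almost
  everywhere convergence is required with respect to the latter.  (If the multiple is 0,
  then \<open>L\<close> vanishes, and both readings make every Borel function integrable with integral 0.)\<close>

definition has_levy_integral ::
    "'a measure \<Rightarrow> (real \<Rightarrow> 'a \<Rightarrow> real) \<Rightarrow> (real \<Rightarrow> real) \<Rightarrow> ('a \<Rightarrow> real) \<Rightarrow> bool" where
  "has_levy_integral M L \<phi> Y \<longleftrightarrow>
     \<phi> \<in> borel_measurable borel \<and> Y \<in> borel_measurable M \<and>
     (\<exists>\<Lambda> \<phi>s. levy_random_measure M L \<Lambda> \<and>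
        (\<forall>n::nat. simple_integrand (\<phi>s n)) \<and>
        (AE x in lborel. (\<lambda>n. \<phi>s n x) \<longlonglongrightarrow> \<phi> x) \<and>
        (\<forall>A\<in>sets borel. \<exists>Y\<^sub>A\<in>borel_measurable M.
           tendsto_in_prob M (\<lambda>n. simple_stoch_integral \<Lambda> A (\<phi>s n)) Y\<^sub>A sequentially) \<and>
        tendsto_in_prob M (\<lambda>n. simple_stoch_integral \<Lambda> UNIV (\<phi>s n)) Y sequentially)"

definition C2_bounded :: "(real \<Rightarrow> real) \<Rightarrow> bool" where
  "C2_bounded f \<longleftrightarrow>
     (\<exists>f' f''. (\<forall>x. (f has_real_derivative f' x) (at x)) \<and>
        (\<forall>x. (f' has_real_derivative f'' x) (at x)) \<and> continuous_on UNIV f'' \<and>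
        bounded (range f) \<and> bounded (range f') \<and> bounded (range f''))"

definition covariance :: "'a measure \<Rightarrow> ('a \<Rightarrow> real) \<Rightarrow> ('a \<Rightarrow> real) \<Rightarrow> real" where
  "covariance M Y Y' =
     prob_space.expectation M (\<lambda>\<omega>. (Y \<omega> - prob_space.expectation M Y) *
                                   (Y' \<omega> - prob_space.expectation M Y'))"

definition autocov ::
    "'a measure \<Rightarrow> (real \<Rightarrow> real) \<Rightarrow> (real \<Rightarrow> 'a \<Rightarrow> real) \<Rightarrow> int \<Rightarrow> real" where
  "autocov M f X j = covariance M (\<lambda>\<omega>. f (X 0 \<omega>)) (\<lambda>\<omega>. f (X (real_of_int j) \<omega>))"

definition partial_sum ::
    "'a measure \<Rightarrow> (real \<Rightarrow> real) \<Rightarrow> (real \<Rightarrow> 'a \<Rightarrow> real) \<Rightarrow> nat \<Rightarrow> 'a \<Rightarrow> real" where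
  "partial_sum M f X n \<omega> =
     1 / sqrt (real n) *
       (\<Sum>t=1..n. (f (X (real t) \<omega>) - prob_space.expectation M (\<lambda>\<omega>. f (X 1 \<omega>))))"

definition partial_sum_sd ::
    "'a measure \<Rightarrow> (real \<Rightarrow> real) \<Rightarrow> (real \<Rightarrow> 'a \<Rightarrow> real) \<Rightarrow> nat \<Rightarrow> real" where
  "partial_sum_sd M f X n = sqrt (prob_space.variance M (partial_sum M f X n))"

text \<open>The two variables in the distances below may live on different probability spaces.
  The Wasserstein distance is extended real valued; it is meant for integrable variables,
  as the Bochner integral is 0 on non-integrable functions.\<close>

definition wasserstein_dist ::
    "'a measure \<Rightarrow> ('a \<Rightarrow> real) \<Rightarrow> 'b measure \<Rightarrow> ('b \<Rightarrow> real) \<Rightarrow> ereal" where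
  "wasserstein_dist M F N G =
     (SUP h\<in>{h :: real \<Rightarrow> real. 1-lipschitz_on UNIV h}.
        ereal \<bar>prob_space.expectation M (\<lambda>\<omega>. h (F \<omega>)) -
               prob_space.expectation N (\<lambda>\<omega>. h (G \<omega>))\<bar>)"

definition kolmogorov_dist ::
    "'a measure \<Rightarrow> ('a \<Rightarrow> real) \<Rightarrow> 'b measure \<Rightarrow> ('b \<Rightarrow> real) \<Rightarrow> real" where
  "kolmogorov_dist M F N G =
     (SUP x. \<bar>measure M {\<omega>\<in>space M. F \<omega> \<le> x} - measure N {\<omega>\<in>space N. G \<omega> \<le> x}\<bar>)"

end

theory Submission
  imports Defs "HOL-Probability.Probability" "HOL-Real_Asymp.Real_Asymp"
begin

text \<open>
Write \<open>G u = 1\<^bsub>u \<ge> 0\<^esub> g u\<close>, so that \<open>X\<^sub>t = \<integral> G (t - s) dL\<^sub>s\<close>. The noise on the blocks \<open>(k-1, k]\<close> is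
independent, and \<open>X\<^sub>t\<close> is a sum of one contribution per block. If block \<open>k < t\<close> is resampled, its
contribution changes by an amount \<open>\<Delta>\<close> with \<open>E (min 1 \<bar>\<Delta>\<bar>)\<^sup>2 = O ((1 + t - k) powr (- \<alpha>\<beta>))\<close>: the exponent
\<open>w\<close> of \<open>L\<close> satisfies \<open>- Re (w \<theta>) \<le> \<eta> \<bar>\<theta>\<bar> powr \<beta>\<close>, and truncated second moments are controlled by Gaussian
averages of characteristic functions (\<open>levy_exponent_bound\<close>, \<open>block_spread\<close>). As \<open>f\<close> has two bounded
derivatives, first and mixed second differences of \<open>f (X\<^sub>t)\<close> in the blocks are bounded by these truncated
increments and by products of two of them. Hence the square roots \<open>\<rho>\<close> of the second moments decay with exponent
\<open>\<alpha>\<beta> / 2 > 1\<close> and are summable along rows and columns, which is all that the rest uses.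

Covariances: a martingale expansion over the blocks bounds \<open>cov (f X\<^sub>0) (f X\<^sub>j)\<close> by \<open>\<Sum>\<^sub>k \<rho>\<^sub>k\<^sub>0 \<rho>\<^sub>k\<^sub>j\<close>
(\<open>covariance_bound\<close>, \<open>ac_bound\<close>). The sum of the covariances converges, and \<open>v\<^sub>n\<^sup>2\<close> is the Cesaro mean of
its symmetric partial sums, so that it tends to \<open>v\<^sup>2\<close>.

Normal approximation is Stein's method for functions of independent variables, carried out for finitely
many variables with finitely many values, where every expectation is a finite sum (\<open>finite_model\<close>). With
\<open>d\<^sub>k\<close> a bound for the change of \<open>W\<close> when variable \<open>k\<close> is resampled, the Wasserstein error is governed by
\<open>\<Sum>\<^sub>k E d\<^sub>k\<^sup>2 (1 \<and> d\<^sub>k)\<close>. For an indicator the solution of Stein's equation has no Lipschitz derivative; the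
remainder is then monotone in the increment, and an exchange of the two copies turns it into a sum of
almost orthogonal centred variables, whose size is \<open>(\<Sum>\<^sub>k E d\<^sub>k\<^sup>2 (1 \<and> d\<^sub>k\<^sup>2)) powr (1/2)\<close>. For the partial sums
\<open>d\<^sub>k\<close> is \<open>1 / \<surd>n\<close> times a sum \<open>S\<^sub>k\<close> of truncated increments over \<open>t \<le> n\<close>, and the total truncated second moment
\<open>\<Sum>\<^sub>k E S\<^sub>k\<^sup>2 1\<^bsub>S\<^sub>k > M\<^esub>\<close> is \<open>O (n (1 + M) powr (2 - \<alpha>\<beta>))\<close> (\<open>tail_moment\<close>). Summing over \<open>M < \<surd>n\<close> gives the rates, with the
logarithms at \<open>\<alpha>\<beta> = 3\<close> and \<open>\<alpha>\<beta> = 4\<close>.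

The finite models come from replacing \<open>G\<close> by a simple kernel and rounding the block variables
(\<open>kernel_approximation\<close>, \<open>finite_model_approximation\<close>). The bounds do not depend on the accuracy of the
model, hence hold in the limit.
\<close>

section \<open>Stein's equation\<close>

abbreviation phi :: "real => real" where "phi \<equiv> std_normal_density"
abbreviation (input) gauss :: "real measure" where "gauss \<equiv> std_normal_distribution"

abbreviation (input) normal_mean :: "(real => real) => real" where "normal_mean h \<equiv> LINT x|lborel. h x * phi x"
lemmas bintegral_cong = Bochner_Integration.integral_cong and bintegrable_bound = Bochner_Integration.integrable_bound and bintegrable_diff = Bochner_Integration.integrable_diff and bintegral_add = Bochner_Integration.integral_add and bintegral_diff = Bochner_Integration.integral_diff
lemma phi_pos: "0 < phi x" by (simp add: normal_density_pos)

lemma phi_deriv: "(phi has_real_derivative (- x * phi x)) (at x)"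
 unfolding std_normal_density_def by (auto intro!: derivative_eq_intros simp: field_simps power2_eq_square)

lemma phi_cont: "continuous_on A phi"
 using phi_deriv DERIV_isCont continuous_at_imp_continuous_on by blast

lemma integrable_phi_poly: "integrable lborel (%x. phi x * x)" "integrable lborel (%x. phi x * x^2)"
 "integrable lborel (%x. phi x * \<bar>x\<bar>)"
 using integrable_std_normal_moment[of 1] integrable_std_normal_moment[of 2]
  integrable_std_normal_moment_abs[of 1] by simp_all

lemma phi_at_top: "((%x. phi x) \<longlongrightarrow> 0) at_top"
 unfolding std_normal_density_def by real_asymp

lemma integral_FTC_atLeast_nonneg:
 fixes F :: "real => real"
 assumes [measurable]: "f \<in> borel_measurable borel"
  and "!!x. a <= x ==> (F has_real_derivative f x) (at x)" "!!x. a <= x ==> 0 <= f x"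
  and "(F \<longlongrightarrow> l) at_top"
 shows "has_bochner_integral lborel (%x. indicator {a..} x * f x) (l - F a)"
proof -
 have nn: "(\<integral>\<^sup>+x. ennreal (indicator {a..} x * f x) \<partial>lborel) = ennreal (l - F a)"
  using nn_integral_FTC_atLeast[OF assms]
  by (subst nn_integral_cong[where v = "%x. ennreal (f x) * indicator {a..} x"]) (auto split: split_indicator)
 have "F a <= F x" if "a <= x" for x
  by (rule DERIV_nonneg_imp_nondecreasing[OF that]) (use assms in auto)
 then have "F a <= l"
  by (intro tendsto_lowerbound[OF assms(4)]) (auto intro!: eventually_at_top_linorderI[of a])
 then show ?thesis
  using nn assms(3) by (intro has_bochner_integral_nn_integral) (auto split: split_indicator)
qed

lemma phi_tail_first_moment:
 "0 <= w ==> (LINT x|lborel. indicator {w..} x * (x * phi x)) = phi w"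
proof -
 assume "0 <= w"
 moreover have "((%x. - phi x) \<longlongrightarrow> 0) at_top" using tendsto_minus[OF phi_at_top] by simp
 moreover have "((%x. - phi x) has_real_derivative x * phi x) (at x)" for x
  using DERIV_minus[OF phi_deriv[of x]] by simp
 ultimately show ?thesis
  using integral_FTC_atLeast_nonneg[of "%x. x * phi x" w "%x. - phi x" 0] phi_pos[THEN less_imp_le]
  by (auto simp: has_bochner_integral_iff)
qed

text \<open>The Mills ratio. The bounds on it, on \<open>1 - w m(w)\<close> and on \<open>(1 + w^2) m(w) - w\<close> come from the
first two tail moments of the density.\<close>
definition mills :: "real => real" where
 "mills w = (LINT x|lborel. indicator {w..} x * phi x) / phi w"

lemma int_ind[simp]: "integrable lborel f ==> integrable lborel (%x. indicator {w::real..} x * (f x::real))"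
 using integrable_real_mult_indicator[of "{w..}" lborel f] by (simp add: mult.commute)

lemma phi_integrable: "integrable lborel phi" by simp

lemma phi_tail_shifted_moment:
 assumes "0 <= w"
 shows "(LINT x|lborel. indicator {w..} x * ((x - w) * phi x)) = phi w * (1 - w * mills w)"
proof -
 have "(LINT x|lborel. indicator {w..} x * ((x - w) * phi x))
   = (LINT x|lborel. indicator {w..} x * (phi x * x) - w * (indicator {w..} x * phi x))"
  by (rule bintegral_cong) (auto simp: algebra_simps)
 also have "... = (LINT x|lborel. indicator {w..} x * (phi x * x)) - w * (LINT x|lborel. indicator {w..} x * phi x)"
  using int_ind[OF integrable_phi_poly(1)] int_ind[OF phi_integrable]
  by (subst bintegral_diff) auto
 finally show ?thesis
  using phi_tail_first_moment[OF assms] phi_pos[of w]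
  by (simp add: mills_def right_diff_distrib) (simp add: mult.commute)
qed

lemma mills_nonneg: "0 <= mills w"
 using phi_pos[of w] less_imp_le[OF phi_pos] unfolding mills_def by (auto intro!: divide_nonneg_pos integral_nonneg_AE)

lemma mills_upper: assumes "0 <= w" shows "w * mills w <= 1"
proof -
 have "0 <= (LINT x|lborel. indicator {w..} x * ((x - w) * phi x))"
  by (intro integral_nonneg_AE) (auto split: split_indicator simp: phi_pos less_imp_le)
 then show ?thesis
  unfolding phi_tail_shifted_moment[OF assms] using phi_pos[of w] by (simp add: zero_le_mult_iff)
qed

lemma mills_lower: assumes "0 <= w" shows "w <= (1 + w^2) * mills w"
proof (cases "w = 0")
 case True then show ?thesis using mills_nonneg[of 0] by simp
next
 case False
 with assms have w: "0 < w" by simp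
 have 1: "has_bochner_integral lborel (%x. indicator {w..} x * ((1 + 1/x^2) * phi x)) (0 - (- phi w / w))"
 proof (rule integral_FTC_atLeast_nonneg)
  fix x assume "w <= x"
  then show "((%x. - phi x / x) has_real_derivative (1 + 1 / x^2) * phi x) (at x)"
   using w by (auto intro!: derivative_eq_intros phi_deriv simp: field_simps power2_eq_square)
 next
  show "((%x. - phi x / x) \<longlongrightarrow> 0) at_top" unfolding std_normal_density_def by real_asymp
 qed (auto simp: phi_pos less_imp_le)
 have "phi w / w = (LINT x|lborel. indicator {w..} x * ((1 + 1/x^2) * phi x))"
  using 1 by (simp add: has_bochner_integral_iff)
 also have "... <= (LINT x|lborel. (1 + 1/w^2) * (indicator {w..} x * phi x))"
 proof (rule integral_mono)
  show "indicator {w..} x * ((1 + 1/x^2) * phi x) <= (1 + 1/w^2) * (indicator {w..} x * phi x)" for x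
   using w less_imp_le[OF phi_pos[of x]]
   by (auto split: split_indicator intro!: mult_right_mono divide_left_mono power_mono)
 qed (use 1 in \<open>auto simp: has_bochner_integral_iff\<close>)
 finally have "phi w / w <= (1 + 1/w^2) * (mills w * phi w)"
  using phi_pos[of w] by (simp add: mills_def)
 then have "w * phi w <= ((1 + w^2) * mills w) * phi w"
  using w by (simp add: field_simps power2_eq_square)
 then show ?thesis using phi_pos[of w] by (rule mult_right_le_imp_le)
qed

lemma mills_le: assumes "0 <= w" shows "mills w <= 5"
proof (cases "1 <= w")
 case True
 then have "mills w <= w * mills w" using mills_nonneg[of w] mult_right_mono[of 1 w "mills w"] by simp
 with mills_upper[OF assms] show ?thesis by simp
next
 case False
 have "(LINT x|lborel. indicator {w..} x * phi x) <= (LINT x|lborel. phi x)"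
  by (intro integral_mono) (auto split: split_indicator simp: phi_pos less_imp_le)
 then have a: "(LINT x|lborel. indicator {w..} x * phi x) <= 1" by simp
 have "w^2 <= 1" using False assms by (simp add: power_le_one)
 then have "exp (w^2/2) <= exp (1/2)" by simp
 also have "exp (1/2::real) <= 1 + 1/2 + (1/2)^2" by (rule exp_bound) auto
 finally have b: "exp (w^2/2) <= 7/4" by (simp add: power2_eq_square)
 have "sqrt (2*pi) <= sqrt 8" using pi_less_4 by simp
 also have "... <= sqrt (8.1225)" by simp
 also have "... = 2.85" by (rule real_sqrt_unique) (auto simp: power2_eq_square)
 finally have c: "sqrt (2*pi) <= 2.85" .
 have "1 / phi w = sqrt (2*pi) * exp (w^2/2)"
  by (simp add: std_normal_density_def exp_minus field_simps)
 also have "... <= 2.85 * (7/4)" by (intro mult_mono b c) auto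
 finally have "1 / phi w <= 5" by simp
 moreover have "mills w <= 1 / phi w" unfolding mills_def using a phi_pos[of w] by (auto intro!: divide_right_mono)
 ultimately show ?thesis by simp
qed

text \<open>The solution of Stein's equation for \<open>w \<ge> 0\<close>, up to sign: \<open>(\<integral>\<^bsub>w..\<^esub> k
\<phi>) / \<phi>(w)\<close>. Negative \<open>w\<close> are reached by reflection.\<close>
definition tailq :: "(real => real) => real => real" where
 "tailq k w = (LINT x|lborel. indicator {w..} x * (k x * phi x)) / phi w"

lemma tailq_bounded:
 assumes [measurable]: "k \<in> borel_measurable borel" and k: "!!x. \<bar>k x\<bar> <= 1" and w: "0 <= w"
 shows "\<bar>tailq k w\<bar> <= 5" "\<bar>w * tailq k w\<bar> <= 1"
proof -
 have "\<bar>LINT x|lborel. indicator {w..} x * (k x * phi x)\<bar> <= (LINT x|lborel. \<bar>indicator {w..} x * (k x * phi x)\<bar>)"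
  by (rule integral_abs_bound)
 also have "... <= (LINT x|lborel. indicator {w..} x * phi x)"
 proof (rule integral_mono')
  show "\<bar>indicator {w..} x * (k x * phi x)\<bar> <= indicator {w..} x * phi x" for x
   using mult_right_mono[OF k[of x] less_imp_le[OF phi_pos[of x]]] phi_pos[of x]
   by (auto simp: abs_mult split: split_indicator)
 qed (auto simp: phi_pos less_imp_le)
 finally have *: "\<bar>tailq k w\<bar> <= mills w"
  using phi_pos[of w] unfolding tailq_def mills_def by (simp add: divide_right_mono abs_divide)
 then show "\<bar>tailq k w\<bar> <= 5" using mills_le[OF w] by linarith
 have "\<bar>w * tailq k w\<bar> = w * \<bar>tailq k w\<bar>" using w by (simp add: abs_mult)
 also have "... <= w * mills w" using * w by (rule mult_left_mono)
 finally show "\<bar>w * tailq k w\<bar> <= 1" using mills_upper[OF w] by linarith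
qed

text \<open>Splitting off the value \<open>k w\<close> of \<open>k\<close> at the end point leaves a remainder bounded by the
shifted tail moment \<open>1 - w m(w)\<close>; the Mills bounds then beat the linear growth of \<open>k\<close>.\<close>
lemma tailq_lipschitz:
 assumes lip: "!!x y. \<bar>k x - k y\<bar> <= \<bar>x - y\<bar>" and kb: "!!x. \<bar>k x\<bar> <= \<bar>x\<bar> + 1" and w: "0 <= w"
 shows "\<bar>tailq k w\<bar> <= 7" "\<bar>k w - w * tailq k w\<bar> <= 11" "\<bar>(1 + w^2) * tailq k w - w * k w\<bar> <= 7"
proof -
 have "continuous_on UNIV k" 
  by (rule lipschitz_on_continuous_on[of 1]) (auto simp: lipschitz_on_def dist_real_def lip)
 then have [measurable]: "k \<in> borel_measurable borel" by (rule borel_measurable_continuous_onI)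
 let ?m = "mills w" and ?i = "1 - w * mills w" and ?j = "(1 + w^2) * mills w - w"
 have int1: "integrable lborel (%x. indicator {w..} x * ((x - w) * phi x))"
  using int_ind[OF bintegrable_diff[OF integrable_phi_poly(1) integrable_mult_right[OF phi_integrable, of w]]]
  by (simp add: algebra_simps)
 have int2: "integrable lborel (%x. indicator {w..} x * ((k x - k w) * phi x))"
 proof (rule bintegrable_bound[OF int1])
  have "norm (indicator {w..} x * ((k x - k w) * phi x)) <= norm (indicator {w..} x * ((x - w) * phi x))" for x
   using lip[of x w] phi_pos[of x] by (auto simp: abs_mult intro!: mult_right_mono split: split_indicator)
  then show "AE x in lborel. norm (indicator {w..} x * ((k x - k w) * phi x)) <= norm (indicator {w..} x * ((x - w) * phi x))"
   by (intro AE_I2)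
 qed simp
 define r where "r = (LINT x|lborel. indicator {w..} x * ((k x - k w) * phi x)) / phi w"
 have "\<bar>LINT x|lborel. indicator {w..} x * ((k x - k w) * phi x)\<bar> <= (LINT x|lborel. \<bar>indicator {w..} x * ((k x - k w) * phi x)\<bar>)"
  by (rule integral_abs_bound)
 also have "... <= (LINT x|lborel. indicator {w..} x * ((x - w) * phi x))"
 proof (rule integral_mono'[OF int1])
  show "\<bar>indicator {w..} x * ((k x - k w) * phi x)\<bar> <= indicator {w..} x * ((x - w) * phi x)" for x
   using lip[of x w] phi_pos[of x] by (auto simp: abs_mult intro!: mult_right_mono split: split_indicator)
 qed (auto simp: phi_pos less_imp_le split: split_indicator)
 finally have r: "\<bar>r\<bar> <= ?i"
  using phi_pos[of w] phi_tail_shifted_moment[OF w] unfolding r_def by (simp add: abs_divide divide_le_eq mult.commute)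
 have "(LINT x|lborel. indicator {w..} x * (k x * phi x)) =
   (LINT x|lborel. indicator {w..} x * ((k x - k w) * phi x) + k w * (indicator {w..} x * phi x))"
  by (rule bintegral_cong) (auto simp: algebra_simps)
 also have "... = (LINT x|lborel. indicator {w..} x * ((k x - k w) * phi x)) + k w * (LINT x|lborel. indicator {w..} x * phi x)"
  using int2 by (subst bintegral_add) auto
 finally have G: "tailq k w = r + k w * ?m"
  unfolding tailq_def r_def mills_def using phi_pos[of w] by (simp add: add_divide_distrib)
 have m: "0 <= ?m" "?m <= 5" "0 <= ?i" "0 <= ?j" "w * ?m <= 1"
  using mills_nonneg mills_le[OF w] mills_upper[OF w] mills_lower[OF w] by auto
 have j: "?j = ?m - w * ?i" by (simp add: algebra_simps power2_eq_square)
 have i1: "?i <= 1" using m w by simp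
 have wi: "w * ?i <= 5" using j m by linarith
 have id: "(1 + w^2) * ?i + w * ?j = 1" by (simp add: algebra_simps power2_eq_square)
 have wj: "w * ?j <= 1" "(1 + w^2) * ?i <= 1" using id mult_nonneg_nonneg[of w ?j, OF w m(4)] mult_nonneg_nonneg[of "1+w^2" ?i, OF _ m(3)] by (smt (verit) zero_le_power2)+
 have kw: "\<bar>k w\<bar> <= w + 1" using kb[of w] w by simp
 have "\<bar>k w * ?m\<bar> <= (w + 1) * ?m" unfolding abs_mult using kw m by (intro mult_mono) auto
 then show "\<bar>tailq k w\<bar> <= 7" unfolding G using r i1 m abs_triangle_ineq[of r "k w * ?m"] by (simp add: distrib_right)
 have "k w - w * tailq k w = k w * ?i - w * r" unfolding G by (simp add: algebra_simps)
 moreover have "\<bar>k w * ?i\<bar> <= (w + 1) * ?i" unfolding abs_mult using kw m by (intro mult_mono) auto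
 moreover have "\<bar>w * r\<bar> <= w * ?i" unfolding abs_mult using r w by (intro mult_mono) auto
 ultimately have "\<bar>k w - w * tailq k w\<bar> <= (w + 1) * ?i + w * ?i"
  using abs_triangle_ineq4[of "k w * ?i" "w * r"] by linarith
 also have "... = 2 * (w * ?i) + ?i" by (simp add: distrib_right)
 finally show "\<bar>k w - w * tailq k w\<bar> <= 11" using wi i1 by linarith
 have "(1 + w^2) * tailq k w - w * k w = k w * ?j + (1 + w^2) * r" unfolding G by (simp add: algebra_simps)
 moreover have "\<bar>k w * ?j\<bar> <= (w + 1) * ?j" unfolding abs_mult using kw m by (intro mult_mono) auto
 moreover have "\<bar>(1 + w^2) * r\<bar> <= (1 + w^2) * ?i" unfolding abs_mult using r w by (intro mult_mono) auto
 moreover have "(w + 1) * ?j <= 6" 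
 proof -
  have "?j <= 5" using j m(2) mult_nonneg_nonneg[OF w m(3)] by linarith
  moreover have "(w + 1) * ?j = w * ?j + ?j" by (simp only: distrib_right mult_1)
  ultimately show ?thesis using wj by linarith
 qed
 ultimately show "\<bar>(1 + w^2) * tailq k w - w * k w\<bar> <= 7" using wj by linarith
qed

text \<open>The solution \<open>f\<close> of \<open>f' w = w f w + k w\<close> for a function \<open>k\<close> of Gaussian mean 0.\<close>

definition stein :: "(real => real) => real => real" where
 "stein k w = (LINT x|lborel. indicator {..w} x * (k x * phi x)) / phi w"

lemma stein_eq_tailq:
 assumes int: "integrable lborel (%x. k x * phi x)" and 0: "(LINT x|lborel. k x * phi x) = 0"
 shows "stein k w = - tailq k w"
proof -
 have "AE x in lborel. (k x * phi x) = indicator {..w} x * (k x * phi x) + indicator {w..} x * (k x * phi x)"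
  using AE_lborel_singleton[of w] by eventually_elim (auto split: split_indicator)
 then have "(LINT x|lborel. k x * phi x) = (LINT x|lborel. indicator {..w} x * (k x * phi x) + indicator {w..} x * (k x * phi x))"
  using borel_measurable_integrable[OF int] by (intro integral_cong_AE) auto
 also have "... = (LINT x|lborel. indicator {..w} x * (k x * phi x)) + (LINT x|lborel. indicator {w..} x * (k x * phi x))"
  using int_ind[OF int] integrable_real_mult_indicator[of "{..w}" lborel, OF _ int] 
  by (subst bintegral_add) (auto simp: mult.commute)
 finally have "(LINT x|lborel. indicator {..w} x * (k x * phi x)) = - (LINT x|lborel. indicator {w..} x * (k x * phi x))"
  unfolding 0 by simp
 then show ?thesis unfolding stein_def tailq_def by simp
qed

lemma stein_reflect: "stein k (- w) = tailq (%x. k (- x)) w"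
proof -
 have "(LINT x|lborel. indicator {..-w} x * (k x * phi x)) = (LINT x|lborel. indicator {..-w} (-x) * (k (-x) * phi (-x)))"
  using lborel_integral_real_affine[of "-1" "%x. indicator {..-w} x * (k x * phi x)" 0] by simp
 also have "... = (LINT x|lborel. indicator {w..} x * (k (-x) * phi x))"
  by (rule bintegral_cong) (auto split: split_indicator simp: std_normal_density_def)
 finally show ?thesis unfolding stein_def tailq_def by (simp add: std_normal_density_def)
qed

lemma stein_deriv:
 assumes int: "integrable lborel (%x. k x * phi x)" and cont: "continuous_on UNIV k"
 shows "(stein k has_real_derivative (w * stein k w + k w)) (at w)"
proof -
 define S where "S w = (LINT x|lborel. indicator {..w} x * (k x * phi x))" for w
 have c: "continuous_on A (%x. k x * phi x)" for A
  by (intro continuous_intros phi_cont continuous_on_subset[OF cont]) auto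
 have S: "S y = S (w - 1) + integral {w - 1..y} (%x. k x * phi x)" if "y \<in> {w - 1..w + 1}" for y
 proof -
  have "integral {w - 1..y} (%x. k x * phi x) = (LINT x|lborel. indicator {w - 1..y} x * (k x * phi x))"
   using set_borel_integral_eq_integral(2)[of "{w-1..y}" "%x. k x * phi x"]
    borel_integrable_atLeastAtMost'[OF c] by (simp add: set_lebesgue_integral_def)
  moreover have "S y = (LINT x|lborel. indicator {..w - 1} x * (k x * phi x) + indicator {w - 1..y} x * (k x * phi x))"
   unfolding S_def
  proof (rule integral_cong_AE)
   show "AE x in lborel. indicator {..y} x * (k x * phi x) = indicator {..w - 1} x * (k x * phi x) + indicator {w - 1..y} x * (k x * phi x)"
    using AE_lborel_singleton[of "w - 1"] by eventually_elim (use that in \<open>auto split: split_indicator\<close>)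
  qed (use borel_measurable_integrable[OF int] in auto)
  ultimately show ?thesis
   using integrable_real_mult_indicator[of "{..w-1}" lborel, OF _ int] integrable_real_mult_indicator[of "{w-1..y}" lborel, OF _ int]
   unfolding S_def by (simp add: mult.commute)
 qed
 have "((%y. S (w - 1) + integral {w - 1..y} (%x. k x * phi x)) has_real_derivative k w * phi w) (at w within {w - 1..w + 1})"
  by (auto intro!: derivative_eq_intros integral_has_real_derivative c)
 then have "(S has_real_derivative k w * phi w) (at w within {w - 1..w + 1})"
  by (rule has_field_derivative_transform_within[of _ _ _ _ 1]) (simp_all only: S[symmetric], simp_all)
 then have dS: "(S has_real_derivative k w * phi w) (at w)"
  using at_within_Icc_at[of "w-1" w "w+1"] by simp
 have "((%w. S w / phi w) has_real_derivative (w * (S w / phi w) + k w)) (at w)"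
  using phi_pos[of w] by (auto intro!: derivative_eq_intros dS phi_deriv simp: field_simps)
 then show ?thesis unfolding stein_def[abs_def] S_def .
qed

lemma stein_bounded:
 fixes h :: "real => real"
 assumes cont: "continuous_on UNIV h" and h: "!!x. 0 <= h x" "!!x. h x <= 1"
 defines "c \<equiv> normal_mean h"
 obtains f where "!!w. (f has_real_derivative (w * f w + h w - c)) (at w)" "!!w. \<bar>f w\<bar> <= 5" "!!w. \<bar>w * f w\<bar> <= 1"
  "!!w. \<bar>h w - c\<bar> <= 1"
proof -
 have [measurable]: "h \<in> borel_measurable borel" using cont by (rule borel_measurable_continuous_onI)
 have inth: "integrable lborel (%x. h x * phi x)"
 proof (rule bintegrable_bound[OF phi_integrable])
  show "AE x in lborel. norm (h x * phi x) <= norm (phi x)"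
   using h phi_pos by (auto simp: abs_mult less_imp_le intro!: mult_left_le_one_le)
 qed simp
 have "c <= (LINT x|lborel. phi x)" unfolding c_def using inth h phi_pos
  by (intro integral_mono) (auto simp: less_imp_le intro!: mult_left_le_one_le)
 moreover have "0 <= c" unfolding c_def using h phi_pos by (intro integral_nonneg_AE) (auto simp: less_imp_le)
 ultimately have c: "0 <= c" "c <= 1" by auto
 define k where "k x = h x - c" for x
 have k: "\<bar>k x\<bar> <= 1" for x using h[of x] c by (simp add: k_def abs_le_iff)
 have [measurable]: "k \<in> borel_measurable borel" unfolding k_def[abs_def] by simp
 have int: "integrable lborel (%x. k x * phi x)" unfolding k_def left_diff_distrib using inth by auto
 have 0: "(LINT x|lborel. k x * phi x) = 0" unfolding k_def left_diff_distrib using inth by (simp add: c_def)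
 have contk: "continuous_on UNIV k" unfolding k_def[abs_def] by (intro continuous_intros cont)
 have "\<bar>stein k w\<bar> <= 5 \<and> \<bar>w * stein k w\<bar> <= 1" for w
 proof (cases "0 <= w")
  case True then show ?thesis using tailq_bounded[of k w] k stein_eq_tailq[OF int 0] by simp
 next
  case False then show ?thesis using tailq_bounded[of "%x. k (-x)" "-w"] k stein_reflect[of k "-w"] by simp
 qed
 moreover have "(stein k has_real_derivative (w * stein k w + h w - c)) (at w)" for w
  using stein_deriv[OF int contk, of w] by (simp add: k_def add_diff_eq)
 moreover have "\<bar>h w - c\<bar> <= 1" for w using k[of w] by (simp add: k_def)
 ultimately show thesis by (intro that[of "stein k"]) auto
qed

text \<open>The derivative \<open>w f w + h w - c\<close> of the solution is Lipschitz because \<open>(w f w)' = (1 + w^2) f w + w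
k w\<close> stays bounded.\<close>
lemma stein_lipschitz:
 fixes h :: "real => real"
 assumes h: "!!x y. \<bar>h x - h y\<bar> <= \<bar>x - y\<bar>"
 defines "c \<equiv> normal_mean h"
 obtains f where "!!w. (f has_real_derivative (w * f w + h w - c)) (at w)" "!!w. \<bar>f w\<bar> <= 7"
  "!!w. \<bar>w * f w + h w - c\<bar> <= 11" "!!a b. \<bar>(b * f b + h b - c) - (a * f a + h a - c)\<bar> <= 8 * \<bar>b - a\<bar>"
proof -
 have cont: "continuous_on UNIV h" 
  by (rule lipschitz_on_continuous_on[of 1]) (auto simp: lipschitz_on_def dist_real_def h)
 then have [measurable]: "h \<in> borel_measurable borel" by (rule borel_measurable_continuous_onI)
 have inth: "integrable lborel (%x. h x * phi x)"
 proof (rule bintegrable_bound)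
  show "integrable lborel (%x. phi x * \<bar>x\<bar> + \<bar>h 0\<bar> * phi x)" using integrable_phi_poly by auto
  have "\<bar>h x\<bar> <= \<bar>x\<bar> + \<bar>h 0\<bar>" for x using h[of x 0] by simp
  from mult_right_mono[OF this less_imp_le[OF phi_pos]] have "norm (h x * phi x) <= norm (phi x * \<bar>x\<bar> + \<bar>h 0\<bar> * phi x)" for x
   using phi_pos[of x] by (simp add: abs_mult algebra_simps)
  then show "AE x in lborel. norm (h x * phi x) <= norm (phi x * \<bar>x\<bar> + \<bar>h 0\<bar> * phi x)"
   by (intro AE_I2)
 qed simp
 define k where "k x = h x - c" for x
 have lip: "\<bar>k x - k y\<bar> <= \<bar>x - y\<bar>" for x y using h by (simp add: k_def)
 have int: "integrable lborel (%x. k x * phi x)" unfolding k_def left_diff_distrib using inth by auto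
 have 0: "(LINT x|lborel. k x * phi x) = 0" unfolding k_def left_diff_distrib using inth by (simp add: c_def)
 have contk: "continuous_on UNIV k" unfolding k_def[abs_def] by (intro continuous_intros cont)
 have absm: "(LINT x|lborel. phi x * \<bar>x\<bar>) <= 1"
 proof -
  have "(LINT x|lborel. phi x * \<bar>x\<bar>) <= (LINT x|lborel. phi x * (1/2) + (phi x * x^2) * (1/2))"
  proof (rule integral_mono)
   have "\<bar>x\<bar> <= 1/2 + x^2 * (1/2)" for x :: real
    using zero_le_power2[of "\<bar>x\<bar> - 1"] by (simp add: power2_diff)
   from mult_left_mono[OF this less_imp_le[OF phi_pos]] 
   show "phi x * \<bar>x\<bar> <= phi x * (1/2) + (phi x * x^2) * (1/2)" for x by (simp add: algebra_simps)
  qed (use integrable_phi_poly in auto)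
  also have "... = 1" using integrable_phi_poly(2) integral_std_normal_moment_even[of 1] by simp
  finally show ?thesis .
 qed
 have kb: "\<bar>k x\<bar> <= \<bar>x\<bar> + 1" for x
 proof -
  have "k x = (LINT y|lborel. (k x - k y) * phi y)"
   unfolding left_diff_distrib using int 0 by simp
  also have "\<bar>...\<bar> <= (LINT y|lborel. \<bar>(k x - k y) * phi y\<bar>)" by (rule integral_abs_bound)
  also have "... <= (LINT y|lborel. \<bar>x\<bar> * phi y + phi y * \<bar>y\<bar>)"
  proof (rule integral_mono')
   fix y
   have "\<bar>k x - k y\<bar> <= \<bar>x\<bar> + \<bar>y\<bar>" using lip[of x y] by linarith
   from mult_right_mono[OF this less_imp_le[OF phi_pos[of y]]] have "\<bar>k x - k y\<bar> * phi y <= (\<bar>x\<bar> + \<bar>y\<bar>) * phi y" .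
   then show "\<bar>(k x - k y) * phi y\<bar> <= \<bar>x\<bar> * phi y + phi y * \<bar>y\<bar>"
    using abs_of_pos[OF phi_pos[of y]] by (simp only: abs_mult distrib_right mult.commute[of "phi y"])
  qed (use integrable_phi_poly in auto)
  also have "... = \<bar>x\<bar> + (LINT y|lborel. phi y * \<bar>y\<bar>)" using integrable_phi_poly by simp
  finally show ?thesis using absm by simp
 qed
 have B: "\<bar>stein k w\<bar> <= 7 \<and> \<bar>k w + w * stein k w\<bar> <= 11 \<and> \<bar>(1 + w^2) * stein k w + w * k w\<bar> <= 7" for w
 proof (cases "0 <= w")
  case True
  have "k w + w * stein k w = k w - w * tailq k w" 
   "(1 + w^2) * stein k w + w * k w = - ((1 + w^2) * tailq k w - w * k w)" "stein k w = - tailq k w"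
   unfolding stein_eq_tailq[OF int 0] by simp_all
  then show ?thesis using tailq_lipschitz[OF lip kb True] by (simp only: abs_minus_cancel)
 next
  case False 
  have 1: "!!x y. \<bar>k (- x) - k (- y)\<bar> <= \<bar>x - y\<bar>" subgoal for x y using lip[of "-x" "-y"] by simp done
  have 2: "!!x. \<bar>k (- x)\<bar> <= \<bar>x\<bar> + 1" subgoal for x using kb[of "-x"] by simp done
  have "stein k w = tailq (%x. k (-x)) (-w)" using stein_reflect[of k "-w"] by simp
  then show ?thesis using False tailq_lipschitz[of "%x. k (-x)" "-w", OF 1 2] by simp
 qed
 note d = stein_deriv[OF int contk]
 have dq: "((%w. w * stein k w) has_real_derivative ((1 + w^2) * stein k w + w * k w)) (at w)" for w
  by (auto intro!: derivative_eq_intros d simp: algebra_simps power2_eq_square)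
 have lq: "\<bar>b * stein k b - a * stein k a\<bar> <= 7 * \<bar>b - a\<bar>" for a b
  using field_differentiable_bound[of UNIV "%w. w * stein k w" "%w. (1 + w^2) * stein k w + w * k w" 7 b a, OF convex_UNIV dq] B by simp
 have l8: "\<bar>(b * stein k b + h b - c) - (a * stein k a + h a - c)\<bar> <= 8 * \<bar>b - a\<bar>" for a b
 proof -
  have "(b * stein k b + h b - c) - (a * stein k a + h a - c) = (b * stein k b - a * stein k a) + (h b - h a)" by simp
  then have "\<bar>(b * stein k b + h b - c) - (a * stein k a + h a - c)\<bar> <= \<bar>b * stein k b - a * stein k a\<bar> + \<bar>h b - h a\<bar>"
   by (simp only: abs_triangle_ineq)
  also have "... <= 7 * \<bar>b - a\<bar> + \<bar>b - a\<bar>" by (rule add_mono[OF lq h])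
  finally show ?thesis by simp
 qed
 have e: "w * stein k w + h w - c = k w + w * stein k w" for w by (simp add: k_def)
 have D: "(stein k has_real_derivative (w * stein k w + h w - c)) (at w)" for w
  by (rule DERIV_cong[OF d]) (simp add: k_def)
 have b: "\<bar>stein k w\<bar> <= 7" "\<bar>w * stein k w + h w - c\<bar> <= 11" for w using B[of w] by blast (subst e, use B[of w] in blast)
 show thesis by (rule that[of "stein k", OF D b l8])
qed

section \<open>Functions of finitely many independent variables\<close>

lemma sum_CS_le:
 fixes w f g :: "'i => real"
 assumes w: "!!i. i \<in> I ==> 0 <= w i" and f: "(\<Sum>i\<in>I. w i * (f i)^2) <= a^2" and g: "(\<Sum>i\<in>I. w i * (g i)^2) <= b^2"
  and "0 <= a" "0 <= b"
 shows "(\<Sum>i\<in>I. w i * (f i * g i)) <= a * b"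
proof -
 have "(\<Sum>i\<in>I. w i * (f i * g i)) = (\<Sum>i\<in>I. (sqrt (w i) * f i) * (sqrt (w i) * g i))"
  using w by (intro sum.cong) auto
 also have "... <= a * b"
 proof (rule power2_le_imp_le)
  have "(\<Sum>i\<in>I. (sqrt (w i) * f i) * (sqrt (w i) * g i))^2 <= (\<Sum>i\<in>I. (sqrt (w i) * f i)^2) * (\<Sum>i\<in>I. (sqrt (w i) * g i)^2)"
   by (rule Cauchy_Schwarz_ineq_sum)
  also have "... = (\<Sum>i\<in>I. w i * (f i)^2) * (\<Sum>i\<in>I. w i * (g i)^2)"
   using w by (simp add: power_mult_distrib)
  also have "... <= a^2 * b^2" using f g w by (intro mult_mono sum_nonneg mult_nonneg_nonneg) auto
  finally show "(\<Sum>i\<in>I. (sqrt (w i) * f i) * (sqrt (w i) * g i))^2 <= (a * b)^2" by (simp add: power_mult_distrib)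
 qed (use assms in auto)
 finally show ?thesis .
qed

locale finite_model =
 fixes m :: nat and S :: "nat => 's set" and p :: "nat => 's => real"
 assumes p_nonneg: "!!k x. 0 <= p k x"
  and p_sum: "!!k. (\<Sum>x\<in>S k. p k x) = 1"
begin

text \<open>\<open>av k\<close> integrates out coordinate \<open>k\<close>, \<open>avs j\<close> the coordinates below
\<open>j\<close>. All of them together give a constant, the expectation, whatever the state at which it is read.\<close>
definition av :: "nat => ((nat => 's) => real) => (nat => 's) => real" where
 "av k G s = (\<Sum>x\<in>S k. p k x * G (s(k := x)))"

primrec avs :: "nat => ((nat => 's) => real) => (nat => 's) => real" where
 "avs 0 G = G"
| "avs (Suc j) G = av j (avs j G)"

definition EE :: "((nat => 's) => real) => real" where "EE G = avs m G undefined"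

definition free :: "nat => ((nat => 's) => real) => bool" where
 "free k G \<longleftrightarrow> (\<forall>s x. G (s(k := x)) = G s)"

lemma freeD: "free k G ==> G (s(k := x)) = G s" by (simp add: free_def)

lemma av_const: "av k (%s. c) s = c" by (simp add: av_def p_sum flip: sum_distrib_right)
lemma av_add: "av k (%s. F s + G s) s = av k F s + av k G s" by (simp add: av_def sum.distrib algebra_simps)
lemma av_diff: "av k (%s. F s - G s) s = av k F s - av k G s" by (simp add: av_def sum_subtractf algebra_simps)
lemma av_cmult: "av k (%s. c * F s) s = c * av k F s" by (simp add: av_def sum_distrib_left algebra_simps)
lemma av_sum: "av k (%s. \<Sum>i\<in>I. F i s) s = (\<Sum>i\<in>I. av k (F i) s)"
 unfolding av_def sum_distrib_left by (rule sum.swap)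
lemma av_mono: "(!!s. F s <= G s) ==> av k F s <= av k G s"
 unfolding av_def by (intro sum_mono mult_left_mono p_nonneg)
lemma av_mult: "free k H ==> av k (%s. H s * G s) s = H s * av k G s"
 by (simp add: av_def freeD sum_distrib_left algebra_simps)
lemma av_mult_fun: "free k H ==> av k (%s. H s * G s) = (%s. H s * av k G s)"
 by (rule ext) (rule av_mult)
lemma av_upd [simp]: "av k G (s(k := x)) = av k G s" by (simp add: av_def)
lemma free_av: "free k (av k G)" by (simp add: free_def)
lemma av_free: "free k G ==> av k G = G" using av_mult[of k G "%_. 1"] av_const[of k 1] by (auto simp: fun_eq_iff)
lemma av_commute: "av k (av l G) = av l (av k G)"
proof (cases "k = l")
 case False
 show ?thesis unfolding av_def sum_distrib_left
  by (subst sum.swap) (auto simp: fun_upd_twist[OF False] fun_eq_iff mult.left_commute)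
qed simp
lemma free_av_other: "free k G ==> free k (av l G)"
proof (cases "k = l")
 case False
 assume "free k G"
 then have "G (s(k := x, l := y)) = G (s(l := y))" for s x y
  unfolding fun_upd_twist[OF False] by (rule freeD)
 then show ?thesis by (simp add: free_def av_def)
qed (simp add: free_av)

lemma avs_const: "avs j (%s. c) = (%s. c)" by (induction j) (auto simp: av_const)
lemma avs_add: "avs j (%s. F s + G s) = (%s. avs j F s + avs j G s)" by (induction j) (auto simp: av_add)
lemma avs_diff: "avs j (%s. F s - G s) = (%s. avs j F s - avs j G s)" by (induction j) (auto simp: av_diff)
lemma avs_cmult: "avs j (%s. c * F s) = (%s. c * avs j F s)" by (induction j) (auto simp: av_cmult)
lemma avs_sum: "avs j (%s. \<Sum>i\<in>I. F i s) = (%s. \<Sum>i\<in>I. avs j (F i) s)" by (induction j) (auto simp: av_sum)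
lemma avs_mono: "(!!s. F s <= G s) ==> avs j F s <= avs j G s"
 by (induction j arbitrary: s) (auto intro: av_mono)
lemma avs_mult: "(!!k. k < j ==> free k H) ==> avs j (%s. H s * G s) = (%s. H s * avs j G s)"
 by (induction j) (auto simp: av_mult)
lemma free_avs: "k < j ==> free k (avs j G)"
 by (induction j) (auto simp: less_Suc_eq free_av free_av_other)
lemma av_avs: "av k (avs j G) = avs j (av k G)"
 by (induction j) (simp_all add: av_commute)

lemma EE_const: "EE (%s. c) = c" by (simp add: EE_def avs_const)
lemma EE_add: "EE (%s. F s + G s) = EE F + EE G" by (simp add: EE_def avs_add)
lemma EE_diff: "EE (%s. F s - G s) = EE F - EE G" by (simp add: EE_def avs_diff)
lemma EE_cmult: "EE (%s. c * F s) = c * EE F" by (simp add: EE_def avs_cmult)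
lemma EE_sum: "EE (%s. \<Sum>i\<in>I. F i s) = (\<Sum>i\<in>I. EE (F i))" by (simp add: EE_def avs_sum)
lemma EE_mono: "(!!s. F s <= G s) ==> EE F <= EE G" by (simp add: EE_def avs_mono)
lemma EE_abs: "\<bar>EE F\<bar> <= EE (%s. \<bar>F s\<bar>)"
 using EE_mono[of F "%s. \<bar>F s\<bar>"] EE_mono[of "%s. (-1) * F s" "%s. \<bar>F s\<bar>"] EE_cmult[of "-1" F]
 by (simp add: abs_le_iff)
lemma EE_av: "k < m ==> EE (av k G) = EE G"
 unfolding EE_def av_avs[symmetric] by (simp add: av_free free_avs)
lemma EE_coord: 
 assumes "k < m" shows "EE (%s. g (s k)) = (\<Sum>x\<in>S k. p k x * g x)"
proof -
 have "av k (%s. g (s k)) = (%s. \<Sum>x\<in>S k. p k x * g x)" by (auto simp: av_def)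
 then show ?thesis using EE_av[OF assms, of "%s. g (s k)"] by (simp add: EE_const)
qed
lemma EE_mult_avs: "EE (%s. avs m G s * H s) = EE G * EE H"
 unfolding EE_def by (simp add: avs_mult free_avs)
lemma EE_zero_av: assumes "k < m" "!!s. av k G s = 0" "free k H" shows "EE (%s. H s * G s) = 0"
proof -
 have "av k (%s. H s * G s) = (%s. 0)" by (rule ext) (simp add: av_mult[OF assms(3)] assms(2))
 then show ?thesis using EE_av[OF assms(1), of "%s. H s * G s"] by (simp add: EE_const)
qed

lemma EE_abs_le_sqrt: "EE (%s. \<bar>F s\<bar>) <= sqrt (EE (%s. (F s)^2))"
proof (rule real_le_rsqrt)
 define c where "c = EE (%s. \<bar>F s\<bar>)"
 have "0 <= EE (%s. (\<bar>F s\<bar> - c)^2)" using EE_mono[of "%s. 0" "%s. (\<bar>F s\<bar> - c)^2"] by (simp add: EE_const)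
 also have "... = EE (%s. ((F s)^2 + c^2) - (2 * c) * \<bar>F s\<bar>)" by (simp add: power2_diff algebra_simps)
 also have "... = EE (%s. (F s)^2) + c^2 - (2 * c) * c" by (simp only: EE_diff EE_add EE_const EE_cmult c_def[symmetric])
 finally show "(EE (%s. \<bar>F s\<bar>))^2 <= EE (%s. (F s)^2)" unfolding c_def[symmetric] by (simp add: power2_eq_square)
qed

text \<open>The martingale differences for the filtration in which coordinates are integrated out one after the other; they sum to
\<open>F - E F\<close> and are orthogonal.\<close>

definition MD :: "nat => ((nat => 's) => real) => (nat => 's) => real" where
 "MD k F s = avs k F s - av k (avs k F) s"

lemma av_MD: "av k (MD k F) s = 0"
proof -
 have "MD k F = (%s. avs k F s - av k (avs k F) s)" by (auto simp: MD_def)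
 then show ?thesis using av_free[OF free_av[of k "avs k F"]] by (simp add: av_diff)
qed

lemma sum_MD: "(\<Sum>k<j. MD k F s) = F s - avs j F s"
 by (induction j) (auto simp: MD_def)

lemma EE_product:
 "EE (%s. F s * H s) = EE F * EE H + (\<Sum>k<m. EE (%s. MD k F s * H s))"
proof -
 have "F s * H s = avs m F s * H s + (\<Sum>k<m. MD k F s * H s)" for s
  unfolding sum_distrib_right[symmetric] sum_MD by (simp add: algebra_simps)
 then show ?thesis by (simp add: EE_add EE_sum EE_mult_avs)
qed

lemma EE_MD_free: "k < m ==> free k H ==> EE (%s. MD k F s * H s) = 0"
 using EE_zero_av[of k "MD k F" H] av_MD[of k F] by (simp add: mult.commute)

lemma MD_alt: "MD k F s = (\<Sum>y\<in>S k. p k y * (avs k F (s(k := s k)) - avs k F (s(k := y))))"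
 by (simp add: MD_def av_def right_diff_distrib sum_subtractf p_sum flip: sum_distrib_right)

definition lip1 :: "(nat => 's => 's => real) => ((nat => 's) => real) => bool" where
 "lip1 d G \<longleftrightarrow> (\<forall>k s x y. \<bar>G (s(k := x)) - G (s(k := y))\<bar> <= d k x y)"

definition lip2 :: "(nat => nat => 's => 's => 's => 's => real) => ((nat => 's) => real) => bool" where
 "lip2 e G \<longleftrightarrow> (\<forall>k l s x y u v. k \<noteq> l -->
   \<bar>(G (s(k := x, l := u)) - G (s(k := y, l := u))) - (G (s(k := x, l := v)) - G (s(k := y, l := v)))\<bar> <= e k l x y u v)"

lemma lip1D: "lip1 d G ==> \<bar>G (s(k := x)) - G (s(k := y))\<bar> <= d k x y" by (simp add: lip1_def)
lemma lip1_nonneg: "lip1 d G ==> 0 <= d k x y" using lip1D abs_ge_zero order_trans by blast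
lemma lip2D: "lip2 e G ==> k \<noteq> l ==> 
 \<bar>(G (s(k := x, l := u)) - G (s(k := y, l := u))) - (G (s(k := x, l := v)) - G (s(k := y, l := v)))\<bar> <= e k l x y u v"
 by (simp add: lip2_def)
lemma lip2_nonneg: "lip2 e G ==> k \<noteq> l ==> 0 <= e k l x y u v" using lip2D abs_ge_zero order_trans by blast

lemma wsum_abs_le:
 assumes "!!x. \<bar>f x\<bar> <= c"
 shows "\<bar>\<Sum>x\<in>S k. p k x * f x\<bar> <= c"
proof -
 have "\<bar>\<Sum>x\<in>S k. p k x * f x\<bar> <= (\<Sum>x\<in>S k. \<bar>p k x * f x\<bar>)" by (rule sum_abs)
 also have "... <= (\<Sum>x\<in>S k. p k x * c)" using assms p_nonneg by (intro sum_mono) (auto simp: abs_mult intro!: mult_left_mono)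
 finally show ?thesis by (simp add: p_sum flip: sum_distrib_right)
qed

lemma lip1_av: assumes "lip1 d G" shows "lip1 d (av j G)"
 unfolding lip1_def
proof (intro allI)
 fix k s x y
 show "\<bar>av j G (s(k := x)) - av j G (s(k := y))\<bar> <= d k x y"
 proof (cases "j = k")
  case True then show ?thesis using lip1_nonneg[OF assms] by simp
 next
  case False
  have "av j G (s(k := x)) - av j G (s(k := y)) = (\<Sum>z\<in>S j. p j z * (G (s(j := z, k := x)) - G (s(j := z, k := y))))"
   using False by (simp add: av_def right_diff_distrib sum_subtractf fun_upd_twist)
  also have "\<bar>...\<bar> <= d k x y" using lip1D[OF assms] by (intro wsum_abs_le) auto
  finally show ?thesis .
 qed
qed

lemma lip2_av: assumes "lip2 e G" shows "lip2 e (av j G)"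
 unfolding lip2_def
proof (intro allI impI)
 fix k l :: nat and s x y u v assume kl: "k \<noteq> l"
 consider "j = k" | "j = l" | "j \<noteq> k" "j \<noteq> l" by auto
 then show "\<bar>(av j G (s(k := x, l := u)) - av j G (s(k := y, l := u))) - (av j G (s(k := x, l := v)) - av j G (s(k := y, l := v)))\<bar> <= e k l x y u v"
 proof cases
  case 1 then show ?thesis using lip2_nonneg[OF assms kl] kl by (simp add: fun_upd_twist[OF kl])
 next
  case 2 then show ?thesis using lip2_nonneg[OF assms kl] kl by simp
 next
  case 3
  have upd: "s(k := x, l := u, j := z) = s(j := z, k := x, l := u)" for x u z using 3 by (auto simp: fun_eq_iff)
  have "(av j G (s(k := x, l := u)) - av j G (s(k := y, l := u))) - (av j G (s(k := x, l := v)) - av j G (s(k := y, l := v)))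
   = (\<Sum>z\<in>S j. p j z * ((G (s(j := z, k := x, l := u)) - G (s(j := z, k := y, l := u))) - (G (s(j := z, k := x, l := v)) - G (s(j := z, k := y, l := v)))))"
   by (simp add: av_def right_diff_distrib sum_subtractf upd)
  also have "\<bar>...\<bar> <= e k l x y u v"
   using lip2D[OF assms kl] by (intro wsum_abs_le) auto
  finally show ?thesis .
 qed
qed

lemma lip1_avs: "lip1 d G ==> lip1 d (avs j G)" by (induction j) (auto intro: lip1_av)
lemma lip2_avs: "lip2 e G ==> lip2 e (avs j G)" by (induction j) (auto intro: lip2_av)

definition E2 :: "nat => ('s => 's => real) => real" where
 "E2 k g = (\<Sum>x\<in>S k. p k x * (\<Sum>y\<in>S k. p k y * g x y))"

abbreviation (input) "square d k \<equiv> E2 k (%x y. (d k x y)^2)"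
abbreviation (input) "cubic d k \<equiv> E2 k (%x y. (d k x y)^2 * min 1 (d k x y))"
abbreviation (input) "quartic d k \<equiv> E2 k (%x y. (d k x y)^2 * min 1 ((d k x y)^2))"

lemma E2_mono: "(!!x y. f x y <= g x y) ==> E2 k f <= E2 k g"
 unfolding E2_def by (intro sum_mono mult_left_mono p_nonneg)
lemma E2_cmult: "E2 k (%x y. c * f x y) = c * E2 k f" by (simp add: E2_def sum_distrib_left algebra_simps)
lemma E2_add: "E2 k (%x y. f x y + g x y) = E2 k f + E2 k g" by (simp add: E2_def sum.distrib algebra_simps)
lemma E2_sum: "E2 k (%x y. \<Sum>i\<in>I. f i x y) = (\<Sum>i\<in>I. E2 k (f i))"
proof -
 have "E2 k (%x y. \<Sum>i\<in>I. f i x y) = (\<Sum>x\<in>S k. \<Sum>y\<in>S k. \<Sum>i\<in>I. p k x * (p k y * f i x y))"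
  by (simp add: E2_def sum_distrib_left)
 also have "... = (\<Sum>x\<in>S k. \<Sum>i\<in>I. \<Sum>y\<in>S k. p k x * (p k y * f i x y))"
  by (intro sum.cong sum.swap) auto
 also have "... = (\<Sum>i\<in>I. \<Sum>x\<in>S k. \<Sum>y\<in>S k. p k x * (p k y * f i x y))" by (rule sum.swap)
 finally show ?thesis by (simp add: E2_def sum_distrib_left)
qed
lemma E2_nonneg: "(!!x y. 0 <= f x y) ==> 0 <= E2 k f"
 unfolding E2_def by (intro sum_nonneg mult_nonneg_nonneg p_nonneg) auto
lemma E2_swap: "E2 k (%x y. f y x) = E2 k f"
 unfolding E2_def sum_distrib_left by (subst sum.swap) (simp add: mult.left_commute)
lemma E2_const1: "E2 k (%x y. f x) = (\<Sum>x\<in>S k. p k x * f x)" by (simp add: E2_def p_sum flip: sum_distrib_right)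

lemma wsum_sq_le: "(\<Sum>x\<in>S k. p k x * f x)^2 <= (\<Sum>x\<in>S k. p k x * (f x)^2)"
proof -
 define c where "c = (\<Sum>x\<in>S k. p k x * f x)"
 have "0 <= (\<Sum>x\<in>S k. p k x * (f x - c)^2)" by (intro sum_nonneg mult_nonneg_nonneg p_nonneg) auto
 also have "... = (\<Sum>x\<in>S k. p k x * (f x)^2) + (\<Sum>x\<in>S k. p k x) * c^2 - 2 * c * (\<Sum>x\<in>S k. p k x * f x)"
  by (simp add: power2_diff sum.distrib sum_subtractf sum_distrib_left sum_distrib_right algebra_simps)
 finally show ?thesis unfolding p_sum c_def[symmetric] by (simp add: power2_eq_square)
qed

lemma E2_CS:
 assumes "E2 k (%x y. (f x y)^2) <= a^2" "E2 k (%x y. (g x y)^2) <= b^2" "0 <= a" "0 <= b"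
 shows "E2 k (%x y. f x y * g x y) <= a * b"
proof -
 have e: "E2 k h = (\<Sum>z\<in>S k \<times> S k. (p k (fst z) * p k (snd z)) * h (fst z) (snd z))" for h
  unfolding E2_def by (simp add: sum_distrib_left sum.cartesian_product split_beta mult.assoc)
 show ?thesis using assms unfolding e by (intro sum_CS_le) (auto intro: mult_nonneg_nonneg p_nonneg)
qed

definition db :: "(nat => 's => 's => real) => nat => 's => real" where
 "db d k w = (\<Sum>y\<in>S k. p k y * d k w y)"

lemma MD_bound: assumes "lip1 d F" shows "\<bar>MD k F s\<bar> <= db d k (s k)"
proof -
 have "\<bar>MD k F s\<bar> <= (\<Sum>y\<in>S k. \<bar>p k y * (avs k F (s(k := s k)) - avs k F (s(k := y)))\<bar>)"
  unfolding MD_alt by (rule sum_abs)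
 also have "... <= db d k (s k)"
  unfolding db_def abs_mult using lip1D[OF lip1_avs[OF assms]] p_nonneg
  by (intro sum_mono mult_mono) (simp_all del: fun_upd_triv)
 finally show ?thesis .
qed

lemma diff_av_bound: assumes "lip1 d F" shows "\<bar>F s - av k F s\<bar> <= db d k (s k)"
proof -
 have "F s - av k F s = (\<Sum>y\<in>S k. p k y * (F (s(k := s k)) - F (s(k := y))))"
  by (simp add: av_def right_diff_distrib sum_subtractf p_sum flip: sum_distrib_right)
 also have "\<bar>...\<bar> <= (\<Sum>y\<in>S k. \<bar>p k y * (F (s(k := s k)) - F (s(k := y)))\<bar>)" by (rule sum_abs)
 also have "... <= db d k (s k)"
  unfolding db_def abs_mult using lip1D[OF assms] p_nonneg by (intro sum_mono mult_mono) (simp_all del: fun_upd_triv)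
 finally show ?thesis .
qed

lemma db_sq: "(\<Sum>w\<in>S k. p k w * (db d k w)^2) <= square d k"
 unfolding E2_def db_def by (intro sum_mono mult_left_mono wsum_sq_le p_nonneg)

text \<open>\<open>cov F H = \<Sum>\<^sub>k E (MD\<^sub>k F) (H - av\<^sub>k H)\<close>, and the two factors are bounded by the
mean change under resampling coordinate \<open>k\<close>.\<close>
lemma covariance_bound:
 assumes F: "lip1 d F" and H: "lip1 d' H"
  and a: "!!k. k < m ==> square d k <= (a k)^2" "!!k. k < m ==> 0 <= a k"
  and b: "!!k. k < m ==> E2 k (%x y. (d' k x y)^2) <= (b k)^2" "!!k. k < m ==> 0 <= b k"
 shows "\<bar>EE (%s. F s * H s) - EE F * EE H\<bar> <= (\<Sum>k<m. a k * b k)"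
proof -
 have "\<bar>EE (%s. MD k F s * H s)\<bar> <= a k * b k" if k: "k < m" for k
 proof -
  have "EE (%s. MD k F s * H s) = EE (%s. MD k F s * (H s - av k H s))"
   using EE_MD_free[OF k free_av[of k H], of F] by (simp add: right_diff_distrib EE_diff)
  also have "\<bar>...\<bar> <= EE (%s. \<bar>MD k F s * (H s - av k H s)\<bar>)" by (rule EE_abs)
  also have "... <= EE (%s. db d k (s k) * db d' k (s k))"
   unfolding abs_mult using MD_bound[OF F] diff_av_bound[OF H]
   by (intro EE_mono mult_mono) (auto intro: order_trans[OF abs_ge_zero])
  also have "... = (\<Sum>x\<in>S k. p k x * (db d k x * db d' k x))" by (rule EE_coord[OF k])
  also have "... <= a k * b k"
   using db_sq[of k d] db_sq[of k d'] a[OF k] b[OF k] by (intro sum_CS_le p_nonneg) auto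
  finally show ?thesis .
 qed
 then have "(\<Sum>k<m. \<bar>EE (%s. MD k F s * H s)\<bar>) <= (\<Sum>k<m. a k * b k)" by (intro sum_mono) auto
 with sum_abs have "\<bar>\<Sum>k<m. EE (%s. MD k F s * H s)\<bar> <= (\<Sum>k<m. a k * b k)" by (rule order_trans)
 then show ?thesis by (subst EE_product) simp
qed

text \<open>Since \<open>W = \<Sum>\<^sub>k MD\<^sub>k W\<close> and \<open>MD\<^sub>k W\<close> averages to 0 over coordinate
\<open>k\<close>, \<open>E W f(W)\<close> only sees \<open>f(W) - f(W')\<close> with \<open>W'\<close> resampled in
\<open>k\<close>. Taylor expansion at \<open>W'\<close> gives the weight \<open>TT W\<close>, whose mean is the variance, and a
remainder. Expanding at \<open>W'\<close> makes \<open>f'\<close> independent of the old value of coordinate \<open>k\<close>.\<close>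

definition tau :: "nat => ((nat => 's) => real) => (nat => 's) => real" where
 "tau k W = av k (%s. MD k W s * W s)"

definition TT :: "((nat => 's) => real) => (nat => 's) => real" where
 "TT W s = (\<Sum>k<m. tau k W s)"

lemma stein_identity:
 assumes W: "EE W = 0"
 shows "EE (%s. W s * f (W s)) = EE (%s. TT W s * f' (W s)) +
  (\<Sum>k<m. EE (%s. MD k W s * (\<Sum>x\<in>S k. p k x * 
    (f (W s) - f (W (s(k := x))) - (W s - W (s(k := x))) * f' (W (s(k := x)))))))"
proof -
 have step: "EE (%s. MD k W s * f (W s)) = EE (%s. tau k W s * f' (W s)) + 
   EE (%s. MD k W s * (\<Sum>x\<in>S k. p k x * 
    (f (W s) - f (W (s(k := x))) - (W s - W (s(k := x))) * f' (W (s(k := x))))))" if k: "k < m" for k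
 proof -
  let ?g = "av k (%s. f' (W s))"
  have "(\<Sum>x\<in>S k. p k x * (f (W s) - f (W (s(k := x))) - (W s - W (s(k := x))) * f' (W (s(k := x)))))
   = f (W s) - av k (%s. f (W s)) s - W s * ?g s + av k (%s. W s * f' (W s)) s" for s
   using p_sum[of k] by (simp add: av_def right_diff_distrib left_diff_distrib sum_subtractf sum_distrib_left algebra_simps flip: sum_distrib_right)
    (simp add: sum.distrib sum_subtractf algebra_simps flip: sum_distrib_left sum_distrib_right)
  then have "EE (%s. MD k W s * (\<Sum>x\<in>S k. p k x * (f (W s) - f (W (s(k := x))) - (W s - W (s(k := x))) * f' (W (s(k := x))))))
    = EE (%s. MD k W s * f (W s) - MD k W s * av k (%s. f (W s)) s - MD k W s * (W s * ?g s) + MD k W s * av k (%s. W s * f' (W s)) s)"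
   by (intro arg_cong[where f = EE] ext) (simp only: right_diff_distrib distrib_left)
  also have "... = EE (%s. MD k W s * f (W s)) - EE (%s. MD k W s * (W s * ?g s))"
   by (simp add: EE_add EE_diff EE_MD_free[OF k free_av])
  also have "EE (%s. MD k W s * (W s * ?g s)) = EE (%s. tau k W s * f' (W s))"
  proof -
   have "EE (%s. MD k W s * (W s * ?g s)) = EE (av k (%s. ?g s * (MD k W s * W s)))"
    by (simp add: EE_av[OF k] algebra_simps)
   also have "... = EE (%s. ?g s * tau k W s)" by (simp only: av_mult_fun[OF free_av] tau_def)
   also have "... = EE (%s. tau k W s * ?g s)" by (simp add: mult.commute)
   also have "... = EE (av k (%s. tau k W s * f' (W s)))" unfolding tau_def by (simp only: av_mult_fun[OF free_av])
   finally show ?thesis by (simp add: EE_av[OF k])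
  qed
  finally show ?thesis by linarith
 qed
 have "(\<Sum>k<m. EE (%s. MD k W s * f (W s))) = (\<Sum>k<m. EE (%s. tau k W s * f' (W s)) + 
   EE (%s. MD k W s * (\<Sum>x\<in>S k. p k x * 
    (f (W s) - f (W (s(k := x))) - (W s - W (s(k := x))) * f' (W (s(k := x)))))))"
  by (rule sum.cong[OF refl], rule step) simp
 moreover have "EE (%s. TT W s * f' (W s)) = (\<Sum>k<m. EE (%s. tau k W s * f' (W s)))"
  unfolding TT_def sum_distrib_right by (rule EE_sum)
 ultimately show ?thesis by (subst EE_product) (simp only: W sum.distrib mult_zero_left add_0_left)
qed

lemma EE_TT: assumes "EE W = 0" shows "EE (TT W) = EE (%s. (W s)^2)"
proof -
 show ?thesis
  using stein_identity[OF assms, of "%x. x" "%x. 1"]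
  by (simp add: power2_eq_square EE_const)
qed

end

section \<open>Lipschitz test functions\<close>

context finite_model begin

lemma E2_mult_sep: "E2 k (%x y. f x * g y) = (\<Sum>x\<in>S k. p k x * f x) * (\<Sum>y\<in>S k. p k y * g y)"
proof -
 have "(\<Sum>y\<in>S k. p k y * (f x * g y)) = f x * (\<Sum>y\<in>S k. p k y * g y)" for x
  by (simp add: sum_distrib_left mult.left_commute)
 then show ?thesis by (simp add: E2_def sum_distrib_right mult.assoc)
qed

lemma E2_prod_diff:
 "E2 k (%x y. (f x - f y) * (g x - g y)) =
   2 * ((\<Sum>x\<in>S k. p k x * (f x * g x)) - (\<Sum>x\<in>S k. p k x * f x) * (\<Sum>x\<in>S k. p k x * g x))"
proof -
 have "E2 k (%x y. (f x - f y) * (g x - g y)) = E2 k (%x y. (f x * g x + f y * g y) - (f x * g y + g x * f y))"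
  by (simp add: algebra_simps)
 also have "... = E2 k (%x y. f x * g x) + E2 k (%x y. f y * g y) - (E2 k (%x y. f x * g y) + E2 k (%x y. g x * f y))"
  by (simp add: E2_def sum.distrib sum_subtractf distrib_left right_diff_distrib)
 also have "E2 k (%x y. f y * g y) = E2 k (%x y. f x * g x)" by (rule E2_swap)
 finally show ?thesis unfolding E2_mult_sep E2_const1 by simp
qed

lemma tau_alt: "tau k W s = 1/2 * E2 k (%x y. (avs k W (s(k := x)) - avs k W (s(k := y))) * (W (s(k := x)) - W (s(k := y))))"
proof -
 have "tau k W s = av k (%s. avs k W s * W s) s - av k (avs k W) s * av k W s"
  unfolding tau_def MD_def left_diff_distrib av_diff av_mult[OF free_av] ..
 then show ?thesis
  unfolding E2_prod_diff[of k "%x. avs k W (s(k := x))" "%x. W (s(k := x))"] by (simp add: av_def)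
qed

lemma prod_diff_bound:
 fixes a1 a2 b1 b2 :: real
 assumes "\<bar>a1 - a2\<bar> <= e" "\<bar>b1 - b2\<bar> <= e" "\<bar>b1\<bar> <= d" "\<bar>a2\<bar> <= d"
 shows "\<bar>a1 * b1 - a2 * b2\<bar> <= 2 * (e * d)"
proof -
 have "\<bar>a1 * b1 - a2 * b2\<bar> = \<bar>(a1 - a2) * b1 + (b1 - b2) * a2\<bar>" by (simp add: algebra_simps)
 also have "... <= \<bar>a1 - a2\<bar> * \<bar>b1\<bar> + \<bar>b1 - b2\<bar> * \<bar>a2\<bar>"
  using abs_triangle_ineq[of "(a1 - a2) * b1" "(b1 - b2) * a2"] by (simp add: abs_mult)
 also have "... <= e * d + e * d" using assms by (intro add_mono mult_mono) auto
 also have "... = 2 * (e * d)" by (rule mult_2[symmetric])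
 finally show ?thesis .
qed

lemma E2_diff: "E2 k (%x y. f x y - g x y) = E2 k f - E2 k g"
 by (simp add: E2_def sum_subtractf right_diff_distrib)

lemma E2_abs_le: assumes "!!x y. \<bar>f x y\<bar> <= g x y" shows "\<bar>E2 k f\<bar> <= E2 k g"
proof (rule abs_leI)
 show "E2 k f <= E2 k g" by (rule E2_mono) (use assms abs_le_D1 in blast)
 have "E2 k (%x y. (-1) * f x y) <= E2 k g" by (rule E2_mono) (use assms abs_le_D2 in force)
 then show "- E2 k f <= E2 k g" unfolding E2_cmult by simp
qed

lemma tau_diff:
 assumes d: "lip1 d W" and e: "lip2 e W" and kl: "k \<noteq> l"
 shows "\<bar>tau k W (s(l := u)) - tau k W (s(l := v))\<bar> <= E2 k (%x y. e k l x y u v * d k x y)"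
proof -
 let ?A = "%u x. avs k W (s(k := x, l := u))" and ?W = "%u x. W (s(k := x, l := u))"
 have t: "s(l := u, k := x) = s(k := x, l := u)" for u x using kl by (auto simp: fun_eq_iff)
 have d1: "\<bar>?W u x - ?W u y\<bar> <= d k x y" "\<bar>?A u x - ?A u y\<bar> <= d k x y" for u x y
  unfolding t[symmetric] using lip1D[OF d] lip1D[OF lip1_avs[OF d]] by blast+
 have eq: "tau k W (s(l := u)) - tau k W (s(l := v)) = 
   E2 k (%x y. 1/2 * ((?A u x - ?A u y) * (?W u x - ?W u y) - (?A v x - ?A v y) * (?W v x - ?W v y)))"
  unfolding tau_alt E2_cmult E2_diff t by (simp add: right_diff_distrib)
 show ?thesis unfolding eq
 proof (rule E2_abs_le)
  fix x y
  show "\<bar>1/2 * ((?A u x - ?A u y) * (?W u x - ?W u y) - (?A v x - ?A v y) * (?W v x - ?W v y))\<bar> <= e k l x y u v * d k x y"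
  proof -
   have "\<bar>(?A u x - ?A u y) * (?W u x - ?W u y) - (?A v x - ?A v y) * (?W v x - ?W v y)\<bar> <= 2 * (e k l x y u v * d k x y)"
    by (rule prod_diff_bound[OF lip2D[OF lip2_avs[OF e] kl] lip2D[OF e kl] d1(1) d1(2)])
   then show ?thesis by (simp add: abs_mult)
  qed
 qed
qed

text \<open>Resampling \<open>l\<close> changes \<open>tau k W\<close> through mixed second differences only, so \<open>TT
W\<close> fluctuates less than \<open>W\<close> by the factor \<open>ep\<close>.\<close>
lemma TT_lip1:
 assumes d: "lip1 d W" and e: "lip2 e W"
  and eps: "!!l u v. (\<Sum>k\<in>{..<m} - {l}. E2 k (%x y. e k l x y u v * d k x y)) <= ep * d l u v"
 shows "lip1 (%l u v. ep * d l u v) (TT W)"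
 unfolding lip1_def
proof (intro allI)
 fix l s u v
 have z: "tau l W (s(l := u)) = tau l W (s(l := v))" by (simp add: tau_def)
 have "\<bar>TT W (s(l := u)) - TT W (s(l := v))\<bar> <= (\<Sum>k<m. \<bar>tau k W (s(l := u)) - tau k W (s(l := v))\<bar>)"
  unfolding TT_def sum_subtractf[symmetric] by (rule sum_abs)
 also have "... = (\<Sum>k\<in>{..<m} - {l}. \<bar>tau k W (s(l := u)) - tau k W (s(l := v))\<bar>)"
  by (rule sum.mono_neutral_right) (auto simp: z)
 also have "... <= (\<Sum>k\<in>{..<m} - {l}. E2 k (%x y. e k l x y u v * d k x y))"
  using tau_diff[OF d e] by (intro sum_mono) auto
 finally show "\<bar>TT W (s(l := u)) - TT W (s(l := v))\<bar> <= ep * d l u v" using eps[of l u v] by linarith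
qed

text \<open>The Efron-Stein inequality up to a constant.\<close>
lemma variance_bound:
 assumes "lip1 d F" 
 shows "EE (%s. (F s - EE F)^2) <= (\<Sum>k<m. square d k)"
proof -
 have "EE (%s. (F s - EE F)^2) = EE (%s. (F s * F s - (2 * EE F) * F s) + (EE F)^2)"
  by (simp add: power2_eq_square algebra_simps)
 also have "... = EE (%s. F s * F s) - EE F * EE F"
  by (simp only: EE_add EE_diff EE_cmult EE_const) (simp add: power2_eq_square)
 also have "... <= (\<Sum>k<m. sqrt (square d k) * sqrt (square d k))"
  by (rule order_trans[OF abs_ge_self covariance_bound[OF assms assms]]) (auto simp: E2_nonneg)
 finally show ?thesis by (simp add: E2_nonneg)
qed

lemma TT_bound:
 assumes W: "EE W = 0" and d: "lip1 d W" and e: "lip2 e W"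
  and eps: "!!l u v. (\<Sum>k\<in>{..<m} - {l}. E2 k (%x y. e k l x y u v * d k x y)) <= ep * d l u v"
  and B: "(\<Sum>k<m. square d k) <= B" and e0: "0 <= ep"
 shows "EE (%s. \<bar>1 - TT W s\<bar>) <= \<bar>1 - EE (%s. (W s)^2)\<bar> + ep * sqrt B"
proof -
 have B0: "0 <= B" using B by (rule order_trans[rotated]) (auto intro!: sum_nonneg E2_nonneg)
 have "EE (%s. (TT W s - EE (TT W))^2) <= (\<Sum>k<m. E2 k (%x y. (ep * d k x y)^2))"
  by (rule variance_bound[OF TT_lip1[OF d e eps]])
 also have "... = ep^2 * (\<Sum>k<m. square d k)"
  by (simp add: power_mult_distrib E2_cmult sum_distrib_left)
 also have "... <= ep^2 * B" using B by (intro mult_left_mono) auto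
 finally have "sqrt (EE (%s. (TT W s - EE (TT W))^2)) <= sqrt (ep^2 * B)" by simp
 then have 1: "EE (%s. \<bar>TT W s - EE (TT W)\<bar>) <= ep * sqrt B"
  using EE_abs_le_sqrt[of "%s. TT W s - EE (TT W)"] e0 by (simp add: real_sqrt_mult)
 have "EE (%s. \<bar>1 - TT W s\<bar>) <= EE (%s. \<bar>1 - EE (TT W)\<bar> + \<bar>TT W s - EE (TT W)\<bar>)" by (rule EE_mono) linarith
 then show ?thesis using 1 unfolding EE_add EE_const EE_TT[OF W] by linarith
qed

lemma wsum_prod_le:
 assumes "!!x y. f x * g y <= h x + h' y"
 shows "(\<Sum>x\<in>S k. p k x * f x) * (\<Sum>y\<in>S k. p k y * g y) <= (\<Sum>x\<in>S k. p k x * h x) + (\<Sum>y\<in>S k. p k y * h' y)"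
proof -
 have "(\<Sum>x\<in>S k. p k x * f x) * (\<Sum>y\<in>S k. p k y * g y) = E2 k (%x y. f x * g y)"
  by (rule E2_mult_sep[symmetric])
 also have "... <= E2 k (%x y. h x + h' y)" by (rule E2_mono) (rule assms)
 also have "... = E2 k (%x y. h x) + E2 k (%x y. h' y)" by (rule E2_add)
 also have "E2 k (%x y. h' y) = E2 k (%x y. h' x)" by (rule E2_swap)
 finally show ?thesis by (simp only: E2_const1)
qed

lemma EE_free_coord:
 assumes "k < m" "free k H" shows "EE (%s. H s * g (s k)) = EE H * (\<Sum>x\<in>S k. p k x * g x)"
proof -
 have "av k (%s. H s * g (s k)) = (%s. (\<Sum>x\<in>S k. p k x * g x) * H s)"
  by (rule ext) (simp add: av_mult[OF assms(2)], simp add: av_def)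
 then have "EE (%s. H s * g (s k)) = EE (%s. (\<Sum>x\<in>S k. p k x * g x) * H s)"
  using EE_av[OF assms(1), of "%s. H s * g (s k)"] by (simp only:)
 then show ?thesis unfolding EE_cmult by (simp add: mult.commute)
qed

lemma mult_min_le3: fixes a b :: real assumes "0 <= a" "0 <= b" shows "a * (b * min 1 b) <= a^2 * min 1 a + b^2 * min 1 b"
proof (cases "a <= b")
 case True
 then have "a * (b * min 1 b) <= b * (b * min 1 b)" using assms by (intro mult_right_mono) auto
 then show ?thesis using assms by (simp add: power2_eq_square add_increasing)
next
 case False
 then have "a * (b * min 1 b) <= a * (a * min 1 a)" using assms by (intro mult_left_mono mult_mono) auto
 then show ?thesis using assms by (simp add: power2_eq_square add_increasing2)
qed

lemma remainder_weighted:
 assumes k: "k < m" and d: "lip1 d W" and H: "free k H" "!!s. 0 <= H s"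
 shows "EE (%s. \<bar>MD k W s\<bar> * (\<Sum>x\<in>S k. p k x * (H s * (d k (s k) x * min 1 (d k (s k) x))))) <=
   EE H * (2 * cubic d k)"
proof -
 let ?g = "%w. \<Sum>x\<in>S k. p k x * (d k w x * min 1 (d k w x))"
 note d0 = lip1_nonneg[OF d]
 have g0: "0 <= ?g w" for w using d0 by (auto intro!: sum_nonneg mult_nonneg_nonneg p_nonneg)
 have "EE (%s. \<bar>MD k W s\<bar> * (\<Sum>x\<in>S k. p k x * (H s * (d k (s k) x * min 1 (d k (s k) x)))))
   <= EE (%s. H s * (db d k (s k) * ?g (s k)))"
 proof (rule EE_mono)
  fix s
  have "\<bar>MD k W s\<bar> * (\<Sum>x\<in>S k. p k x * (H s * (d k (s k) x * min 1 (d k (s k) x)))) = \<bar>MD k W s\<bar> * (H s * ?g (s k))"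
   by (simp add: sum_distrib_left mult_ac)
  also have "... <= db d k (s k) * (H s * ?g (s k))"
   using H(2)[of s] g0 by (intro mult_right_mono MD_bound[OF d]) auto
  finally show "\<bar>MD k W s\<bar> * (\<Sum>x\<in>S k. p k x * (H s * (d k (s k) x * min 1 (d k (s k) x)))) <= H s * (db d k (s k) * ?g (s k))"
   by (simp add: mult_ac)
 qed
 also have "... = EE H * (\<Sum>w\<in>S k. p k w * (db d k w * ?g w))" by (rule EE_free_coord[OF k H(1)])
 also have "... <= EE H * (2 * cubic d k)"
 proof (rule mult_left_mono)
  have "(\<Sum>w\<in>S k. p k w * (db d k w * ?g w)) <= (\<Sum>w\<in>S k. p k w * (2 * (\<Sum>x\<in>S k. p k x * ((d k w x)^2 * min 1 (d k w x)))))"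
  proof (intro sum_mono mult_left_mono p_nonneg)
   fix w
   show "db d k w * ?g w <= 2 * (\<Sum>x\<in>S k. p k x * ((d k w x)^2 * min 1 (d k w x)))"
    unfolding db_def using wsum_prod_le[of "d k w" "%x. d k w x * min 1 (d k w x)", OF mult_min_le3[OF d0 d0]] by simp
  qed
  then show "(\<Sum>w\<in>S k. p k w * (db d k w * ?g w)) <= 2 * cubic d k"
   unfolding E2_def by (simp add: sum_distrib_left mult_ac)
  show "0 <= EE H" using EE_mono[of "%s. 0" H] H(2) by (simp add: EE_const)
 qed
 finally show ?thesis .
qed

definition H3 :: "(nat => 's => 's => real) => real" where
 "H3 d = (\<Sum>k<m. cubic d k)"

definition H4 :: "(nat => 's => 's => real) => real" where
 "H4 d = (\<Sum>k<m. quartic d k)"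

lemma lip1_diff: "lip1 d W ==> \<bar>W s - W (s(k := x))\<bar> <= d k (s k) x"
 using lip1D[of d W s k "s k" x] by simp

lemma mvt_between:
 fixes f f' :: "real => real"
 assumes "!!w. (f has_real_derivative f' w) (at w)"
 obtains z where "min a b <= z" "z <= max a b" "f b - f a = (b - a) * f' z"
proof (cases a b rule: linorder_cases)
 case less
 from MVT2[OF less assms] obtain z where "a < z" "z < b" "f b - f a = (b - a) * f' z" by auto
 then show ?thesis by (intro that[of z]) auto
next
 case greater
 from MVT2[OF greater assms] obtain z where "b < z" "z < a" "f a - f b = (a - b) * f' z" by auto
 then show ?thesis by (intro that[of z]) (auto simp: algebra_simps)
qed (auto intro: that[of a])

text \<open>The part of the error that does not depend on the class of test functions: \<open>TT W\<close> is compared with 1, and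
the Taylor remainders are left over.\<close>
lemma stein_error:
 assumes W: "EE W = 0" and d: "lip1 d W" and e: "lip2 e W"
  and eps: "!!l u v. (\<Sum>k\<in>{..<m} - {l}. E2 k (%x y. e k l x y u v * d k x y)) <= ep * d l u v"
  and B: "(\<Sum>k<m. square d k) <= B" and e0: "0 <= ep"
  and f': "!!w. f' w = w * f w + h w - c" "!!w. \<bar>f' w\<bar> <= K"
  and R: "!!b a. R b a = f b - f a - (b - a) * f' a"
 shows "\<bar>EE (%s. h (W s)) - c\<bar> <= K * (\<bar>1 - EE (%s. (W s)^2)\<bar> + ep * sqrt B) +
   (\<Sum>k<m. \<bar>EE (%s. MD k W s * (\<Sum>x\<in>S k. p k x * R (W s) (W (s(k := x)))))\<bar>)"
proof -
 let ?R = "%k. EE (%s. MD k W s * (\<Sum>x\<in>S k. p k x * R (W s) (W (s(k := x)))))"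
 have "EE (%s. W s * f (W s)) = EE (%s. TT W s * f' (W s)) + (\<Sum>k<m. ?R k)"
  unfolding R by (rule stein_identity[OF W])
 moreover have "EE (%s. f' (W s)) = EE (%s. W s * f (W s)) + (EE (%s. h (W s)) - c)"
  unfolding f'(1) EE_diff EE_add EE_const by simp
 moreover have "EE (%s. f' (W s) * (1 - TT W s)) = EE (%s. f' (W s)) - EE (%s. TT W s * f' (W s))"
  by (simp add: right_diff_distrib EE_diff mult.commute)
 moreover have "\<bar>EE (%s. f' (W s) * (1 - TT W s))\<bar> <= K * (\<bar>1 - EE (%s. (W s)^2)\<bar> + ep * sqrt B)"
 proof -
  have "0 <= K" using f'(2)[of 0] by linarith
  have "\<bar>EE (%s. f' (W s) * (1 - TT W s))\<bar> <= EE (%s. \<bar>f' (W s) * (1 - TT W s)\<bar>)" by (rule EE_abs)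
  also have "... <= EE (%s. K * \<bar>1 - TT W s\<bar>)"
   unfolding abs_mult using f'(2) by (intro EE_mono mult_right_mono) auto
  also have "... = K * EE (%s. \<bar>1 - TT W s\<bar>)" by (rule EE_cmult)
  also have "... <= K * (\<bar>1 - EE (%s. (W s)^2)\<bar> + ep * sqrt B)"
   using TT_bound[OF W d e eps B e0] \<open>0 <= K\<close> by (rule mult_left_mono)
  finally show ?thesis .
 qed
 moreover have "\<bar>\<Sum>k<m. ?R k\<bar> <= (\<Sum>k<m. \<bar>?R k\<bar>)" by (rule sum_abs)
 ultimately show ?thesis by linarith
qed

text \<open>\<open>f'\<close> is bounded and Lipschitz, so the Taylor remainder is of order \<open>d (1 \<and> d)\<close>; the
factor \<open>MD\<^sub>k W\<close> contributes one more \<open>d\<close>.\<close>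
theorem normal_approximation_lipschitz:
 assumes W: "EE W = 0" and d: "lip1 d W" and e: "lip2 e W"
  and eps: "!!l u v. (\<Sum>k\<in>{..<m} - {l}. E2 k (%x y. e k l x y u v * d k x y)) <= ep * d l u v"
  and B: "(\<Sum>k<m. square d k) <= B" and e0: "0 <= ep"
  and h: "!!x y. \<bar>h x - h y\<bar> <= \<bar>x - y\<bar>"
 shows "\<bar>EE (%s. h (W s)) - normal_mean h\<bar> <= 11 * (\<bar>1 - EE (%s. (W s)^2)\<bar> + ep * sqrt B) + 44 * H3 d"
proof -
 define c where "c = normal_mean h"
 obtain f where f: "!!w. (f has_real_derivative (w * f w + h w - c)) (at w)" 
  "!!w. \<bar>w * f w + h w - c\<bar> <= 11" "!!a b. \<bar>(b * f b + h b - c) - (a * f a + h a - c)\<bar> <= 8 * \<bar>b - a\<bar>"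
  using stein_lipschitz[of h, OF h] unfolding c_def[symmetric] by metis
 define f' where "f' w = w * f w + h w - c" for w
 have ff: "(f has_real_derivative f' w) (at w)" for w unfolding f'_def by (rule f(1))
 define R where "R b a = f b - f a - (b - a) * f' a" for b a
 have R: "\<bar>R b a\<bar> <= 22 * (\<bar>b - a\<bar> * min 1 \<bar>b - a\<bar>)" for a b
 proof -
  obtain z where "min a b <= z" "z <= max a b" and zf: "f b - f a = (b - a) * f' z" by (rule mvt_between[OF ff])
  then have z: "\<bar>z - a\<bar> <= \<bar>b - a\<bar>" by linarith
  have "R b a = (b - a) * (f' z - f' a)" unfolding R_def zf by (simp add: algebra_simps)
  moreover have "\<bar>f' z - f' a\<bar> <= 22" using f(2)[of z] f(2)[of a] unfolding f'_def by linarith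
  moreover have "\<bar>f' z - f' a\<bar> <= 22 * \<bar>b - a\<bar>"
  proof -
   have "\<bar>f' z - f' a\<bar> <= 8 * \<bar>z - a\<bar>" unfolding f'_def by (rule f(3))
   also have "... <= 22 * \<bar>b - a\<bar>" using z by (intro mult_mono) auto
   finally show ?thesis .
  qed
  ultimately have "\<bar>R b a\<bar> = \<bar>b - a\<bar> * \<bar>f' z - f' a\<bar>" "\<bar>f' z - f' a\<bar> <= 22 * min 1 \<bar>b - a\<bar>"
   by (simp_all add: abs_mult min_def)
  then show ?thesis using mult_left_mono[of "\<bar>f' z - f' a\<bar>" "22 * min 1 \<bar>b - a\<bar>" "\<bar>b - a\<bar>"] by simp
 qed
 let ?R = "%k. EE (%s. MD k W s * (\<Sum>x\<in>S k. p k x * R (W s) (W (s(k := x)))))"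
 have Rk: "\<bar>?R k\<bar> <= 44 * cubic d k" if k: "k < m" for k
 proof -
  have "\<bar>?R k\<bar> <= EE (%s. \<bar>MD k W s * (\<Sum>x\<in>S k. p k x * R (W s) (W (s(k := x))))\<bar>)" by (rule EE_abs)
  also have "... <= EE (%s. \<bar>MD k W s\<bar> * (\<Sum>x\<in>S k. p k x * (22 * (d k (s k) x * min 1 (d k (s k) x)))))"
  proof (rule EE_mono)
   fix s
   have "\<bar>\<Sum>x\<in>S k. p k x * R (W s) (W (s(k := x)))\<bar> <= (\<Sum>x\<in>S k. \<bar>p k x * R (W s) (W (s(k := x)))\<bar>)" by (rule sum_abs)
   also have "... <= (\<Sum>x\<in>S k. p k x * (22 * (d k (s k) x * min 1 (d k (s k) x))))"
   proof (rule sum_mono)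
    fix x
    have "\<bar>R (W s) (W (s(k := x)))\<bar> <= 22 * (\<bar>W s - W (s(k := x))\<bar> * min 1 \<bar>W s - W (s(k := x))\<bar>)" by (rule R)
    also have "... <= 22 * (d k (s k) x * min 1 (d k (s k) x))"
     using lip1_diff[OF d, of s k x] by (intro mult_left_mono mult_mono) auto
    finally show "\<bar>p k x * R (W s) (W (s(k := x)))\<bar> <= p k x * (22 * (d k (s k) x * min 1 (d k (s k) x)))"
     using p_nonneg[of k x] by (simp add: abs_mult mult_left_mono)
   qed
   finally show "\<bar>MD k W s * (\<Sum>x\<in>S k. p k x * R (W s) (W (s(k := x))))\<bar> <= \<bar>MD k W s\<bar> * (\<Sum>x\<in>S k. p k x * (22 * (d k (s k) x * min 1 (d k (s k) x))))"
    unfolding abs_mult by (rule mult_left_mono) auto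
  qed
  also have "... <= EE (%s. 22) * (2 * cubic d k)"
   by (rule remainder_weighted[OF k d, of "%s. 22"]) (auto simp: free_def)
  finally show ?thesis by (simp add: EE_const)
 qed
 have "\<bar>EE (%s. h (W s)) - c\<bar> <= 11 * (\<bar>1 - EE (%s. (W s)^2)\<bar> + ep * sqrt B) + (\<Sum>k<m. \<bar>?R k\<bar>)"
  by (rule stein_error[OF W d e eps B e0 f'_def f(2)[folded f'_def] R_def])
 also have "(\<Sum>k<m. \<bar>?R k\<bar>) <= (\<Sum>k<m. 44 * cubic d k)"
  by (rule sum_mono, rule Rk) simp
 also have "... = 44 * H3 d" unfolding H3_def sum_distrib_left ..
 finally show ?thesis unfolding c_def by simp
qed

end

section \<open>An antisymmetric kernel\<close>

context finite_model begin

lemma EE_swap_resample: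
 assumes k: "k < m"
 shows "EE (%s. \<Sum>x\<in>S k. p k x * K s (s(k := x))) = EE (%s. \<Sum>x\<in>S k. p k x * K (s(k := x)) s)"
proof -
 have "av k (%s. \<Sum>x\<in>S k. p k x * K s (s(k := x))) = av k (%s. \<Sum>x\<in>S k. p k x * K (s(k := x)) s)"
 proof
  fix s
  show "av k (%s. \<Sum>x\<in>S k. p k x * K s (s(k := x))) s = av k (%s. \<Sum>x\<in>S k. p k x * K (s(k := x)) s) s"
   using E2_swap[of k "%x y. K (s(k := x)) (s(k := y))"] by (simp add: av_def E2_def)
 qed
 from arg_cong[where f = EE, OF this] show ?thesis unfolding EE_av[OF k] .
qed

lemma EE_mult_centred:
 assumes k: "k < m" and l: "l < m" and q: "!!s. av k q s = 0" and r: "!!s. av l r s = 0"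
 shows "EE (%s. q s * r s) = EE (%s. (q s - av l q s) * (r s - av k r s))"
proof -
 have 1: "EE (%s. av k r s * q s) = 0" by (rule EE_zero_av[OF k q free_av])
 have 2: "EE (%s. av l q s * r s) = 0" by (rule EE_zero_av[OF l r free_av])
 have "av k q = (%s. 0)" using q by auto
 then have z: "av k (av l q) s = 0" for s by (subst av_commute) (simp add: av_const)
 have 3: "EE (%s. av k r s * av l q s) = 0" by (rule EE_zero_av[OF k z free_av])
 have "(q s - av l q s) * (r s - av k r s) = (q s * r s - av k r s * q s) - (av l q s * r s - av k r s * av l q s)" for s
  by (simp add: algebra_simps)
 then show ?thesis by (simp add: EE_diff 1 2 3)
qed

lemma mult_le_half_squares: "a * b <= 1/2 * a^2 + 1/2 * (b::real)^2"
 using sum_squares_bound[of a b] by simp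

text \<open>If \<open>q\<^sub>k\<close> is centred in coordinate \<open>k\<close>, then in \<open>E q\<^sub>k q\<^sub>l\<close>
each factor may be replaced by its fluctuation in the coordinate of the other one.\<close>
lemma almost_orthogonal:
 assumes q: "!!k s. k < m ==> av k (q k) s = 0"
 shows "EE (%s. (\<Sum>k<m. q k s)^2) <=
  (\<Sum>k<m. EE (%s. (q k s)^2) + (\<Sum>l\<in>{..<m} - {k}. EE (%s. (q k s - av l (q k) s)^2)))"
proof -
 define U where "U k l = (if k = l then EE (%s. (q k s)^2) else EE (%s. (q k s - av l (q k) s)^2))" for k l
 have kl: "EE (%s. q k s * q l s) <= 1/2 * U k l + 1/2 * U l k" if "k < m" "l < m" for k l
 proof (cases "k = l")
  case True then show ?thesis by (simp add: U_def power2_eq_square)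
 next
  case False
  have "EE (%s. q k s * q l s) = EE (%s. (q k s - av l (q k) s) * (q l s - av k (q l) s))"
   by (rule EE_mult_centred) (use that q in auto)
  also have "... <= EE (%s. 1/2 * (q k s - av l (q k) s)^2 + 1/2 * (q l s - av k (q l) s)^2)"
  proof (rule EE_mono)
   fix s
   show "(q k s - av l (q k) s) * (q l s - av k (q l) s) <= 1/2 * (q k s - av l (q k) s)^2 + 1/2 * (q l s - av k (q l) s)^2"
    by (rule mult_le_half_squares)
  qed
  also have "... = 1/2 * EE (%s. (q k s - av l (q k) s)^2) + 1/2 * EE (%s. (q l s - av k (q l) s)^2)"
   by (simp only: EE_add EE_cmult)
  also have "... = 1/2 * U k l + 1/2 * U l k" unfolding U_def if_not_P[OF False] if_not_P[OF False[symmetric]] ..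
  finally show ?thesis .
 qed
 have "EE (%s. (\<Sum>k<m. q k s)^2) = EE (%s. \<Sum>k<m. \<Sum>l<m. q k s * q l s)"
  by (simp add: power2_eq_square sum_product)
 also have "... = (\<Sum>k<m. \<Sum>l<m. EE (%s. q k s * q l s))" by (simp add: EE_sum)
 also have "... <= (\<Sum>k<m. \<Sum>l<m. 1/2 * U k l + 1/2 * U l k)" using kl by (intro sum_mono) auto
 also have "... = 1/2 * (\<Sum>k<m. \<Sum>l<m. U k l) + 1/2 * (\<Sum>k<m. \<Sum>l<m. U l k)"
  by (simp add: sum.distrib sum_distrib_left)
 also have "(\<Sum>k<m. \<Sum>l<m. U l k) = (\<Sum>k<m. \<Sum>l<m. U k l)" by (rule sum.swap)
 also have "1/2 * (\<Sum>k<m. \<Sum>l<m. U k l) + 1/2 * (\<Sum>k<m. \<Sum>l<m. U k l) = (\<Sum>k<m. \<Sum>l<m. U k l)" by simp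
 also have "... = (\<Sum>k<m. U k k + (\<Sum>l\<in>{..<m} - {k}. U k l))"
  by (intro sum.cong refl sum.remove) auto
 also have "... = (\<Sum>k<m. EE (%s. (q k s)^2) + (\<Sum>l\<in>{..<m} - {k}. EE (%s. (q k s - av l (q k) s)^2)))"
  unfolding U_def by (intro sum.cong refl arg_cong2[where f = plus]) auto
 finally show ?thesis .
qed

definition E3 :: "nat => ('s => 's => 's => real) => real" where
 "E3 k g = E2 k (%w x. \<Sum>z\<in>S k. p k z * g w x z)"

lemma E3_mono: "(!!w x z. f w x z <= g w x z) ==> E3 k f <= E3 k g"
 unfolding E3_def by (intro E2_mono sum_mono mult_left_mono p_nonneg)
lemma E3_add: "E3 k (%w x z. f w x z + g w x z) = E3 k f + E3 k g"
 by (simp add: E3_def distrib_left sum.distrib E2_add)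
lemma E3_cmult: "E3 k (%w x z. c * f w x z) = c * E3 k f"
 by (simp add: E3_def sum_distrib_left mult.left_commute flip: E2_cmult)
lemma E3_12: "E3 k (%w x z. f w x) = E2 k f" by (simp add: E3_def p_sum flip: sum_distrib_right)
lemma E3_13: "E3 k (%w x z. f w z) = E2 k f" by (simp add: E3_def E2_const1, simp add: E2_def)
lemma E3_23: "E3 k (%w x z. f x z) = E2 k f"
proof -
 have "E3 k (%w x z. f x z) = E2 k (%w x. \<Sum>z\<in>S k. p k z * f w z)"
  unfolding E3_def by (rule E2_swap)
 then show ?thesis by (simp add: E2_const1, simp add: E2_def)
qed

lemma EE_coord2:
 assumes "k < m" "l < m" "k \<noteq> l"
 shows "EE (%s. g (s k) (s l)) = (\<Sum>w\<in>S k. p k w * (\<Sum>u\<in>S l. p l u * g w u))"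
proof -
 have "av l (%s. g (s k) (s l)) = (%s. \<Sum>u\<in>S l. p l u * g (s k) u)"
  using assms(3) by (auto simp: av_def)
 from arg_cong[where f = EE, OF this] show ?thesis
  unfolding EE_av[OF assms(2)] EE_coord[OF assms(1), of "%w. \<Sum>u\<in>S l. p l u * g w u"] .
qed

lemma E2_wsum: "E2 l (%u v. \<Sum>x\<in>S k. p k x * g x u v) = (\<Sum>x\<in>S k. p k x * E2 l (g x))"
 unfolding E2_sum E2_cmult ..

lemma MD_diff:
 assumes e: "lip2 e W" and kl: "k \<noteq> l"
 shows "\<bar>MD k W (s(l := u)) - MD k W (s(l := v))\<bar> <= (\<Sum>z\<in>S k. p k z * e k l (s k) z u v)"
proof -
 have t: "s(l := u, k := x) = s(k := x, l := u)" for u x using kl by (auto simp: fun_eq_iff)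
 have r: "(s(l := u)) k = s k" for u using kl by simp
 have eq: "MD k W (s(l := u)) - MD k W (s(l := v)) = (\<Sum>z\<in>S k. p k z * ((avs k W (s(k := s k, l := u)) - avs k W (s(k := z, l := u))) - (avs k W (s(k := s k, l := v)) - avs k W (s(k := z, l := v)))))"
  unfolding MD_alt t r right_diff_distrib[symmetric] sum_subtractf[symmetric] ..
 have "\<bar>\<Sum>z\<in>S k. p k z * ((avs k W (s(k := s k, l := u)) - avs k W (s(k := z, l := u))) - (avs k W (s(k := s k, l := v)) - avs k W (s(k := z, l := v))))\<bar>
   <= (\<Sum>z\<in>S k. \<bar>p k z * ((avs k W (s(k := s k, l := u)) - avs k W (s(k := z, l := u))) - (avs k W (s(k := s k, l := v)) - avs k W (s(k := z, l := v))))\<bar>)"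
  by (rule sum_abs)
 also have "... <= (\<Sum>z\<in>S k. p k z * e k l (s k) z u v)"
  unfolding abs_mult abs_of_nonneg[OF p_nonneg] by (intro sum_mono mult_left_mono p_nonneg lip2D[OF lip2_avs[OF e] kl])
 finally show ?thesis unfolding eq .
qed

text \<open>With \<open>s'\<close> a copy of \<open>s\<close> resampled in \<open>k\<close>, \<open>KK\<close> changes sign when
the two are exchanged. Hence \<open>qq\<close>, its mean over the copy, is centred in coordinate \<open>k\<close>. Increments
above 1 are cut off to have fourth moments.\<close>

definition KK where
 "KK d W k s s' = of_bool (d k (s k) (s' k) <= 1) * ((W s - W s') * (\<bar>MD k W s\<bar> + \<bar>MD k W s'\<bar>))"

definition qq where
 "qq d W k s = (\<Sum>x\<in>S k. p k x * KK d W k s (s(k := x)))"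

lemma KK_antisym: "(!!x y. d k x y = d k y x) ==> KK d W k s' s = - KK d W k s s'"
 unfolding KK_def by (simp add: algebra_simps)

lemma av_qq:
 assumes "!!x y. d k x y = d k y x"
 shows "av k (qq d W k) s = 0"
proof -
 have 1: "av k (qq d W k) s = E2 k (%y x. KK d W k (s(k := y)) (s(k := x)))"
  by (simp add: av_def qq_def E2_def)
 have an: "KK d W k (s(k := x)) (s(k := y)) = (-1) * KK d W k (s(k := y)) (s(k := x))" for x y
  unfolding mult_minus1 by (rule KK_antisym[of d k, OF assms])
 have "E2 k (%y x. KK d W k (s(k := y)) (s(k := x))) = E2 k (%y x. KK d W k (s(k := x)) (s(k := y)))"
  by (rule E2_swap[symmetric])
 also have "... = E2 k (%y x. (-1) * KK d W k (s(k := y)) (s(k := x)))"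
  by (intro arg_cong[where f = "E2 k"] ext) (rule an)
 also have "... = - E2 k (%y x. KK d W k (s(k := y)) (s(k := x)))" unfolding E2_cmult by simp
 finally show ?thesis unfolding 1 by simp
qed

lemma mult_min_le: fixes a b :: real assumes "0 <= a" "0 <= b" shows "b * min 1 a <= b * min 1 b + a * min 1 a"
proof (cases "a <= b")
 case True
 then have "b * min 1 a <= b * min 1 b" using assms by (intro mult_left_mono) auto
 then show ?thesis using assms by (simp add: add_increasing2)
next
 case False
 then have "b * min 1 a <= a * min 1 a" using assms by (intro mult_right_mono) auto
 then show ?thesis using assms by (simp add: add_increasing)
qed

lemma sq_add_le: "(a + b)^2 <= 2 * (a^2 + (b::real)^2)"
 using sum_squares_bound[of a b] by (simp add: power2_sum)

lemma sq_of_bool_le: fixes a :: real shows "0 <= a ==> of_bool (a <= 1) * a^2 <= min 1 (a^2)"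
 by (auto simp: power_le_one)

lemma qq_sq_bound:
 assumes k: "k < m" and d: "lip1 d W"
 shows "EE (%s. (qq d W k s)^2) <= 8 * quartic d k"
proof -
 note d0 = lip1_nonneg[OF d]
 let ?h = "%x y. (d k x y)^2 * min 1 ((d k x y)^2)"
 let ?g = "%w x z. min 1 ((d k w x)^2) * (2 * ((d k w z)^2 + (d k x z)^2))"
 have K: "(KK d W k s (s(k := x)))^2 <= (\<Sum>z\<in>S k. p k z * ?g (s k) x z)" for s x
 proof -
  let ?w = "s k"
  have "\<bar>KK d W k s (s(k := x))\<bar> <= of_bool (d k ?w x <= 1) * (d k ?w x * (db d k ?w + db d k x))"
   unfolding KK_def abs_mult using lip1_diff[OF d, of s k x] MD_bound[OF d, of k s] MD_bound[OF d, of k "s(k := x)"]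
   by (intro mult_mono) (auto intro!: add_nonneg_nonneg)
  then have "(KK d W k s (s(k := x)))^2 <= (of_bool (d k ?w x <= 1) * (d k ?w x * (db d k ?w + db d k x)))^2"
   by (rule sqrt_le_D[rotated] abs_le_square_iff[THEN iffD1, OF order_trans[OF _ abs_ge_self]])
  also have "... = (of_bool (d k ?w x <= 1) * (d k ?w x)^2) * (db d k ?w + db d k x)^2"
   by (simp add: power_mult_distrib)
  also have "... <= min 1 ((d k ?w x)^2) * (2 * ((db d k ?w)^2 + (db d k x)^2))"
   using sq_of_bool_le[OF d0] by (intro mult_mono sq_add_le) auto
  also have "... <= min 1 ((d k ?w x)^2) * (2 * ((\<Sum>z\<in>S k. p k z * (d k ?w z)^2) + (\<Sum>z\<in>S k. p k z * (d k x z)^2)))"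
   unfolding db_def by (intro mult_left_mono add_mono wsum_sq_le) auto
  also have "... = (\<Sum>z\<in>S k. p k z * ?g (s k) x z)"
   by (simp add: sum_distrib_left sum.distrib distrib_left mult_ac)
  finally show ?thesis .
 qed
 have "EE (%s. (qq d W k s)^2) <= EE (%s. \<Sum>x\<in>S k. p k x * (\<Sum>z\<in>S k. p k z * ?g (s k) x z))"
  unfolding qq_def by (intro EE_mono order_trans[OF wsum_sq_le] sum_mono mult_left_mono p_nonneg K)
 also have "... = (\<Sum>w\<in>S k. p k w * (\<Sum>x\<in>S k. p k x * (\<Sum>z\<in>S k. p k z * ?g w x z)))"
  by (rule EE_coord[OF k])
 also have "... = E3 k ?g" by (simp add: E3_def E2_def)
 also have "... <= E3 k (%w x z. 4 * ?h w x + (2 * ?h w z + 2 * ?h x z))"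
 proof (rule E3_mono)
  fix w x z
  show "?g w x z <= 4 * ?h w x + (2 * ?h w z + 2 * ?h x z)"
   using mult_min_le[of "(d k w x)^2" "(d k w z)^2"] mult_min_le[of "(d k w x)^2" "(d k x z)^2"]
   by (simp add: algebra_simps)
 qed
 also have "... = 8 * E2 k ?h" unfolding E3_add E3_cmult E3_12 E3_13 E3_23 by simp
 finally show ?thesis .
qed

end

section \<open>Monotone test functions\<close>

lemma sq_sum4_le: "((a + b) + (c + d))^2 <= 4 * ((a^2 + b^2) + (c^2 + (d::real)^2))"
proof -
 have "((a + b) + (c + d))^2 <= 2 * ((a + b)^2 + (c + d)^2)"
  using sum_squares_bound[of "a + b" "c + d"] by (simp add: power2_sum)
 also have "... <= 2 * (2 * (a^2 + b^2) + 2 * (c^2 + d^2))"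
  using sum_squares_bound[of a b] sum_squares_bound[of c d] by (intro mult_left_mono add_mono) (auto simp: power2_sum)
 finally show ?thesis by simp
qed

lemma offdiag_pointwise:
 fixes a b c ep :: real
 assumes "0 <= a" "0 <= b" "0 <= c" "0 <= ep"
 shows "of_bool (a <= 1) * ((b^2 + c^2) * (ep * a) + a^2 * (ep * b + ep * c)) <=
  ep^2 * (b^2 + c^2 + 2 * a^2) + 2 * (b^2 * min 1 (b^2) + c^2 * min 1 (c^2) + 2 * (a^2 * min 1 (a^2)))"
proof (cases "a <= 1")
 case True
 then have a1: "min 1 (a^2) = a^2" using assms by (simp add: power_le_one)
 have h: "x^2 * a^2 <= x^2 * min 1 (x^2) + a^2 * min 1 (a^2)" if "0 <= x" for x
  using finite_model.mult_min_le[of "%_. {undefined}" "%_ _. 1" "a^2" "x^2"] by (simp add: a1 finite_model_def)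
 have e: "ep * x <= ep^2 + x^2" for x
 proof -
  have "ep * x <= 1/2 * ep^2 + 1/2 * x^2" using sum_squares_bound[of ep x] by simp
  then show ?thesis using zero_le_power2[of ep] zero_le_power2[of x] by linarith
 qed
 have "(b^2 + c^2) * (ep * a) <= (b^2 + c^2) * (ep^2 + a^2)" by (intro mult_left_mono e) auto
 moreover have "a^2 * (ep * b + ep * c) <= a^2 * ((ep^2 + b^2) + (ep^2 + c^2))" by (intro mult_left_mono add_mono e) auto
 ultimately show ?thesis using True h[OF assms(2)] h[OF assms(3)] by (simp add: algebra_simps)
next
 case False
 then show ?thesis using assms by (auto intro!: add_nonneg_nonneg mult_nonneg_nonneg)
qed

context finite_model begin

lemma E3_sum: "E3 k (%w x z. \<Sum>l\<in>I. f l w x z) = (\<Sum>l\<in>I. E3 k (f l))"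
proof -
 have "(%w x. \<Sum>z\<in>S k. p k z * (\<Sum>l\<in>I. f l w x z)) = (%w x. \<Sum>l\<in>I. \<Sum>z\<in>S k. p k z * f l w x z)"
  by (intro ext) (unfold sum_distrib_left, rule sum.swap)
 then show ?thesis unfolding E3_def by (simp only: E2_sum)
qed

lemma qq_offdiag_diff:
 assumes d: "lip1 d W" and e: "lip2 e W" and kl: "k \<noteq> l"
 shows "\<bar>qq d W k (s(l := u)) - qq d W k (s(l := v))\<bar> <=
  (\<Sum>x\<in>S k. p k x * (\<Sum>z\<in>S k. p k z * (of_bool (d k (s k) x <= 1) *
   ((e k l (s k) x u v * d k (s k) z + e k l (s k) x u v * d k x z) + (d k (s k) x * e k l (s k) z u v + d k (s k) x * e k l x z u v)))))"
proof -
 let ?w = "s k"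
 have t: "s(l := u, k := x) = s(k := x, l := u)" for u x using kl by (auto simp: fun_eq_iff)
 have r: "(s(l := u)) k = s k" "(s(k := x, l := u)) k = x" for u x using kl by auto
 have W: "\<bar>(W (s(l := u)) - W (s(k := x, l := u))) - (W (s(l := v)) - W (s(k := x, l := v)))\<bar> <= e k l ?w x u v" for x
  using lip2D[OF e kl, of s ?w u x v] by simp
 have W1: "\<bar>W (s(l := v)) - W (s(k := x, l := v))\<bar> <= d k ?w x" for x
  using lip1_diff[OF d, of "s(l := v)" k x] unfolding t r .
 have m1: "\<bar>MD k W (s(l := u))\<bar> <= (\<Sum>z\<in>S k. p k z * d k ?w z)" for u
  using MD_bound[OF d, of k "s(l := u)"] unfolding r db_def .
 have m2: "\<bar>MD k W (s(k := x, l := u))\<bar> <= (\<Sum>z\<in>S k. p k z * d k x z)" for u x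
  using MD_bound[OF d, of k "s(k := x, l := u)"] unfolding r db_def .
 have M1: "\<bar>MD k W (s(l := u)) - MD k W (s(l := v))\<bar> <= (\<Sum>z\<in>S k. p k z * e k l ?w z u v)" by (rule MD_diff[OF e kl])
 have M2: "\<bar>MD k W (s(k := x, l := u)) - MD k W (s(k := x, l := v))\<bar> <= (\<Sum>z\<in>S k. p k z * e k l x z u v)" for x
  using MD_diff[OF e kl, of "s(k := x)" u v] by simp
 have K: "\<bar>KK d W k (s(l := u)) (s(k := x, l := u)) - KK d W k (s(l := v)) (s(k := x, l := v))\<bar> <=
   (\<Sum>z\<in>S k. p k z * (of_bool (d k ?w x <= 1) *
   ((e k l ?w x u v * d k ?w z + e k l ?w x u v * d k x z) + (d k ?w x * e k l ?w z u v + d k ?w x * e k l x z u v))))" for x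
 proof -
  define Du where "Du = W (s(l := u)) - W (s(k := x, l := u))"
  define Dv where "Dv = W (s(l := v)) - W (s(k := x, l := v))"
  define Mu where "Mu = \<bar>MD k W (s(l := u))\<bar> + \<bar>MD k W (s(k := x, l := u))\<bar>"
  define Mv where "Mv = \<bar>MD k W (s(l := v))\<bar> + \<bar>MD k W (s(k := x, l := v))\<bar>"
  have 1: "\<bar>Du - Dv\<bar> <= e k l ?w x u v" unfolding Du_def Dv_def by (rule W)
  have 2: "\<bar>Dv\<bar> <= d k ?w x" unfolding Dv_def by (rule W1)
  have 3: "\<bar>Mu\<bar> <= (\<Sum>z\<in>S k. p k z * d k ?w z) + (\<Sum>z\<in>S k. p k z * d k x z)"
   unfolding Mu_def using m1[of u] m2[of x u] by simp
  have 4: "\<bar>Mu - Mv\<bar> <= (\<Sum>z\<in>S k. p k z * e k l ?w z u v) + (\<Sum>z\<in>S k. p k z * e k l x z u v)"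
   unfolding Mu_def Mv_def using M1 M2[of x] by linarith
  have "\<bar>Du * Mu - Dv * Mv\<bar> = \<bar>(Du - Dv) * Mu + Dv * (Mu - Mv)\<bar>" by (simp add: algebra_simps)
  also have "... <= \<bar>Du - Dv\<bar> * \<bar>Mu\<bar> + \<bar>Dv\<bar> * \<bar>Mu - Mv\<bar>"
   using abs_triangle_ineq[of "(Du - Dv) * Mu" "Dv * (Mu - Mv)"] by (simp add: abs_mult)
  also have "... <= e k l ?w x u v * ((\<Sum>z\<in>S k. p k z * d k ?w z) + (\<Sum>z\<in>S k. p k z * d k x z)) +
    d k ?w x * ((\<Sum>z\<in>S k. p k z * e k l ?w z u v) + (\<Sum>z\<in>S k. p k z * e k l x z u v))"
   using 1 2 3 4 lip1_nonneg[OF d] lip2_nonneg[OF e kl] by (intro add_mono mult_mono) auto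
  also have "... = (\<Sum>z\<in>S k. p k z * 
   ((e k l ?w x u v * d k ?w z + e k l ?w x u v * d k x z) + (d k ?w x * e k l ?w z u v + d k ?w x * e k l x z u v)))"
   by (simp add: distrib_left sum.distrib sum_distrib_left mult_ac)
  finally have f: "\<bar>Du * Mu - Dv * Mv\<bar> <= (\<Sum>z\<in>S k. p k z * 
   ((e k l ?w x u v * d k ?w z + e k l ?w x u v * d k x z) + (d k ?w x * e k l ?w z u v + d k ?w x * e k l x z u v)))" .
  have KKe: "KK d W k (s(l := u)) (s(k := x, l := u)) - KK d W k (s(l := v)) (s(k := x, l := v)) = of_bool (d k ?w x <= 1) * (Du * Mu - Dv * Mv)"
   unfolding KK_def r Du_def Dv_def Mu_def Mv_def by (rule right_diff_distrib[symmetric])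
  show ?thesis unfolding KKe using f by (cases "d k ?w x <= 1") auto
 qed
 have eq: "qq d W k (s(l := u)) - qq d W k (s(l := v)) = (\<Sum>x\<in>S k. p k x * (KK d W k (s(l := u)) (s(k := x, l := u)) - KK d W k (s(l := v)) (s(k := x, l := v))))"
  unfolding qq_def t by (simp add: right_diff_distrib sum_subtractf)
 show ?thesis unfolding eq
  by (rule order_trans[OF sum_abs]) (auto simp: abs_mult abs_of_nonneg[OF p_nonneg] intro!: sum_mono mult_left_mono p_nonneg K)
qed

lemma qq_offdiag_bound:
 assumes k: "k < m" and l: "l < m" and kl: "k \<noteq> l" and d: "lip1 d W" and e: "lip2 e W"
 defines "ee \<equiv> %a b. E2 l (%u v. (e k l a b u v)^2)"
 shows "EE (%s. (qq d W k s - av l (qq d W k) s)^2) <=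
  E3 k (%w x z. 4 * (of_bool (d k w x <= 1) * (((d k w z)^2 + (d k x z)^2) * ee w x + (d k w x)^2 * (ee w z + ee x z))))"
proof -
 define \<Psi> where "\<Psi> w x z u v = 4 * (of_bool (d k w x <= 1) * 
  (((d k w z)^2 + (d k x z)^2) * (e k l w x u v)^2 + (d k w x)^2 * ((e k l w z u v)^2 + (e k l x z u v)^2)))" for w x z u v
 have 1: "(qq d W k s - av l (qq d W k) s)^2 <= (\<Sum>v\<in>S l. p l v * (\<Sum>x\<in>S k. p k x * (\<Sum>z\<in>S k. p k z * \<Psi> (s k) x z (s l) v)))" for s
 proof -
  have eq: "qq d W k s - av l (qq d W k) s = (\<Sum>v\<in>S l. p l v * (qq d W k (s(l := s l)) - qq d W k (s(l := v))))"
   by (simp add: av_def right_diff_distrib sum_subtractf p_sum flip: sum_distrib_right)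
  have 2: "(qq d W k (s(l := u)) - qq d W k (s(l := v)))^2 <= (\<Sum>x\<in>S k. p k x * (\<Sum>z\<in>S k. p k z * \<Psi> (s k) x z u v))" for u v
  proof -
   let ?w = "s k"
   let ?f = "%x z. of_bool (d k ?w x <= 1) *
    ((e k l ?w x u v * d k ?w z + e k l ?w x u v * d k x z) + (d k ?w x * e k l ?w z u v + d k ?w x * e k l x z u v))"
   have "(qq d W k (s(l := u)) - qq d W k (s(l := v)))^2 <= (\<Sum>x\<in>S k. p k x * (\<Sum>z\<in>S k. p k z * ?f x z))^2"
    using qq_offdiag_diff[OF d e kl, of s u v] by (rule power2_le_iff_abs_le[THEN iffD2, rotated]) 
     (auto intro!: sum_nonneg mult_nonneg_nonneg add_nonneg_nonneg p_nonneg lip1_nonneg[OF d] lip2_nonneg[OF e kl])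
   also have "... <= (\<Sum>x\<in>S k. p k x * (\<Sum>z\<in>S k. p k z * ?f x z)^2)" by (rule wsum_sq_le)
   also have "... <= (\<Sum>x\<in>S k. p k x * (\<Sum>z\<in>S k. p k z * (?f x z)^2))" by (intro sum_mono mult_left_mono wsum_sq_le p_nonneg)
   also have "... <= (\<Sum>x\<in>S k. p k x * (\<Sum>z\<in>S k. p k z * \<Psi> ?w x z u v))"
   proof (intro sum_mono mult_left_mono p_nonneg)
    fix x z
    show "(?f x z)^2 <= \<Psi> ?w x z u v"
    proof (cases "d k ?w x <= 1")
     case True
     then have "(?f x z)^2 = ((e k l ?w x u v * d k ?w z + e k l ?w x u v * d k x z) + (d k ?w x * e k l ?w z u v + d k ?w x * e k l x z u v))^2" by simp
     also have "... <= 4 * (((e k l ?w x u v * d k ?w z)^2 + (e k l ?w x u v * d k x z)^2) + ((d k ?w x * e k l ?w z u v)^2 + (d k ?w x * e k l x z u v)^2))"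
      by (rule sq_sum4_le)
     also have "... = \<Psi> ?w x z u v" using True unfolding \<Psi>_def by (simp add: power_mult_distrib algebra_simps)
     finally show ?thesis .
    qed (simp add: \<Psi>_def)
   qed
   finally show ?thesis .
  qed
  show ?thesis unfolding eq by (rule order_trans[OF wsum_sq_le], intro sum_mono mult_left_mono p_nonneg 2)
 qed
 have "EE (%s. (qq d W k s - av l (qq d W k) s)^2) <= EE (%s. \<Sum>v\<in>S l. p l v * (\<Sum>x\<in>S k. p k x * (\<Sum>z\<in>S k. p k z * \<Psi> (s k) x z (s l) v)))"
  by (rule EE_mono) (rule 1)
 also have "... = (\<Sum>w\<in>S k. p k w * (\<Sum>u\<in>S l. p l u * (\<Sum>v\<in>S l. p l v * (\<Sum>x\<in>S k. p k x * (\<Sum>z\<in>S k. p k z * \<Psi> w x z u v)))))"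
  by (rule EE_coord2[OF k l kl])
 also have "... = (\<Sum>w\<in>S k. p k w * (\<Sum>x\<in>S k. p k x * (\<Sum>z\<in>S k. p k z * E2 l (\<Psi> w x z))))"
 proof -
  have inner: "(\<Sum>u\<in>S l. p l u * (\<Sum>v\<in>S l. p l v * (\<Sum>x\<in>S k. p k x * (\<Sum>z\<in>S k. p k z * \<Psi> w x z u v))))
   = (\<Sum>x\<in>S k. p k x * (\<Sum>z\<in>S k. p k z * E2 l (\<Psi> w x z)))" for w
  proof -
  have "(\<Sum>u\<in>S l. p l u * (\<Sum>v\<in>S l. p l v * (\<Sum>x\<in>S k. p k x * (\<Sum>z\<in>S k. p k z * \<Psi> w x z u v))))
   = E2 l (%u v. \<Sum>x\<in>S k. p k x * (\<Sum>z\<in>S k. p k z * \<Psi> w x z u v))" unfolding E2_def ..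
  also have "... = (\<Sum>x\<in>S k. p k x * E2 l (%u v. \<Sum>z\<in>S k. p k z * \<Psi> w x z u v))" by (rule E2_wsum)
  also have "... = (\<Sum>x\<in>S k. p k x * (\<Sum>z\<in>S k. p k z * E2 l (\<Psi> w x z)))" unfolding E2_wsum ..
  finally show ?thesis .
  qed
  show ?thesis unfolding inner ..
 qed
 also have "... = E3 k (%w x z. E2 l (\<Psi> w x z))" unfolding E3_def E2_def[of k] ..
 also have "(%w x z. E2 l (\<Psi> w x z)) = (%w x z. 4 * (of_bool (d k w x <= 1) * (((d k w z)^2 + (d k x z)^2) * ee w x + (d k w x)^2 * (ee w z + ee x z))))"
  unfolding \<Psi>_def ee_def E2_cmult E2_add ..
 finally show ?thesis .
qed

text \<open>The diagonal contributes \<open>H4\<close>. Off the diagonal, differences of \<open>qq\<close> in a second coordinate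
are bounded by mixed second differences of \<open>W\<close>, which are small by \<open>ep\<close>.\<close>
lemma QQ_bound:
 assumes d: "lip1 d W" and e: "lip2 e W" and sym: "!!k x y. d k x y = d k y x"
  and eps: "!!k a b. k < m ==> (\<Sum>l\<in>{..<m} - {k}. E2 l (%u v. (e k l a b u v)^2)) <= ep * d k a b"
  and B: "(\<Sum>k<m. square d k) <= B" and e0: "0 <= ep"
 shows "EE (%s. (\<Sum>k<m. qq d W k s)^2) <= 40 * H4 d + 16 * ep^2 * B"
proof -
 note d0 = lip1_nonneg[OF d]
 let ?h = "%k x y. (d k x y)^2 * min 1 ((d k x y)^2)"
 have off: "(\<Sum>l\<in>{..<m} - {k}. EE (%s. (qq d W k s - av l (qq d W k) s)^2)) <= 16 * ep^2 * square d k + 32 * E2 k (?h k)"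
  if k: "k < m" for k
 proof -
  define ee where "ee l a b = E2 l (%u v. (e k l a b u v)^2)" for l a b
  define J where "J w x = (of_bool (d k w x <= 1) :: real)" for w x
  have "(\<Sum>l\<in>{..<m} - {k}. EE (%s. (qq d W k s - av l (qq d W k) s)^2)) <=
    (\<Sum>l\<in>{..<m} - {k}. E3 k (%w x z. 4 * (J w x * (((d k w z)^2 + (d k x z)^2) * ee l w x + (d k w x)^2 * (ee l w z + ee l x z)))))"
   unfolding ee_def J_def by (intro sum_mono qq_offdiag_bound k d e) auto
  also have "... = E3 k (%w x z. \<Sum>l\<in>{..<m} - {k}. 4 * (J w x * (((d k w z)^2 + (d k x z)^2) * ee l w x + (d k w x)^2 * (ee l w z + ee l x z))))"
   by (rule E3_sum[symmetric])
  also have "... <= E3 k (%w x z. (4 * ep^2) * ((d k w z)^2 + (d k x z)^2 + 2 * (d k w x)^2) + 8 * (?h k w z + ?h k x z + 2 * ?h k w x))"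
  proof (rule E3_mono)
   fix w x z
   have "(\<Sum>l\<in>{..<m} - {k}. 4 * (J w x * (((d k w z)^2 + (d k x z)^2) * ee l w x + (d k w x)^2 * (ee l w z + ee l x z))))
     = 4 * (J w x * (((d k w z)^2 + (d k x z)^2) * (\<Sum>l\<in>{..<m} - {k}. ee l w x) + (d k w x)^2 * ((\<Sum>l\<in>{..<m} - {k}. ee l w z) + (\<Sum>l\<in>{..<m} - {k}. ee l x z))))"
    by (simp add: sum_distrib_left sum.distrib distrib_left)
   also have "... <= 4 * (J w x * (((d k w z)^2 + (d k x z)^2) * (ep * d k w x) + (d k w x)^2 * (ep * d k w z + ep * d k x z)))"
    unfolding ee_def J_def by (intro mult_left_mono add_mono eps k) auto
   also have "... <= 4 * (ep^2 * ((d k w z)^2 + (d k x z)^2 + 2 * (d k w x)^2) + 2 * (?h k w z + ?h k x z + 2 * ?h k w x))"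
    unfolding J_def by (intro mult_left_mono offdiag_pointwise d0 e0) auto
   finally show "(\<Sum>l\<in>{..<m} - {k}. 4 * (J w x * (((d k w z)^2 + (d k x z)^2) * ee l w x + (d k w x)^2 * (ee l w z + ee l x z))))
    <= (4 * ep^2) * ((d k w z)^2 + (d k x z)^2 + 2 * (d k w x)^2) + 8 * (?h k w z + ?h k x z + 2 * ?h k w x)"
    by (simp add: algebra_simps)
  qed
  also have "... = 16 * ep^2 * square d k + 32 * E2 k (?h k)"
   unfolding E3_add E3_cmult E3_12 E3_13 E3_23 by simp
  finally show ?thesis .
 qed
 have "EE (%s. (\<Sum>k<m. qq d W k s)^2) <= (\<Sum>k<m. EE (%s. (qq d W k s)^2) + (\<Sum>l\<in>{..<m} - {k}. EE (%s. (qq d W k s - av l (qq d W k) s)^2)))"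
  by (rule almost_orthogonal) (rule av_qq[OF sym])
 also have "... <= (\<Sum>k<m. 8 * E2 k (?h k) + (16 * ep^2 * square d k + 32 * E2 k (?h k)))"
  by (intro sum_mono add_mono qq_sq_bound d off) auto
 also have "... = 40 * H4 d + 16 * ep^2 * (\<Sum>k<m. square d k)"
  by (simp add: H4_def sum.distrib sum_distrib_left)
 also have "... <= 40 * H4 d + 16 * ep^2 * B" using B by (intro add_left_mono mult_left_mono) auto
 finally show ?thesis .
qed

text \<open>Replace each of the three numbers by the largest one.\<close>
lemma mult_min_le4:
 fixes a b c :: real assumes "0 <= a" "0 <= b" "0 <= c"
 shows "a * (b * min 1 (b * c)) <= a^2 * min 1 (a^2) + (b^2 * min 1 (b^2) + c^2 * min 1 (c^2))"
proof -
 define r where "r = max a (max b c)"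
 have r: "a <= r" "b <= r" "c <= r" "0 <= r" unfolding r_def using assms by auto
 have "a * (b * min 1 (b * c)) <= r * (r * min 1 (r * r))"
  using r assms by (intro mult_mono min.mono order_refl) auto
 also have "... = r^2 * min 1 (r^2)" by (simp add: power2_eq_square mult.assoc)
 also have "... <= a^2 * min 1 (a^2) + (b^2 * min 1 (b^2) + c^2 * min 1 (c^2))"
 proof -
  have "r = a \<or> r = b \<or> r = c" unfolding r_def by (auto simp: max_def)
  moreover have "0 <= x^2 * min 1 (x^2)" for x :: real by simp
  note this[of a] this[of b] this[of c]
  ultimately show ?thesis by auto
 qed
 finally show ?thesis .
qed

lemma remainder_triple:
 assumes k: "k < m" and d: "lip1 d W"
 shows "EE (%s. \<bar>MD k W s\<bar> * (\<Sum>x\<in>S k. p k x * (\<Sum>y\<in>S k. p k y * (d k (s k) x * min 1 (d k (s k) x * d k x y))))) <=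
   3 * quartic d k"
proof -
 note d0 = lip1_nonneg[OF d]
 let ?h = "%x y. (d k x y)^2 * min 1 ((d k x y)^2)"
 let ?g = "%w. \<Sum>x\<in>S k. p k x * (\<Sum>y\<in>S k. p k y * (d k w x * min 1 (d k w x * d k x y)))"
 have g0: "0 <= ?g w" for w using d0 by (auto intro!: sum_nonneg mult_nonneg_nonneg p_nonneg)
 have "EE (%s. \<bar>MD k W s\<bar> * ?g (s k)) <= EE (%s. db d k (s k) * ?g (s k))"
  by (intro EE_mono mult_right_mono MD_bound[OF d] g0)
 also have "... = (\<Sum>w\<in>S k. p k w * (db d k w * ?g w))" by (rule EE_coord[OF k])
 also have "... <= (\<Sum>w\<in>S k. p k w * ((\<Sum>z\<in>S k. p k z * ?h w z) + (\<Sum>x\<in>S k. p k x * (\<Sum>y\<in>S k. p k y * (?h w x + ?h x y)))))"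
 proof (intro sum_mono mult_left_mono p_nonneg)
  fix w
  show "db d k w * ?g w <= (\<Sum>z\<in>S k. p k z * ?h w z) + (\<Sum>x\<in>S k. p k x * (\<Sum>y\<in>S k. p k y * (?h w x + ?h x y)))"
   unfolding db_def
  proof (rule wsum_prod_le)
   fix z x
   have "d k w z * (\<Sum>y\<in>S k. p k y * (d k w x * min 1 (d k w x * d k x y))) = (\<Sum>y\<in>S k. p k y * (d k w z * (d k w x * min 1 (d k w x * d k x y))))"
    by (simp add: sum_distrib_left mult.left_commute)
   also have "... <= (\<Sum>y\<in>S k. p k y * (?h w z + (?h w x + ?h x y)))"
    by (intro sum_mono mult_left_mono p_nonneg mult_min_le4 d0)
   also have "... = ?h w z + (\<Sum>y\<in>S k. p k y * (?h w x + ?h x y))"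
    by (simp add: distrib_left sum.distrib p_sum flip: sum_distrib_right)
   finally show "d k w z * (\<Sum>y\<in>S k. p k y * (d k w x * min 1 (d k w x * d k x y))) <= ?h w z + (\<Sum>y\<in>S k. p k y * (?h w x + ?h x y))" .
  qed
 qed
 also have "... = E2 k ?h + E3 k (%w x z. ?h w x + ?h x z)"
  unfolding E3_def E2_def by (simp only: distrib_left sum.distrib)
 also have "... = 3 * E2 k ?h" unfolding E3_add E3_12 E3_23 by simp
 finally show ?thesis .
qed

text \<open>Here \<open>f'\<close> jumps with \<open>h\<close>, but as \<open>h\<close> decreases the resulting part of the
remainder is \<open>(b - a) (h a - h b) \<ge> 0\<close>, without an absolute value. Weighted with \<open>\<bar>MD\<^sub>k
W\<bar>\<close> and with the two copies exchanged, it becomes \<open>- E h(W) qq\<^sub>k\<close>; by \<open>0 \<le> h \<le>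
1\<close> the sum over \<open>k\<close> is at most the square root of \<open>QQ_bound\<close>.\<close>
theorem normal_approximation_monotone:
 assumes W: "EE W = 0" and d: "lip1 d W" and e: "lip2 e W" and sym: "!!k x y. d k x y = d k y x"
  and eps: "!!l u v. (\<Sum>k\<in>{..<m} - {l}. E2 k (%x y. e k l x y u v * d k x y)) <= ep * d l u v"
  and eps': "!!k a b. k < m ==> (\<Sum>l\<in>{..<m} - {k}. E2 l (%u v. (e k l a b u v)^2)) <= ep * d k a b"
  and B: "(\<Sum>k<m. square d k) <= B" and e0: "0 <= ep"
  and h: "continuous_on UNIV h" "!!x. 0 <= h x" "!!x. h x <= 1" "antimono h"
 shows "\<bar>EE (%s. h (W s)) - normal_mean h\<bar> <= 2 * (\<bar>1 - EE (%s. (W s)^2)\<bar> + ep * sqrt B) +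
   (16 + 4 * EE (%s. \<bar>W s\<bar>)) * H3 d + 6 * H4 d + sqrt (40 * H4 d + 16 * ep^2 * B)"
proof -
 note d0 = lip1_nonneg[OF d]
 define c where "c = normal_mean h"
 obtain f where f: "!!w. (f has_real_derivative (w * f w + h w - c)) (at w)" 
  "!!w. \<bar>f w\<bar> <= 5" "!!w. \<bar>w * f w\<bar> <= 1" "!!w. \<bar>h w - c\<bar> <= 1"
  using stein_bounded[of h, OF h(1,2,3)] unfolding c_def[symmetric] by blast
 define f' where "f' w = w * f w + h w - c" for w
 have ff: "(f has_real_derivative f' w) (at w)" for w unfolding f'_def by (rule f(1))
 have f'2: "\<bar>f' w\<bar> <= 2" for w using f(3)[of w] f(4)[of w] unfolding f'_def by linarith
 define q where "q w = w * f w" for w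
 have dq: "(q has_real_derivative (f w + w * f' w)) (at w)" for w
  unfolding q_def[abs_def] by (auto intro!: derivative_eq_intros ff)
 have ql: "\<bar>q z - q a\<bar> <= min 2 ((7 + 2 * \<bar>a\<bar>) * r)" if "\<bar>z - a\<bar> <= r" for z a r
 proof -
  have 2: "\<bar>q z - q a\<bar> <= 2" using f(3)[of z] f(3)[of a] unfolding q_def by linarith
  have "\<bar>q z - q a\<bar> <= (7 + 2 * \<bar>a\<bar>) * r"
  proof (cases "r <= 1")
   case True
   have "\<bar>q z - q a\<bar> <= (7 + 2 * \<bar>a\<bar>) * \<bar>z - a\<bar>"
   proof (rule field_differentiable_bound[of "{a - r..a + r}" q "%w. f w + w * f' w" "7 + 2 * \<bar>a\<bar>" z a, simplified real_norm_def])
    fix w assume w: "w \<in> {a - r..a + r}"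
    show "(q has_real_derivative f w + w * f' w) (at w within {a - r..a + r})" by (rule DERIV_subset[OF dq]) simp
    have "\<bar>w\<bar> <= \<bar>a\<bar> + 1" using w True by auto
    then have "\<bar>w * f' w\<bar> <= (\<bar>a\<bar> + 1) * 2" unfolding abs_mult using f'2[of w] by (intro mult_mono) auto
    then show "\<bar>f w + w * f' w\<bar> <= 7 + 2 * \<bar>a\<bar>" using f(2)[of w] abs_triangle_ineq[of "f w" "w * f' w"] by (smt (verit))
   qed (use that in auto)
   also have "... <= (7 + 2 * \<bar>a\<bar>) * r" using that by (intro mult_left_mono) auto
   finally show ?thesis .
  next
   case False
   then have "2 * 1 <= (7 + 2 * \<bar>a\<bar>) * r" by (intro mult_mono) auto
   then show ?thesis using 2 by simp
  qed
  with 2 show ?thesis by simp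
 qed
 define R where "R b a = f b - f a - (b - a) * f' a" for b a
 have R: "\<bar>R b a\<bar> <= \<bar>b - a\<bar> * min 2 ((7 + 2 * \<bar>a\<bar>) * \<bar>b - a\<bar>) + (b - a) * (h a - h b)" for a b
 proof -
  obtain z where zz: "min a b <= z" "z <= max a b" and zf: "f b - f a = (b - a) * f' z" by (rule mvt_between[OF ff])
  have z: "\<bar>z - a\<bar> <= \<bar>b - a\<bar>" using zz by linarith
  have zh: "\<bar>h z - h a\<bar> <= \<bar>h b - h a\<bar>"
   using zz antimonoD[OF h(4), of a z] antimonoD[OF h(4), of z b] antimonoD[OF h(4), of b z] antimonoD[OF h(4), of z a]
   by (cases "a <= b") auto
  have "R b a = (b - a) * (q z - q a) + (b - a) * (h z - h a)" unfolding R_def zf f'_def q_def by (simp add: algebra_simps)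
  then have "\<bar>R b a\<bar> <= \<bar>b - a\<bar> * \<bar>q z - q a\<bar> + \<bar>b - a\<bar> * \<bar>h z - h a\<bar>"
   using abs_triangle_ineq[of "(b - a) * (q z - q a)" "(b - a) * (h z - h a)"] by (simp add: abs_mult)
  also have "... <= \<bar>b - a\<bar> * min 2 ((7 + 2 * \<bar>a\<bar>) * \<bar>b - a\<bar>) + \<bar>b - a\<bar> * \<bar>h b - h a\<bar>"
   using ql[OF z] zh by (intro add_mono mult_left_mono) auto
  also have "\<bar>b - a\<bar> * \<bar>h b - h a\<bar> = (b - a) * (h a - h b)"
  proof (cases "a <= b")
   case True then have "h b <= h a" using h(4) by (auto simp: antimono_def)
   with True show ?thesis by simp
  next
   case False then have "h a <= h b" using h(4) by (auto simp: antimono_def)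
   with False show ?thesis by (simp add: algebra_simps)
  qed
  finally show ?thesis .
 qed
 define aW where "aW k = av k (%s. \<bar>W s\<bar>)" for k
 have aW0: "0 <= aW k s" for k s unfolding aW_def av_def by (intro sum_nonneg mult_nonneg_nonneg p_nonneg) auto
 let ?I = "%k x y. of_bool (d k x y <= 1) :: real"
 let ?tr = "%k s x. \<Sum>y\<in>S k. p k y * (d k (s k) x * min 1 (d k (s k) x * d k x y))"
 define K where "K k s s' = \<bar>MD k W s\<bar> * (?I k (s k) (s' k) * (W s - W s'))" for k s s'
 have R2: "\<bar>R (W s) (W (s(k := x)))\<bar> <= (8 + 2 * aW k s) * (d k (s k) x * min 1 (d k (s k) x)) + 2 * ?tr k s x
   + ?I k (s k) x * ((W s - W (s(k := x))) * (h (W (s(k := x))) - h (W s)))" for s k x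
 proof -
  let ?D = "d k (s k) x" and ?W = "W s" and ?V = "W (s(k := x))"
  have D: "\<bar>?W - ?V\<bar> <= ?D" by (rule lip1_diff[OF d])
  have D0: "0 <= ?D" by (rule d0)
  have "min 2 ((7 + 2 * \<bar>?V\<bar>) * ?D) <= (7 + 2 * \<bar>W (s(k := y))\<bar>) * min 1 ?D + 2 * min 1 (?D * d k x y)" for y
  proof -
   have "\<bar>?V\<bar> <= \<bar>W (s(k := y))\<bar> + d k x y" using lip1D[OF d, of s k x y] by linarith
   then have "(7 + 2 * \<bar>?V\<bar>) * ?D <= (7 + 2 * (\<bar>W (s(k := y))\<bar> + d k x y)) * ?D" using D0 by (intro mult_right_mono) auto
   then have 1: "(7 + 2 * \<bar>?V\<bar>) * ?D <= (7 + 2 * \<bar>W (s(k := y))\<bar>) * ?D + 2 * (?D * d k x y)" by (simp add: algebra_simps)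
   have 2: "min 2 ((7 + 2 * \<bar>W (s(k := y))\<bar>) * ?D) <= (7 + 2 * \<bar>W (s(k := y))\<bar>) * min 1 ?D"
    by (auto simp: min_def)
   have 3: "0 <= (7 + 2 * \<bar>W (s(k := y))\<bar>) * ?D" "0 <= 2 * (?D * d k x y)" using D0 d0[of k x y] by auto
   have 4: "min 2 A <= min 2 P + min 2 Q" if "A <= P + Q" "0 <= P" "0 <= Q" for A P Q :: real
    using that by (auto simp: min_def)
   have 5: "min 2 (2 * (?D * d k x y)) = 2 * min 1 (?D * d k x y)" by (simp add: min_def)
   show ?thesis using 4[OF 1 3] 2 unfolding 5 by linarith
  qed
  then have "(\<Sum>y\<in>S k. p k y * min 2 ((7 + 2 * \<bar>?V\<bar>) * ?D)) <= (\<Sum>y\<in>S k. p k y * ((7 + 2 * \<bar>W (s(k := y))\<bar>) * min 1 ?D + 2 * min 1 (?D * d k x y)))"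
   by (intro sum_mono mult_left_mono p_nonneg)
  also have "... = 7 * (\<Sum>y\<in>S k. p k y) * min 1 ?D + 2 * aW k s * min 1 ?D + 2 * (\<Sum>y\<in>S k. p k y * min 1 (?D * d k x y))"
   unfolding aW_def av_def by (simp add: sum_distrib_left sum_distrib_right sum.distrib algebra_simps)
  finally have 1: "min 2 ((7 + 2 * \<bar>?V\<bar>) * ?D) <= (7 + 2 * aW k s) * min 1 ?D + 2 * (\<Sum>y\<in>S k. p k y * min 1 (?D * d k x y))"
   by (simp add: p_sum algebra_simps flip: sum_distrib_right)
  have "\<bar>?W - ?V\<bar> * min 2 ((7 + 2 * \<bar>?V\<bar>) * \<bar>?W - ?V\<bar>) <= ?D * min 2 ((7 + 2 * \<bar>?V\<bar>) * ?D)"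
   using D by (intro mult_mono min.mono mult_left_mono) auto
  also have "... <= ?D * ((7 + 2 * aW k s) * min 1 ?D + 2 * (\<Sum>y\<in>S k. p k y * min 1 (?D * d k x y)))"
   using 1 D0 by (rule mult_left_mono)
  also have "... = (7 + 2 * aW k s) * (?D * min 1 ?D) + 2 * ?tr k s x"
   by (simp add: distrib_left sum_distrib_left mult_ac)
  finally have A: "\<bar>?W - ?V\<bar> * min 2 ((7 + 2 * \<bar>?V\<bar>) * \<bar>?W - ?V\<bar>) <= (7 + 2 * aW k s) * (?D * min 1 ?D) + 2 * ?tr k s x" .
  have C: "(?W - ?V) * (h ?V - h ?W) <= ?D * min 1 ?D + ?I k (s k) x * ((?W - ?V) * (h ?V - h ?W))"
  proof (cases "?D <= 1")
   case True then show ?thesis using D0 by simp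
  next
   case False
   have "(?W - ?V) * (h ?V - h ?W) <= \<bar>?W - ?V\<bar> * \<bar>h ?V - h ?W\<bar>" unfolding abs_mult[symmetric] by (rule abs_ge_self)
   also have "... <= ?D * 1" using D h(2)[of ?V] h(2)[of ?W] h(3)[of ?V] h(3)[of ?W] by (intro mult_mono) auto
   finally show ?thesis using False by simp
  qed
  show ?thesis using R[of ?W ?V] A C by (simp add: distrib_right)
 qed
 have arrange: "x <= ((8 + 2 * a) * (2 * b) + 2 * (3 * c)) + - e ==> x <= (16 + 4 * a) * b + 6 * c - e" for x a b c e :: real
  by (simp add: algebra_simps)
 let ?R = "%k. EE (%s. MD k W s * (\<Sum>x\<in>S k. p k x * R (W s) (W (s(k := x)))))"
 have Rk: "\<bar>?R k\<bar> <= (16 + 4 * EE (%s. \<bar>W s\<bar>)) * cubic d k +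
   6 * quartic d k - EE (%s. h (W s) * qq d W k s)" if k: "k < m" for k
 proof -
  let ?t1 = "%s. \<bar>MD k W s\<bar> * (\<Sum>x\<in>S k. p k x * ((8 + 2 * aW k s) * (d k (s k) x * min 1 (d k (s k) x))))"
  let ?t2 = "%s. \<bar>MD k W s\<bar> * (\<Sum>x\<in>S k. p k x * ?tr k s x)"
  have "\<bar>?R k\<bar> <= EE (%s. \<bar>MD k W s * (\<Sum>x\<in>S k. p k x * R (W s) (W (s(k := x))))\<bar>)" by (rule EE_abs)
  also have "... <= EE (%s. (?t1 s + 2 * ?t2 s) + ((\<Sum>x\<in>S k. p k x * (K k s (s(k := x)) * h (W (s(k := x))))) - (\<Sum>x\<in>S k. p k x * (K k s (s(k := x)) * h (W s)))))"
  proof (rule EE_mono)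
   fix s
   have "\<bar>MD k W s * (\<Sum>x\<in>S k. p k x * R (W s) (W (s(k := x))))\<bar> <= \<bar>MD k W s\<bar> * (\<Sum>x\<in>S k. \<bar>p k x * R (W s) (W (s(k := x)))\<bar>)"
    unfolding abs_mult[of "MD k W s"] by (intro mult_left_mono sum_abs) auto
   also have "... <= \<bar>MD k W s\<bar> * (\<Sum>x\<in>S k. p k x * ((8 + 2 * aW k s) * (d k (s k) x * min 1 (d k (s k) x)) + 2 * ?tr k s x
     + ?I k (s k) x * ((W s - W (s(k := x))) * (h (W (s(k := x))) - h (W s)))))"
    unfolding abs_mult[of "p k x" for x] abs_of_nonneg[OF p_nonneg] by (intro mult_left_mono sum_mono R2 p_nonneg) auto
   also have "... = (?t1 s + 2 * ?t2 s) + ((\<Sum>x\<in>S k. p k x * (K k s (s(k := x)) * h (W (s(k := x))))) - (\<Sum>x\<in>S k. p k x * (K k s (s(k := x)) * h (W s))))"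
   proof -
    have "\<bar>MD k W s\<bar> * (\<Sum>x\<in>S k. p k x * (?I k (s k) x * ((W s - W (s(k := x))) * (h (W (s(k := x))) - h (W s))))) =
     (\<Sum>x\<in>S k. p k x * (K k s (s(k := x)) * h (W (s(k := x))))) - (\<Sum>x\<in>S k. p k x * (K k s (s(k := x)) * h (W s)))"
     unfolding sum_subtractf[symmetric] sum_distrib_left K_def by (intro sum.cong refl) (simp add: algebra_simps)
    moreover have "(\<Sum>x\<in>S k. p k x * (2 * t x)) = 2 * (\<Sum>x\<in>S k. p k x * t x)" for t
     by (simp add: sum_distrib_left mult.left_commute)
    ultimately show ?thesis unfolding distrib_left sum.distrib by simp
   qed
   finally show "\<bar>MD k W s * (\<Sum>x\<in>S k. p k x * R (W s) (W (s(k := x))))\<bar> <= (?t1 s + 2 * ?t2 s) + ((\<Sum>x\<in>S k. p k x * (K k s (s(k := x)) * h (W (s(k := x))))) - (\<Sum>x\<in>S k. p k x * (K k s (s(k := x)) * h (W s))))" .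
  qed
  also have "... = (EE ?t1 + 2 * EE ?t2) + (EE (%s. \<Sum>x\<in>S k. p k x * (K k s (s(k := x)) * h (W (s(k := x))))) - EE (%s. \<Sum>x\<in>S k. p k x * (K k s (s(k := x)) * h (W s))))"
   unfolding EE_add EE_diff EE_cmult ..
  also have "EE (%s. \<Sum>x\<in>S k. p k x * (K k s (s(k := x)) * h (W (s(k := x))))) = EE (%s. \<Sum>x\<in>S k. p k x * (K k (s(k := x)) s * h (W s)))"
   by (rule EE_swap_resample[OF k, of "%s s'. K k s s' * h (W s')"])
  also have "EE (%s. \<Sum>x\<in>S k. p k x * (K k (s(k := x)) s * h (W s))) - EE (%s. \<Sum>x\<in>S k. p k x * (K k s (s(k := x)) * h (W s)))
    = EE (%s. (-1) * (h (W s) * qq d W k s))"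
   unfolding EE_diff[symmetric] sum_subtractf[symmetric]
  proof (intro arg_cong[where f = EE] ext)
   fix s
   have "p k x * (K k (s(k := x)) s * h (W s)) - p k x * (K k s (s(k := x)) * h (W s)) = (-1) * (h (W s) * (p k x * KK d W k s (s(k := x))))" for x
    unfolding K_def KK_def fun_upd_same sym[of k x "s k"] by (simp add: algebra_simps)
   then show "(\<Sum>x\<in>S k. p k x * (K k (s(k := x)) s * h (W s)) - p k x * (K k s (s(k := x)) * h (W s))) = (-1) * (h (W s) * qq d W k s)"
    unfolding qq_def by (simp only: sum_distrib_left)
  qed
  also have "... = - EE (%s. h (W s) * qq d W k s)" unfolding EE_cmult by simp
  also have "EE ?t1 <= EE (%s. 8 + 2 * aW k s) * (2 * cubic d k)"
   using aW0 by (intro remainder_weighted[OF k d]) (auto simp: free_def aW_def)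
  also have "EE (%s. 8 + 2 * aW k s) = 8 + 2 * EE (%s. \<bar>W s\<bar>)" unfolding EE_add EE_const EE_cmult aW_def EE_av[OF k] ..
  also have "EE ?t2 <= 3 * quartic d k" by (rule remainder_triple[OF k d])
  finally show ?thesis by (rule arrange) simp_all
 qed
 have Q: "- (\<Sum>k<m. EE (%s. h (W s) * qq d W k s)) <= sqrt (40 * H4 d + 16 * ep^2 * B)"
 proof -
  have "(\<Sum>k<m. EE (%s. h (W s) * qq d W k s)) = EE (%s. h (W s) * (\<Sum>k<m. qq d W k s))"
   by (simp add: sum_distrib_left EE_sum)
  moreover have "- EE (%s. h (W s) * (\<Sum>k<m. qq d W k s)) <= \<bar>EE (%s. h (W s) * (\<Sum>k<m. qq d W k s))\<bar>" by simp
  moreover have "... <= EE (%s. \<bar>h (W s) * (\<Sum>k<m. qq d W k s)\<bar>)" by (rule EE_abs)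
  moreover have "... <= EE (%s. \<bar>\<Sum>k<m. qq d W k s\<bar>)"
   using h(2,3) by (intro EE_mono) (auto simp: abs_mult intro!: mult_left_le_one_le)
  moreover have "... <= sqrt (EE (%s. (\<Sum>k<m. qq d W k s)^2))" by (rule EE_abs_le_sqrt)
  moreover have "... <= sqrt (40 * H4 d + 16 * ep^2 * B)"
   by (rule real_sqrt_le_mono) (rule QQ_bound[OF d e sym eps' B e0])
  ultimately show ?thesis by linarith
 qed
 have "\<bar>EE (%s. h (W s)) - c\<bar> <= 2 * (\<bar>1 - EE (%s. (W s)^2)\<bar> + ep * sqrt B) + (\<Sum>k<m. \<bar>?R k\<bar>)"
  by (rule stein_error[OF W d e eps B e0 f'_def f'2 R_def])
 also have "(\<Sum>k<m. \<bar>?R k\<bar>) <= (\<Sum>k<m. (16 + 4 * EE (%s. \<bar>W s\<bar>)) * cubic d k +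
   6 * quartic d k - EE (%s. h (W s) * qq d W k s))" by (rule sum_mono, rule Rk) simp
 also have "... = (16 + 4 * EE (%s. \<bar>W s\<bar>)) * H3 d + 6 * H4 d - (\<Sum>k<m. EE (%s. h (W s) * qq d W k s))"
  unfolding H3_def H4_def sum_subtractf sum.distrib sum_distrib_left ..
 finally show ?thesis using Q unfolding c_def by linarith
qed

end

section \<open>Sums of smooth functionals of linear combinations\<close>

text \<open>For large increments the bounds on \<open>f\<close> and \<open>f'\<close> replace those on their derivatives.\<close>
lemma C2_bounded_increments:
 assumes "C2_bounded f"
 obtains C where "0 < C" "!!x y. \<bar>f x - f y\<bar> <= C * min 1 \<bar>x - y\<bar>"
  "!!x a b. \<bar>(f (x + a + b) - f (x + a)) - (f (x + b) - f x)\<bar> <= C * (min 1 \<bar>a\<bar> * min 1 \<bar>b\<bar>)"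
proof -
 obtain f' f'' where f: "!!x. (f has_real_derivative f' x) (at x)" "!!x. (f' has_real_derivative f'' x) (at x)"
  "bounded (range f)" "bounded (range f')" "bounded (range f'')"
  using assms unfolding C2_bounded_def by blast
 obtain B0 B1 B2 where B: "!!x. \<bar>f x\<bar> <= B0" "!!x. \<bar>f' x\<bar> <= B1" "!!x. \<bar>f'' x\<bar> <= B2"
  using f(3,4,5) unfolding bounded_iff by auto
 have B0: "0 <= B0" "0 <= B1" "0 <= B2" using B by (meson abs_ge_zero order_trans)+
 have l0: "\<bar>f x - f y\<bar> <= B1 * \<bar>x - y\<bar>" for x y
  using field_differentiable_bound[of UNIV f f' B1 x y] f(1) B(2) by auto
 have l1: "\<bar>f' x - f' y\<bar> <= B2 * \<bar>x - y\<bar>" for x y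
  using field_differentiable_bound[of UNIV f' f'' B2 x y] f(2) B(3) by auto
 have m: "\<bar>u x - u y\<bar> <= (K + 2 * B) * min 1 \<bar>x - y\<bar>"
  if u: "!!x. \<bar>u x\<bar> <= B" "!!x y. \<bar>u x - u y\<bar> <= K * \<bar>x - y\<bar>" "0 <= B" "0 <= K" for u :: "real => real" and B K x y
 proof (cases "\<bar>x - y\<bar> <= 1")
  case True
  have "K * \<bar>x - y\<bar> <= (K + 2 * B) * \<bar>x - y\<bar>" using u(3) by (intro mult_right_mono) auto
  then show ?thesis using u(2)[of x y] True by simp
 next
  case False
  then have "min 1 \<bar>x - y\<bar> = 1" by simp
  then show ?thesis using u(1)[of x] u(1)[of y] u(4) abs_triangle_ineq4[of "u x" "u y"] by simp
 qed
 note m0 = m[OF B(1) l0 B0(1,2)] and m1 = m[OF B(2) l1 B0(2,3)]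
 define C where "C = B2 + 4 * B1 + 4 * B0 + 1"
 show thesis
 proof (rule that[of C])
  show "0 < C" using B0 by (simp add: C_def)
  fix x y
  have "(B1 + 2 * B0) * min 1 \<bar>x - y\<bar> <= C * min 1 \<bar>x - y\<bar>" using B0 by (intro mult_right_mono) (auto simp: C_def)
  then show "\<bar>f x - f y\<bar> <= C * min 1 \<bar>x - y\<bar>" using m0[of x y] by linarith
 next
  fix x a b
  define g where "g u = f (x + a + u) - f (x + u)" for u
  have sh: "((%u. f (c + u)) has_real_derivative f' (c + u)) (at u)" for c u
  proof -
   have "((%u. c + u) has_real_derivative 1) (at u)" by (auto intro!: derivative_eq_intros)
   from DERIV_chain2[OF f(1) this] show ?thesis by simp
  qed
  have dg: "(g has_real_derivative (f' (x + a + u) - f' (x + u))) (at u)" for u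
   using DERIV_diff[OF sh[of "x + a" u] sh[of x u]] by (simp add: g_def[abs_def])
  have m1': "\<bar>f' (x + a + u) - f' (x + u)\<bar> <= (B2 + 2 * B1) * min 1 \<bar>a\<bar>" for u using m1[of "x + a + u" "x + u"] by simp
  have "\<bar>g b - g 0\<bar> <= ((B2 + 2 * B1) * min 1 \<bar>a\<bar>) * \<bar>b - 0\<bar>"
   using field_differentiable_bound[of UNIV g "%u. f' (x + a + u) - f' (x + u)" "(B2 + 2 * B1) * min 1 \<bar>a\<bar>" b 0] dg m1' by simp
  then have 1: "\<bar>g b - g 0\<bar> <= (B2 + 2 * B1) * (min 1 \<bar>a\<bar> * \<bar>b\<bar>)" by (simp add: mult.assoc)
  have "\<bar>g b\<bar> <= (B1 + 2 * B0) * min 1 \<bar>a\<bar>" "\<bar>g 0\<bar> <= (B1 + 2 * B0) * min 1 \<bar>a\<bar>"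
   using m0[of "x + a + b" "x + b"] m0[of "x + a" x] by (auto simp: g_def)
  then have "\<bar>g b\<bar> + \<bar>g 0\<bar> <= 2 * ((B1 + 2 * B0) * min 1 \<bar>a\<bar>)" by simp
  with abs_triangle_ineq4[of "g b" "g 0"] have "\<bar>g b - g 0\<bar> <= 2 * ((B1 + 2 * B0) * min 1 \<bar>a\<bar>)" by (rule order_trans)
  then have 2: "\<bar>g b - g 0\<bar> <= (2 * (B1 + 2 * B0)) * (min 1 \<bar>a\<bar> * 1)" by (simp only: mult.assoc mult_1_right)
  have "\<bar>g b - g 0\<bar> <= C * (min 1 \<bar>a\<bar> * min 1 \<bar>b\<bar>)"
  proof (cases "\<bar>b\<bar> <= 1")
   case True
   have "(B2 + 2 * B1) * (min 1 \<bar>a\<bar> * \<bar>b\<bar>) <= C * (min 1 \<bar>a\<bar> * \<bar>b\<bar>)" using B0 by (intro mult_right_mono) (auto simp: C_def)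
   then have "\<bar>g b - g 0\<bar> <= C * (min 1 \<bar>a\<bar> * \<bar>b\<bar>)" using 1 by (rule order_trans[rotated])
   then show ?thesis using True by (simp only: min_absorb2)
  next
   case False
   have "(2 * (B1 + 2 * B0)) * (min 1 \<bar>a\<bar> * 1) <= C * (min 1 \<bar>a\<bar> * 1)" using B0 by (intro mult_right_mono) (auto simp: C_def)
   then have "\<bar>g b - g 0\<bar> <= C * (min 1 \<bar>a\<bar> * 1)" using 2 by (rule order_trans[rotated])
   moreover have "min 1 \<bar>b\<bar> = 1" using False by simp
   ultimately show ?thesis by (simp only:)
  qed
  moreover have "(f (x + a + b) - f (x + a)) - (f (x + b) - f x) = g b - g 0" by (simp add: g_def)
  ultimately show "\<bar>(f (x + a + b) - f (x + a)) - (f (x + b) - f x)\<bar> <= C * (min 1 \<bar>a\<bar> * min 1 \<bar>b\<bar>)"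
   by (simp only:)
 qed
qed

lemma sum_rearrange:
 fixes D A :: real
 shows "(\<Sum>k\<in>I. D * (\<Sum>t\<in>T. c t * (r k t * A))) = D * (\<Sum>t\<in>T. c t * ((\<Sum>k\<in>I. r k t) * A))"
proof -
 have "(\<Sum>k\<in>I. D * (\<Sum>t\<in>T. c t * (r k t * A))) = (\<Sum>k\<in>I. \<Sum>t\<in>T. D * (c t * (r k t * A)))"
  by (simp add: sum_distrib_left)
 also have "... = (\<Sum>t\<in>T. \<Sum>k\<in>I. D * (c t * (r k t * A)))" by (rule sum.swap)
 also have "... = (\<Sum>t\<in>T. D * (c t * ((\<Sum>k\<in>I. r k t) * A)))"
  by (intro sum.cong refl) (simp add: sum_distrib_left sum_distrib_right)
 finally show ?thesis by (simp only: sum_distrib_left[symmetric])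
qed

context finite_model begin

definition XX :: "(nat => int => 's => real) => int => (nat => 's) => real" where
 "XX Y t s = (\<Sum>k<m. Y k t (s k))"

definition inc :: "(nat => int => 's => real) => nat => int => 's => 's => real" where
 "inc Y k t x y = min 1 \<bar>Y k t x - Y k t y\<bar>"

lemma inc_bounds: "0 <= inc Y k t x y" "inc Y k t x y <= 1" by (auto simp: inc_def)
lemma inc_sym: "inc Y k t x y = inc Y k t y x" by (simp add: inc_def abs_minus_commute)

lemma XX_upd: "XX Y t (s(k := x)) = XX Y t s + (if k < m then Y k t x - Y k t (s k) else 0)"
proof (cases "k < m")
 case True
 have "XX Y t s' = Y k t (s' k) + (\<Sum>j\<in>{..<m} - {k}. Y j t (s' j))" for s'
  unfolding XX_def by (rule sum.remove) (use True in auto)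
 note this[of s] this[of "s(k := x)"]
 moreover have "(\<Sum>j\<in>{..<m} - {k}. Y j t ((s(k := x)) j)) = (\<Sum>j\<in>{..<m} - {k}. Y j t (s j))"
  by (intro sum.cong) auto
 ultimately show ?thesis using True by simp
qed (auto simp: XX_def intro!: sum.cong)

lemma lip1_single:
 assumes f: "!!x y. \<bar>f x - f y\<bar> <= C * min 1 \<bar>x - y\<bar>" and C: "0 <= C"
 shows "lip1 (%k x y. C * inc Y k t x y) (%s. f (XX Y t s))"
 unfolding lip1_def
proof (intro allI)
 fix k s x y
 have "\<bar>f (XX Y t (s(k := x))) - f (XX Y t (s(k := y)))\<bar> <= C * min 1 \<bar>XX Y t (s(k := x)) - XX Y t (s(k := y))\<bar>" by (rule f)
 also have "... <= C * inc Y k t x y" unfolding XX_upd inc_def using C by (intro mult_left_mono) auto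
 finally show "\<bar>f (XX Y t (s(k := x))) - f (XX Y t (s(k := y)))\<bar> <= C * inc Y k t x y" .
qed

lemma lip2_single:
 assumes f: "!!x a b. \<bar>(f (x + a + b) - f (x + a)) - (f (x + b) - f x)\<bar> <= C * (min 1 \<bar>a\<bar> * min 1 \<bar>b\<bar>)" and C: "0 <= C"
 shows "lip2 (%k l x y u v. C * (inc Y k t x y * inc Y l t u v)) (%s. f (XX Y t s))"
 unfolding lip2_def
proof (intro allI impI)
 fix k l :: nat and s x y u v assume kl: "k \<noteq> l"
 define a where "a = (if k < m then Y k t x - Y k t y else 0)"
 define b where "b = (if l < m then Y l t u - Y l t v else 0)"
 define z where "z = XX Y t (s(k := y, l := v))"
 have e: "XX Y t (s(k := x, l := u)) = z + a + b" "XX Y t (s(k := y, l := u)) = z + b" "XX Y t (s(k := x, l := v)) = z + a"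
  unfolding z_def a_def b_def using kl by (auto simp: XX_upd)
 have "\<bar>(f (z + a + b) - f (z + a)) - (f (z + b) - f z)\<bar> <= C * (min 1 \<bar>a\<bar> * min 1 \<bar>b\<bar>)" by (rule f)
 also have "... <= C * (inc Y k t x y * inc Y l t u v)"
  unfolding a_def b_def inc_def using C by (intro mult_left_mono mult_mono) auto
 finally show "\<bar>(f (XX Y t (s(k := x, l := u))) - f (XX Y t (s(k := y, l := u)))) - (f (XX Y t (s(k := x, l := v))) - f (XX Y t (s(k := y, l := v))))\<bar> <= C * (inc Y k t x y * inc Y l t u v)"
  unfolding e z_def[symmetric] by (simp add: algebra_simps)
qed

lemma lip1_sum: assumes "!!t. t \<in> T ==> lip1 (d t) (F t)" "0 <= c"
 shows "lip1 (%k x y. c * (\<Sum>t\<in>T. d t k x y)) (%s. c * (\<Sum>t\<in>T. F t s - \<mu> t))"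
 unfolding lip1_def
proof (intro allI)
 fix k s x y
 have "\<bar>c * (\<Sum>t\<in>T. F t (s(k := x)) - \<mu> t) - c * (\<Sum>t\<in>T. F t (s(k := y)) - \<mu> t)\<bar> = c * \<bar>\<Sum>t\<in>T. F t (s(k := x)) - F t (s(k := y))\<bar>"
  using assms(2) by (simp add: abs_mult sum_subtractf flip: right_diff_distrib)
 also have "... <= c * (\<Sum>t\<in>T. \<bar>F t (s(k := x)) - F t (s(k := y))\<bar>)" using assms(2) by (intro mult_left_mono sum_abs)
 also have "... <= c * (\<Sum>t\<in>T. d t k x y)" using assms by (intro mult_left_mono sum_mono lip1D) auto
 finally show "\<bar>c * (\<Sum>t\<in>T. F t (s(k := x)) - \<mu> t) - c * (\<Sum>t\<in>T. F t (s(k := y)) - \<mu> t)\<bar> <= c * (\<Sum>t\<in>T. d t k x y)" .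
qed

lemma lip2_sum: assumes "!!t. t \<in> T ==> lip2 (e t) (F t)" "0 <= c"
 shows "lip2 (%k l x y u v. c * (\<Sum>t\<in>T. e t k l x y u v)) (%s. c * (\<Sum>t\<in>T. F t s - \<mu> t))"
 unfolding lip2_def
proof (intro allI impI)
 fix k l :: nat and s x y u v assume kl: "k \<noteq> l"
 let ?m = "%t. (F t (s(k := x, l := u)) - F t (s(k := y, l := u))) - (F t (s(k := x, l := v)) - F t (s(k := y, l := v)))"
 have "\<bar>c * (\<Sum>t\<in>T. F t (s(k := x, l := u)) - \<mu> t) - c * (\<Sum>t\<in>T. F t (s(k := y, l := u)) - \<mu> t) -
  (c * (\<Sum>t\<in>T. F t (s(k := x, l := v)) - \<mu> t) - c * (\<Sum>t\<in>T. F t (s(k := y, l := v)) - \<mu> t))\<bar> = c * \<bar>\<Sum>t\<in>T. ?m t\<bar>"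
  using assms(2) by (simp add: abs_mult sum_subtractf flip: right_diff_distrib)
 also have "... <= c * (\<Sum>t\<in>T. \<bar>?m t\<bar>)" using assms(2) by (intro mult_left_mono sum_abs)
 also have "... <= c * (\<Sum>t\<in>T. e t k l x y u v)" using assms kl by (intro mult_left_mono sum_mono lip2D) auto
 finally show "\<bar>c * (\<Sum>t\<in>T. F t (s(k := x, l := u)) - \<mu> t) - c * (\<Sum>t\<in>T. F t (s(k := y, l := u)) - \<mu> t) -
  (c * (\<Sum>t\<in>T. F t (s(k := x, l := v)) - \<mu> t) - c * (\<Sum>t\<in>T. F t (s(k := y, l := v)) - \<mu> t))\<bar> <= c * (\<Sum>t\<in>T. e t k l x y u v)" .
qed

end

locale decaying_model = finite_model m S p for m and S :: "nat => 's set" and p +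
 fixes Y :: "nat => int => 's => real" and T :: "int set" and \<rho> :: "nat => int => real" and A :: real
 assumes finT: "finite T"
  and inc_sq: "!!k t. k < m ==> t \<in> T ==> E2 k (%x y. (inc Y k t x y)^2) <= (\<rho> k t)^2"
  and \<rho>_nonneg: "!!k t. 0 <= \<rho> k t"
  and A_row: "!!k. k < m ==> (\<Sum>t\<in>T. \<rho> k t) <= A"
  and A_col: "!!t. t \<in> T ==> (\<Sum>k<m. \<rho> k t) <= A"
  and A_nonneg: "0 <= A"
begin

abbreviation "inc' \<equiv> inc Y"

lemma inc_prod: "k < m ==> t \<in> T ==> t' \<in> T ==> E2 k (%x y. inc' k t x y * inc' k t' x y) <= \<rho> k t * \<rho> k t'"
 by (intro E2_CS inc_sq \<rho>_nonneg)

definition SS :: "nat => 's => 's => real" where "SS k x y = (\<Sum>t\<in>T. inc' k t x y)"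

lemma SS_nonneg: "0 <= SS k x y" unfolding SS_def by (intro sum_nonneg inc_bounds)

lemma E2_sum_inc_sq:
 assumes k: "k < m" and T': "T' \<subseteq> T"
 shows "E2 k (%x y. (\<Sum>t\<in>T'. inc' k t x y)^2) <= (\<Sum>t\<in>T'. \<rho> k t)^2"
proof -
 have "E2 k (%x y. (\<Sum>t\<in>T'. inc' k t x y)^2) = (\<Sum>t\<in>T'. \<Sum>t'\<in>T'. E2 k (%x y. inc' k t x y * inc' k t' x y))"
  unfolding power2_eq_square sum_product E2_sum ..
 also have "... <= (\<Sum>t\<in>T'. \<Sum>t'\<in>T'. \<rho> k t * \<rho> k t')" using T' by (intro sum_mono inc_prod k) auto
 finally show ?thesis unfolding power2_eq_square sum_product .
qed

lemma SS_second_moment: "(\<Sum>k<m. E2 k (%x y. (SS k x y)^2)) <= A^2 * card T"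
proof -
 have "(\<Sum>k<m. E2 k (%x y. (SS k x y)^2)) <= (\<Sum>k<m. A * (\<Sum>t\<in>T. \<rho> k t))"
 proof (rule sum_mono)
  fix k assume k: "k \<in> {..<m}"
  have "E2 k (%x y. (SS k x y)^2) <= (\<Sum>t\<in>T. \<rho> k t) * (\<Sum>t\<in>T. \<rho> k t)"
   using E2_sum_inc_sq[of k T] k unfolding SS_def power2_eq_square by auto
  also have "... <= A * (\<Sum>t\<in>T. \<rho> k t)" using k by (intro mult_right_mono A_row sum_nonneg \<rho>_nonneg) auto
  finally show "E2 k (%x y. (SS k x y)^2) <= A * (\<Sum>t\<in>T. \<rho> k t)" .
 qed
 also have "... = A * (\<Sum>t\<in>T. \<Sum>k<m. \<rho> k t)" unfolding sum_distrib_left[symmetric] by (subst sum.swap) simp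
 also have "... <= A * (\<Sum>t\<in>T. A)" by (intro mult_left_mono sum_mono A_col A_nonneg)
 finally show ?thesis by (simp add: power2_eq_square algebra_simps)
qed

text \<open>Column sums of \<open>\<rho>\<close> are at most \<open>A\<close>; the other factor \<open>A\<close> comes from a row
sum. This is what makes the \<open>ep\<close> of the normal approximation of order \<open>1 / \<surd>n\<close>.\<close>
lemma interaction_sum:
 assumes c: "!!t. 0 <= c t"
 shows "(\<Sum>k\<in>{..<m} - {l}. D^2 * (\<Sum>t\<in>T. c t * (\<rho> k t * A))) <= (D * A^2) * (D * (\<Sum>t\<in>T. c t))"
proof -
 have "(\<Sum>k\<in>{..<m} - {l}. D^2 * (\<Sum>t\<in>T. c t * (\<rho> k t * A))) = D^2 * (\<Sum>t\<in>T. c t * ((\<Sum>k\<in>{..<m} - {l}. \<rho> k t) * A))"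
  by (rule sum_rearrange)
 also have "... <= D^2 * (\<Sum>t\<in>T. c t * (A * A))"
 proof (intro mult_left_mono sum_mono mult_right_mono)
  fix t assume t: "t \<in> T"
  have "(\<Sum>k\<in>{..<m} - {l}. \<rho> k t) <= (\<Sum>k<m. \<rho> k t)" by (intro sum_mono2) (auto simp: \<rho>_nonneg)
  then show "(\<Sum>k\<in>{..<m} - {l}. \<rho> k t) <= A" using A_col[OF t] by linarith
 qed (auto simp: c A_nonneg)
 also have "... = (D * A^2) * (D * (\<Sum>t\<in>T. c t))" unfolding sum_distrib_right[symmetric] by (simp add: power2_eq_square)
 finally show ?thesis .
qed

lemma eps_first:
 "(\<Sum>k\<in>{..<m} - {l}. E2 k (%x y. (D * (\<Sum>t\<in>T. inc' k t x y * inc' l t u v)) * (D * SS k x y))) <= (D * A^2) * (D * SS l u v)"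
proof -
 have "(\<Sum>k\<in>{..<m} - {l}. E2 k (%x y. (D * (\<Sum>t\<in>T. inc' k t x y * inc' l t u v)) * (D * SS k x y)))
  = (\<Sum>k\<in>{..<m} - {l}. D^2 * (\<Sum>t\<in>T. inc' l t u v * (\<Sum>t'\<in>T. E2 k (%x y. inc' k t x y * inc' k t' x y))))"
 proof (rule sum.cong[OF refl])
  fix k
  have "(D * (\<Sum>t\<in>T. inc' k t x y * inc' l t u v)) * (D * SS k x y) = D^2 * (\<Sum>t\<in>T. \<Sum>t'\<in>T. inc' l t u v * (inc' k t x y * inc' k t' x y))" for x y
  proof -
   have "(\<Sum>t\<in>T. \<Sum>t'\<in>T. inc' l t u v * (inc' k t x y * inc' k t' x y)) = (\<Sum>t\<in>T. inc' k t x y * inc' l t u v) * SS k x y"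
    unfolding SS_def sum_product by (intro sum.cong refl) simp
   then show ?thesis by (simp add: power2_eq_square)
  qed
  then show "E2 k (%x y. (D * (\<Sum>t\<in>T. inc' k t x y * inc' l t u v)) * (D * SS k x y)) = D^2 * (\<Sum>t\<in>T. inc' l t u v * (\<Sum>t'\<in>T. E2 k (%x y. inc' k t x y * inc' k t' x y)))"
   by (simp only: E2_cmult E2_sum sum_distrib_left)
 qed
 also have "... <= (\<Sum>k\<in>{..<m} - {l}. D^2 * (\<Sum>t\<in>T. inc' l t u v * (\<rho> k t * A)))"
 proof (intro sum_mono mult_left_mono)
  fix k t assume k: "k \<in> {..<m} - {l}" and t: "t \<in> T"
  have "(\<Sum>t'\<in>T. E2 k (%x y. inc' k t x y * inc' k t' x y)) <= (\<Sum>t'\<in>T. \<rho> k t * \<rho> k t')"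
   using k t by (intro sum_mono inc_prod) auto
  also have "... <= \<rho> k t * A" unfolding sum_distrib_left[symmetric] using k by (intro mult_left_mono A_row \<rho>_nonneg) auto
  finally show "(\<Sum>t'\<in>T. E2 k (%x y. inc' k t x y * inc' k t' x y)) <= \<rho> k t * A" .
 qed (auto simp: inc_bounds)
 also have "... <= (D * A^2) * (D * SS l u v)" unfolding SS_def by (rule interaction_sum) (rule inc_bounds)
 finally show ?thesis .
qed

lemma eps_second:
 assumes k: "k < m"
 shows "(\<Sum>l\<in>{..<m} - {k}. E2 l (%u v. (D * (\<Sum>t\<in>T. inc' k t a b * inc' l t u v))^2)) <= (D * A^2) * (D * SS k a b)"
proof -
 have "(\<Sum>l\<in>{..<m} - {k}. E2 l (%u v. (D * (\<Sum>t\<in>T. inc' k t a b * inc' l t u v))^2))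
  = (\<Sum>l\<in>{..<m} - {k}. D^2 * (\<Sum>t\<in>T. \<Sum>t'\<in>T. (inc' k t a b * inc' k t' a b) * E2 l (%u v. inc' l t u v * inc' l t' u v)))"
 proof (rule sum.cong[OF refl])
  fix l
  have "(D * (\<Sum>t\<in>T. inc' k t a b * inc' l t u v))^2 = D^2 * (\<Sum>t\<in>T. \<Sum>t'\<in>T. (inc' k t a b * inc' k t' a b) * (inc' l t u v * inc' l t' u v))" for u v
   unfolding power_mult_distrib by (simp add: power2_eq_square sum_product mult_ac)
  then show "E2 l (%u v. (D * (\<Sum>t\<in>T. inc' k t a b * inc' l t u v))^2) = D^2 * (\<Sum>t\<in>T. \<Sum>t'\<in>T. (inc' k t a b * inc' k t' a b) * E2 l (%u v. inc' l t u v * inc' l t' u v))"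
   by (simp only: E2_cmult E2_sum)
 qed
 also have "... <= (\<Sum>l\<in>{..<m} - {k}. D^2 * (\<Sum>t\<in>T. \<Sum>t'\<in>T. inc' k t a b * (\<rho> l t * \<rho> l t')))"
 proof (intro sum_mono mult_left_mono mult_mono)
  fix l t t' assume *: "l \<in> {..<m} - {k}" "t \<in> T" "t' \<in> T"
  show "inc' k t a b * inc' k t' a b <= inc' k t a b" using inc_bounds by (intro mult_right_le_one_le) auto
  show "E2 l (%u v. inc' l t u v * inc' l t' u v) <= \<rho> l t * \<rho> l t'" using * by (intro inc_prod) auto
  show "0 <= E2 l (%u v. inc' l t u v * inc' l t' u v)" by (intro E2_nonneg mult_nonneg_nonneg inc_bounds)
 qed (auto simp: inc_bounds)
 also have "... <= (\<Sum>l\<in>{..<m} - {k}. D^2 * (\<Sum>t\<in>T. inc' k t a b * (\<rho> l t * A)))"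
  unfolding sum_distrib_left[symmetric] by (intro sum_mono mult_left_mono A_row) (auto simp: inc_bounds \<rho>_nonneg)
 also have "... <= (D * A^2) * (D * SS k a b)" unfolding SS_def by (rule interaction_sum) (rule inc_bounds)
 finally show ?thesis .
qed

end

section \<open>Models with polynomially decaying dependence\<close>

lemma powr_telescope:
 fixes x a :: real
 assumes x: "0 < x" and a: "0 < a" "a \<noteq> 1"
 shows "(x + 1) powr (- a) <= ((x + 1) powr (1 - a) - x powr (1 - a)) / (1 - a)"
proof -
 have d: "((%x. x powr (1 - a) / (1 - a)) has_real_derivative z powr (- a)) (at z)" if "x <= z" for z
  using that x a DERIV_cdivide[OF has_real_derivative_powr[of z "1 - a"], of "1 - a"] by simp
 obtain z where z: "x < z" "z < x + 1" "(x + 1) powr (1 - a) / (1 - a) - x powr (1 - a) / (1 - a) = (x + 1 - x) * z powr (- a)"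
  using MVT2[of x "x + 1" "%x. x powr (1 - a) / (1 - a)" "%z. z powr (- a)"] d by auto
 have "(x + 1) powr (- a) <= z powr (- a)" using z x a by (intro powr_mono2') auto
 also have "... = ((x + 1) powr (1 - a) - x powr (1 - a)) / (1 - a)" using z(3) by (simp add: diff_divide_distrib)
 finally show ?thesis .
qed

lemma powr_sum_telescope:
 assumes a: "0 < a" "a \<noteq> 1"
 shows "(\<Sum>j<N. (1 + real (Suc M + j)) powr (- a)) <= ((1 + real (M + N)) powr (1 - a) - (1 + real M) powr (1 - a)) / (1 - a)"
proof (induction N)
 case (Suc N)
 have "(1 + real (Suc M + N)) powr (- a) <= ((1 + real (M + Suc N)) powr (1 - a) - (1 + real (M + N)) powr (1 - a)) / (1 - a)"
  using powr_telescope[of "1 + real (M + N)", OF _ a] by (simp add: algebra_simps)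
 then show ?case using Suc by (simp add: diff_divide_distrib)
qed simp

lemma decay_sum_le:
 assumes s: "1 < s" and J: "finite J" "!!j. j \<in> J ==> M <= j"
 shows "(\<Sum>j\<in>J. (1 + real j) powr (- s)) <= s / (s - 1) * (1 + real M) powr (1 - s)"
proof -
 obtain N where N: "J \<subseteq> {..N}" using J(1) finite_nat_set_iff_bounded_le by auto
 have "(\<Sum>j\<in>J. (1 + real j) powr (- s)) <= (\<Sum>j\<in>{M..M + N}. (1 + real j) powr (- s))"
  using N J by (intro sum_mono2) (auto dest: J(2))
 also have "... = (1 + real M) powr (- s) + (\<Sum>j<N. (1 + real (Suc M + j)) powr (- s))"
 proof -
  have "{M..M + N} = insert M ((%j. Suc M + j) ` {..<N})"
  proof (intro set_eqI iffI)
   fix x assume x: "x \<in> {M..M + N}"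
   show "x \<in> insert M ((%j. Suc M + j) ` {..<N})"
   proof (cases "x = M")
    case False
    with x have "x = Suc M + (x - Suc M)" "x - Suc M < N" by auto
    then show ?thesis by blast
   qed simp
  qed auto
  moreover have "(\<Sum>j\<in>insert M ((%j. Suc M + j) ` {..<N}). (1 + real j) powr (- s)) =
    (1 + real M) powr (- s) + (\<Sum>j\<in>(%j. Suc M + j) ` {..<N}. (1 + real j) powr (- s))"
   by (rule sum.insert) auto
  moreover have "(\<Sum>j\<in>(%j. Suc M + j) ` {..<N}. (1 + real j) powr (- s)) = (\<Sum>j<N. (1 + real (Suc M + j)) powr (- s))"
   by (subst sum.reindex) (auto simp: inj_on_def)
  ultimately show ?thesis by simp
 qed
 also have "... <= (1 + real M) powr (1 - s) + (1 + real M) powr (1 - s) / (s - 1)"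
 proof (rule add_mono)
  show "(1 + real M) powr (- s) <= (1 + real M) powr (1 - s)" by (rule powr_mono) auto
  have "((1 + real (M + N)) powr (1 - s) - (1 + real M) powr (1 - s)) / (1 - s) = ((1 + real M) powr (1 - s) - (1 + real (M + N)) powr (1 - s)) / (s - 1)"
   using s by (simp add: field_simps)
  also have "... <= (1 + real M) powr (1 - s) / (s - 1)" using s by (intro divide_right_mono) auto
  finally show "(\<Sum>j<N. (1 + real (Suc M + j)) powr (- s)) <= (1 + real M) powr (1 - s) / (s - 1)"
   using powr_sum_telescope[of s M N] s by simp
 qed
 also have "... = s / (s - 1) * (1 + real M) powr (1 - s)" using s by (simp add: field_simps)
 finally show ?thesis .
qed

text \<open>Layer-cake bounds: \<open>r\<close> and \<open>r^2\<close> are at most the sums of the weights \<open>1\<close> and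
\<open>2 M + 1\<close> over the integers \<open>M < r\<close>.\<close>
lemma count_below:
 assumes "0 <= r" "r <= real N"
 shows "r <= (\<Sum>M<N. of_bool (real M < r))" "r^2 <= (\<Sum>M<N. (2 * real M + 1) * of_bool (real M < r))"
proof -
 define L where "L = nat \<lceil>r\<rceil>"
 have L: "r <= real L" "L <= N" unfolding L_def using assms by linarith+
 have lt: "real M < r" if "M < L" for M using that assms unfolding L_def by linarith
 have sub: "(\<Sum>M<L. g M) <= (\<Sum>M<N. g M * of_bool (real M < r))" if "!!M. 0 <= g M" for g :: "nat => real"
 proof -
  have "(\<Sum>M<L. g M) = (\<Sum>M<L. g M * of_bool (real M < r))" using lt by (intro sum.cong) auto
  also have "... <= (\<Sum>M<N. g M * of_bool (real M < r))" using L that by (intro sum_mono2) auto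
  finally show ?thesis .
 qed
 show "r <= (\<Sum>M<N. of_bool (real M < r))" using sub[of "%_. 1"] L by simp
 have "r^2 <= (real L)^2" using L assms by (intro power_mono) auto
 also have "(real L)^2 = (\<Sum>M<L. 2 * real M + 1)" by (induction L) (auto simp: power2_eq_square algebra_simps)
 also have "... <= (\<Sum>M<N. (2 * real M + 1) * of_bool (real M < r))" by (rule sub) simp
 finally show "r^2 <= (\<Sum>M<N. (2 * real M + 1) * of_bool (real M < r))" .
qed

definition G3 :: "real => nat => real" where
 "G3 s n = 1 / sqrt n * (\<Sum>M<nat \<lceil>sqrt n\<rceil>. (1 + real M) powr (2 - 2 * s))"

definition G4 :: "real => nat => real" where
 "G4 s n = 1 / n * (\<Sum>M<nat \<lceil>sqrt n\<rceil>. (1 + real M) powr (3 - 2 * s))"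

definition decay :: "real => int => real" where
 "decay s j = (if j < 0 then 0 else (1 + real_of_int j) powr (- s))"

lemma decay_nonneg: "0 <= decay s j" by (simp add: decay_def)

lemma decay_row_sum:
 assumes s: "1 < s" and J: "finite J" "!!j. j \<in> J ==> 0 <= j ==> int M <= j"
 shows "(\<Sum>j\<in>J. decay s j) <= s / (s - 1) * (1 + real M) powr (1 - s)"
proof -
 have "(\<Sum>j\<in>J. decay s j) = (\<Sum>j\<in>{j\<in>J. 0 <= j}. decay s j)"
  using J(1) by (intro sum.mono_neutral_right) (auto simp: decay_def)
 also have "... = (\<Sum>j\<in>nat ` {j\<in>J. 0 <= j}. (1 + real j) powr (- s))"
  by (subst sum.reindex) (auto simp: inj_on_def decay_def intro!: sum.cong)
 also have "... <= s / (s - 1) * (1 + real M) powr (1 - s)"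
  using J by (intro decay_sum_le s) (auto, force)
 finally show ?thesis .
qed

locale block_model = finite_model m S p for m and S :: "nat => 's set" and p +
 fixes Y :: "nat => int => 's => real" and n :: nat and lo :: int and s C :: real
 assumes n1: "1 <= n" and s1: "1 < s" and C0: "0 <= C"
  and inc_decay: "!!k t. k < m ==> t \<in> {1..int n} ==> E2 k (%x y. (inc Y k t x y)^2) <= (C * decay s (t - (lo + int k)))^2"
begin

abbreviation "\<rho> k t \<equiv> C * decay s (t - (lo + int k))"

text \<open>A bound for the tail \<open>\<Sum>\<^bsub>j \<ge> M\<^esub> \<rho>\<close> of a row.\<close>
definition \<tau> :: "nat => real" where "\<tau> M = C * (s / (s - 1) * (1 + real M) powr (1 - s))"

lemma \<tau>_nonneg: "0 <= \<tau> M" unfolding \<tau>_def using C0 s1 by auto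

lemma row_sum:
 assumes "finite T'" "!!t. t \<in> T' ==> lo + int k <= t ==> lo + int k + int M <= t"
 shows "(\<Sum>t\<in>T'. \<rho> k t) <= \<tau> M"
proof -
 have "(\<Sum>t\<in>T'. \<rho> k t) = C * (\<Sum>j\<in>(%t. t - (lo + int k)) ` T'. decay s j)"
  by (subst sum.reindex) (auto simp: inj_on_def sum_distrib_left)
 also have "... <= \<tau> M" unfolding \<tau>_def using assms C0 by (intro mult_left_mono decay_row_sum s1) (auto, force)
 finally show ?thesis .
qed

lemma col_sum:
 assumes "finite K'" "!!k. k \<in> K' ==> lo + int k <= t ==> lo + int k + int M <= t"
 shows "(\<Sum>k\<in>K'. \<rho> k t) <= \<tau> M"
proof -
 have "(\<Sum>k\<in>K'. \<rho> k t) = C * (\<Sum>j\<in>(%k. t - (lo + int k)) ` K'. decay s j)"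
  by (subst sum.reindex) (auto simp: inj_on_def sum_distrib_left)
 also have "... <= \<tau> M" unfolding \<tau>_def using assms C0 by (intro mult_left_mono decay_row_sum s1) (auto, force)
 finally show ?thesis .
qed

definition A :: real where "A = C * (s / (s - 1))"

lemma A_tau: "A = \<tau> 0" by (simp add: A_def \<tau>_def)

sublocale decaying_model m S p Y "{1..int n}" \<rho> A
proof
 show "E2 k (%x y. (inc Y k t x y)^2) <= (\<rho> k t)^2" if "k < m" "t \<in> {1..int n}" for k t
  using inc_decay that by auto
qed (use row_sum[of "{1..int n}" _ 0] col_sum[of "{..<m}" _ 0] C0 in \<open>auto simp: A_tau \<tau>_nonneg decay_nonneg\<close>)

abbreviation (input) "tail_square k M \<equiv> E2 k (%x y. (SS k x y)^2 * of_bool (real M < SS k x y))"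

text \<open>Every truncated increment is at most 1, so the at most \<open>M / 2\<close> times right after block \<open>k\<close>
contribute at most \<open>M / 2\<close>. If \<open>SS > M\<close>, more than half of \<open>SS\<close> comes from other times,
where a row sum is at most \<open>\<tau> (M div 2)\<close>.\<close>
lemma tail_moment:
 "(\<Sum>k<m. tail_square k M) <= 4 * real n * (\<tau> (M div 2))^2"
proof -
 let ?T = "{1..int n}" and ?M = "M div 2"
 define near where "near k = {t \<in> ?T. lo + int k <= t \<and> t < lo + int k + int ?M}" for k
 define far where "far k = ?T - near k" for k
 have pt: "(SS k x y)^2 * of_bool (real M < SS k x y) <= 4 * (\<Sum>t\<in>far k. inc' k t x y)^2" for k x y
 proof (cases "real M < SS k x y")
  case True
  have "near k \<subseteq> {lo + int k..<lo + int k + int ?M}" by (auto simp: near_def)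
  then have "card (near k) <= ?M" using card_mono[of "{lo + int k..<lo + int k + int ?M}" "near k"] by simp
  moreover have "(\<Sum>t\<in>near k. inc' k t x y) <= of_nat (card (near k)) * 1"
   by (rule sum_bounded_above) (simp add: inc_bounds)
  moreover have "real ?M <= real M / 2" by linarith
  ultimately have near: "(\<Sum>t\<in>near k. inc' k t x y) <= SS k x y / 2" using True by linarith
  have "SS k x y = (\<Sum>t\<in>far k. inc' k t x y) + (\<Sum>t\<in>near k. inc' k t x y)"
   unfolding SS_def far_def by (rule sum.subset_diff) (auto simp: near_def)
  with near have "SS k x y <= 2 * (\<Sum>t\<in>far k. inc' k t x y)" by simp
  from power_mono[OF this SS_nonneg, of 2] show ?thesis using True by (simp add: power_mult_distrib)
 qed simp
 have "(\<Sum>k<m. tail_square k M) <= (\<Sum>k<m. 4 * (\<tau> ?M * (\<Sum>t\<in>?T. if t \<in> near k then 0 else \<rho> k t)))"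
 proof (rule sum_mono)
  fix k assume k: "k \<in> {..<m}"
  have r: "(\<Sum>t\<in>far k. \<rho> k t) <= \<tau> ?M" by (rule row_sum) (auto simp: far_def near_def)
  have "tail_square k M <= E2 k (%x y. 4 * (\<Sum>t\<in>far k. inc' k t x y)^2)"
   by (rule E2_mono) (rule pt)
  also have "... = 4 * E2 k (%x y. (\<Sum>t\<in>far k. inc' k t x y)^2)" by (rule E2_cmult)
  also have "... <= 4 * (\<Sum>t\<in>far k. \<rho> k t)^2" using k by (intro mult_left_mono E2_sum_inc_sq) (auto simp: far_def)
  also have "... <= 4 * (\<tau> ?M * (\<Sum>t\<in>far k. \<rho> k t))"
   unfolding power2_eq_square using r C0 by (intro mult_left_mono mult_right_mono sum_nonneg) (auto simp: decay_nonneg)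
  also have "(\<Sum>t\<in>far k. \<rho> k t) = (\<Sum>t\<in>?T. if t \<in> near k then 0 else \<rho> k t)"
   unfolding far_def by (intro sum.mono_neutral_cong_left) auto
  finally show "tail_square k M <= 4 * (\<tau> ?M * (\<Sum>t\<in>?T. if t \<in> near k then 0 else \<rho> k t))" .
 qed
 also have "... = 4 * (\<tau> ?M * (\<Sum>t\<in>?T. \<Sum>k<m. if t \<in> near k then 0 else \<rho> k t))"
  unfolding sum_distrib_left[symmetric] by (subst sum.swap) simp
 also have "... <= 4 * (\<tau> ?M * (\<Sum>t\<in>?T. \<tau> ?M))"
 proof (intro mult_left_mono sum_mono \<tau>_nonneg)
  fix t assume t: "t \<in> ?T"
  have "(\<Sum>k<m. if t \<in> near k then 0 else \<rho> k t) = (\<Sum>k\<in>{k. k < m \<and> t \<notin> near k}. \<rho> k t)"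
   by (intro sum.mono_neutral_cong_right) auto
  also have "... <= \<tau> ?M" using t by (intro col_sum) (auto simp: near_def)
  finally show "(\<Sum>k<m. if t \<in> near k then 0 else \<rho> k t) <= \<tau> ?M" .
 qed simp
 finally show ?thesis by (simp add: power2_eq_square algebra_simps)
qed

lemma tau_half: "(\<tau> (M div 2))^2 <= A^2 * 2 powr (2 * s - 2) * (1 + real M) powr (2 - 2 * s)"
proof -
 have "((1 + real (M div 2)) powr (1 - s))^2 = (1 + real (M div 2)) powr (2 - 2 * s)"
  by (simp add: powr_realpow[symmetric] powr_powr power2_eq_square powr_add[symmetric])
 also have "... <= ((1 + real M) / 2) powr (2 - 2 * s)" using s1 by (intro powr_mono2') auto
 also have "... = 2 powr (2 * s - 2) * (1 + real M) powr (2 - 2 * s)"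
  by (simp add: powr_divide powr_minus_divide[of 2 "2 - 2 * s", simplified, symmetric] powr_diff field_simps)
 finally have "((1 + real (M div 2)) powr (1 - s))^2 <= 2 powr (2 * s - 2) * (1 + real M) powr (2 - 2 * s)" .
 from mult_left_mono[OF this, of "A^2"]
 have "(A * (1 + real (M div 2)) powr (1 - s))^2 <= A^2 * 2 powr (2 * s - 2) * (1 + real M) powr (2 - 2 * s)"
  by (simp add: power_mult_distrib mult.assoc)
 moreover have "\<tau> (M div 2) = A * (1 + real (M div 2)) powr (1 - s)" by (simp add: \<tau>_def A_def)
 ultimately show ?thesis by simp
qed

definition Q where "Q = 4 * (A^2 * 2 powr (2 * s - 2))"

lemma tail_moment': "(\<Sum>k<m. tail_square k M) <= real n * (Q * (1 + real M) powr (2 - 2 * s))"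
proof -
 have "4 * real n * (\<tau> (M div 2))^2 <= 4 * real n * (A^2 * 2 powr (2 * s - 2) * (1 + real M) powr (2 - 2 * s))"
  by (intro mult_left_mono tau_half) auto
 then show ?thesis using tail_moment[of M] by (simp add: Q_def algebra_simps)
qed

lemma min_one_scale: fixes k x :: real assumes "0 <= k" "0 <= x" shows "min 1 (k * x) <= (1 + k) * min 1 x"
proof (cases "x <= 1")
 case True
 have "k * x <= (1 + k) * x" using assms by (intro mult_right_mono) auto
 then show ?thesis using True by simp
next
 case False then show ?thesis using assms by simp
qed

text \<open>\<open>min 1 (r / \<surd>n)\<close> is a sum of indicators of \<open>M < r\<close> over \<open>M < \<surd>n\<close>,
up to the factor \<open>1 / \<surd>n\<close>; \<open>tail_moment\<close> bounds each term. The same with squares gives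
\<open>H4_bound\<close>.\<close>
lemma H3_bound:
 assumes k: "0 <= q"
 shows "H3 (%k x y. q / sqrt n * SS k x y) <= q^2 * (1 + q) * Q * G3 s n"
proof -
 define N where "N = nat \<lceil>sqrt n\<rceil>"
 have N: "sqrt n <= real N" unfolding N_def by linarith
 have n0: "0 < real n" using n1 by simp
 have pt: "(q / sqrt n * r)^2 * min 1 (q / sqrt n * r) <= (q^2 * (1 + q) / (n * sqrt n)) * (\<Sum>M<N. r^2 * of_bool (real M < r))"
  if r: "0 <= r" for r
 proof -
  have "min 1 (q / sqrt n * r) <= (1 + q) * min 1 (r / sqrt n)" using min_one_scale[of q "r / sqrt n"] r k by simp
  also have "min 1 (r / sqrt n) = min (sqrt n) r / sqrt n" using n0 by (simp add: min_divide_distrib_right)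
  also have "min (sqrt n) r <= (\<Sum>M<N. of_bool (real M < min (sqrt n) r))" using r N by (intro count_below) auto
  also have "... <= (\<Sum>M<N. of_bool (real M < r))" by (intro sum_mono) auto
  finally have "min 1 (q / sqrt n * r) <= (1 + q) * ((\<Sum>M<N. of_bool (real M < r)) / sqrt n)"
   using k n0 by (simp add: divide_right_mono mult_left_mono)
  then have "(q / sqrt n * r)^2 * min 1 (q / sqrt n * r) <= (q / sqrt n * r)^2 * ((1 + q) * ((\<Sum>M<N. of_bool (real M < r)) / sqrt n))"
   by (intro mult_left_mono) auto
  also have "... = (q^2 * (1 + q) / (n * sqrt n)) * (r^2 * (\<Sum>M<N. of_bool (real M < r)))"
   using n0 by (simp add: power_mult_distrib power_divide)
  finally show ?thesis by (simp only: sum_distrib_left)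
 qed
 have "H3 (%k x y. q / sqrt n * SS k x y) <= (\<Sum>k<m. E2 k (%x y. (q^2 * (1 + q) / (n * sqrt n)) * (\<Sum>M<N. (SS k x y)^2 * of_bool (real M < SS k x y))))"
  unfolding H3_def by (intro sum_mono E2_mono pt SS_nonneg)
 also have "... = (q^2 * (1 + q) / (n * sqrt n)) * (\<Sum>M<N. \<Sum>k<m. tail_square k M)"
  unfolding E2_cmult E2_sum unfolding sum_distrib_left[symmetric] by (subst sum.swap) (rule refl)
 also have "... <= (q^2 * (1 + q) / (n * sqrt n)) * (\<Sum>M<N. real n * (Q * (1 + real M) powr (2 - 2 * s)))"
  using k by (intro mult_left_mono sum_mono tail_moment') auto
 also have "... = q^2 * (1 + q) * Q * G3 s n"
  unfolding G3_def N_def[symmetric] sum_distrib_left[symmetric] using n0 by simp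
 finally show ?thesis .
qed

lemma H4_bound:
 assumes k: "0 <= q"
 shows "H4 (%k x y. q / sqrt n * SS k x y) <= q^2 * (1 + q^2) * (2 * Q) * G4 s n"
proof -
 define N where "N = nat \<lceil>sqrt n\<rceil>"
 have N: "sqrt n <= real N" unfolding N_def by linarith
 have n0: "0 < real n" using n1 by simp
 have pt: "(q / sqrt n * r)^2 * min 1 ((q / sqrt n * r)^2) <= (q^2 * (1 + q^2) / (real n * n)) * (\<Sum>M<N. (2 * real M + 1) * (r^2 * of_bool (real M < r)))"
  if r: "0 <= r" for r
 proof -
  have "min 1 ((q / sqrt n * r)^2) <= (1 + q^2) * min 1 (r^2 / n)"
   using min_one_scale[of "q^2" "r^2 / n"] n0 by (simp add: power_mult_distrib power_divide)
  also have "min 1 (r^2 / n) = min (real n) (r^2) / n" using n0 by (simp add: min_divide_distrib_right)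
  also have "min (real n) (r^2) = (min (sqrt n) r)^2"
   using r n0 by (auto simp: min_def real_le_lsqrt real_sqrt_le_iff not_le power_mono abs_le_square_iff)
    (smt (verit) power_mono real_sqrt_ge_zero real_sqrt_pow2 real_le_rsqrt)+
  also have "(min (sqrt n) r)^2 <= (\<Sum>M<N. (2 * real M + 1) * of_bool (real M < min (sqrt n) r))" using r N by (intro count_below) auto
  also have "... <= (\<Sum>M<N. (2 * real M + 1) * of_bool (real M < r))" by (intro sum_mono) auto
  finally have "min 1 ((q / sqrt n * r)^2) <= (1 + q^2) * ((\<Sum>M<N. (2 * real M + 1) * of_bool (real M < r)) / n)"
   using k n0 by (simp add: divide_right_mono mult_left_mono)
  then have "(q / sqrt n * r)^2 * min 1 ((q / sqrt n * r)^2) <= (q / sqrt n * r)^2 * ((1 + q^2) * ((\<Sum>M<N. (2 * real M + 1) * of_bool (real M < r)) / n))"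
   by (intro mult_left_mono) auto
  also have "... = (q^2 * (1 + q^2) / (real n * n)) * (r^2 * (\<Sum>M<N. (2 * real M + 1) * of_bool (real M < r)))"
   using n0 by (simp add: power_mult_distrib power_divide)
  finally show ?thesis by (simp only: sum_distrib_left mult.left_commute[of "r^2"])
 qed
 have "H4 (%k x y. q / sqrt n * SS k x y) <= (\<Sum>k<m. E2 k (%x y. (q^2 * (1 + q^2) / (real n * n)) * (\<Sum>M<N. (2 * real M + 1) * ((SS k x y)^2 * of_bool (real M < SS k x y)))))"
  unfolding H4_def by (intro sum_mono E2_mono pt SS_nonneg)
 also have "... = (q^2 * (1 + q^2) / (real n * n)) * (\<Sum>M<N. (2 * real M + 1) * (\<Sum>k<m. tail_square k M))"
  unfolding E2_cmult E2_sum unfolding sum_distrib_left[symmetric] by (subst sum.swap) (simp only: sum_distrib_left)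
 also have "... <= (q^2 * (1 + q^2) / (real n * n)) * (\<Sum>M<N. real n * (2 * Q * (1 + real M) powr (3 - 2 * s)))"
 proof (intro mult_left_mono sum_mono)
  fix M
  have "(2 * real M + 1) * (\<Sum>k<m. tail_square k M) <= (2 * (1 + real M)) * (real n * (Q * (1 + real M) powr (2 - 2 * s)))"
   by (intro mult_mono tail_moment' sum_nonneg E2_nonneg mult_nonneg_nonneg) auto
  also have "... = real n * (2 * Q * ((1 + real M) powr 1 * (1 + real M) powr (2 - 2 * s)))" by simp
  also have "... = real n * (2 * Q * (1 + real M) powr (3 - 2 * s))" unfolding powr_add[symmetric] by simp
  finally show "(2 * real M + 1) * (\<Sum>k<m. tail_square k M) <= real n * (2 * Q * (1 + real M) powr (3 - 2 * s))" .
 qed auto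
 also have "... = q^2 * (1 + q^2) * (2 * Q) * G4 s n"
  unfolding G4_def N_def[symmetric] sum_distrib_left[symmetric] using n0 by simp
 finally show ?thesis .
qed

lemma lip1_weaken: "lip1 d G ==> (!!k x y. d k x y <= d' k x y) ==> lip1 d' G"
 unfolding lip1_def by (meson order_trans)
lemma lip2_weaken: "lip2 e G ==> (!!k l x y u v. e k l x y u v <= e' k l x y u v) ==> lip2 e' G"
 unfolding lip2_def by (meson order_trans)

lemma A0: "0 <= A" using A_tau \<tau>_nonneg by simp

lemma partial_sum_lipschitz:
 fixes f :: "real => real" and c q C\<^sub>f :: real and \<mu> :: "int => real"
 assumes f: "!!x y. \<bar>f x - f y\<bar> <= C\<^sub>f * min 1 \<bar>x - y\<bar>"
   "!!x a b. \<bar>(f (x + a + b) - f (x + a)) - (f (x + b) - f x)\<bar> <= C\<^sub>f * (min 1 \<bar>a\<bar> * min 1 \<bar>b\<bar>)"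
  and c: "0 <= c" "0 <= C\<^sub>f" "c * C\<^sub>f <= q / sqrt n"
 defines "W \<equiv> %s. c * (\<Sum>t\<in>{1..int n}. f (XX Y t s) - \<mu> t)"
 shows "lip1 (%k x y. q / sqrt n * SS k x y) W"
  "lip2 (%k l x y u v. q / sqrt n * (\<Sum>t\<in>{1..int n}. inc Y k t x y * inc Y l t u v)) W"
proof -
 have 1: "lip1 (%k x y. c * (\<Sum>t\<in>{1..int n}. C\<^sub>f * inc Y k t x y)) W"
  unfolding W_def by (rule lip1_sum) (use lip1_single[OF f(1) c(2)] c in auto)
 have "c * (\<Sum>t\<in>{1..int n}. C\<^sub>f * inc Y k t x y) <= q / sqrt n * SS k x y" for k x y
  using mult_right_mono[OF c(3) SS_nonneg] by (simp add: SS_def sum_distrib_left mult.assoc)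
 with 1 show "lip1 (%k x y. q / sqrt n * SS k x y) W" by (rule lip1_weaken)
 have 2: "lip2 (%k l x y u v. c * (\<Sum>t\<in>{1..int n}. C\<^sub>f * (inc Y k t x y * inc Y l t u v))) W"
  unfolding W_def by (rule lip2_sum) (use lip2_single[OF f(2) c(2)] c in auto)
 have "c * (\<Sum>t\<in>{1..int n}. C\<^sub>f * (inc Y k t x y * inc Y l t u v)) <= q / sqrt n * (\<Sum>t\<in>{1..int n}. inc Y k t x y * inc Y l t u v)" for k l x y u v
 proof -
  have "0 <= (\<Sum>t\<in>{1..int n}. inc Y k t x y * inc Y l t u v)" by (intro sum_nonneg mult_nonneg_nonneg inc_bounds)
  from mult_right_mono[OF c(3) this] show ?thesis by (simp add: sum_distrib_left mult.assoc)
 qed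
 with 2 show "lip2 (%k l x y u v. q / sqrt n * (\<Sum>t\<in>{1..int n}. inc Y k t x y * inc Y l t u v)) W" by (rule lip2_weaken)
qed

lemma second_moment_total:
 "(\<Sum>k<m. E2 k (%x y. (q / sqrt n * SS k x y)^2)) <= q^2 * A^2"
proof -
 have "(\<Sum>k<m. E2 k (%x y. (q / sqrt n * SS k x y)^2)) = q^2 / n * (\<Sum>k<m. E2 k (%x y. (SS k x y)^2))"
  unfolding power_mult_distrib E2_cmult sum_distrib_left by (simp add: power_divide)
 also have "... <= q^2 / n * (A^2 * card {1..int n})" by (intro mult_left_mono SS_second_moment) auto
 also have "... = q^2 * A^2" using n1 by simp
 finally show ?thesis .
qed

lemma eps_sqrt: "0 <= q ==> q / sqrt n * A^2 * sqrt (q^2 * A^2) = q^2 * A ^ 3 * (1 / sqrt n)"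
 using A0 by (simp add: real_sqrt_mult power2_eq_square power3_eq_cube)

theorem partial_sum_lipschitz_bound:
 fixes f h :: "real => real" and c q C\<^sub>f :: real and \<mu> :: "int => real"
 assumes f: "!!x y. \<bar>f x - f y\<bar> <= C\<^sub>f * min 1 \<bar>x - y\<bar>"
   "!!x a b. \<bar>(f (x + a + b) - f (x + a)) - (f (x + b) - f x)\<bar> <= C\<^sub>f * (min 1 \<bar>a\<bar> * min 1 \<bar>b\<bar>)"
  and c: "0 <= c" "0 <= C\<^sub>f" "c * C\<^sub>f <= q / sqrt n" and k: "0 <= q"
  and h: "!!x y. \<bar>h x - h y\<bar> <= \<bar>x - y\<bar>"
 defines "W \<equiv> %s. c * (\<Sum>t\<in>{1..int n}. f (XX Y t s) - \<mu> t)"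
 assumes W: "EE W = 0"
 shows "\<bar>EE (%s. h (W s)) - normal_mean h\<bar> <= 11 * \<bar>1 - EE (%s. (W s)^2)\<bar> +
   (11 * q^2 * A ^ 3 * (1 / sqrt n) + 44 * (q^2 * (1 + q) * Q) * G3 s n)"
proof -
 note l = partial_sum_lipschitz[OF f c, of \<mu>, folded W_def]
 have "\<bar>EE (%s. h (W s)) - normal_mean h\<bar> <= 
  11 * (\<bar>1 - EE (%s. (W s)^2)\<bar> + q / sqrt n * A^2 * sqrt (q^2 * A^2)) + 44 * H3 (%k x y. q / sqrt n * SS k x y)"
  by (rule normal_approximation_lipschitz[OF W l eps_first second_moment_total _ h]) (use k in auto)
 also have "... <= 11 * (\<bar>1 - EE (%s. (W s)^2)\<bar> + q^2 * A ^ 3 * (1 / sqrt n)) + 44 * (q^2 * (1 + q) * Q * G3 s n)"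
  unfolding eps_sqrt[OF k] by (intro add_left_mono mult_left_mono H3_bound k) auto
 finally show ?thesis by (simp add: algebra_simps)
qed

theorem partial_sum_monotone_bound:
 fixes f h :: "real => real" and c q C\<^sub>f :: real and \<mu> :: "int => real"
 assumes f: "!!x y. \<bar>f x - f y\<bar> <= C\<^sub>f * min 1 \<bar>x - y\<bar>"
   "!!x a b. \<bar>(f (x + a + b) - f (x + a)) - (f (x + b) - f x)\<bar> <= C\<^sub>f * (min 1 \<bar>a\<bar> * min 1 \<bar>b\<bar>)"
  and c: "0 <= c" "0 <= C\<^sub>f" "c * C\<^sub>f <= q / sqrt n" and k: "0 <= q"
  and h: "continuous_on UNIV h" "!!x. 0 <= h x" "!!x. h x <= 1" "antimono h"
 defines "W \<equiv> %s. c * (\<Sum>t\<in>{1..int n}. f (XX Y t s) - \<mu> t)"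
 assumes W: "EE W = 0"
 shows "\<bar>EE (%s. h (W s)) - normal_mean h\<bar> <= 2 * \<bar>1 - EE (%s. (W s)^2)\<bar> +
   (6 * q^2 * A ^ 3 * (1 / sqrt n) + (22 + 4 * (q * A)) * (q^2 * (1 + q) * Q) * G3 s n + sqrt (40 * (q^2 * (1 + q^2) * (2 * Q))) * sqrt (G4 s n))"
proof -
 let ?d = "%k x y. q / sqrt n * SS k x y"
 note l = partial_sum_lipschitz[OF f c, of \<mu>, folded W_def]
 have "EE (%s. (W s - EE W)^2) <= q^2 * A^2" by (rule order_trans[OF variance_bound[OF l(1)] second_moment_total])
 then have "EE (%s. \<bar>W s\<bar>) <= sqrt (q^2 * A^2)"
  using EE_abs_le_sqrt[of W] unfolding W by (simp del: real_sqrt_le_iff, meson order_trans real_sqrt_le_mono)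
 also have "... = q * A" using k A0 by (simp add: real_sqrt_mult)
 finally have absW: "EE (%s. \<bar>W s\<bar>) <= q * A" .
 have H43: "H4 ?d <= H3 ?d"
 proof -
  have "x^2 * min 1 (x^2) <= x^2 * min 1 x" if "0 <= x" for x :: real
  proof (cases "x <= 1")
   case True then show ?thesis using that mult_left_mono[of x 1 x] by (intro mult_left_mono) (auto simp: power2_eq_square min_def)
  qed (auto simp: min_def mult_left_mono)
  moreover have "0 <= ?d k x y" for k x y using k SS_nonneg by auto
  ultimately show ?thesis unfolding H3_def H4_def by (intro sum_mono E2_mono) blast
 qed
 have H30: "0 <= H3 ?d" unfolding H3_def using k SS_nonneg by (intro sum_nonneg E2_nonneg mult_nonneg_nonneg) auto
 have "\<bar>EE (%s. h (W s)) - normal_mean h\<bar> <= 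
  2 * (\<bar>1 - EE (%s. (W s)^2)\<bar> + q / sqrt n * A^2 * sqrt (q^2 * A^2)) + (16 + 4 * EE (%s. \<bar>W s\<bar>)) * H3 ?d + 6 * H4 ?d +
   sqrt (40 * H4 ?d + 16 * (q / sqrt n * A^2)^2 * (q^2 * A^2))"
  by (rule normal_approximation_monotone[OF W l _ eps_first eps_second second_moment_total _ h])
    (use k in \<open>auto simp: SS_def inc_sym\<close>)
 also have "... <= 2 * (\<bar>1 - EE (%s. (W s)^2)\<bar> + q^2 * A ^ 3 * (1 / sqrt n)) + ((16 + 4 * (q * A)) * H3 ?d + 6 * H3 ?d) +
   (sqrt (40 * (q^2 * (1 + q^2) * (2 * Q))) * sqrt (G4 s n) + 4 * (q^2 * A ^ 3 * (1 / sqrt n)))"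
 proof -
  have "sqrt (40 * H4 ?d + 16 * (q / sqrt n * A^2)^2 * (q^2 * A^2)) <= sqrt (40 * H4 ?d) + sqrt (16 * (q / sqrt n * A^2)^2 * (q^2 * A^2))"
   using k SS_nonneg unfolding H4_def by (intro sqrt_add_le_add_sqrt mult_nonneg_nonneg sum_nonneg E2_nonneg) auto
  also have "sqrt (16 * (q / sqrt n * A^2)^2 * (q^2 * A^2)) = 4 * (q / sqrt n * A^2 * sqrt (q^2 * A^2))"
   using k A0 by (simp add: real_sqrt_mult)
  also have "... = 4 * (q^2 * A ^ 3 * (1 / sqrt n))" unfolding eps_sqrt[OF k] ..
  also have "sqrt (40 * H4 ?d) <= sqrt (40 * (q^2 * (1 + q^2) * (2 * Q)) * G4 s n)"
  proof (rule real_sqrt_le_mono)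
   show "40 * H4 ?d <= 40 * (q^2 * (1 + q^2) * (2 * Q)) * G4 s n"
    using mult_left_mono[OF H4_bound[OF k], of 40] by (simp only: mult.assoc)
  qed
  also have "... = sqrt (40 * (q^2 * (1 + q^2) * (2 * Q))) * sqrt (G4 s n)" by (rule real_sqrt_mult)
  finally have "sqrt (40 * H4 ?d + 16 * (q / sqrt n * A^2)^2 * (q^2 * A^2)) <= sqrt (40 * (q^2 * (1 + q^2) * (2 * Q))) * sqrt (G4 s n) + 4 * (q^2 * A ^ 3 * (1 / sqrt n))"
   by simp
  moreover have "(16 + 4 * EE (%s. \<bar>W s\<bar>)) * H3 ?d <= (16 + 4 * (q * A)) * H3 ?d" using absW H30 by (intro mult_right_mono) auto
  ultimately show ?thesis unfolding eps_sqrt[OF k] using H43 by linarith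
 qed
 also have "(16 + 4 * (q * A)) * H3 ?d + 6 * H3 ?d = (22 + 4 * (q * A)) * H3 ?d" by (simp add: algebra_simps)
 also have "... <= (22 + 4 * (q * A)) * (q^2 * (1 + q) * Q * G3 s n)" using k A0 by (intro mult_left_mono H3_bound) auto
 finally show ?thesis by (simp add: algebra_simps)
qed

end

section \<open>The rates\<close>

definition rateW :: "real => nat => real" where
 "rateW q n = (if q > 3 then real n powr (- 1 / 2) else if q = 3 then real n powr (- 1 / 2) * ln (real n)
   else real n powr ((2 - q) / 2))"

definition rateK :: "real => nat => real" where
 "rateK q n = (if q > 4 then real n powr (- 1 / 2) else if q = 4 then real n powr (- 1 / 2) * ln (real n)
   else real n powr ((2 - q) / 4))"

lemma powr_sum_gt1: "1 < a ==> (\<Sum>M<N. (1 + real M) powr (- a)) <= a / (a - 1)"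
 using decay_sum_le[of a "{..<N}" 0] by simp

lemma powr_sum_lt1:
 assumes a: "a < 1" shows "(\<Sum>M<N. (1 + real M) powr (- a)) <= (1 + 1 / (1 - a)) * real N powr (1 - a)"
proof (cases "0 < a")
 case True
 show ?thesis
 proof (cases N)
  case (Suc L)
  have "(\<Sum>M<N. (1 + real M) powr (- a)) = 1 + (\<Sum>j<L. (1 + real (Suc 0 + j)) powr (- a))"
   unfolding Suc by (subst sum.lessThan_Suc_shift) simp
  also have "... <= 1 + ((1 + real L) powr (1 - a) - 1) / (1 - a)"
   using powr_sum_telescope[of a 0 L] True a by simp
  also have "... = (real N powr (1 - a) - a) / (1 - a)" using a Suc by (simp add: field_simps)
  also have "... <= real N powr (1 - a) / (1 - a)" using True a by (intro divide_right_mono) auto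
  also have "... <= real N powr (1 - a) + real N powr (1 - a) / (1 - a)" by simp
  finally show ?thesis by (simp add: distrib_right)
 qed simp
next
 case False
 have "(\<Sum>M<N. (1 + real M) powr (- a)) <= of_nat (card {..<N}) * real N powr (- a)"
  using False by (intro sum_bounded_above powr_mono2) auto
 also have "... = real N powr (1 - a)"
  by (cases "N = 0") (auto simp: powr_add[of _ 1 "- a", simplified])
 also have "... <= (1 + 1 / (1 - a)) * real N powr (1 - a)" using a by (simp add: distrib_right)
 finally show ?thesis .
qed

lemma powr_sum_eq1: assumes "1 <= N" shows "(\<Sum>M<N. (1 + real M) powr (- 1)) <= 1 + ln N"
 using assms
proof (induction N rule: dec_induct)
 case (step N)
 have "1 - real N / (1 + real N) <= ln ((1 + real N) / real N)"
  using ln_one_minus_pos_upper_bound[of "1 / (1 + real N)"] step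
  by (simp add: ln_div field_simps)
 then have "(1 + real N) powr (- 1) <= ln (real (Suc N)) - ln (real N)"
  using step by (simp add: powr_minus ln_div field_simps)
 then show ?case using step.IH by simp
qed simp

lemma ceil_sqrt: assumes "1 <= (n::nat)"
 shows "1 <= nat \<lceil>sqrt n\<rceil>" "real (nat \<lceil>sqrt n\<rceil>) <= 2 * sqrt n"
proof -
 have "1 <= sqrt n" using assms by simp
 then show "1 <= nat \<lceil>sqrt n\<rceil>" "real (nat \<lceil>sqrt n\<rceil>) <= 2 * sqrt n" by linarith+
qed

lemma inv_sqrt_powr: "1 <= (n::nat) ==> 1 / sqrt n = real n powr (- 1 / 2)"
 by (simp add: powr_half_sqrt[symmetric] powr_minus_divide)

lemma sum_ceil_lt1:
 assumes "1 <= (n::nat)" "a < 1"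
 shows "(\<Sum>M<nat \<lceil>sqrt n\<rceil>. (1 + real M) powr (- a)) <= (1 + 1 / (1 - a)) * 2 powr (1 - a) * real n powr ((1 - a) / 2)"
proof -
 have "(\<Sum>M<nat \<lceil>sqrt n\<rceil>. (1 + real M) powr (- a)) <= (1 + 1 / (1 - a)) * real (nat \<lceil>sqrt n\<rceil>) powr (1 - a)"
  by (rule powr_sum_lt1[OF assms(2)])
 also have "... <= (1 + 1 / (1 - a)) * (2 * sqrt n) powr (1 - a)"
  using assms ceil_sqrt[OF assms(1)] by (intro mult_left_mono powr_mono2) auto
 also have "(2 * sqrt n) powr (1 - a) = 2 powr (1 - a) * real n powr ((1 - a) / 2)"
  using assms by (simp add: powr_mult powr_half_sqrt[symmetric] powr_powr)
 finally show ?thesis by simp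
qed

lemma sum_ceil_eq1:
 assumes "2 <= (n::nat)"
 shows "(\<Sum>M<nat \<lceil>sqrt n\<rceil>. (1 + real M) powr (- 1)) <= ((1 + ln 2) / ln 2 + 1) * ln n"
proof -
 have n: "1 <= n" using assms by simp
 have "(\<Sum>M<nat \<lceil>sqrt n\<rceil>. (1 + real M) powr (- 1)) <= 1 + ln (nat \<lceil>sqrt n\<rceil>)" by (rule powr_sum_eq1[OF ceil_sqrt(1)[OF n]])
 also have "ln (nat \<lceil>sqrt n\<rceil>) <= ln (2 * sqrt n)" using ceil_sqrt[OF n] n by (subst ln_le_cancel_iff) auto
 also have "ln (2 * sqrt n) = ln 2 + ln n / 2" using n by (simp add: ln_mult ln_sqrt)
 also have "1 + (ln 2 + ln n / 2) <= (1 + ln 2) / ln 2 * ln n + ln n"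
 proof -
  have "ln 2 <= ln (real n)" "0 < ln (2::real)" using assms by auto
  then have "(1 + ln 2) / ln 2 * ln 2 <= (1 + ln 2) / ln 2 * ln (real n)" by (intro mult_left_mono) auto
  moreover have "(1 + ln 2) / ln 2 * ln 2 = 1 + ln (2::real)" using \<open>0 < ln (2::real)\<close> by simp
  moreover have "0 <= ln (real n)" using \<open>ln 2 <= ln (real n)\<close> \<open>0 < ln (2::real)\<close> by linarith
  ultimately show ?thesis by linarith
 qed
 finally show ?thesis by (simp add: distrib_right)
qed

text \<open>The order of \<open>\<Sum>\<^bsub>M < \<surd>n\<^esub> (1 + M) powr (- a)\<close>.\<close>
definition growth :: "real => nat => real" where
 "growth a n = (if a > 1 then 1 else if a = 1 then ln (real n) else real n powr ((1 - a) / 2))"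

lemma sum_ceil_growth:
 obtains C where "0 < C" "\<forall>n\<ge>1. (a = 1 --> 2 <= n) -->
  (\<Sum>M<nat \<lceil>sqrt n\<rceil>. (1 + real M) powr (- a)) <= C * growth a n \<and> 1 <= C * growth a n"
proof -
 consider "a > 1" | "a = 1" | "a < 1" by linarith
 then show thesis
 proof cases
  case 1
  show ?thesis by (rule that[of "a / (a - 1)"]) (use 1 powr_sum_gt1[OF 1] in \<open>auto simp: growth_def\<close>)
 next
  case 2
  define c where "c = (1 + ln 2) / ln 2 + (1::real)"
  have l2: "0 < ln (2::real)" by simp
  have "c * ln 2 = 1 + 2 * ln 2" using l2 unfolding c_def by (simp add: field_simps)
  then have c: "0 < c" "1 <= c * ln 2" using l2 by (auto simp: c_def add_pos_pos)
  show ?thesis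
  proof (rule that[OF c(1)], intro allI impI)
   fix n :: nat assume "a = 1 --> 2 <= n"
   with 2 have n2: "2 <= n" by simp
   then have "c * ln 2 <= c * ln n" using c by (intro mult_left_mono) auto
   with c(2) have "1 <= c * ln n" by linarith
   then show "(\<Sum>M<nat \<lceil>sqrt n\<rceil>. (1 + real M) powr (- a)) <= c * growth a n \<and> 1 <= c * growth a n"
    using sum_ceil_eq1[OF n2] 2 by (simp add: growth_def c_def)
  qed
 next
  case 3
  define c where "c = (1 + 1 / (1 - a)) * 2 powr (1 - a)"
  have "1 * 1 <= (1 + 1 / (1 - a)) * 2 powr (1 - a)" using 3 by (intro mult_mono ge_one_powr_ge_zero) auto
  then have c: "1 <= c" by (simp add: c_def)
  show ?thesis
  proof (rule that[of c], goal_cases)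
   case 2
   show ?case
   proof (intro allI impI)
   fix n :: nat assume n: "1 <= n"
   have "1 * 1 <= c * real n powr ((1 - a) / 2)" using c 3 n by (intro mult_mono ge_one_powr_ge_zero) auto
   then show "(\<Sum>M<nat \<lceil>sqrt n\<rceil>. (1 + real M) powr (- a)) <= c * growth a n \<and> 1 <= c * growth a n"
    using sum_ceil_lt1[OF n 3] 3 by (simp add: growth_def c_def)
   qed
  qed (use c in simp)
 qed
qed

lemma rateW_growth:
 assumes "1 <= n" shows "rateW q n = 1 / sqrt n * growth (q - 2) n"
proof -
 have "real n powr ((2 - q) / 2) = real n powr (- 1 / 2) * real n powr ((1 - (q - 2)) / 2)"
  unfolding powr_add[symmetric] by (rule arg_cong[where f = "%x. real n powr x"]) (simp add: field_simps)
 then show ?thesis using inv_sqrt_powr[OF assms] by (auto simp: rateW_def growth_def)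
qed

lemma rateK_growth:
 assumes n: "1 <= n" and q: "q = 4 --> 2 <= n" shows "sqrt (1 / n * growth (q - 3) n) <= 2 * rateK q n"
proof -
 consider "q > 4" | "q = 4" | "q < 4" by linarith
 then show ?thesis
 proof cases
  case 1 then show ?thesis using inv_sqrt_powr[OF n] by (simp add: growth_def rateK_def real_sqrt_divide)
 next
  case 2
  have "ln (1 / 2) <= 1 / 2 - (1::real)" by (rule ln_le_minus_one) simp
  then have "1 / 2 <= ln (2::real)" by (simp add: ln_div)
  also have "... <= ln n" using q 2 by simp
  finally have l: "1 / 2 <= ln (real n)" .
  then have "ln n * 1 <= ln n * (4 * ln (real n))" by (intro mult_left_mono) auto
  then have "sqrt (ln n) <= sqrt ((2 * ln n)^2)" by (intro real_sqrt_le_mono) (simp add: power2_eq_square)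
  also have "... = 2 * ln n" using l by (subst real_sqrt_abs) simp
  finally have "1 / sqrt n * sqrt (ln n) <= 1 / sqrt n * (2 * ln n)" by (intro mult_left_mono) auto
  moreover have "rateK q n = 1 / sqrt n * ln n" using 2 inv_sqrt_powr[OF n] by (simp add: rateK_def)
  ultimately show ?thesis using 2 by (simp add: growth_def real_sqrt_divide)
 next
  case 3
  have e: "(2 - q) / 2 = - 1 + (1 - (q - 3)) / 2" by (simp add: field_simps)
  have "1 / n = real n powr (- 1)" using n by (simp add: powr_minus_divide)
  then have "1 / n * real n powr ((1 - (q - 3)) / 2) = real n powr ((2 - q) / 2)"
   unfolding e powr_add by (simp only:)
  then have "sqrt (1 / n * growth (q - 3) n) = rateK q n"
   using 3 by (simp add: growth_def rateK_def powr_half_sqrt[symmetric] powr_powr)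
  moreover have "0 <= rateK q n" using 3 by (simp add: rateK_def)
  ultimately show ?thesis by simp
 qed
qed

lemma G3_rate: "\<exists>C>0. \<forall>n\<ge>1. (2 * s = 3 --> 2 <= n) --> G3 s n <= C * rateW (2 * s) n \<and> 1 / sqrt n <= C * rateW (2 * s) n"
proof -
 obtain C where C: "0 < C" "\<forall>n\<ge>1. (2 * s - 2 = 1 --> 2 <= n) -->
  (\<Sum>M<nat \<lceil>sqrt n\<rceil>. (1 + real M) powr (- (2 * s - 2))) <= C * growth (2 * s - 2) n \<and> 1 <= C * growth (2 * s - 2) n"
  by (rule sum_ceil_growth[of "2 * s - 2"])
 show ?thesis
 proof (intro exI[of _ C] conjI allI impI)
  fix n :: nat assume n: "1 <= n" "2 * s = 3 --> 2 <= n"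
  have r: "C * rateW (2 * s) n = 1 / sqrt n * (C * growth (2 * s - 2) n)" unfolding rateW_growth[OF n(1)] by simp
  show "G3 s n <= C * rateW (2 * s) n" unfolding G3_def r using C(2)[rule_format, of n] n by (intro mult_left_mono) auto
  have "1 / sqrt n * 1 <= 1 / sqrt n * (C * growth (2 * s - 2) n)" using C(2)[rule_format, of n] n by (intro mult_left_mono) auto
  then show "1 / sqrt n <= C * rateW (2 * s) n" unfolding r by simp
 qed (rule C)
qed

lemma G4_rate: "\<exists>C>0. \<forall>n\<ge>1. (2 * s = 4 --> 2 <= n) --> sqrt (G4 s n) <= C * rateK (2 * s) n"
proof -
 obtain C where C: "0 < C" "\<forall>n\<ge>1. (2 * s - 3 = 1 --> 2 <= n) -->
  (\<Sum>M<nat \<lceil>sqrt n\<rceil>. (1 + real M) powr (- (2 * s - 3))) <= C * growth (2 * s - 3) n \<and> 1 <= C * growth (2 * s - 3) n"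
  by (rule sum_ceil_growth[of "2 * s - 3"])
 show ?thesis
 proof (intro exI[of _ "sqrt C * 2"] conjI allI impI)
  fix n :: nat assume n: "1 <= n" "2 * s = 4 --> 2 <= n"
  have "G4 s n <= 1 / n * (C * growth (2 * s - 3) n)" unfolding G4_def using C(2)[rule_format, of n] n by (intro mult_left_mono) auto
  then have "sqrt (G4 s n) <= sqrt C * sqrt (1 / n * growth (2 * s - 3) n)"
   unfolding real_sqrt_mult[symmetric] by (intro real_sqrt_le_mono) (simp add: mult.left_commute)
  also have "... <= sqrt C * (2 * rateK (2 * s) n)" using C(1) by (intro mult_left_mono rateK_growth n) auto
  finally show "sqrt (G4 s n) <= sqrt C * 2 * rateK (2 * s) n" by (simp add: mult.assoc)
 qed (use C in simp)
qed

text \<open>For \<open>q = 3\<close> a logarithm is absorbed by \<open>n powr (1/4)\<close>.\<close>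
lemma rateW_le_rateK:
 assumes q: "2 < q"
 shows "\<exists>C>0. \<forall>n\<ge>1. (q = 4 --> 2 <= n) --> rateW q n <= C * rateK q n"
proof -
 consider "4 < q" | "q = 4" | "3 < q" "q < 4" | "q = 3" | "q < 3" by linarith
 then show ?thesis
 proof cases
  case 1 then show ?thesis by (intro exI[of _ 1]) (auto simp: rateW_def rateK_def)
 next
  case 2
  show ?thesis
  proof (intro exI[of _ "1 / ln 2"] conjI allI impI)
   fix n :: nat assume "1 <= n" "q = 4 --> 2 <= n"
   with 2 have "ln 2 <= ln (real n)" by simp
   then have "1 <= ln (real n) / ln 2" by simp
   then have "real n powr (- 1 / 2) * 1 <= real n powr (- 1 / 2) * (ln (real n) / ln 2)" by (intro mult_left_mono) auto
   then show "rateW q n <= 1 / ln 2 * rateK q n" using 2 by (simp add: rateW_def rateK_def)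
  qed simp
 next
  case 3 then show ?thesis by (intro exI[of _ 1]) (auto simp: rateW_def rateK_def intro!: powr_mono)
 next
  case 4
  show ?thesis
  proof (intro exI[of _ 4] conjI allI impI)
   fix n :: nat assume n: "1 <= n"
   have "ln (real n) / 4 = ln (real n powr (1 / 4))" using n by (simp add: ln_powr)
   also have "... <= real n powr (1 / 4)" using n ln_less_self[of "real n powr (1/4)"] by simp
   finally have "ln (real n) <= 4 * real n powr (1 / 4)" by simp
   then have "real n powr (- 1 / 2) * ln (real n) <= real n powr (- 1 / 2) * (4 * real n powr (1 / 4))" by (intro mult_left_mono) auto
   also have "... = 4 * (real n powr (- 1 / 2) * real n powr (1 / 4))" by simp
   also have "real n powr (- 1 / 2) * real n powr (1 / 4) = real n powr (- 1 / 4)" unfolding powr_add[symmetric] by simp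
   finally show "rateW q n <= 4 * rateK q n" using 4 by (simp add: rateW_def rateK_def)
  qed simp
 next
  case 5 then show ?thesis using q by (intro exI[of _ 1]) (auto simp: rateW_def rateK_def intro!: powr_mono)
 qed
qed

section \<open>Convergence in probability through a truncated first moment\<close>

context prob_space begin

text \<open>A metric for convergence in probability.\<close>
definition pn :: "('a => real) => real" where "pn Y = expectation (%r. min 1 \<bar>Y r\<bar>)"

lemma pn_integrable [simp]: "Y \<in> borel_measurable M ==> integrable M (%r. min 1 \<bar>Y r :: real\<bar>)"
 by (rule integrable_const_bound[where B = 1]) auto

lemma pn_nonneg: "0 <= pn Y" unfolding pn_def by (intro integral_nonneg_AE) auto

lemma pn_triangle:
 assumes [measurable]: "X \<in> borel_measurable M" "Y \<in> borel_measurable M"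
 shows "pn (%r. X r + Y r) <= pn X + pn Y"
proof -
 have "pn (%r. X r + Y r) <= expectation (%r. min 1 \<bar>X r\<bar> + min 1 \<bar>Y r\<bar>)"
  unfolding pn_def by (intro integral_mono) auto
 then show ?thesis by (simp add: pn_def)
qed

lemma pn_cong_AE: "X \<in> borel_measurable M ==> Y \<in> borel_measurable M ==> AE r in M. X r = Y r ==> pn X = pn Y"
 unfolding pn_def by (intro integral_cong_AE) auto

lemma pn_uminus: "pn (%r. - X r) = pn X" by (simp add: pn_def)
lemma pn_minus_commute: "pn (%r. X r - Y r) = pn (%r. Y r - X r)" by (simp add: pn_def abs_minus_commute)

lemma pn_diff_triangle:
 assumes [measurable]: "X \<in> borel_measurable M" "Y \<in> borel_measurable M" "Z \<in> borel_measurable M"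
 shows "pn (%r. X r - Z r) <= pn (%r. X r - Y r) + pn (%r. Y r - Z r)"
 using pn_triangle[of "%r. X r - Y r" "%r. Y r - Z r"] by simp

lemma pn_eq_0: assumes [measurable]: "X \<in> borel_measurable M" and "pn X <= 0" shows "AE r in M. X r = 0"
proof -
 have "expectation (%r. min 1 \<bar>X r\<bar>) = 0" using assms(2) pn_nonneg[of X] unfolding pn_def by linarith
 then have "AE r in M. min 1 \<bar>X r\<bar> = 0" by (subst (asm) integral_nonneg_eq_0_iff_AE) auto
 moreover have "min 1 \<bar>x\<bar> = 0 ==> x = 0" for x :: real by (simp add: min_def split: if_splits)
 ultimately show ?thesis by (auto elim: eventually_mono)
qed

lemma tendsto_in_prob_iff_pn:
 assumes [measurable]: "!!i. Y i \<in> borel_measurable M" "Y' \<in> borel_measurable M"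
 shows "tendsto_in_prob M Y Y' F \<longleftrightarrow> ((%i. pn (%r. Y i r - Y' r)) \<longlongrightarrow> 0) F"
proof
 assume *: "tendsto_in_prob M Y Y' F"
 show "((%i. pn (%r. Y i r - Y' r)) \<longlongrightarrow> 0) F"
 proof (rule tendstoI)
  fix e :: real assume e: "0 < e"
  define d where "d = e / 2"
  have d: "0 < d" "e = d + d" using e by (auto simp: d_def)
  let ?A = "%i. {r\<in>space M. d < \<bar>Y i r - Y' r\<bar>}"
  have "((%i. prob (?A i)) \<longlongrightarrow> 0) F"
   by (rule *[unfolded tendsto_in_prob_def, rule_format, OF d(1)])
  then have "\<forall>\<^sub>F i in F. prob (?A i) < d" by (rule order_tendstoD(2)) (rule d)
  then show "\<forall>\<^sub>F i in F. dist (pn (%r. Y i r - Y' r)) 0 < e"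
  proof eventually_elim
   case (elim i)
   have iA: "integrable M (indicator (?A i) :: _ => real)"
    by (intro integrable_real_indicator) (auto simp: emeasure_eq_measure)
   have "pn (%r. Y i r - Y' r) <= expectation (%r. d + indicator (?A i) r)"
    unfolding pn_def
   proof (rule integral_mono)
    show "integrable M (%r. d + indicator (?A i) r)" using iA by simp
    show "min 1 \<bar>Y i r - Y' r\<bar> <= d + indicator (?A i) r" if "r \<in> space M" for r
     using that d by (auto split: split_indicator intro: min.coboundedI1 min.coboundedI2)
   qed simp
   also have "... = d + prob (?A i)" using iA by (simp add: prob_space)
   finally show ?case using elim d pn_nonneg[of "%r. Y i r - Y' r"] by (simp add: dist_real_def)
  qed
 qed
next
 assume *: "((%i. pn (%r. Y i r - Y' r)) \<longlongrightarrow> 0) F"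
 show "tendsto_in_prob M Y Y' F"
  unfolding tendsto_in_prob_def
 proof safe
  fix e :: real assume e: "0 < e"
  let ?A = "%i. {r\<in>space M. e < \<bar>Y i r - Y' r\<bar>}"
  define d where "d = min 1 e"
  have d: "0 < d" using e by (simp add: d_def)
  have b: "prob (?A i) <= pn (%r. Y i r - Y' r) / d" for i
  proof -
   have "d * prob (?A i) = expectation (%r. d * indicator (?A i) r)" by simp
   also have "... <= pn (%r. Y i r - Y' r)"
    unfolding pn_def
   proof (rule integral_mono)
    show "integrable M (%r. d * indicator (?A i) r)"
     by (intro integrable_mult_right integrable_real_indicator) (auto simp: emeasure_eq_measure)
    show "d * indicator (?A i) r <= min 1 \<bar>Y i r - Y' r\<bar>" for r
     by (auto split: split_indicator simp: d_def)
   qed simp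
   finally show ?thesis using d by (simp add: field_simps)
  qed
  have l: "((%i. pn (%r. Y i r - Y' r) / d) \<longlongrightarrow> 0) F" using tendsto_divide[OF * tendsto_const[of d]] d by simp
  show "((%i. prob (?A i)) \<longlongrightarrow> 0) F"
   by (rule tendsto_sandwich[OF always_eventually always_eventually tendsto_const l]) (use b in auto)
 qed
qed

section \<open>Characteristic functions and truncated second moments\<close>

abbreviation chf :: "('a => real) => real => complex" where
 "chf X \<equiv> char (distr M borel X)"

lemma real_distribution_distr': "X \<in> borel_measurable M ==> real_distribution (distr M borel X)"
 by (rule real_distribution_distr)

lemma chf_eq: "X \<in> borel_measurable M ==> chf X t = expectation (%r. iexp (t * X r))"
 unfolding char_def by (subst integral_distr) auto

lemma integrable_iexp': "X \<in> borel_measurable M ==> integrable M (%r. iexp (t * X r))"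
 by (intro integrable_const_bound[of _ 1]) auto

lemma Re_chf: "X \<in> borel_measurable M ==> Re (chf X t) = expectation (%r. cos (t * X r))"
 using integral_Re[OF integrable_iexp'[of X t]] by (simp add: chf_eq Re_exp)

lemma one_minus_exp_lower: fixes x :: real shows "min 1 (x^2) <= 3 * (1 - exp (- x\<^sup>2 / 2))"
proof -
 define y where "y = x^2 / 2"
 have y: "0 <= y" by (simp add: y_def)
 have "1 + y <= exp y" by (rule exp_ge_add_one_self)
 then have "exp (- y) <= 1 / (1 + y)" using y by (simp add: exp_minus field_simps)
 then have "y / (1 + y) <= 1 - exp (- y)" using y by (simp add: field_simps)
 moreover have "min 1 (2 * y) <= 3 * (y / (1 + y))"
  using y by (cases "2 * y <= 1") (auto simp: field_simps min_def power2_eq_square mult_left_le)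
 ultimately show ?thesis by (simp add: y_def)
qed

text \<open>\<open>min 1 (x^2) \<le> 3 (1 - exp (- x^2 / 2))\<close>, and the exponential is the characteristic function of the
normal distribution at \<open>x\<close>.\<close>
lemma truncated_second_moment:
 assumes [measurable]: "X \<in> borel_measurable M"
 shows "expectation (%r. min 1 ((X r)^2)) <= 3 * (LINT v|gauss. 1 - Re (chf X v))"
proof -
 interpret N: real_distribution gauss by (rule real_dist_normal_dist)
 interpret P: pair_sigma_finite gauss M ..
 have int: "integrable (gauss \<Otimes>\<^sub>M M) (%(v, r). 1 - cos (v * X r))"
 proof -
  interpret PP: pair_prob_space gauss M ..
  have "\<bar>1 - cos z\<bar> <= 2" for z :: real using cos_ge_minus_one[of z] cos_le_one[of z] by linarith
  then show ?thesis by (intro PP.P.integrable_const_bound[where B = 2] AE_I2) (auto simp: split_beta)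
 qed
 have "(LINT v|gauss. 1 - Re (chf X v)) = (LINT v|gauss. expectation (%r. 1 - cos (v * X r)))"
 proof (rule bintegral_cong[OF refl])
  fix v
  have "integrable M (%r. cos (v * X r))" by (intro integrable_const_bound[of _ 1]) auto
  then show "1 - Re (chf X v) = expectation (%r. 1 - cos (v * X r))"
   unfolding Re_chf[OF assms] by (simp add: prob_space)
 qed
 also have "... = expectation (%r. LINT v|gauss. 1 - cos (v * X r))"
  using P.Fubini_integral[OF int] by simp
 also have "... = expectation (%r. 1 - exp (- (X r)\<^sup>2 / 2))"
 proof (rule bintegral_cong[OF refl])
  fix r
  have i: "integrable gauss (%v. iexp (X r * v))" by (intro N.integrable_const_bound[of _ 1]) auto
  have "(LINT v|gauss. cos (v * X r)) = Re (char gauss (X r))"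
   unfolding char_def using integral_Re[OF i] by (simp add: Re_exp mult.commute)
  also have "... = exp (- (X r)\<^sup>2 / 2)" by (simp add: char_std_normal_distribution)
  moreover have "integrable gauss (%v. cos (v * X r))" by (intro N.integrable_const_bound[of _ 1]) auto
  ultimately show "(LINT v|gauss. 1 - cos (v * X r)) = 1 - exp (- (X r)\<^sup>2 / 2)"
   using N.prob_space by simp
 qed
 finally have eq: "(LINT v|gauss. 1 - Re (chf X v)) = expectation (%r. 1 - exp (- (X r)\<^sup>2 / 2))" .
 have "expectation (%r. min 1 ((X r)^2)) <= expectation (%r. 3 * (1 - exp (- (X r)\<^sup>2 / 2)))"
  by (intro integral_mono integrable_const_bound[of _ 1] integrable_mult_right one_minus_exp_lower) auto
 also have "... = 3 * expectation (%r. 1 - exp (- (X r)\<^sup>2 / 2))" by (rule integral_mult_right_zero)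
 finally show ?thesis unfolding eq .
qed

lemma pn_le_truncated:
 assumes [measurable]: "X \<in> borel_measurable M"
 shows "(pn X)^2 <= expectation (%r. min 1 ((X r)^2))"
proof -
 let ?Y = "%r. min 1 \<bar>X r\<bar>"
 have sq: "(?Y r)^2 = min 1 ((X r)^2)" for r
 proof (cases "\<bar>X r\<bar> <= 1")
  case True
  then have "(X r)^2 <= 1" by (simp add: abs_square_le_1)
  with True show ?thesis by (simp add: min_absorb2)
 next
  case False
  then have "\<not> (X r)^2 <= 1" by (simp add: abs_square_le_1)
  with False show ?thesis by (simp add: min_absorb1)
 qed
 have "0 <= expectation (%r. (?Y r - pn X)^2)" by (intro integral_nonneg_AE) auto
 also have "... = expectation (%r. min 1 ((X r)^2) + (pn X)^2 - 2 * pn X * ?Y r)"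
  by (simp add: power2_diff sq mult_ac)
 also have "... = expectation (%r. min 1 ((X r)^2)) + (pn X)^2 - 2 * pn X * pn X"
 proof -
  have "integrable M (%r. min 1 ((X r)^2))" by (intro integrable_const_bound[of _ 1]) auto
  then show ?thesis by (simp add: prob_space pn_def)
 qed
 finally show ?thesis by (simp add: power2_eq_square)
qed

lemma pn_tendsto_0_chf:
 assumes [measurable]: "!!i::nat. X i \<in> borel_measurable M" and lim: "!!v. (%i. chf (X i) v) \<longlonglongrightarrow> 1"
 shows "(%i. pn (X i)) \<longlonglongrightarrow> 0"
proof -
 interpret N: real_distribution gauss by (rule real_dist_normal_dist)
 have "(%i. LINT v|gauss. 1 - Re (chf (X i) v)) \<longlonglongrightarrow> (LINT v|gauss. 0)"
 proof (rule integral_dominated_convergence[where w = "%_. 2"])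
  show "AE v in gauss. (%i. 1 - Re (chf (X i) v)) \<longlonglongrightarrow> 0"
   using tendsto_diff[OF tendsto_const tendsto_Re[OF lim], of 1] by simp
  fix i
  interpret R: real_distribution "distr M borel (X i)" by (rule real_distribution_distr') simp
  show "(%v. 1 - Re (chf (X i) v)) \<in> borel_measurable gauss" by simp
  show "AE v in gauss. norm (1 - Re (chf (X i) v)) <= 2"
  proof (rule AE_I2)
   fix v show "norm (1 - Re (chf (X i) v)) <= 2"
    using abs_Re_le_cmod[of "chf (X i) v"] R.cmod_char_le_1[of v] by (simp add: abs_le_iff)
  qed
 qed (auto)
 then have 1: "(%i. sqrt (3 * (LINT v|gauss. 1 - Re (chf (X i) v)))) \<longlonglongrightarrow> sqrt (3 * 0)"
  by (intro tendsto_intros) simp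
 have "pn (X i) <= sqrt (3 * (LINT v|gauss. 1 - Re (chf (X i) v)))" for i
  using pn_le_truncated[of "X i"] truncated_second_moment[of "X i"] by (intro real_le_rsqrt) auto
 then show ?thesis
  by (intro tendsto_sandwich[OF always_eventually always_eventually tendsto_const 1[simplified]] allI pn_nonneg)
qed

end

section \<open>The Levy exponent\<close>

lemma exp_tail_integral: "has_bochner_integral lborel (%s. indicator {t..} s * exp (- s)) (exp (- t :: real))"
proof -
 have "((%x. - exp (- x)) \<longlongrightarrow> (0::real)) at_top" by real_asymp
 moreover have "((%s. - exp (- s)) has_real_derivative exp (- x)) (at x)" for x :: real
  by (auto intro!: derivative_eq_intros)
 ultimately show ?thesis using integral_FTC_atLeast_nonneg[of "%s. exp (- s)" t "%s. - exp (- s)" 0] by simp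
qed

text \<open>With \<open>J t = \<integral>\<^bsub>t..\<^esub> exp (- s) c s ds = exp (- t) c t R\<close>, the function
\<open>c\<close> inherits differentiability from the integral, and a linear differential equation results. \<open>R\<close>
depends on \<open>c\<close> through an integral, which yields continuity of the exponent in a parameter.\<close>
lemma multiplicative_is_exponential:
 fixes c :: "real => complex"
 assumes cont: "continuous_on {0..} c" and c0: "c 0 = 1" and add: "!!s t. 0 <= s ==> 0 <= t ==> c (s + t) = c s * c t"
  and bound: "!!s. 0 <= s ==> norm (c s) <= 1"
 defines "R \<equiv> LINT s|lborel. indicator {0..} s *\<^sub>R (exp (- s) *\<^sub>R c (max 0 s))"
 shows "R \<noteq> 0" "!!t. 0 <= t ==> c t = exp (of_real t * (1 - 1 / R))"
proof -
 define g where "g s = exp (- s) *\<^sub>R c (max 0 s)" for s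
 have cmax: "continuous_on A (%s. c (max 0 s))" for A
  by (intro continuous_on_compose2[OF cont] continuous_on_max continuous_on_const continuous_on_id) auto
 have gc: "continuous_on A g" for A
  unfolding g_def[abs_def] by (intro continuous_intros cmax)
 have [measurable]: "g \<in> borel_measurable borel" by (intro borel_measurable_continuous_onI gc)
 have dom: "integrable lborel (%s. indicator {t..} s * exp (- s))" for t :: real
  using exp_tail_integral[of t] by (simp add: has_bochner_integral_iff)
 have ng: "norm (g s) <= exp (- s)" for s using bound[of "max 0 s"] by (simp add: g_def mult_left_le)
 have ig: "integrable lborel (%s. indicator {t..} s *\<^sub>R g s)" for t
  by (rule bintegrable_bound[OF dom[of t]]) (auto intro!: AE_I2 ng split: split_indicator)
 define J where "J t = (LINT s|lborel. indicator {t..} s *\<^sub>R g s)" for t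
 have R: "R = J 0" unfolding R_def J_def g_def ..
 have J1: "exp t *\<^sub>R J t = c t * R" if t: "0 <= t" for t
 proof -
  have "J t = (LINT s|lborel. indicator {t..} (t + 1 * s) *\<^sub>R g (t + 1 * s))"
   unfolding J_def using lborel_integral_real_affine[of 1 "%s. indicator {t..} s *\<^sub>R g s" t] by simp
  also have "... = (LINT s|lborel. (exp (- t) *\<^sub>R c t) * (indicator {0..} s *\<^sub>R g s))"
  proof (rule bintegral_cong[OF refl])
   fix s
   show "indicator {t..} (t + 1 * s) *\<^sub>R g (t + 1 * s) = (exp (- t) *\<^sub>R c t) * (indicator {0..} s *\<^sub>R g s)"
   proof (cases "0 <= s")
    case True
    then have "g (t + s) = (exp (- t) *\<^sub>R c t) * g s"
     using t add[of t s] by (simp add: g_def exp_diff exp_minus add_nonneg_nonneg max_def exp_add field_simps)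
    then show ?thesis using True by simp
   qed simp
  qed
  also have "... = (exp (- t) *\<^sub>R c t) * J 0" unfolding J_def by (rule integral_mult_right_zero)
  finally show ?thesis by (simp add: R exp_minus)
 qed
 define K where "K t = integral {-1..t} g" for t
 have dK: "(K has_vector_derivative g t) (at t within {0..})" if t: "0 <= t" for t
 proof -
  have "(K has_vector_derivative g t) (at t within {-1..t + 1})"
   unfolding K_def[abs_def] using t by (intro integral_has_vector_derivative gc) auto
  then have "(K has_vector_derivative g t) (at t)"
   using at_within_Icc_at[of "-1" t "t + 1"] t by simp
  then show ?thesis by (rule has_vector_derivative_at_within)
 qed
 have JK: "J t = J (-1) - K t" if t: "0 <= t" for t
 proof -
  have K: "K t = (LINT s|lborel. indicator {-1..t} s *\<^sub>R g s)"
   unfolding K_def using set_borel_integral_eq_integral(2)[of "{-1..t}" g] borel_integrable_atLeastAtMost'[OF gc]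
   by (simp add: set_lebesgue_integral_def)
  have iK: "integrable lborel (%s. indicator {-1..t} s *\<^sub>R g s)"
   using borel_integrable_atLeastAtMost'[OF gc] by (simp add: set_integrable_def)
  have "J (-1) = (LINT s|lborel. indicator {t..} s *\<^sub>R g s + indicator {-1..t} s *\<^sub>R g s)"
   unfolding J_def
  proof (rule integral_cong_AE)
   show "AE s in lborel. indicator {-1..} s *\<^sub>R g s = indicator {t..} s *\<^sub>R g s + indicator {-1..t} s *\<^sub>R g s"
    using AE_lborel_singleton[of t] by eventually_elim (use t in \<open>auto split: split_indicator\<close>)
  qed auto
  also have "... = J t + K t" unfolding K J_def using ig iK by (rule bintegral_add)
  finally show ?thesis by simp
 qed
 have dJ: "(J has_vector_derivative - g t) (at t within {0..})" if t: "0 <= t" for t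
 proof -
  have "((%t. J (-1) - K t) has_vector_derivative (0 - g t)) (at t within {0..})"
   by (intro derivative_intros dK t)
  then have "((%t. J (-1) - K t) has_vector_derivative - g t) (at t within {0..})" by simp
  then show ?thesis by (rule has_vector_derivative_transform[rotated 2]) (use JK t in auto)
 qed
 show R0: "R \<noteq> 0"
 proof
  assume "R = 0"
  then have J0: "J t = 0" if "0 <= t" for t using J1[OF that] by simp
  have "((%_. 0) has_vector_derivative - g 0) (at 0 within {0..1})"
  proof (rule has_vector_derivative_transform[OF _ _ has_vector_derivative_within_subset[OF dJ[of 0]]])
   show "0 = J t" if "t \<in> {0..1}" for t using J0[of t] that by simp
  qed auto
  moreover have "((%_. 0::complex) has_vector_derivative 0) (at 0 within {0..1::real})" by simp
  ultimately have "- g 0 = 0" by (intro vector_derivative_unique_within_closed_interval[of 0 1 0]) auto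
  then show False by (simp add: g_def c0)
 qed
 define w where "w = 1 - 1 / R"
 define D where "D t = exp (of_real t * (1 - w)) * J t" for t :: real
 have "(D has_vector_derivative 0) (at t within {0..})" if t: "t \<in> {0..}" for t
 proof -
  have t0: "0 <= t" using that by simp
  have e: "((%t. exp (of_real t * (1 - w))) has_vector_derivative (1 - w) * exp (of_real t * (1 - w))) (at t within {0..})"
   by (rule has_vector_derivative_real_field) (auto intro!: derivative_eq_intros)
  have "(D has_vector_derivative (exp (of_real t * (1 - w)) * (- g t) + ((1 - w) * exp (of_real t * (1 - w))) * J t)) (at t within {0..})"
   unfolding D_def[abs_def] by (rule has_vector_derivative_mult[OF e dJ[OF t0]])
  moreover have "exp (of_real t * (1 - w)) * (- g t) + ((1 - w) * exp (of_real t * (1 - w))) * J t = exp (of_real t * (1 - w)) * (- g t + (1 - w) * J t)"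
   by (simp add: algebra_simps)
  moreover have "(1 - w) * J t = g t"
  proof -
   have "J t = (exp (- t) * exp t) *\<^sub>R J t" by (simp add: exp_minus)
   also have "... = exp (- t) *\<^sub>R (c t * R)" using J1[OF t0] by (simp only: scaleR_scaleR[symmetric])
   finally have "J t = exp (- t) *\<^sub>R (c t * R)" .
   then show ?thesis using R0 t0 by (simp add: w_def g_def)
  qed
  ultimately have "exp (of_real t * (1 - w)) * (- g t) + ((1 - w) * exp (of_real t * (1 - w))) * J t = 0" by simp
  with \<open>(D has_vector_derivative (exp (of_real t * (1 - w)) * (- g t) + ((1 - w) * exp (of_real t * (1 - w))) * J t)) (at t within {0..})\<close>
  show ?thesis by (simp only:)
 qed
 then obtain k where k: "!!t. t \<in> {0..} ==> D t = k"
  using has_vector_derivative_zero_constant[of "{0..}" D thesis] convex_real_interval(1) by blast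
 fix t :: real assume t: "0 <= t"
 have "D t = R" using k[of t] k[of 0] t by (simp add: D_def R)
 then have "exp (of_real t * (1 - w)) * J t = R" by (simp add: D_def)
 moreover have "J t = exp (- of_real t) * (c t * R)"
 proof -
  have "J t = (exp (- t) * exp t) *\<^sub>R J t" by (simp add: exp_minus)
  also have "... = exp (- t) *\<^sub>R (c t * R)" using J1[OF t] by (simp only: scaleR_scaleR[symmetric])
  finally show ?thesis by (simp add: scaleR_conv_of_real exp_of_real[symmetric])
 qed
 ultimately have "exp (of_real t * (1 - w)) * exp (- of_real t) * c t = 1" using R0 by (simp add: mult.assoc)
 then have "exp (- (of_real t * w)) * c t = 1" unfolding exp_add[symmetric] by (simp add: algebra_simps)
 then have "exp (of_real t * w) * (exp (- (of_real t * w)) * c t) = exp (of_real t * w)" by (simp only: mult_1_right)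
 then have "c t = exp (of_real t * w)" unfolding mult.assoc[symmetric] by (simp only: exp_minus_inverse mult_1_left)
 then show "c t = exp (of_real t * (1 - 1 / R))" by (simp add: w_def)
qed

locale levy_space = prob_space M for M :: "'a measure" +
 fixes L :: "real => 'a => real"
 assumes levy: "two_sided_levy_process M L"
begin

lemma L_meas [measurable]: "L t \<in> borel_measurable M" using levy by (simp add: two_sided_levy_process_def)

definition cL :: "real => real => complex" where "cL t = chf (%r. L t r - L 0 r)"

lemma chf_increment: "s <= t ==> chf (%r. L t r - L s r) = cL (t - s)"
proof -
 assume st: "s <= t"
 have "\<forall>s t h. s <= t --> distr M borel (%r. L (t + h) r - L (s + h) r) = distr M borel (%r. L t r - L s r)"
  using levy by (simp add: two_sided_levy_process_def)
 from this[rule_format, of 0 "t - s" s] st show ?thesis by (simp add: cL_def)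
qed

lemma cL_0: "cL 0 v = 1" unfolding cL_def by (subst chf_eq) (auto simp: prob_space)

lemma cL_norm: "norm (cL t v) <= 1"
 unfolding cL_def by (rule real_distribution.cmod_char_le_1[OF real_distribution_distr']) simp

lemma cL_add:
 assumes st: "0 <= s" "0 <= t" shows "cL (s + t) v = cL s v * cL t v"
proof (cases "s = 0 \<or> t = 0")
 case True then show ?thesis by (auto simp: cL_0)
next
 case False
 define \<tau> :: "nat => real" where "\<tau> i = (if i = 0 then 0 else if i = 1 then s else s + t)" for i
 have "strict_mono_on {..2} \<tau>" using False st by (auto simp: strict_mono_on_def \<tau>_def)
 then have "indep_vars (%_. borel) (%i r. L (\<tau> (Suc i)) r - L (\<tau> i) r) {..<2}"
  using levy unfolding two_sided_levy_process_def by blast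
 from char_distr_sum[OF this, of v]
 have "chf (%r. L (s + t) r - L 0 r) v = chf (%r. L s r - L 0 r) v * chf (%r. L (s + t) r - L s r) v"
  by (simp add: numeral_2_eq_2 \<tau>_def algebra_simps)
 moreover have "chf (%r. L (s + t) r - L s r) = cL t" using chf_increment[of s "s + t"] st by simp
 ultimately show ?thesis by (simp add: cL_def)
qed

lemma chf_minus_1:
 assumes [measurable]: "Y \<in> borel_measurable M"
 shows "norm (chf Y v - 1) <= (2 + \<bar>v\<bar>) * pn Y"
proof -
 have "norm (iexp x - 1) <= \<bar>x\<bar>" for x using iexp_approx1[of x 0] by simp
 moreover have n2: "norm (iexp x - 1) <= 2" for x using norm_triangle_ineq4[of "iexp x" 1] by simp
 ultimately have b: "norm (iexp (v * y) - 1) <= (2 + \<bar>v\<bar>) * min 1 \<bar>y\<bar>" for y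
 proof (cases "\<bar>y\<bar> <= 1")
  case True
  have "norm (iexp (v * y) - 1) <= \<bar>v\<bar> * \<bar>y\<bar>" using \<open>!!x. norm (iexp x - 1) <= \<bar>x\<bar>\<close>[of "v * y"] by (simp add: abs_mult)
  also have "... <= (2 + \<bar>v\<bar>) * \<bar>y\<bar>" by (intro mult_right_mono) auto
  finally show ?thesis using True by simp
 next
  case False
  have "2 <= (2 + \<bar>v\<bar>) * 1" by simp
  then show ?thesis using n2[of "v * y"] False by simp
 qed
 have "chf Y v - 1 = expectation (%r. iexp (v * Y r) - 1)"
  unfolding chf_eq[OF assms] using bintegral_diff[OF integrable_iexp'[OF assms, of v] integrable_const[of 1]]
  by (simp add: prob_space del: of_real_mult)
 also have "norm ... <= expectation (%r. norm (iexp (v * Y r) - 1))" by (rule integral_norm_bound)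
 also have "... <= expectation (%r. (2 + \<bar>v\<bar>) * min 1 \<bar>Y r\<bar>)"
  by (intro integral_mono b integrable_mult_right pn_integrable integrable_norm bintegrable_diff integrable_iexp') auto
 finally show ?thesis by (simp add: pn_def)
qed

lemma cL_right_0: "((%t. cL t v) \<longlongrightarrow> 1) (at_right 0)"
proof -
 have "tendsto_in_prob M L (L 0) (at 0)" using levy by (simp add: two_sided_levy_process_def)
 then have "((%t. pn (%r. L t r - L 0 r)) \<longlongrightarrow> 0) (at 0)" by (subst (asm) tendsto_in_prob_iff_pn) auto
 then have "((%t. (2 + \<bar>v\<bar>) * pn (%r. L t r - L 0 r)) \<longlongrightarrow> 0) (at 0)" by (rule tendsto_mult_right_zero)
 then have "((%t. (2 + \<bar>v\<bar>) * pn (%r. L t r - L 0 r)) \<longlongrightarrow> 0) (at_right 0)" by (rule tendsto_within_subset) auto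
 then have "((%t. cL t v - 1) \<longlongrightarrow> 0) (at_right 0)"
  by (rule Lim_null_comparison[OF always_eventually, rotated]) (simp add: cL_def chf_minus_1)
 then show ?thesis by (simp add: LIM_zero_iff)
qed

lemma cL_continuous: "continuous_on {0..} (%t. cL t v)"
 unfolding continuous_on_iff
proof (intro ballI allI impI)
 fix t e :: real assume t: "t \<in> {0..}" and e: "0 < e"
 have "eventually (%h. dist (cL h v) 1 < e) (at_right 0)" using cL_right_0 e by (rule tendstoD)
 then obtain b where b: "0 < b" "!!h. 0 < h ==> h < b ==> dist (cL h v) 1 < e" by (auto simp: eventually_at_right_field)
 have key: "dist (cL (u + h) v) (cL u v) < e" if "0 <= u" "0 <= h" "h < b" for u h
 proof (cases "h = 0")
  case False
  have "cL (u + h) v - cL u v = cL u v * (cL h v - 1)" using that by (simp add: cL_add algebra_simps)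
  then have "dist (cL (u + h) v) (cL u v) <= 1 * dist (cL h v) 1"
   unfolding dist_norm norm_mult by (metis cL_norm mult_right_mono norm_ge_zero norm_mult)
  then show ?thesis using b(2)[of h] that False by simp
 qed (use e in simp)
 show "\<exists>d>0. \<forall>t'\<in>{0..}. dist t' t < d --> dist (cL t' v) (cL t v) < e"
 proof (intro exI[of _ b] conjI ballI impI b)
  fix t' assume t': "t' \<in> {0..}" "dist t' t < b"
  show "dist (cL t' v) (cL t v) < e"
  proof (cases "t <= t'")
   case True then show ?thesis using key[of t "t' - t"] t t' by (simp add: dist_real_def)
  next
   case False then show ?thesis using key[of t' "t - t'"] t t' by (simp add: dist_real_def dist_commute)
  qed
 qed
qed

lemma levy_exponent_exists:
 "\<exists>w. (\<forall>t\<ge>0. \<forall>v. cL t v = exp (of_real t * w v)) \<and> continuous_on UNIV w \<and> w 0 = 0 \<and> (\<forall>v. Re (w v) <= 0)"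
proof -
 define R where "R v = (LINT s|lborel. indicator {0..} s *\<^sub>R (exp (- s) *\<^sub>R cL (max 0 s) v))" for v
 define w where "w v = 1 - 1 / R v" for v
 have R: "R v \<noteq> 0" "!!t. 0 <= t ==> cL t v = exp (of_real t * w v)" for v
  unfolding R_def w_def
  by (rule multiplicative_is_exponential[of "%t. cL t v", OF cL_continuous cL_0 cL_add cL_norm], assumption+)+
 have meas: "(%s. cL (max 0 s) v) \<in> borel_measurable borel" for v
  by (intro borel_measurable_continuous_onI continuous_on_compose2[OF cL_continuous] continuous_on_max continuous_on_const continuous_on_id) auto
 have "isCont R v" for v
  unfolding continuous_at_sequentially
 proof safe
  fix x :: "nat => real" assume x: "x \<longlonglongrightarrow> v"
  have cont: "(%i. cL t (x i)) \<longlonglongrightarrow> cL t v" for t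
   unfolding cL_def by (rule isCont_tendsto_compose[OF real_distribution.isCont_char[OF real_distribution_distr'] x]) simp
  show "(R \<circ> x) \<longlonglongrightarrow> R v"
   unfolding R_def o_def
  proof (rule integral_dominated_convergence[where w = "%s. indicator {0..} s * exp (- s)"])
   show "integrable lborel (%s. indicator {0..} s * exp (- s::real))"
    using exp_tail_integral[of 0] by (simp add: has_bochner_integral_iff)
   show "AE s in lborel. (%i. indicator {0..} s *\<^sub>R (exp (- s) *\<^sub>R cL (max 0 s) (x i))) \<longlonglongrightarrow> indicator {0..} s *\<^sub>R (exp (- s) *\<^sub>R cL (max 0 s) v)"
    by (intro AE_I2 tendsto_intros cont)
   show "AE s in lborel. norm (indicator {0..} s *\<^sub>R (exp (- s) *\<^sub>R cL (max 0 s) (x i))) <= indicator {0..} s * exp (- s)" for i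
    using cL_norm by (intro AE_I2) (auto split: split_indicator simp: mult_left_le)
  qed (use meas in measurable)
 qed
 then have "isCont w v" for v unfolding w_def[abs_def] using R(1) by (intro continuous_intros) auto
 then have cw: "continuous_on UNIV w" by (simp add: continuous_at_imp_continuous_on)
 have "w 0 = 0"
 proof -
  have cL1: "cL t 0 = 1" for t unfolding cL_def by (subst chf_eq) (auto simp: prob_space)
  have "has_bochner_integral lborel (%s. indicator {0..} s * exp (- s)) (1::real)"
   using exp_tail_integral[of 0] by simp
  then have "has_bochner_integral lborel (%s. of_real (indicator {0..} s * exp (- s))) (of_real 1 :: complex)"
   by (rule has_bochner_integral_of_real)
  then have "R 0 = 1" by (simp add: R_def cL1 has_bochner_integral_iff scaleR_conv_of_real)
  then show ?thesis by (simp add: w_def)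
 qed
 moreover have "Re (w v) <= 0" for v
 proof -
  have "norm (exp (w v)) <= 1" using R(2)[of 1 v] cL_norm[of 1 v] by simp
  then show ?thesis by simp
 qed
 ultimately show ?thesis using R(2) cw by blast
qed

definition w :: "real => complex" where
 "w = (SOME w. (\<forall>t\<ge>0. \<forall>v. cL t v = exp (of_real t * w v)) \<and> continuous_on UNIV w \<and> w 0 = 0 \<and> (\<forall>v. Re (w v) <= 0))"

lemma w: "!!t v. 0 <= t ==> cL t v = exp (of_real t * w v)" "continuous_on UNIV w" "w 0 = 0" "!!v. Re (w v) <= 0"
 using someI_ex[OF levy_exponent_exists] unfolding w_def[symmetric] by auto

end

section \<open>The stable-like bound on the exponent\<close>

lemma nn_integral_even_on_halves:
 fixes F :: "real => real"
 assumes [measurable]: "F \<in> borel_measurable borel" and nonneg: "!!x. 0 <= F x" and even: "!!x. F (- x) = F x"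
  and half: "(\<integral>\<^sup>+ x. ennreal (indicator {0..} x * F x) \<partial>lborel) <= ennreal c" and c: "0 <= c"
 shows "(\<integral>\<^sup>+ x. ennreal (F x) \<partial>lborel) <= ennreal (2 * c)"
proof -
 obtain d where d: "0 <= d" "(\<integral>\<^sup>+ x. ennreal (indicator {0..} x * F x) \<partial>lborel) = ennreal d"
  using half by (cases "(\<integral>\<^sup>+ x. ennreal (indicator {0..} x * F x) \<partial>lborel)") (auto simp: top_unique)
 have dc: "d <= c" using half d c by (simp add: ennreal_le_iff)
 have "has_bochner_integral lborel (%x. indicator {0..} x *\<^sub>R F x) d"
  by (rule has_bochner_integral_nn_integral) (use d nonneg in auto)
 from has_bochner_integral_even_function[OF this even] have "has_bochner_integral lborel F (2 * d)" by simp
 then have "(\<integral>\<^sup>+ x. ennreal (F x) \<partial>lborel) = ennreal (2 * d)"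
  using nonneg by (auto simp: has_bochner_integral_iff nn_integral_eq_integral)
 then show ?thesis using dc by (simp add: ennreal_leI)
qed

lemma one_minus_cos_le: fixes x :: real shows "1 - cos x <= min 2 (x^2 / 2)"
proof -
 have "1 - cos x = 2 * (sin (x / 2))^2" using cos_double_sin[of "x / 2"] by simp
 also have "(sin (x / 2))^2 <= (x / 2)^2" using abs_sin_x_le_abs_x[of "x / 2"] by (simp only: abs_le_square_iff)
 finally have "1 - cos x <= x^2 / 2" by (simp add: power_divide)
 moreover have "1 - cos x <= 2" using cos_ge_minus_one[of x] by simp
 ultimately show ?thesis by simp
qed

text \<open>\<open>1 - cos y\<close> is at most \<open>y^2 / 2\<close> near 0 and at most 2 elsewhere; the split is at
\<open>\<bar>v x\<bar> = 1\<close>.\<close>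
lemma stable_cos_integral:
 assumes \<beta>: "0 < \<beta>" "\<beta> < 2" and v: "v \<noteq> 0"
 shows "(\<integral>\<^sup>+ x. ennreal (\<bar>x\<bar> powr (- 1 - \<beta>) * (1 - cos (v * x))) \<partial>lborel)
  <= ennreal ((1 / (2 - \<beta>) + 4 / \<beta>) * \<bar>v\<bar> powr \<beta>)"
proof -
 define a where "a = 1 / \<bar>v\<bar>"
 have a: "0 < a" using v by (simp add: a_def)
 have i1: "(\<integral>\<^sup>+ x. ennreal (x powr (1 - \<beta>)) * indicator {0..a} x \<partial>lborel) = ennreal (a powr (2 - \<beta>) / (2 - \<beta>))"
  using nn_integral_has_integral_lebesgue'[OF _ has_integral_powr_from_0[of "1 - \<beta>" a]] \<beta> a by (simp add: algebra_simps)
 have i2: "(\<integral>\<^sup>+ x. ennreal (x powr (- 1 - \<beta>)) * indicator {a..} x \<partial>lborel) = ennreal (a powr (- \<beta>) / \<beta>)"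
  using nn_integral_has_integral_lebesgue'[OF _ has_integral_powr_to_inf[of "- 1 - \<beta>" a]] \<beta> a by simp
 have "(\<integral>\<^sup>+ x. ennreal (indicator {0..} x * (\<bar>x\<bar> powr (- 1 - \<beta>) * (1 - cos (v * x)))) \<partial>lborel)
   <= (\<integral>\<^sup>+ x. ennreal (v^2 / 2) * (ennreal (x powr (1 - \<beta>)) * indicator {0..a} x) + ennreal 2 * (ennreal (x powr (- 1 - \<beta>)) * indicator {a..} x) \<partial>lborel)"
 proof (rule nn_integral_mono)
  fix x :: real
  show "ennreal (indicator {0..} x * (\<bar>x\<bar> powr (- 1 - \<beta>) * (1 - cos (v * x))))
   <= ennreal (v^2 / 2) * (ennreal (x powr (1 - \<beta>)) * indicator {0..a} x) + ennreal 2 * (ennreal (x powr (- 1 - \<beta>)) * indicator {a..} x)"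
  proof (cases "x <= 0")
   case True then show ?thesis by (cases "x = 0") auto
  next
   case False
   then have x: "0 < x" by simp
   have e: "x powr (1 - \<beta>) = x powr (- 1 - \<beta>) * x^2"
   proof -
    have "x powr (1 - \<beta>) = x powr ((- 1 - \<beta>) + 2)" by simp
    then show ?thesis using x by (simp only: powr_add powr_numeral)
   qed
   show ?thesis
   proof (cases "x <= a")
    case True
    have "x powr (- 1 - \<beta>) * (1 - cos (v * x)) <= x powr (- 1 - \<beta>) * ((v * x)^2 / 2)"
     using one_minus_cos_le[of "v * x"] by (intro mult_left_mono) auto
    also have "... = v^2 / 2 * x powr (1 - \<beta>)" by (simp add: e power_mult_distrib)
    finally have "ennreal (x powr (- 1 - \<beta>) * (1 - cos (v * x))) <= ennreal (v^2 / 2) * ennreal (x powr (1 - \<beta>))"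
     by (subst ennreal_mult[symmetric]) (auto intro: ennreal_leI)
    then show ?thesis using True x by (auto intro: add_increasing2)
   next
    case False
    have "x powr (- 1 - \<beta>) * (1 - cos (v * x)) <= x powr (- 1 - \<beta>) * 2"
     using one_minus_cos_le[of "v * x"] by (intro mult_left_mono) auto
    then have "ennreal (x powr (- 1 - \<beta>) * (1 - cos (v * x))) <= ennreal 2 * ennreal (x powr (- 1 - \<beta>))"
     by (subst ennreal_mult[symmetric]) (auto intro!: ennreal_leI simp: mult.commute)
    then show ?thesis using False x by simp
   qed
  qed
 qed
 also have "... = ennreal (v^2 / 2) * ennreal (a powr (2 - \<beta>) / (2 - \<beta>)) + ennreal 2 * ennreal (a powr (- \<beta>) / \<beta>)"
  unfolding i1[symmetric] i2[symmetric] by (simp add: nn_integral_add nn_integral_cmult del: ennreal_numeral)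
 also have "... = ennreal (v^2 / 2 * (a powr (2 - \<beta>) / (2 - \<beta>)) + 2 * (a powr (- \<beta>) / \<beta>))"
  using \<beta> by (simp add: ennreal_mult[symmetric] ennreal_plus[symmetric] del: ennreal_plus ennreal_numeral)
 also have "v^2 / 2 * (a powr (2 - \<beta>) / (2 - \<beta>)) + 2 * (a powr (- \<beta>) / \<beta>) = (1 / (2 - \<beta>) + 4 / \<beta>) / 2 * \<bar>v\<bar> powr \<beta>"
 proof -
  have a': "a = \<bar>v\<bar> powr - 1" using v by (simp add: a_def powr_minus divide_inverse)
  have p: "a powr (- \<beta>) = \<bar>v\<bar> powr \<beta>" "a powr (2 - \<beta>) = \<bar>v\<bar> powr (\<beta> - 2)" unfolding a' powr_powr by simp_all
  have "v^2 = \<bar>v\<bar> powr 2" using v by (simp add: powr_numeral)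
  then have "v^2 * \<bar>v\<bar> powr (\<beta> - 2) = \<bar>v\<bar> powr (2 + (\<beta> - 2))" by (simp only: powr_add)
  then have "v^2 * \<bar>v\<bar> powr (\<beta> - 2) = \<bar>v\<bar> powr \<beta>" by simp
  then show ?thesis unfolding p using \<beta> by (simp add: field_simps)
 qed
 finally have half: "(\<integral>\<^sup>+ x. ennreal (indicator {0..} x * (\<bar>x\<bar> powr (- 1 - \<beta>) * (1 - cos (v * x)))) \<partial>lborel)
  <= ennreal ((1 / (2 - \<beta>) + 4 / \<beta>) / 2 * \<bar>v\<bar> powr \<beta>)" .
 have "(\<integral>\<^sup>+ x. ennreal (\<bar>x\<bar> powr (- 1 - \<beta>) * (1 - cos (v * x))) \<partial>lborel) <= ennreal (2 * ((1 / (2 - \<beta>) + 4 / \<beta>) / 2 * \<bar>v\<bar> powr \<beta>))"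
  by (rule nn_integral_even_on_halves[OF _ _ _ half]) (use \<beta> in auto)
 then show ?thesis by simp
qed

lemma cos_integral_le:
 assumes \<kappa>: "\<kappa> \<in> borel_measurable borel" "!!x. 0 <= \<kappa> x" and \<kappa>_le: "!!x. x \<noteq> 0 ==> \<kappa> x <= C\<^sub>0 * \<bar>x\<bar> powr (- 1 - \<beta>)"
  and C: "0 < C\<^sub>0" and \<beta>: "0 < \<beta>" "\<beta> < 2" and v: "v \<noteq> 0"
 shows "(LINT x|density lborel (%x. ennreal (\<kappa> x)). 1 - cos (v * x)) <= C\<^sub>0 * (1 / (2 - \<beta>) + 4 / \<beta>) * \<bar>v\<bar> powr \<beta>"
proof -
 note [measurable] = \<kappa>(1)
 have "ennreal (LINT x|density lborel (%x. ennreal (\<kappa> x)). 1 - cos (v * x)) <= (\<integral>\<^sup>+ x. ennreal (1 - cos (v * x)) \<partial>density lborel (%x. ennreal (\<kappa> x)))"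
 proof (cases "integrable (density lborel (%x. ennreal (\<kappa> x))) (%x. 1 - cos (v * x))")
  case True then show ?thesis by (subst nn_integral_eq_integral) auto
 next
  case False then show ?thesis by (simp add: not_integrable_integral_eq)
 qed
 also have "... = (\<integral>\<^sup>+ x. ennreal (\<kappa> x) * ennreal (1 - cos (v * x)) \<partial>lborel)" by (subst nn_integral_density) auto
 also have "... <= (\<integral>\<^sup>+ x. ennreal C\<^sub>0 * ennreal (\<bar>x\<bar> powr (- 1 - \<beta>) * (1 - cos (v * x))) \<partial>lborel)"
 proof (rule nn_integral_mono)
  fix x :: real
  have "\<kappa> x * (1 - cos (v * x)) <= C\<^sub>0 * (\<bar>x\<bar> powr (- 1 - \<beta>) * (1 - cos (v * x)))"
   using \<kappa>_le[of x] mult_right_mono[of "\<kappa> x" "C\<^sub>0 * \<bar>x\<bar> powr (- 1 - \<beta>)" "1 - cos (v * x)"] by (cases "x = 0") (auto simp: mult.assoc)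
  then have "ennreal (\<kappa> x * (1 - cos (v * x))) <= ennreal (C\<^sub>0 * (\<bar>x\<bar> powr (- 1 - \<beta>) * (1 - cos (v * x))))" by (rule ennreal_leI)
  then show "ennreal (\<kappa> x) * ennreal (1 - cos (v * x)) <= ennreal C\<^sub>0 * ennreal (\<bar>x\<bar> powr (- 1 - \<beta>) * (1 - cos (v * x)))"
   using \<kappa>(2)[of x] C by (simp add: ennreal_mult)
 qed
 also have "... <= ennreal C\<^sub>0 * ennreal ((1 / (2 - \<beta>) + 4 / \<beta>) * \<bar>v\<bar> powr \<beta>)"
  by (subst nn_integral_cmult) (auto intro!: mult_left_mono stable_cos_integral \<beta> v)
 also have "... = ennreal (C\<^sub>0 * (1 / (2 - \<beta>) + 4 / \<beta>) * \<bar>v\<bar> powr \<beta>)"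
  using C \<beta> by (simp add: ennreal_mult[symmetric] mult.assoc)
 finally show ?thesis using C \<beta> by (subst (asm) ennreal_le_iff) auto
qed

context levy_space
begin

lemma levy_exponent_bound:
 assumes \<nu>: "no_gaussian_with_levy_measure M L \<nu>"
  and \<kappa>: "\<kappa> \<in> borel_measurable borel" "!!x. 0 <= \<kappa> x" "\<nu> = density lborel (%x. ennreal (\<kappa> x))"
  and \<kappa>_le: "!!x. x \<noteq> 0 ==> \<kappa> x <= C\<^sub>0 * \<bar>x\<bar> powr (- 1 - \<beta>)"
  and C: "0 < C\<^sub>0" and \<beta>: "0 < \<beta>" "\<beta> < 2"
 shows "- Re (w v) <= C\<^sub>0 * (1 / (2 - \<beta>) + 4 / \<beta>) * \<bar>v\<bar> powr \<beta>"
proof (cases "v = 0")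
 case True then show ?thesis by (simp add: w(3))
next
 case v: False
 from \<nu> obtain h b where char: "char (distr M borel (L 1)) v =
   exp ((\<integral>x. (iexp (v * x) - 1 - \<i> * complex_of_real (v * x * h x)) \<partial>\<nu>) + \<i> * complex_of_real (b * v))"
  unfolding no_gaussian_with_levy_measure_def by blast
 have L0: "AE r in M. L 0 r = 0" using levy by (simp add: two_sided_levy_process_def)
 have "chf (L 1) v = chf (%r. L 1 r - L 0 r) v"
  unfolding chf_eq[OF L_meas] by (subst chf_eq, simp, rule integral_cong_AE) (use L0 in \<open>auto elim: eventually_mono\<close>)
 also have "... = exp (w v)" using w(1)[of 1 v] by (simp add: cL_def)
 finally have chf: "chf (L 1) v = exp (w v)" .
 define I where "I = (\<integral>x. (iexp (v * x) - 1 - \<i> * complex_of_real (v * x * h x)) \<partial>\<nu>)"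
 have "exp (Re (w v)) = norm (exp (w v))" by simp
 also have "... = norm (exp (I + \<i> * complex_of_real (b * v)))" using chf char unfolding I_def by metis
 also have "... = exp (Re I)" by simp
 finally have Re: "Re (w v) = Re I" by simp
 show ?thesis
 proof (cases "integrable \<nu> (%x. iexp (v * x) - 1 - \<i> * complex_of_real (v * x * h x))")
  case False
  then have "I = 0" unfolding I_def by (rule not_integrable_integral_eq)
  then show ?thesis using Re C \<beta> by simp
 next
  case True
  have "Re I = (LINT x|\<nu>. Re (iexp (v * x) - 1 - \<i> * complex_of_real (v * x * h x)))"
   unfolding I_def by (rule integral_Re[OF True, symmetric])
  also have "... = (LINT x|\<nu>. - (1 - cos (v * x)))" by (intro bintegral_cong refl) (simp add: Re_exp)
  also have "... = - (LINT x|\<nu>. 1 - cos (v * x))" by (rule Bochner_Integration.integral_minus)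
  finally have "- Re I = (LINT x|\<nu>. 1 - cos (v * x))" by simp
  then show ?thesis unfolding Re \<kappa>(3) using cos_integral_le[OF \<kappa>(1,2) \<kappa>_le C \<beta> v] by simp
 qed
qed

end

lemma std_normal_abs_powr_moment:
 assumes \<beta>: "0 <= \<beta>" "\<beta> <= 2"
 shows "integrable gauss (%v. \<bar>v\<bar> powr \<beta>)" "(LINT v|gauss. \<bar>v\<bar> powr \<beta>) <= 2"
proof -
 interpret N: real_distribution gauss by (rule real_dist_normal_dist)
 have i: "integrable gauss (%v. v^2)" "(LINT v|gauss. v^2) = 1"
  using integrable_std_normal_distribution_moment[of 2] std_normal_distribution_even_moments(1)[of 1] by simp_all
 have b: "\<bar>v\<bar> powr \<beta> <= 1 + v^2" for v :: real
 proof (cases "\<bar>v\<bar> <= 1")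
  case True
  have "\<bar>v\<bar> powr \<beta> <= 1" using True \<beta> by (simp add: powr_le_one_le powr_le1)
  then show ?thesis by (simp add: add_increasing2)
 next
  case False
  then have "\<bar>v\<bar> powr \<beta> <= \<bar>v\<bar> powr 2" using \<beta> by (intro powr_mono) auto
  also have "... = v^2" using False by (simp add: powr_numeral)
  finally show ?thesis by simp
 qed
 have i1: "integrable gauss (%v. 1 + v^2)" using i by simp
 show I: "integrable gauss (%v. \<bar>v\<bar> powr \<beta>)"
  by (rule bintegrable_bound[OF i1]) (use b in auto)
 have "(LINT v|gauss. \<bar>v\<bar> powr \<beta>) <= (LINT v|gauss. 1 + v^2)"
  using I i1 b by (intro integral_mono) auto
 also have "... = 2" using i N.prob_space by simp
 finally show "(LINT v|gauss. \<bar>v\<bar> powr \<beta>) <= 2" .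
qed

section \<open>The Levy random measure\<close>

lemma bounded_borel_Ioc [simp]: "{s<..t} \<in> bounded_borel" by (simp add: bounded_borel_def)
lemma bounded_borel_empty [simp]: "{} \<in> bounded_borel" by (simp add: bounded_borel_def)
lemma bounded_borel_sets: "A \<in> bounded_borel ==> A \<in> sets borel" by (simp add: bounded_borel_def)
lemma bounded_borel_Int: "A \<in> bounded_borel ==> B \<in> sets borel ==> A \<inter> B \<in> bounded_borel"
 by (auto simp: bounded_borel_def intro: bounded_subset)
lemma bounded_borel_Int': "A \<in> bounded_borel ==> B \<in> sets borel ==> B \<inter> A \<in> bounded_borel"
 by (auto simp: bounded_borel_def intro: bounded_subset)
lemma bounded_borel_Diff: "A \<in> bounded_borel ==> B \<in> sets borel ==> A - B \<in> bounded_borel"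
 by (auto simp: bounded_borel_def intro: bounded_subset)
lemma bounded_borel_Un: "A \<in> bounded_borel ==> B \<in> bounded_borel ==> A \<union> B \<in> bounded_borel"
 by (auto simp: bounded_borel_def)
lemma bounded_borel_UN: "finite I ==> (!!i. i \<in> I ==> A i \<in> bounded_borel) ==> (\<Union>i\<in>I. A i) \<in> bounded_borel"
 by (auto simp: bounded_borel_def)
lemma bounded_borel_finite: "A \<in> bounded_borel ==> emeasure lborel A < \<infinity>"
 using emeasure_bounded_finite[of A] by (simp add: bounded_borel_def)

text \<open>Intervals generate the Borel sets of a bounded interval and are closed under intersection.\<close>
lemma bounded_borel_induct [consumes 1, case_names empty interval diff union]:
 assumes A: "A \<in> bounded_borel"
  and e: "P {}"
  and i: "!!s t. s <= t ==> P {s<..t}"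
  and d: "!!A B. A \<in> bounded_borel ==> B \<in> bounded_borel ==> A \<subseteq> B ==> P A ==> P B ==> P (B - A)"
  and u: "!!A :: nat => real set. disjoint_family A ==> (!!n. A n \<in> bounded_borel) ==> (\<Union>n. A n) \<in> bounded_borel ==> (!!n. P (A n)) ==> P (\<Union>n. A n)"
 shows "P A"
proof -
 from A obtain B where B: "!!x. x \<in> A ==> \<bar>x\<bar> <= B" by (auto simp: bounded_borel_def bounded_iff)
 obtain m :: nat where m: "B < real m" using reals_Archimedean2 by blast
 define I where "I = {- real m<..real m}"
 have AI: "A \<inter> I = A" using B m unfolding I_def by (fastforce dest: B simp: abs_le_iff)
 have I: "I \<in> bounded_borel" "P I" unfolding I_def by (auto intro: i)
 have A': "A \<in> sigma_sets UNIV (range (%(i, j). {i<..j::real}))"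
  using A arg_cong[OF borel_sigma_sets_Ioc, of sets] by (auto simp: bounded_borel_def)
 have stable: "Int_stable (range (%(i, j). {i<..j::real}))"
  unfolding Int_stable_def by (auto intro!: image_eqI[where x = "(max _ _, min _ _)"] simp: Int_greaterThanAtMost)
 have "range (%(i, j). {i<..j::real}) \<subseteq> Pow UNIV" by simp
 from stable this A' have "P (A \<inter> I) \<and> A \<in> sets borel"
 proof (induction rule: sigma_sets_induct_disjoint)
  case (basic A)
  then obtain s t where st: "A = {s<..t}" by auto
  show ?case unfolding st I_def Int_greaterThanAtMost using i[of "max s (- real m)" "min t (real m)"] e
   by (cases "max s (- real m) <= min t (real m)") auto
 next
  case empty show ?case using e by simp
 next
  case (compl A)
  have "(UNIV - A) \<inter> I = I - A \<inter> I" by auto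
  then show ?case using d[of "A \<inter> I" I] I compl sets.Diff[of UNIV borel A] by (simp add: bounded_borel_Int')
 next
  case (union A)
  have "P (\<Union>n. A n \<inter> I)"
   using union I by (intro u) (auto simp: disjoint_family_on_def bounded_borel_Int' simp flip: Int_UN_distrib2 intro!: bounded_borel_Int')
  then show ?case using union by auto
 qed
 then show ?thesis by (simp add: AI)
qed

context prob_space
begin

lemma indep_sets_reindex:
 assumes inj: "inj_on e J" and F: "indep_sets (%j. F (e j)) J"
 shows "indep_sets F (e ` J)"
proof (rule indep_setsI)
 show "F i \<subseteq> events" if "i \<in> e ` J" for i using F that by (auto simp: indep_sets_def)
next
 fix A K assume K: "K \<noteq> {}" "K \<subseteq> e ` J" "finite K" and A: "\<forall>j\<in>K. A j \<in> F j"
 define K' where "K' = J \<inter> e -` K"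
 have e: "e ` K' = K" using K by (auto simp: K'_def)
 have inj': "inj_on e K'" using inj by (auto simp: K'_def inj_on_def)
 have "prob (\<Inter>j\<in>K'. A (e j)) = (\<Prod>j\<in>K'. prob (A (e j)))"
 proof (rule indep_setsD[OF F])
  show "K' \<subseteq> J" "K' \<noteq> {}" using K e by (auto simp: K'_def)
  show "finite K'" using K(3) e inj' finite_imageD by blast
  show "\<forall>j\<in>K'. A (e j) \<in> F (e j)" using A e by auto
 qed
 then show "prob (\<Inter>j\<in>K. A j) = (\<Prod>j\<in>K. prob (A j))"
  unfolding e[symmetric] by (simp add: prod.reindex[OF inj'] image_image)
qed

lemma indep_vars_reindex:
 assumes "inj_on e J" "indep_vars (%j. M' (e j)) (%j. X (e j)) J"
 shows "indep_vars M' X (e ` J)"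
 using assms indep_sets_reindex[of e J "%i. {X i -` A \<inter> space M |A. A \<in> sets (M' i)}"]
 by (auto simp: indep_vars_def2)

lemma chf_cong_AE:
 assumes [measurable]: "X \<in> borel_measurable M" "Y \<in> borel_measurable M" and "AE r in M. X r = Y r"
 shows "chf X v = chf Y v"
 unfolding chf_eq[OF assms(1)] chf_eq[OF assms(2)] by (rule integral_cong_AE) (use assms(3) in \<open>auto elim: eventually_mono\<close>)

lemma chf_tendsto_AE:
 assumes [measurable]: "!!n::nat. X n \<in> borel_measurable M" "Y \<in> borel_measurable M" and lim: "AE r in M. (%n. X n r) \<longlonglongrightarrow> Y r"
 shows "(%n. chf (X n) v) \<longlonglongrightarrow> chf Y v"
 unfolding chf_eq[OF assms(1)] chf_eq[OF assms(2)]
proof (rule integral_dominated_convergence[where w = "%_. 1"])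
 show "AE r in M. (%n. iexp (v * X n r)) \<longlonglongrightarrow> iexp (v * Y r)"
  using lim by eventually_elim (intro tendsto_intros)
qed auto

lemma chf_sum:
 assumes "indep_vars (%_. borel) X J"
 shows "chf (%r. \<Sum>j\<in>J. X j r) v = (\<Prod>j\<in>J. chf (X j) v)"
 using char_distr_sum[OF assms, of v] by simp

lemma chf_scale:
 assumes [measurable]: "X \<in> borel_measurable M"
 shows "chf (%r. c * X r) v = chf X (v * c)"
 by (subst chf_eq, simp, subst chf_eq, simp) (simp add: mult_ac)

end

locale levy_noise = levy_space M L for M :: "'a measure" and L +
 fixes \<Lambda> :: "real set => 'a => real"
 assumes noise: "levy_random_measure M L \<Lambda>"
begin

lemma \<Lambda>_measurable [measurable]: "A \<in> bounded_borel ==> \<Lambda> A \<in> borel_measurable M"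
 using noise by (simp add: levy_random_measure_def independently_scattered_def)

lemma \<Lambda>_seq:
 fixes A :: "nat => real set"
 assumes "disjoint_family A" "!!n. A n \<in> bounded_borel"
 shows "indep_vars (%_. borel) (%n. \<Lambda> (A n)) UNIV"
  "(\<Union>n. A n) \<in> bounded_borel ==> AE r in M. (%n. \<Lambda> (A n) r) sums \<Lambda> (\<Union>n. A n) r"
 using noise assms by (auto simp: levy_random_measure_def independently_scattered_def image_subset_iff)

lemma \<Lambda>_Ioc: "s <= t ==> AE r in M. \<Lambda> {s<..t} r = L t r - L s r"
 using noise by (simp add: levy_random_measure_def)

lemma \<Lambda>_empty: "AE r in M. \<Lambda> {} r = 0"
 using \<Lambda>_seq(2)[of "%_. {}"]
proof (simp add: disjoint_family_on_def, elim eventually_mono)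
 fix r assume "(%n. \<Lambda> {} r) sums \<Lambda> {} r"
 then have "(%n::nat. \<Lambda> {} r) \<longlonglongrightarrow> 0" by (intro summable_LIMSEQ_zero sums_summable)
 then show "\<Lambda> {} r = 0" by (simp add: LIMSEQ_const_iff)
qed

lemma \<Lambda>_Un:
 assumes "A \<in> bounded_borel" "B \<in> bounded_borel" "A \<inter> B = {}"
 shows "AE r in M. \<Lambda> (A \<union> B) r = \<Lambda> A r + \<Lambda> B r"
proof -
 have U: "(\<Union>n. binaryset A B n) = A \<union> B" by (rule UN_binaryset_eq)
 have "AE r in M. (%n. \<Lambda> (binaryset A B n) r) sums \<Lambda> (\<Union>n. binaryset A B n) r"
 proof (rule \<Lambda>_seq(2))
  show "disjoint_family (binaryset A B)" using assms by (auto simp: disjoint_family_on_def binaryset_def)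
  show "binaryset A B n \<in> bounded_borel" for n using assms by (auto simp: binaryset_def)
  show "(\<Union>n. binaryset A B n) \<in> bounded_borel" unfolding U using assms by (simp add: bounded_borel_Un)
 qed
 then show ?thesis using \<Lambda>_empty
 proof eventually_elim
  case (elim r)
  from binaryset_sums[of "%A. \<Lambda> A r" A B] elim show ?case unfolding U using sums_unique2 by blast
 qed
qed

lemma \<Lambda>_Diff:
 assumes "A \<in> bounded_borel" "B \<in> bounded_borel" "A \<subseteq> B"
 shows "AE r in M. \<Lambda> B r = \<Lambda> A r + \<Lambda> (B - A) r"
proof -
 have "A \<union> (B - A) = B" using assms by auto
 then show ?thesis using \<Lambda>_Un[of A "B - A"] assms by (simp add: bounded_borel_Diff bounded_borel_sets)
qed

lemma \<Lambda>_UN: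
 assumes "finite I" "disjoint_family_on A I" "!!i. i \<in> I ==> A i \<in> bounded_borel"
 shows "AE r in M. \<Lambda> (\<Union>i\<in>I. A i) r = (\<Sum>i\<in>I. \<Lambda> (A i) r)"
 using assms
proof (induction I)
 case empty then show ?case using \<Lambda>_empty by simp
next
 case (insert i I)
 have "AE r in M. \<Lambda> (A i \<union> (\<Union>i\<in>I. A i)) r = \<Lambda> (A i) r + \<Lambda> (\<Union>i\<in>I. A i) r"
  using insert by (intro \<Lambda>_Un bounded_borel_UN) (auto simp: disjoint_family_on_def)
 moreover have "AE r in M. \<Lambda> (\<Union>i\<in>I. A i) r = (\<Sum>i\<in>I. \<Lambda> (A i) r)"
  using insert by (intro insert.IH) (auto simp: disjoint_family_on_def)
 ultimately show ?case using insert by (auto elim: eventually_elim2)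
qed

lemma \<Lambda>_indep:
 assumes I: "finite I" "disjoint_family_on A I" "!!i. i \<in> I ==> A i \<in> bounded_borel"
 shows "indep_vars (%_. borel) (%i. \<Lambda> (A i)) I"
proof -
 obtain e where e: "bij_betw e {..<card I} I" using ex_bij_betw_nat_finite[OF I(1)] by (auto simp: atLeast0LessThan)
 define B where "B n = (if n < card I then A (e n) else {})" for n
 have "disjoint_family B"
  unfolding disjoint_family_on_def
 proof (intro ballI impI)
  fix m n :: nat assume "m \<noteq> n"
  then show "B m \<inter> B n = {}" using e I(2)
   by (auto simp: B_def disjoint_family_on_def bij_betw_def inj_on_def) blast
 qed
 moreover have "B n \<in> bounded_borel" for n using e I(3) by (auto simp: B_def bij_betw_def)
 ultimately have "indep_vars (%_. borel) (%n. \<Lambda> (B n)) UNIV" by (rule \<Lambda>_seq(1))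
 then have "indep_vars (%_. borel) (%n. \<Lambda> (B n)) {..<card I}" by (rule indep_vars_subset) simp
 then have "indep_vars (%_. borel) (%n. \<Lambda> (A (e n))) {..<card I}"
  by (subst indep_vars_cong[OF refl _ refl, of _ _ "%n. \<Lambda> (B n)"]) (auto simp: B_def)
 then have "indep_vars (%_. borel) (%i. \<Lambda> (A i)) (e ` {..<card I})"
  using e by (intro indep_vars_reindex) (auto simp: bij_betw_def)
 then show ?thesis using e by (simp add: bij_betw_def)
qed

text \<open>The multiplicative set function \<open>A \<mapsto> chf (\<Lambda> A)\<close> is determined by its values on intervals.\<close>
lemma chf_\<Lambda>: "A \<in> bounded_borel ==> chf (\<Lambda> A) v = exp (of_real (measure lborel A) * w v)"
proof (induction rule: bounded_borel_induct)
 case empty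
 have "chf (\<Lambda> {}) v = chf (%_. 0) v" by (rule chf_cong_AE) (auto simp: \<Lambda>_empty)
 also have "... = 1" by (subst chf_eq) (auto simp: prob_space)
 finally show ?case by simp
next
 case (interval s t)
 have "chf (\<Lambda> {s<..t}) v = chf (%r. L t r - L s r) v" using interval by (intro chf_cong_AE \<Lambda>_Ioc) auto
 then show ?case using interval by (simp add: chf_increment w(1))
next
 case (diff A B)
 note [simp] = diff(1,2) bounded_borel_sets[OF diff(1)]
 have D: "B - A \<in> bounded_borel" by (simp add: bounded_borel_Diff)
 define F where "F b = (if b then A else B - A)" for b
 have "indep_vars (%_. borel) (%b. \<Lambda> (F b)) UNIV"
  using D by (intro \<Lambda>_indep) (auto simp: disjoint_family_on_def F_def)
 from chf_sum[OF this, of v] have p: "chf (%r. \<Lambda> A r + \<Lambda> (B - A) r) v = chf (\<Lambda> A) v * chf (\<Lambda> (B - A)) v"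
  by (simp add: UNIV_bool F_def add.commute mult.commute)
 have "chf (\<Lambda> B) v = chf (%r. \<Lambda> A r + \<Lambda> (B - A) r) v"
  using D diff by (intro chf_cong_AE \<Lambda>_Diff) auto
 then have "exp (of_real (measure lborel B) * w v) = exp (of_real (measure lborel A) * w v) * chf (\<Lambda> (B - A)) v"
  using p diff by simp
 moreover have "measure lborel (B - A) = measure lborel B - measure lborel A"
  using diff bounded_borel_finite[of A] bounded_borel_finite[of B] by (intro measure_Diff) (auto simp: bounded_borel_sets)
 ultimately show ?case by (simp add: left_diff_distrib exp_diff)
next
 case (union A)
 note [measurable] = \<Lambda>_measurable[OF union(2)] \<Lambda>_measurable[OF union(3)]
 have "AE r in M. (%n. \<Sum>k<n. \<Lambda> (A k) r) \<longlonglongrightarrow> \<Lambda> (\<Union>n. A n) r"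
  using \<Lambda>_seq(2)[OF union(1-3)] by (simp add: sums_def)
 then have l1: "(%n. chf (%r. \<Sum>k<n. \<Lambda> (A k) r) v) \<longlonglongrightarrow> chf (\<Lambda> (\<Union>n. A n)) v"
  by (intro chf_tendsto_AE) auto
 have e: "chf (%r. \<Sum>k<n. \<Lambda> (A k) r) v = exp (of_real (\<Sum>k<n. measure lborel (A k)) * w v)" for n
 proof -
  have "indep_vars (%_. borel) (%n. \<Lambda> (A n)) {..<n}" by (rule indep_vars_subset[OF \<Lambda>_seq(1)[OF union(1,2)]]) simp
  from chf_sum[OF this] show ?thesis by (simp add: union(4) exp_sum sum_distrib_right)
 qed
 have "(%n. measure lborel (A n)) sums measure lborel (\<Union>n. A n)"
  using union bounded_borel_finite[OF union(3)] by (intro measure_UNION) (auto simp: bounded_borel_sets)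
 then have "(%n. exp (of_real (\<Sum>k<n. measure lborel (A k)) * w v)) \<longlonglongrightarrow> exp (of_real (measure lborel (\<Union>n. A n)) * w v)"
  unfolding sums_def by (intro tendsto_intros)
 with l1 show ?case unfolding e by (rule LIMSEQ_unique)
qed

lemma chf_combination:
 assumes I: "finite I" "disjoint_family_on A I" "!!i. i \<in> I ==> A i \<in> bounded_borel"
 shows "chf (%r. \<Sum>i\<in>I. c i * \<Lambda> (A i) r) v = exp (\<Sum>i\<in>I. of_real (measure lborel (A i)) * w (v * c i))"
proof -
 have "indep_vars (%_. borel) (%i r. c i * \<Lambda> (A i) r) I"
  using indep_vars_compose2[OF \<Lambda>_indep[OF I], of "%i x. c i * x" "%_. borel"] by simp
 from chf_sum[OF this, of v] I(1) show ?thesis by (simp add: exp_sum chf_scale I(3) chf_\<Lambda>)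
qed

text \<open>The integrals \<open>X t\<close> may be defined with a different noise for every \<open>t\<close>; all these noises agree almost surely.\<close>
lemma \<Lambda>_unique:
 assumes "levy_random_measure M L \<Lambda>'" and "A \<in> bounded_borel"
 shows "AE r in M. \<Lambda> A r = \<Lambda>' A r"
 using assms(2)
proof (induction rule: bounded_borel_induct)
 interpret N: levy_noise M L \<Lambda>' by unfold_locales (rule assms(1))
 {
  case empty show ?case using \<Lambda>_empty N.\<Lambda>_empty by eventually_elim simp
 next
  case (interval s t) show ?case using \<Lambda>_Ioc[OF interval] N.\<Lambda>_Ioc[OF interval] by eventually_elim simp
 next
  case (diff A B)
  show ?case using \<Lambda>_Diff[OF diff(1-3)] N.\<Lambda>_Diff[OF diff(1-3)] diff(4,5) by eventually_elim simp
 next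
  case (union A)
  have "AE r in M. \<forall>n. \<Lambda> (A n) r = \<Lambda>' (A n) r" using union(4) by (simp add: AE_all_countable)
  with \<Lambda>_seq(2)[OF union(1-3)] N.\<Lambda>_seq(2)[OF union(1-3)] show ?case
   by eventually_elim (auto intro: sums_unique2)
 }
qed

end

section \<open>Integrals of simple functions\<close>

lemma simple_integrandD:
 assumes "simple_integrand g"
 shows "finite (range g)" "g \<in> borel_measurable borel" "{x. g x \<noteq> 0} \<in> bounded_borel"
  "0 \<notin> V ==> g -` V \<in> bounded_borel" "g -` V \<in> sets borel"
proof -
 show f: "finite (range g)" and m: "g \<in> borel_measurable borel"
  using assms by (auto simp: simple_integrand_def simple_function_def intro: borel_measurable_simple_function)
 have p: "g -` V \<in> sets borel" for V
 proof -
  have "g -` V = (\<Union>y\<in>V \<inter> range g. g -` {y} \<inter> space borel)" by auto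
  also have "... \<in> sets borel" using assms f by (intro sets.finite_UN) (auto simp: simple_integrand_def simple_function_def)
  finally show ?thesis .
 qed
 show "g -` V \<in> sets borel" by (rule p)
 have b: "bounded {x. g x \<noteq> 0}" using assms by (simp add: simple_integrand_def)
 show "{x. g x \<noteq> 0} \<in> bounded_borel" using p[of "- {0}"] b by (auto simp: bounded_borel_def vimage_def)
 show "g -` V \<in> bounded_borel" if "0 \<notin> V"
 proof -
  have "g -` V \<subseteq> {x. g x \<noteq> 0}" using that by auto
  then show ?thesis using p[of V] bounded_subset[OF b] by (simp add: bounded_borel_def)
 qed
qed

lemma simple_integrandI:
 assumes "finite (range g)" "g \<in> borel_measurable borel" "bounded {x. g x \<noteq> 0}"
 shows "simple_integrand g"
 using assms by (auto simp: simple_integrand_def simple_function_borel_measurable)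

lemma simple_integrand_compose:
 assumes "simple_integrand g" "simple_integrand \<psi>" and 0: "h 0 0 = 0"
 shows "simple_integrand (%x. h (g x) (\<psi> x))"
proof -
 have "simple_function borel (%x. h (g x) (\<psi> x))"
  by (rule simple_function_compose2) (use assms(1,2) in \<open>simp_all add: simple_integrand_def\<close>)
 moreover have "{x. h (g x) (\<psi> x) \<noteq> 0} \<subseteq> {x. g x \<noteq> 0} \<union> {x. \<psi> x \<noteq> 0}" using 0 by auto
 moreover have "bounded ({x. g x \<noteq> 0} \<union> {x. \<psi> x \<noteq> 0})" using assms by (simp add: simple_integrand_def)
 ultimately show ?thesis unfolding simple_integrand_def by (blast intro: bounded_subset)
qed

lemma simple_integrand_indicator:
 assumes "simple_integrand g" and A: "A \<in> sets borel"
 shows "simple_integrand (%x. indicator A x * g x)"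
proof -
 have "simple_function borel (%x. indicator A x * g x :: real)"
  using assms by (intro simple_function_mult simple_function_indicator) (auto simp: simple_integrand_def)
 then show ?thesis using assms unfolding simple_integrand_def by (auto intro: bounded_subset[of "{x. g x \<noteq> 0}"])
qed

context levy_noise
begin

abbreviation U :: "real set => (real => real) => 'a => real" where
 "U \<equiv> simple_stoch_integral \<Lambda>"

lemma level_set_bounded_borel:
 "simple_integrand g ==> A \<in> sets borel ==> 0 \<notin> V ==> A \<inter> g -` V \<in> bounded_borel"
 by (intro bounded_borel_Int' simple_integrandD)

lemma U_measurable [measurable]: "simple_integrand g ==> A \<in> sets borel ==> U A g \<in> borel_measurable M"
 unfolding simple_stoch_integral_def[abs_def]
 by (intro borel_measurable_sum borel_measurable_times borel_measurable_const \<Lambda>_measurable level_set_bounded_borel) auto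

lemma U_eq_sum:
 assumes g: "simple_integrand g" and J: "finite J" "disjoint_family_on D J" "!!j. j \<in> J ==> D j \<in> bounded_borel"
  and c: "!!j x. j \<in> J ==> x \<in> D j ==> g x = c j"
  and sub: "!!j. j \<in> J ==> D j \<subseteq> A" and cover: "!!x. x \<in> A ==> g x \<noteq> 0 ==> x \<in> (\<Union>j\<in>J. D j)"
 shows "AE r in M. U A g r = (\<Sum>j\<in>J. c j * \<Lambda> (D j) r)"
proof -
 let ?V = "range g - {0}"
 have "AE r in M. \<Lambda> (A \<inter> g -` {y}) r = (\<Sum>j\<in>{j\<in>J. c j = y}. \<Lambda> (D j) r)" if y: "y \<in> ?V" for y
 proof -
  have "A \<inter> g -` {y} = (\<Union>j\<in>{j\<in>J. c j = y}. D j)"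
  proof (intro set_eqI iffI)
   fix x assume x: "x \<in> A \<inter> g -` {y}"
   then obtain j where j: "j \<in> J" "x \<in> D j" using cover[of x] y by blast
   with x c[OF j] show "x \<in> (\<Union>j\<in>{j\<in>J. c j = y}. D j)" by auto
  next
   fix x assume "x \<in> (\<Union>j\<in>{j\<in>J. c j = y}. D j)"
   then show "x \<in> A \<inter> g -` {y}" using c sub by auto
  qed
  then show ?thesis using \<Lambda>_UN[of "{j\<in>J. c j = y}" D] J by (simp add: disjoint_family_on_def)
 qed
 then have "AE r in M. \<forall>y\<in>?V. \<Lambda> (A \<inter> g -` {y}) r = (\<Sum>j\<in>{j\<in>J. c j = y}. \<Lambda> (D j) r)"
  using simple_integrandD(1)[OF g] by (intro AE_finite_allI) auto
 with \<Lambda>_empty show ?thesis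
 proof eventually_elim
  case (elim r)
  have e: "D j = {}" if "j \<in> J" "c j \<notin> range g" for j
  proof (rule ccontr)
   assume "D j \<noteq> {}"
   then obtain x where "x \<in> D j" by blast
   then show False using c[OF that(1), of x] that(2) by (metis rangeI)
  qed
  have "(\<Sum>j\<in>J. c j * \<Lambda> (D j) r) = (\<Sum>j\<in>{j\<in>J. c j \<in> ?V}. c j * \<Lambda> (D j) r)"
  proof (rule sum.mono_neutral_right[OF J(1)], blast, intro ballI)
   fix j assume j: "j \<in> J - {j\<in>J. c j \<in> ?V}"
   then show "c j * \<Lambda> (D j) r = 0" using e[of j] elim(1) by (cases "c j = 0") auto
  qed
  also have "... = (\<Sum>y\<in>?V. \<Sum>j\<in>{j \<in> {j\<in>J. c j \<in> ?V}. c j = y}. c j * \<Lambda> (D j) r)"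
   using J(1) simple_integrandD(1)[OF g] by (intro sum.group[symmetric]) auto
  also have "... = (\<Sum>y\<in>?V. y * (\<Sum>j\<in>{j\<in>J. c j = y}. \<Lambda> (D j) r))"
   by (intro sum.cong refl) (auto simp: sum_distrib_left intro!: sum.cong)
  also have "... = U A g r" unfolding simple_stoch_integral_def using elim(2) by (intro sum.cong refl) auto
  finally show ?case by simp
 qed
qed

lemma U_eq_sum_range:
 assumes g: "simple_integrand g" and \<Phi>: "finite (range \<Phi>)" "!!v. \<Phi> -` {v} \<in> sets borel"
  and c: "!!x. x \<in> D ==> g x = c (\<Phi> x)"
  and D: "D \<in> bounded_borel" "D \<subseteq> A" "!!x. x \<in> A ==> g x \<noteq> 0 ==> x \<in> D"
 shows "AE r in M. U A g r = (\<Sum>v\<in>range \<Phi>. c v * \<Lambda> (D \<inter> \<Phi> -` {v}) r)"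
 using D c by (intro U_eq_sum g \<Phi>(1) bounded_borel_Int \<Phi>(2)) (auto simp: disjoint_family_on_def)

lemma U_indicator:
 assumes g: "simple_integrand g" and A: "A \<in> sets borel"
 shows "AE r in M. U UNIV (%x. indicator A x * g x) r = U A g r"
proof -
 have "AE r in M. U UNIV (%x. indicator A x * g x) r = (\<Sum>y\<in>range g - {0}. y * \<Lambda> (A \<inter> g -` {y}) r)"
  using simple_integrandD(1)[OF g]
  by (intro U_eq_sum simple_integrand_indicator g A level_set_bounded_borel)
   (auto simp: disjoint_family_on_def split: split_indicator_asm)
 then show ?thesis by (simp add: simple_stoch_integral_def)
qed

lemma U_Un:
 assumes g: "simple_integrand g" and A: "A \<in> sets borel" "B \<in> sets borel" "A \<inter> B = {}"
 shows "AE r in M. U (A \<union> B) g r = U A g r + U B g r"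
proof -
 have "AE r in M. \<Lambda> ((A \<union> B) \<inter> g -` {y}) r = \<Lambda> (A \<inter> g -` {y}) r + \<Lambda> (B \<inter> g -` {y}) r" if "y \<in> range g - {0}" for y
  unfolding Int_Un_distrib2 using that A by (intro \<Lambda>_Un level_set_bounded_borel g) auto
 then have "AE r in M. \<forall>y\<in>range g - {0}. \<Lambda> ((A \<union> B) \<inter> g -` {y}) r = \<Lambda> (A \<inter> g -` {y}) r + \<Lambda> (B \<inter> g -` {y}) r"
  using simple_integrandD(1)[OF g] by (intro AE_finite_allI) auto
 then show ?thesis
  by eventually_elim (simp add: simple_stoch_integral_def sum.distrib[symmetric] distrib_left)
qed

lemma U_diff:
 assumes g: "simple_integrand g" "simple_integrand \<psi>" and A: "A \<in> sets borel"
 shows "AE r in M. U A (%x. g x - \<psi> x) r = U A g r - U A \<psi> r"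
proof -
 define \<Phi> where "\<Phi> x = (g x, \<psi> x)" for x
 define D where "D = A \<inter> ({x. g x \<noteq> 0} \<union> {x. \<psi> x \<noteq> 0})"
 have f: "finite (range \<Phi>)"
  by (rule finite_subset[of _ "range g \<times> range \<psi>"]) (use simple_integrandD(1)[OF g(1)] simple_integrandD(1)[OF g(2)] in \<open>auto simp: \<Phi>_def\<close>)
 have m: "\<Phi> -` {v} \<in> sets borel" for v
 proof -
  have "\<Phi> -` {v} = g -` {fst v} \<inter> \<psi> -` {snd v}" by (auto simp: \<Phi>_def)
  also have "... \<in> sets borel" using simple_integrandD(5) g by blast
  finally show ?thesis .
 qed
 have D: "D \<in> bounded_borel" "D \<subseteq> A" unfolding D_def
  using A simple_integrandD(3) g by (auto intro!: bounded_borel_Int' bounded_borel_Un)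
 have "AE r in M. U A g r = (\<Sum>v\<in>range \<Phi>. fst v * \<Lambda> (D \<inter> \<Phi> -` {v}) r)"
  by (rule U_eq_sum_range[OF g(1) f m _ D]) (auto simp: \<Phi>_def D_def)
 moreover have "AE r in M. U A \<psi> r = (\<Sum>v\<in>range \<Phi>. snd v * \<Lambda> (D \<inter> \<Phi> -` {v}) r)"
  by (rule U_eq_sum_range[OF g(2) f m _ D]) (auto simp: \<Phi>_def D_def)
 moreover have "AE r in M. U A (%x. g x - \<psi> x) r = (\<Sum>v\<in>range \<Phi>. (fst v - snd v) * \<Lambda> (D \<inter> \<Phi> -` {v}) r)"
  by (rule U_eq_sum_range[OF _ f m _ D]) (use simple_integrand_compose[OF g, of "(-)"] in \<open>auto simp: \<Phi>_def D_def\<close>)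
 ultimately show ?thesis by eventually_elim (simp add: left_diff_distrib sum_subtractf)
qed

lemma integral_simple_levels:
 assumes g: "simple_integrand g" and A: "A \<in> sets borel" and h: "h 0 = (0 :: 'b :: {banach, second_countable_topology})"
 shows "has_bochner_integral lborel (%x. indicator A x *\<^sub>R h (g x)) (\<Sum>y\<in>range g - {0}. measure lborel (A \<inter> g -` {y}) *\<^sub>R h y)"
proof -
 have "has_bochner_integral lborel (%x. \<Sum>y\<in>range g - {0}. indicator (A \<inter> g -` {y}) x *\<^sub>R h y) (\<Sum>y\<in>range g - {0}. measure lborel (A \<inter> g -` {y}) *\<^sub>R h y)"
 proof (intro has_bochner_integral_sum has_bochner_integral_scaleR_left)
  fix y assume "y \<in> range g - {0}"
  then have "A \<inter> g -` {y} \<in> bounded_borel" using g A by (intro level_set_bounded_borel) auto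
  then show "has_bochner_integral lborel (indicator (A \<inter> g -` {y})) (measure lborel (A \<inter> g -` {y}))"
   using bounded_borel_finite bounded_borel_sets by (intro has_bochner_integral_real_indicator) auto
 qed
 moreover have "(\<Sum>y\<in>range g - {0}. indicator (A \<inter> g -` {y}) x *\<^sub>R h y) = indicator A x *\<^sub>R h (g x)" for x
 proof -
  have "(\<Sum>y\<in>range g - {0}. indicator (A \<inter> g -` {y}) x *\<^sub>R h y) = (\<Sum>y\<in>range g - {0}. if y = g x then indicator A x *\<^sub>R h y else 0)"
   by (intro sum.cong refl) (auto split: split_indicator)
  also have "... = indicator A x *\<^sub>R h (g x)" using simple_integrandD(1)[OF g] h by (simp add: sum.delta')
  finally show ?thesis .
 qed
 ultimately show ?thesis by simp
qed

lemma chf_U: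
 assumes g: "simple_integrand g" and A: "A \<in> sets borel"
 shows "chf (U A g) \<theta> = exp (LINT x|lborel. indicator A x *\<^sub>R w (\<theta> * g x))"
proof -
 have "chf (U A g) \<theta> = exp (\<Sum>y\<in>range g - {0}. of_real (measure lborel (A \<inter> g -` {y})) * w (\<theta> * y))"
  unfolding simple_stoch_integral_def[abs_def]
  using simple_integrandD(1)[OF g] by (intro chf_combination level_set_bounded_borel g A) (auto simp: disjoint_family_on_def)
 then show ?thesis
  using integral_simple_levels[OF g A, of "%y. w (\<theta> * y)"] by (simp add: w(3) has_bochner_integral_iff scaleR_conv_of_real)
qed

text \<open>Through the exponent: \<open>chf (U A \<xi>) \<theta> = exp (\<integral>\<^sub>A w (\<theta> \<xi>))\<close> with
\<open>w\<close> continuous, and dominated convergence applies on the bounded set \<open>E\<close>.\<close>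
lemma U_null:
 assumes \<xi>: "!!n::nat. simple_integrand (\<xi> n)" and A: "!!n. A n \<in> sets borel" and E: "E \<in> bounded_borel"
  and bound: "!!n. AE x in lborel. \<bar>indicator (A n) x * \<xi> n x\<bar> <= c * indicator E x"
  and lim: "AE x in lborel. (%n. indicator (A n) x * \<xi> n x) \<longlonglongrightarrow> 0"
 shows "(%n. pn (U (A n) (\<xi> n))) \<longlonglongrightarrow> 0"
proof (rule pn_tendsto_0_chf)
 show "U (A n) (\<xi> n) \<in> borel_measurable M" for n using \<xi> A by measurable
 fix \<theta> :: real
 note [measurable] = A simple_integrandD(2)[OF \<xi>] borel_measurable_continuous_onI[OF w(2)] bounded_borel_sets[OF E]
 have wi: "indicator (A n) x *\<^sub>R w (\<theta> * \<xi> n x) = w (\<theta> * (indicator (A n) x * \<xi> n x))" for n x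
  by (simp add: w(3) split: split_indicator)
 have "compact (w ` {- (\<bar>\<theta>\<bar> * \<bar>c\<bar>)..\<bar>\<theta>\<bar> * \<bar>c\<bar>})"
  by (intro compact_continuous_image continuous_on_subset[OF w(2)]) auto
 then obtain B where B: "!!y. \<bar>y\<bar> <= \<bar>\<theta>\<bar> * \<bar>c\<bar> ==> norm (w y) <= B"
  using compact_imp_bounded by (fastforce simp: bounded_iff abs_le_iff)
 have "(%n. LINT x|lborel. indicator (A n) x *\<^sub>R w (\<theta> * \<xi> n x)) \<longlonglongrightarrow> integral\<^sup>L lborel (%x::real. 0)"
 proof (rule integral_dominated_convergence[where w = "%x. B * indicator E x"])
  show "integrable lborel (%x. B * indicator E x :: real)"
   using bounded_borel_finite[OF E] by (intro integrable_mult_right integrable_real_indicator) auto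
  show "AE x in lborel. (%n. indicator (A n) x *\<^sub>R w (\<theta> * \<xi> n x)) \<longlonglongrightarrow> 0"
   using lim
  proof eventually_elim
   case (elim x)
   have "(%n. w (\<theta> * (indicator (A n) x * \<xi> n x))) \<longlonglongrightarrow> w (\<theta> * 0)"
    by (rule continuous_on_tendsto_compose[OF w(2) tendsto_mult_left[OF elim]]) auto
   then show ?case by (simp only: wi mult_zero_right w(3))
  qed
  show "AE x in lborel. norm (indicator (A n) x *\<^sub>R w (\<theta> * \<xi> n x)) <= B * indicator E x" for n
   using bound[of n]
  proof eventually_elim
   case (elim x)
   have "\<bar>\<theta> * (indicator (A n) x * \<xi> n x)\<bar> <= \<bar>\<theta>\<bar> * (\<bar>c\<bar> * indicator E x)"
    unfolding abs_mult[of \<theta>] using elim by (intro mult_left_mono) (auto split: split_indicator_asm split_indicator)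
   then show ?case unfolding wi using B[of "\<theta> * (indicator (A n) x * \<xi> n x)"] by (cases "x \<in> E") (auto simp: w(3))
  qed
 qed measurable
 then have "(%n. exp (LINT x|lborel. indicator (A n) x *\<^sub>R w (\<theta> * \<xi> n x))) \<longlonglongrightarrow> exp 0"
  by (intro tendsto_exp) simp
 then show "(%n. chf (U (A n) (\<xi> n)) \<theta>) \<longlonglongrightarrow> 1" by (simp add: chf_U \<xi> A)
qed

end

section \<open>Approximation of the moving average by simple kernels\<close>

context prob_space
begin

text \<open>The set functions \<open>V n\<close> converge on every Borel set, and each of them is small far out. If the limit were
not small far out, choose indices \<open>n 0 < n 1 < ...\<close> and disjoint shells on which \<open>V (n m)\<close> is large, and
let \<open>G\<close> be the union of every second shell. Then \<open>V (n m) G\<close> is close to the part chosen before for odd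
\<open>m\<close> and far from it for even \<open>m\<close>, so it does not converge.\<close>
lemma gliding_hump:
 fixes V :: "nat => real set => 'a => real" and Y :: "real set => 'a => real"
 assumes V [measurable]: "!!n A. A \<in> sets borel ==> V n A \<in> borel_measurable M"
  and Y [measurable]: "!!A. A \<in> sets borel ==> Y A \<in> borel_measurable M"
  and add: "!!n A B. A \<in> sets borel ==> B \<in> sets borel ==> A \<inter> B = {} ==> AE r in M. V n (A \<union> B) r = V n A r + V n B r"
  and conv: "!!A. A \<in> sets borel ==> (%n. pn (%r. V n A r - Y A r)) \<longlonglongrightarrow> 0"
  and E [measurable]: "!!i. E i \<in> sets borel" and inc: "incseq E"
  and small: "!!n ep. 0 < ep ==> \<exists>i::nat. \<forall>B\<in>sets borel. B \<inter> E i = {} --> pn (V n B) <= ep"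
 shows "(%i. pn (Y (- E i))) \<longlonglongrightarrow> 0"
proof (rule ccontr)
 assume "\<not> ?thesis"
 then obtain e0 where e0: "0 < e0" "!!i0. \<exists>i\<ge>i0. e0 <= pn (Y (- E i))"
  unfolding LIMSEQ_iff using pn_nonneg by (force simp: not_less)
 define e where "e = e0 / 9"
 have e: "0 < e" using e0 by (simp add: e_def)
 have bad: "\<exists>i\<ge>i0. 8 * e < pn (Y (- E i))" for i0 using e0(2)[of i0] e0(1) unfolding e_def by (auto intro: less_le_trans[rotated])
 have E' [measurable]: "- E i \<in> sets borel" for i using E[of i] by (simp add: borel_comp)
 \<comment> \<open>A state is a tail index, the part of the set chosen so far, and a time.\<close>
 define Ok where "Ok s = (case s of (i, P, n) => 8 * e < pn (Y (- E i)) \<and> P \<in> sets borel \<and> P \<subseteq> E i \<and>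
  pn (%r. V n (- E i) r - Y (- E i) r) < e \<and> (\<forall>n'\<ge>n. pn (%r. V n' P r - Y P r) < e))" for s :: "nat \<times> real set \<times> nat"
 define Step where "Step m s s' = (case s of (i, P, n) => case s' of (i', P', n') => i <= i' \<and> n < n' \<and>
  (\<forall>B\<in>sets borel. B \<inter> E i' = {} --> pn (V n B) <= e) \<and> P' = (if even m then P \<union> (E i' - E i) else P))" for m :: nat and s s' :: "nat \<times> real set \<times> nat"
 have choose_n: "\<exists>n\<ge>n0. Ok (i, P, n)" if "8 * e < pn (Y (- E i))" "P \<in> sets borel" "P \<subseteq> E i" for i P n0
 proof -
  have "eventually (%n. pn (%r. V n (- E i) r - Y (- E i) r) < e) sequentially"
   using order_tendstoD(2)[OF conv[OF E'] e] .
  moreover have "eventually (%n. pn (%r. V n P r - Y P r) < e) sequentially"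
   using order_tendstoD(2)[OF conv[OF that(2)] e] .
  ultimately have "eventually (%n. pn (%r. V n (- E i) r - Y (- E i) r) < e \<and> pn (%r. V n P r - Y P r) < e) sequentially"
   by (rule eventually_conj)
  then obtain N where "\<forall>n\<ge>N. pn (%r. V n (- E i) r - Y (- E i) r) < e \<and> pn (%r. V n P r - Y P r) < e"
   unfolding eventually_sequentially by blast
  then show ?thesis using that by (intro exI[of _ "max N n0"]) (auto simp: Ok_def)
 qed
 have "\<exists>f. \<forall>m. Ok (f m) \<and> Step m (f m) (f (Suc m))"
 proof (rule dependent_nat_choice)
  obtain i where "8 * e < pn (Y (- E i))" using bad[of 0] by blast
  then show "\<exists>s. Ok s" using choose_n[of i "{}" 0] by blast
 next
  fix s and m :: nat assume s: "Ok s"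
  obtain i P n where sd: "s = (i, P, n)" by (cases s)
  obtain i1 where i1: "\<forall>B\<in>sets borel. B \<inter> E i1 = {} --> pn (V n B) <= e" using small[OF e] by blast
  obtain i' where i': "i' \<ge> max i i1" "8 * e < pn (Y (- E i'))" using bad[of "max i i1"] by blast
  have sub: "E i1 \<subseteq> E i'" "E i \<subseteq> E i'" using incseqD[OF inc] i' by auto
  define P' where "P' = (if even m then P \<union> (E i' - E i) else P)"
  have "P' \<in> sets borel" "P' \<subseteq> E i'" using s sub unfolding sd P'_def Ok_def by auto
  then obtain n' where n': "n' \<ge> Suc n" "Ok (i', P', n')" using choose_n[OF i'(2)] by blast
  have "\<forall>B\<in>sets borel. B \<inter> E i' = {} --> pn (V n B) <= e" using i1 sub(1) by blast
  then have "Step m s (i', P', n')" using i' n' unfolding sd Step_def P'_def by auto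
  then show "\<exists>s'. Ok s' \<and> Step m s s'" using n'(2) by blast
 qed
 then obtain f where f: "!!m. Ok (f m)" "!!m. Step m (f m) (f (Suc m))" by blast
 define i where "i m = fst (f m)" for m
 define P where "P m = fst (snd (f m))" for m
 define n where "n m = snd (snd (f m))" for m
 have fm: "f m = (i m, P m, n m)" for m by (simp add: i_def P_def n_def)
 have ok: "8 * e < pn (Y (- E (i m)))" "P m \<in> sets borel" "P m \<subseteq> E (i m)"
  "pn (%r. V (n m) (- E (i m)) r - Y (- E (i m)) r) < e" "!!n'. n' \<ge> n m ==> pn (%r. V n' (P m) r - Y (P m) r) < e" for m
  using f(1)[of m] unfolding fm Ok_def by auto
 have st: "i m <= i (Suc m)" "n m < n (Suc m)" "!!B. B \<in> sets borel ==> B \<inter> E (i (Suc m)) = {} ==> pn (V (n m) B) <= e"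
  "P (Suc m) = (if even m then P m \<union> (E (i (Suc m)) - E (i m)) else P m)" for m
  using f(2)[of m] unfolding fm Step_def by auto
 note [measurable] = ok(2)
 have mono: "i m <= i l" if "m <= l" for m l using that st(1) by (rule lift_Suc_mono_le[rotated])
 have Pinc: "P m \<subseteq> P l" if "m <= l" for m l using that by (rule lift_Suc_mono_le[rotated]) (auto simp: st(4))
 have trace: "P l \<inter> E (i m) = P m" if "m <= l" for m l
  using that
 proof (induction l rule: dec_induct)
  case base then show ?case using ok(3) by blast
 next
  case (step l)
  have "E (i m) \<subseteq> E (i l)" using incseqD[OF inc mono[OF step(1)]] .
  then show ?case using step.IH by (auto simp: st(4))
 qed
 define G where "G = (\<Union>m. P m)"
 have G [measurable]: "G \<in> sets borel" unfolding G_def by measurable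
 have GE: "G \<inter> E (i m) = P m" for m
 proof
  show "G \<inter> E (i m) \<subseteq> P m"
  proof
   fix x assume x: "x \<in> G \<inter> E (i m)"
   then obtain l where l: "x \<in> P l" by (auto simp: G_def)
   show "x \<in> P m" using trace[of m l] Pinc[of l m] l x by (cases "m <= l") auto
  qed
  show "P m \<subseteq> G \<inter> E (i m)" using ok(3) by (auto simp: G_def)
 qed
 have split: "AE r in M. V k G r = V k (P (Suc m)) r + V k (G - E (i (Suc m))) r" for k m
 proof -
  have "P (Suc m) \<union> (G - E (i (Suc m))) = G" using GE[of "Suc m"] by auto
  then show ?thesis using add[of "P (Suc m)" "G - E (i (Suc m))" k] ok(3)[of "Suc m"] by auto
 qed
 have tail: "pn (V (n m) (G - E (i (Suc m)))) <= e" for m by (rule st(3)) auto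
 have odd: "pn (%r. V (n m) G r - Y (P m) r) <= 2 * e" if "odd m" for m
 proof -
  have P: "P (Suc m) = P m" using that by (simp add: st(4))
  have "pn (%r. V (n m) G r - Y (P m) r) = pn (%r. (V (n m) (P m) r - Y (P m) r) + V (n m) (G - E (i (Suc m))) r)"
   using split[of "n m" m] by (intro pn_cong_AE) (auto simp: P elim: eventually_mono)
  also have "... <= pn (%r. V (n m) (P m) r - Y (P m) r) + pn (V (n m) (G - E (i (Suc m))))" by (rule pn_triangle) auto
  also have "... <= 2 * e" using tail[of m] ok(5)[of m "n m"] by simp
  finally show ?thesis .
 qed
 have even: "4 * e < pn (%r. V (n m) G r - Y (P m) r)" if "even m" for m
 proof -
  define B where "B = E (i (Suc m)) - E (i m)"
  have B [measurable]: "B \<in> sets borel" by (simp add: B_def)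
  have P: "P (Suc m) = P m \<union> B" using that by (simp add: st(4) B_def)
  have addP: "AE r in M. V (n m) (P m \<union> B) r = V (n m) (P m) r + V (n m) B r"
   using ok(3)[of m] by (intro add) (auto simp: B_def)
  have addE: "AE r in M. V (n m) (- E (i m)) r = V (n m) B r + V (n m) (- E (i (Suc m))) r"
  proof -
   have "- E (i m) = B \<union> - E (i (Suc m))" using incseqD[OF inc st(1)] by (auto simp: B_def)
   then show ?thesis using add[of B "- E (i (Suc m))" "n m"] by (simp add: B_def) blast
  qed
  have "pn (Y (- E (i m))) = pn (%r. Y (- E (i m)) r - V (n m) (- E (i m)) r + V (n m) (- E (i m)) r)" by simp
  also have "... <= pn (%r. Y (- E (i m)) r - V (n m) (- E (i m)) r) + pn (V (n m) (- E (i m)))" by (rule pn_triangle) auto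
  also have "pn (V (n m) (- E (i m))) = pn (%r. V (n m) B r + V (n m) (- E (i (Suc m))) r)" using addE by (intro pn_cong_AE) auto
  also have "... <= pn (V (n m) B) + pn (V (n m) (- E (i (Suc m))))" by (rule pn_triangle) auto
  finally have 1: "6 * e < pn (V (n m) B)"
   using ok(1,4)[of m] st(3)[of "- E (i (Suc m))" m] pn_minus_commute[of "V (n m) (- E (i m))" "Y (- E (i m))"] by simp
  have "pn (V (n m) B) = pn (%r. ((V (n m) G r - Y (P m) r) + (Y (P m) r - V (n m) (P m) r)) + (- V (n m) (G - E (i (Suc m))) r))"
   using split[of "n m" m] addP by (intro pn_cong_AE) (auto simp: P elim: eventually_elim2)
  also have "... <= pn (%r. (V (n m) G r - Y (P m) r) + (Y (P m) r - V (n m) (P m) r)) + pn (%r. - V (n m) (G - E (i (Suc m))) r)"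
   by (rule pn_triangle) auto
  also have "pn (%r. (V (n m) G r - Y (P m) r) + (Y (P m) r - V (n m) (P m) r)) <= pn (%r. V (n m) G r - Y (P m) r) + pn (%r. Y (P m) r - V (n m) (P m) r)"
   by (rule pn_triangle) auto
  finally show ?thesis
   using 1 tail[of m] ok(5)[of m "n m"] pn_minus_commute[of "Y (P m)" "V (n m) (P m)"] by (simp add: pn_uminus)
 qed
 have "strict_mono n" using st(2) by (simp add: strict_mono_Suc_iff)
 then have "filterlim n sequentially sequentially" by (rule filterlim_subseq)
 from filterlim_compose[OF conv[OF G] this] have l: "(%m. pn (%r. V (n m) G r - Y G r)) \<longlonglongrightarrow> 0" .
 obtain N where N: "!!m. N <= m ==> pn (%r. V (n m) G r - Y G r) < e"
  using order_tendstoD(2)[OF l e] by (auto simp: eventually_sequentially)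
 define m where "m = 2 * N + 1"
 have m: "odd m" "even (Suc m)" "N <= m" by (auto simp: m_def)
 have PS: "P (Suc m) = P m" using m by (simp add: st(4))
 have "pn (%r. V (n (Suc m)) G r - Y (P m) r) <= pn (%r. V (n (Suc m)) G r - Y G r) + pn (%r. Y G r - Y (P m) r)"
  by (rule pn_diff_triangle) auto
 also have "pn (%r. Y G r - Y (P m) r) <= pn (%r. Y G r - V (n m) G r) + pn (%r. V (n m) G r - Y (P m) r)"
  by (rule pn_diff_triangle) auto
 finally show False
  using N[of m] N[of "Suc m"] m even[of "Suc m"] odd[of m] pn_minus_commute[of "Y G" "V (n m) G"] unfolding PS by simp
qed

lemma pn_limit_unique:
 assumes [measurable]: "!!n::nat. X n \<in> borel_measurable M" "Y \<in> borel_measurable M" "Y' \<in> borel_measurable M"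
  and "(%n. pn (%r. X n r - Y r)) \<longlonglongrightarrow> 0" "(%n. pn (%r. X n r - Y' r)) \<longlonglongrightarrow> 0"
 shows "AE r in M. Y r = Y' r"
proof -
 have "(%n. pn (%r. X n r - Y r) + pn (%r. X n r - Y' r)) \<longlonglongrightarrow> 0 + 0" by (intro tendsto_add assms)
 moreover have "pn (%r. Y r - Y' r) <= pn (%r. X n r - Y r) + pn (%r. X n r - Y' r)" for n
  using pn_diff_triangle[of Y "X n" Y'] pn_minus_commute[of Y "X n"] by simp
 ultimately have "pn (%r. Y r - Y' r) <= 0" by (intro LIMSEQ_le_const) auto
 then have "AE r in M. Y r - Y' r = 0" by (intro pn_eq_0) auto
 then show ?thesis by eventually_elim simp
qed

end

lemma AE_reflect:
 assumes "AE x in lborel. P x" shows "AE x::real in lborel. P (t - x)"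
proof -
 obtain N where N: "{x. \<not> P x} \<subseteq> N" "emeasure lborel N = 0" "N \<in> sets borel" using AE_E[OF assms] by auto
 then have [measurable]: "N \<in> sets borel" by simp
 have "AE x in lborel. x \<notin> N" using N by (intro AE_not_in) (auto simp: null_sets_def)
 then have "AE x in lborel. t + (-1) * x \<notin> N" by (rule AE_borel_affine[rotated 2]) auto
 then show ?thesis using N(1) by (auto elim!: eventually_mono)
qed

lemma simple_integrand_reflect:
 assumes "simple_integrand g" shows "simple_integrand (%x. g (t - x))"
proof (rule simple_integrandI)
 show "finite (range (%x. g (t - x)))" by (rule finite_subset[OF _ simple_integrandD(1)[OF assms]]) auto
 show "(%x. g (t - x)) \<in> borel_measurable borel" using simple_integrandD(2)[OF assms] by measurable
 have "bounded {x. g x \<noteq> 0}" using assms by (simp add: simple_integrand_def)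
 then obtain a where a: "!!x. g x \<noteq> 0 ==> \<bar>x\<bar> <= a" by (auto simp: bounded_iff)
 have "\<bar>x\<bar> <= \<bar>t\<bar> + a" if "g (t - x) \<noteq> 0" for x using a[OF that] by linarith
 then show "bounded {x. g (t - x) \<noteq> 0}" by (auto simp: bounded_iff)
qed

lemma null_comparison:
 fixes a b :: "nat => real"
 assumes "b \<longlonglongrightarrow> 0 + 0" "!!k. a k <= b k" "!!k. 0 <= a k"
 shows "a \<longlonglongrightarrow> 0"
proof (rule Lim_null_comparison)
 show "eventually (%k. norm (a k) <= b k) sequentially" using assms by (simp add: always_eventually)
 show "b \<longlonglongrightarrow> 0" using assms(1) by simp
qed

context levy_noise
begin

lemma U_change_noise:
 assumes \<Lambda>': "levy_random_measure M L \<Lambda>'" and g: "simple_integrand g" and A: "A \<in> sets borel"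
 shows "AE r in M. U A g r = simple_stoch_integral \<Lambda>' A g r"
proof -
 have "AE r in M. \<forall>y\<in>range g - {0}. \<Lambda> (A \<inter> g -` {y}) r = \<Lambda>' (A \<inter> g -` {y}) r"
  using simple_integrandD(1)[OF g] by (intro AE_finite_allI \<Lambda>_unique[OF \<Lambda>'] level_set_bounded_borel g A) auto
 then show ?thesis by eventually_elim (simp add: simple_stoch_integral_def)
qed

lemma has_levy_integralE:
 assumes "has_levy_integral M L g X"
 obtains gs Y where "!!n::nat. simple_integrand (gs n)" "AE x in lborel. (%n. gs n x) \<longlonglongrightarrow> g x"
  "!!A. A \<in> sets borel ==> Y A \<in> borel_measurable M" "!!A. A \<in> sets borel ==> (%n. pn (%r. U A (gs n) r - Y A r)) \<longlonglongrightarrow> 0"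
  "Y UNIV = X"
proof -
 from assms have X [measurable]: "X \<in> borel_measurable M" by (simp add: has_levy_integral_def)
 from assms obtain \<Lambda>' gs where 1: "levy_random_measure M L \<Lambda>'" "!!n::nat. simple_integrand (gs n)"
  "AE x in lborel. (%n. gs n x) \<longlonglongrightarrow> g x"
  "\<forall>A\<in>sets borel. \<exists>Y\<^sub>A\<in>borel_measurable M. tendsto_in_prob M (%n. simple_stoch_integral \<Lambda>' A (gs n)) Y\<^sub>A sequentially"
  "tendsto_in_prob M (%n. simple_stoch_integral \<Lambda>' UNIV (gs n)) X sequentially"
  unfolding has_levy_integral_def by blast
 interpret N: levy_noise M L \<Lambda>' by unfold_locales (rule 1(1))
 have "\<forall>A. \<exists>Y. A \<in> sets borel --> Y \<in> borel_measurable M \<and> tendsto_in_prob M (%n. simple_stoch_integral \<Lambda>' A (gs n)) Y sequentially \<and> (A = UNIV --> Y = X)"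
  using 1(4,5) X by metis
 then obtain Y where Y: "!!A. A \<in> sets borel ==> Y A \<in> borel_measurable M"
  "!!A. A \<in> sets borel ==> tendsto_in_prob M (%n. simple_stoch_integral \<Lambda>' A (gs n)) (Y A) sequentially" "Y UNIV = X"
  by (metis sets.top space_borel)
 have conv: "(%n. pn (%r. U A (gs n) r - Y A r)) \<longlonglongrightarrow> 0" if A: "A \<in> sets borel" for A
 proof -
  note [measurable] = Y(1)[OF A] N.U_measurable[OF 1(2) A] U_measurable[OF 1(2) A]
  have "(%n. pn (%r. simple_stoch_integral \<Lambda>' A (gs n) r - Y A r)) \<longlonglongrightarrow> 0"
   using Y(2)[OF A] by (subst (asm) tendsto_in_prob_iff_pn) auto
  moreover have "pn (%r. simple_stoch_integral \<Lambda>' A (gs n) r - Y A r) = pn (%r. U A (gs n) r - Y A r)" for n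
  proof (rule pn_cong_AE)
   show "AE r in M. simple_stoch_integral \<Lambda>' A (gs n) r - Y A r = U A (gs n) r - Y A r"
    using U_change_noise[OF 1(1) 1(2)[of n] A] by eventually_elim simp
  qed measurable
  ultimately show ?thesis by simp
 qed
 show ?thesis by (rule that[OF 1(2,3) Y(1) conv Y(3)])
qed

text \<open>The approximating functions in the definition of the integral depend on \<open>t\<close>. Here one sequence of simple
kernels serves all \<open>t \<in> T\<close>: simple approximations of \<open>G\<close>, cut off to sets on which all the given
approximations are bounded too. On these sets \<open>U_null\<close> identifies the limits; the complement is negligible by
\<open>gliding_hump\<close>. The bound by \<open>2 \<bar>G\<bar>\<close> transfers the decay of \<open>G\<close> to the
kernels.\<close>
lemma kernel_approximation:
 fixes G :: "real => real" and X :: "real => 'a => real"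
 assumes T: "finite T" and G [measurable]: "G \<in> borel_measurable borel"
  and X: "!!t. t \<in> T ==> has_levy_integral M L (%s. G (t - s)) (X t)"
 obtains \<psi> where "!!i::nat. simple_integrand (\<psi> i)" "!!i u. \<bar>\<psi> i u\<bar> <= 2 * \<bar>G u\<bar>"
  "!!t. t \<in> T ==> (%i. pn (%r. U UNIV (%s. \<psi> i (t - s)) r - X t r)) \<longlonglongrightarrow> 0"
proof -
 define P where "P t gs Y \<longleftrightarrow> (\<forall>n::nat. simple_integrand (gs n)) \<and> (AE x in lborel. (%n. gs n x) \<longlonglongrightarrow> G (t - x)) \<and>
  (\<forall>A\<in>sets borel. Y A \<in> borel_measurable M \<and> (%n. pn (%r. U A (gs n) r - Y A r)) \<longlonglongrightarrow> 0) \<and> Y UNIV = X t" for t gs Y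
 have "\<exists>gs Y. P t gs Y" if t: "t \<in> T" for t
 proof (rule has_levy_integralE[OF X[OF t]])
  fix gs and Y :: "real set => 'a => real"
  assume "!!n::nat. simple_integrand (gs n)" "AE x in lborel. (%n. gs n x) \<longlonglongrightarrow> G (t - x)"
   "!!A. A \<in> sets borel ==> Y A \<in> borel_measurable M" "!!A. A \<in> sets borel ==> (%n. pn (%r. U A (gs n) r - Y A r)) \<longlonglongrightarrow> 0"
   "Y UNIV = X t"
  then have "P t gs Y" unfolding P_def by blast
  then show ?thesis by blast
 qed
 then obtain gs Y where "!!t. t \<in> T ==> P t (gs t) (Y t)" by metis
 then have gs: "!!t n. t \<in> T ==> simple_integrand (gs t (n::nat))" and glim: "!!t. t \<in> T ==> AE x in lborel. (%n. gs t n x) \<longlonglongrightarrow> G (t - x)"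
  and Y: "!!t A. t \<in> T ==> A \<in> sets borel ==> Y t A \<in> borel_measurable M"
  and Ylim: "!!t A. t \<in> T ==> A \<in> sets borel ==> (%n. pn (%r. U A (gs t n) r - Y t A r)) \<longlonglongrightarrow> 0"
  and YX: "!!t. t \<in> T ==> Y t UNIV = X t"
  unfolding P_def by blast+
 obtain \<psi>0 where \<psi>0: "!!k::nat. simple_function borel (\<psi>0 k)" "!!u. (%k. \<psi>0 k u) \<longlonglongrightarrow> G u" "!!k u. \<bar>\<psi>0 k u\<bar> <= 2 * \<bar>G u\<bar>"
  using borel_measurable_implies_sequence_metric[OF G, of 0] by auto
 note [measurable] = simple_integrandD(2)[OF gs]
 define E where "E i = {u. \<bar>u\<bar> <= real i \<and> (\<forall>t\<in>T. \<forall>n. \<bar>gs t n (t - u)\<bar> <= real i)}" for i :: nat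
 have Em [measurable]: "E i \<in> sets borel" for i
 proof -
  have "E i = {u \<in> space borel. \<bar>u\<bar> <= real i} \<inter> {u \<in> space borel. \<forall>t\<in>T. \<forall>n. \<bar>gs t n (t - u)\<bar> <= real i}" by (auto simp: E_def)
  also have "... \<in> sets borel"
   using T by (intro sets.Int sets.sets_Collect_finite_All sets.sets_Collect_countable_All) measurable
  finally show ?thesis .
 qed
 have Einc: "E i \<subseteq> E j" if "i <= j" for i j
 proof -
  have ij: "real i <= real j" using that by simp
  show ?thesis unfolding E_def using order_trans[OF _ ij] by blast
 qed
 define F where "F t i = {s. t - s \<in> E i}" for t i
 have Fm [measurable]: "F t i \<in> sets borel" for t i
 proof -
  have "F t i = (%s. t - s) -` E i \<inter> space borel" by (auto simp: F_def)
  also have "... \<in> sets borel" by (rule measurable_sets[OF _ Em]) measurable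
  finally show ?thesis .
 qed
 have Fb: "F t i \<in> bounded_borel" for t i
 proof -
  have "\<bar>s\<bar> <= \<bar>t\<bar> + real i" if "s \<in> F t i" for s using that by (auto simp: F_def E_def)
  then show ?thesis using Fm by (auto simp: bounded_borel_def bounded_iff)
 qed
 have Eev: "AE u in lborel. eventually (%i. u \<in> E i) sequentially"
 proof -
  have "AE u in lborel. \<forall>t\<in>T. (%n. gs t n (t - u)) \<longlonglongrightarrow> G (t - (t - u))"
   using T by (intro AE_finite_allI AE_reflect glim) auto
  then show ?thesis
  proof eventually_elim
   case (elim u)
   have "\<exists>K. \<forall>n. \<bar>gs t n (t - u)\<bar> <= K" if "t \<in> T" for t
   proof -
    have "Bseq (%n. gs t n (t - u))" using elim that by (intro convergent_imp_Bseq convergentI) auto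
    then show ?thesis by (auto simp: Bseq_def)
   qed
   then obtain K where K: "!!t n. t \<in> T ==> \<bar>gs t n (t - u)\<bar> <= K t" by metis
   define K1 where "K1 = \<bar>u\<bar> + (\<Sum>t\<in>T. \<bar>K t\<bar>)"
   have K1: "\<bar>gs t n (t - u)\<bar> <= K1" if "t \<in> T" for t n
   proof -
    have "\<bar>gs t n (t - u)\<bar> <= \<bar>K t\<bar>" using K[OF that, of n] by simp
    also have "... <= (\<Sum>t\<in>T. \<bar>K t\<bar>)" using that T by (intro member_le_sum) auto
    finally show ?thesis by (simp add: K1_def)
   qed
   have uK: "\<bar>u\<bar> <= K1" by (simp add: K1_def sum_nonneg)
   show ?case
   proof (rule eventually_sequentiallyI[of "nat \<lceil>K1\<rceil>"])
    fix i assume "nat \<lceil>K1\<rceil> <= i"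
    then have "K1 <= real i" by linarith
    then show "u \<in> E i" unfolding E_def using order_trans[OF K1] order_trans[OF uK] by blast
   qed
  qed
 qed
 have \<psi>Es: "simple_integrand (%u. indicator (E i) u * \<psi>0 k u)" for i k
  unfolding simple_integrand_def
 proof
  show "simple_function borel (%u. indicator (E i) u * \<psi>0 k u)"
   using \<psi>0(1) Em by (intro simple_function_mult simple_function_indicator) auto
  have "bounded (E i)" by (rule bounded_subset[of "cball 0 (real i)"]) (auto simp: E_def)
  then show "bounded {u. indicator (E i) u * \<psi>0 k u \<noteq> 0}" by (rule bounded_subset) (auto split: split_indicator_asm)
 qed
 note \<psi>r = simple_integrand_reflect[OF \<psi>Es]
 \<comment> \<open>On the set where the approximating functions stay bounded, both approximations have the same limit.\<close>
 have step1: "(%k. pn (%r. U UNIV (%s. indicator (E i) (t - s) * \<psi>0 k (t - s)) r - Y t (F t i) r)) \<longlonglongrightarrow> 0" if t: "t \<in> T" for t i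
 proof -
  define \<xi> where "\<xi> k s = gs t k s - indicator (E i) (t - s) * \<psi>0 k (t - s)" for k s
  have \<xi>: "simple_integrand (\<xi> k)" for k
   unfolding \<xi>_def using simple_integrand_compose[OF gs[OF t] \<psi>r, of "(-)"] by simp
  note [measurable] = U_measurable[OF \<xi> Fm] U_measurable[OF gs[OF t] Fm] U_measurable[OF \<psi>r] Y[OF t Fm]
  have "(%k. pn (U (F t i) (\<xi> k))) \<longlonglongrightarrow> 0"
  proof (rule U_null[OF \<xi> Fm Fb])
   have G: "AE s in lborel. s \<in> F t i --> \<bar>G (t - s)\<bar> <= real i"
    using glim[OF t]
   proof eventually_elim
    case (elim s)
    show ?case
    proof
     assume "s \<in> F t i"
     then have "\<bar>gs t n s\<bar> <= real i" for n using t by (auto simp: F_def E_def dest!: bspec[of T _ t])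
     then show "\<bar>G (t - s)\<bar> <= real i" using tendsto_rabs[OF elim] by (intro LIMSEQ_le_const2) auto
    qed
   qed
   show "AE s in lborel. \<bar>indicator (F t i) s * \<xi> k s\<bar> <= 3 * real i * indicator (F t i) s" for k
    using G
   proof eventually_elim
    case (elim s)
    show ?case
    proof (cases "s \<in> F t i")
     case True
     then have 1: "\<bar>gs t k s\<bar> <= real i" and E: "t - s \<in> E i" using t by (auto simp: F_def E_def dest!: bspec[of T _ t])
     have "\<bar>\<psi>0 k (t - s)\<bar> <= 2 * real i" using \<psi>0(3)[of k "t - s"] elim True by simp
     then show ?thesis using 1 E True abs_triangle_ineq4[of "gs t k s" "\<psi>0 k (t - s)"] by (simp add: \<xi>_def)
    qed simp
   qed
   show "AE s in lborel. (%k. indicator (F t i) s * \<xi> k s) \<longlonglongrightarrow> 0"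
    using glim[OF t]
   proof eventually_elim
    case (elim s)
    show ?case
    proof (cases "s \<in> F t i")
     case True
     have "(%k. gs t k s - \<psi>0 k (t - s)) \<longlonglongrightarrow> G (t - s) - G (t - s)" by (intro tendsto_diff elim \<psi>0(2))
     then show ?thesis using True by (simp add: \<xi>_def F_def)
    qed simp
   qed
  qed
  then have "(%k. pn (U (F t i) (\<xi> k)) + pn (%r. U (F t i) (gs t k) r - Y t (F t i) r)) \<longlonglongrightarrow> 0 + 0"
   by (intro tendsto_add Ylim t Fm)
  then show ?thesis
  proof (rule null_comparison)
   fix k
   have "AE r in M. U (F t i) (\<xi> k) r = U (F t i) (gs t k) r - U (F t i) (%s. indicator (E i) (t - s) * \<psi>0 k (t - s)) r"
    unfolding \<xi>_def by (rule U_diff[OF gs[OF t] \<psi>r Fm])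
   moreover have "AE r in M. U UNIV (%s. indicator (E i) (t - s) * \<psi>0 k (t - s)) r = U (F t i) (%s. indicator (E i) (t - s) * \<psi>0 k (t - s)) r"
   proof -
    have "indicator (F t i) s * (indicator (E i) (t - s) * \<psi>0 k (t - s)) = indicator (E i) (t - s) * \<psi>0 k (t - s)" for s
     by (auto simp: F_def split: split_indicator)
    then show ?thesis using U_indicator[OF \<psi>r[of i t k] Fm[of t i]] by (simp only:)
   qed
   ultimately have "pn (%r. U UNIV (%s. indicator (E i) (t - s) * \<psi>0 k (t - s)) r - Y t (F t i) r)
     = pn (%r. - U (F t i) (\<xi> k) r + (U (F t i) (gs t k) r - Y t (F t i) r))"
    by (intro pn_cong_AE) (auto elim: eventually_elim2)
   also have "... <= pn (%r. - U (F t i) (\<xi> k) r) + pn (%r. U (F t i) (gs t k) r - Y t (F t i) r)"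
    by (rule pn_triangle) auto
   finally show "pn (%r. U UNIV (%s. indicator (E i) (t - s) * \<psi>0 k (t - s)) r - Y t (F t i) r)
    <= pn (U (F t i) (\<xi> k)) + pn (%r. U (F t i) (gs t k) r - Y t (F t i) r)"
    by (simp add: pn_uminus)
  qed (rule pn_nonneg)
 qed
 \<comment> \<open>What is left out contributes little, by the gliding hump argument.\<close>
 have step2: "(%i. pn (%r. Y t (F t i) r - X t r)) \<longlonglongrightarrow> 0" if t: "t \<in> T" for t
 proof -
  note [measurable] = Y[OF t] U_measurable[OF gs[OF t]]
  have Xm [measurable]: "X t \<in> borel_measurable M" using Y[OF t, of UNIV] YX[OF t] by simp
  have "(%i. pn (Y t (- F t i))) \<longlonglongrightarrow> 0"
  proof (rule gliding_hump[where V = "%n A. U A (gs t n)"])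
   show "incseq (F t)" unfolding incseq_def F_def using Einc by blast
   show "\<exists>i. \<forall>B\<in>sets borel. B \<inter> F t i = {} --> pn (U B (gs t n)) <= ep" if "0 < ep" for n ep
   proof (rule ccontr)
    assume "\<not> ?thesis"
    then have "\<forall>i. \<exists>B. B \<in> sets borel \<and> B \<inter> F t i = {} \<and> ep < pn (U B (gs t n))" by (auto simp: not_le)
    then obtain B where B: "!!i. B i \<in> sets borel" "!!i. B i \<inter> F t i = {}" "!!i. ep < pn (U (B i) (gs t n))" by metis
    obtain c where c: "!!s. \<bar>gs t n s\<bar> <= c"
     using finite_imp_bounded[OF simple_integrandD(1)[OF gs[OF t, of n]]] by (auto simp: bounded_iff)
    have "(%i. pn (U (B i) (gs t n))) \<longlonglongrightarrow> 0"
    proof (rule U_null[OF gs[OF t] B(1) simple_integrandD(3)[OF gs[OF t, of n]]])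
     show "AE s in lborel. \<bar>indicator (B i) s * gs t n s\<bar> <= c * indicator {s. gs t n s \<noteq> 0} s" for i
      using c order_trans[OF abs_ge_zero c] by (intro AE_I2) (auto split: split_indicator)
     show "AE s in lborel. (%i. indicator (B i) s * gs t n s) \<longlonglongrightarrow> 0"
      using AE_reflect[OF Eev, of t]
     proof eventually_elim
      case (elim s)
      then have "eventually (%i. indicator (B i) s * gs t n s = 0) sequentially"
       by eventually_elim (use B(2) in \<open>auto simp: F_def split: split_indicator\<close>)
      then show ?case by (rule tendsto_eventually)
     qed
    qed
    from order_tendstoD(2)[OF this \<open>0 < ep\<close>] show False using B(3) by (auto simp: eventually_sequentially) (meson less_asym le_refl)
   qed
  qed (use t in \<open>auto intro: U_Un gs Ylim\<close>)
  moreover have dec: "AE r in M. X t r = Y t (F t i) r + Y t (- F t i) r" for i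
  proof (rule pn_limit_unique[of "%n. U UNIV (gs t n)"])
   have m: "- F t i \<in> sets borel" using Fm[of t i] by (simp add: borel_comp)
   note [measurable] = m
   show "U UNIV (gs t n) \<in> borel_measurable M" for n by measurable
   show "X t \<in> borel_measurable M" by measurable
   show "(%r. Y t (F t i) r + Y t (- F t i) r) \<in> borel_measurable M" by measurable
   show "(%n. pn (%r. U UNIV (gs t n) r - X t r)) \<longlonglongrightarrow> 0" using Ylim[OF t, of UNIV] YX[OF t] by simp
   have "(%n. pn (%r. U (F t i) (gs t n) r - Y t (F t i) r) + pn (%r. U (- F t i) (gs t n) r - Y t (- F t i) r)) \<longlonglongrightarrow> 0 + 0"
    by (intro tendsto_add Ylim t Fm m)
   then show "(%n. pn (%r. U UNIV (gs t n) r - (Y t (F t i) r + Y t (- F t i) r))) \<longlonglongrightarrow> 0"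
   proof (rule null_comparison)
    fix n
    have "AE r in M. U (F t i \<union> - F t i) (gs t n) r = U (F t i) (gs t n) r + U (- F t i) (gs t n) r"
     by (intro U_Un gs t Fm m) auto
    then have "AE r in M. U UNIV (gs t n) r = U (F t i) (gs t n) r + U (- F t i) (gs t n) r" by simp
    then have "pn (%r. U UNIV (gs t n) r - (Y t (F t i) r + Y t (- F t i) r)) =
     pn (%r. (U (F t i) (gs t n) r - Y t (F t i) r) + (U (- F t i) (gs t n) r - Y t (- F t i) r))"
     by (intro pn_cong_AE) (auto elim: eventually_mono)
    also have "... <= pn (%r. U (F t i) (gs t n) r - Y t (F t i) r) + pn (%r. U (- F t i) (gs t n) r - Y t (- F t i) r)"
     by (rule pn_triangle) auto
    finally show "pn (%r. U UNIV (gs t n) r - (Y t (F t i) r + Y t (- F t i) r))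
     <= pn (%r. U (F t i) (gs t n) r - Y t (F t i) r) + pn (%r. U (- F t i) (gs t n) r - Y t (- F t i) r)" .
   qed (rule pn_nonneg)
  qed
  have "AE r in M. Y t (F t i) r - X t r = - Y t (- F t i) r" for i
   using dec[of i] by eventually_elim simp
  then have "pn (%r. Y t (F t i) r - X t r) = pn (%r. - Y t (- F t i) r)" for i
   using Fm[of t i] by (intro pn_cong_AE) (auto simp: borel_comp)
  ultimately show ?thesis by (simp add: pn_uminus)
 qed
 have "\<exists>k. \<forall>t\<in>T. pn (%r. U UNIV (%s. indicator (E i) (t - s) * \<psi>0 k (t - s)) r - Y t (F t i) r) < 1 / real (Suc i)" for i
 proof -
  have "eventually (%k. \<forall>t\<in>T. pn (%r. U UNIV (%s. indicator (E i) (t - s) * \<psi>0 k (t - s)) r - Y t (F t i) r) < 1 / real (Suc i)) sequentially"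
   using T by (intro eventually_ball_finite ballI order_tendstoD(2)[OF step1]) auto
  then show ?thesis by (auto simp: eventually_sequentially)
 qed
 then obtain k where k: "!!i t. t \<in> T ==> pn (%r. U UNIV (%s. indicator (E i) (t - s) * \<psi>0 (k i) (t - s)) r - Y t (F t i) r) < 1 / real (Suc i)"
  by metis
 show ?thesis
 proof (rule that[of "%i u. indicator (E i) u * \<psi>0 (k i) u"])
  show "simple_integrand (%u. indicator (E i) u * \<psi>0 (k i) u)" for i by (rule \<psi>Es)
  show "\<bar>indicator (E i) u * \<psi>0 (k i) u\<bar> <= 2 * \<bar>G u\<bar>" for i u using \<psi>0(3)[of "k i" u] by (auto split: split_indicator)
  fix t assume t: "t \<in> T"
  note [measurable] = U_measurable[OF \<psi>r] Y[OF t Fm]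
  have [measurable]: "X t \<in> borel_measurable M" using Y[OF t, of UNIV] YX[OF t] by simp
  have "(%i. 1 / real (Suc i)) \<longlonglongrightarrow> 0" by real_asymp
  then have "(%i. 1 / real (Suc i) + pn (%r. Y t (F t i) r - X t r)) \<longlonglongrightarrow> 0 + 0" by (intro tendsto_add step2[OF t])
  then show "(%i. pn (%r. U UNIV (%s. indicator (E i) (t - s) * \<psi>0 (k i) (t - s)) r - X t r)) \<longlonglongrightarrow> 0"
  proof (rule null_comparison)
   fix i
   have "pn (%r. U UNIV (%s. indicator (E i) (t - s) * \<psi>0 (k i) (t - s)) r - X t r)
     <= pn (%r. U UNIV (%s. indicator (E i) (t - s) * \<psi>0 (k i) (t - s)) r - Y t (F t i) r) + pn (%r. Y t (F t i) r - X t r)"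
    by (rule pn_diff_triangle) measurable
   then show "pn (%r. U UNIV (%s. indicator (E i) (t - s) * \<psi>0 (k i) (t - s)) r - X t r) <= 1 / real (Suc i) + pn (%r. Y t (F t i) r - X t r)"
    using k[OF t, of i] by simp
  qed (rule pn_nonneg)
 qed
qed

end

section \<open>Finite models of independent blocks\<close>

context finite_model
begin

lemma avs_eq_sum:
 "avs j G s = (\<Sum>x\<in>PiE {..<j} S. (\<Prod>k<j. p k (x k)) * G (%k. if k < j then x k else s k))"
proof (induction j arbitrary: s)
 case (Suc j)
 have e: "PiE {..<Suc j} S = (%(y, x). x(j := y)) ` (S j \<times> PiE {..<j} S)"
  by (simp add: lessThan_Suc PiE_insert_eq)
 have inj: "inj_on (%(y, x). x(j := y)) (S j \<times> PiE {..<j} S)"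
  by (rule inj_combinator) simp
 have "(\<Sum>x\<in>PiE {..<Suc j} S. (\<Prod>k<Suc j. p k (x k)) * G (%k. if k < Suc j then x k else s k))
  = (\<Sum>(y, x)\<in>S j \<times> PiE {..<j} S. (\<Prod>k<Suc j. p k ((x(j := y)) k)) * G (%k. if k < Suc j then (x(j := y)) k else s k))"
  unfolding e by (subst sum.reindex[OF inj]) (simp add: o_def split_def)
 also have "... = (\<Sum>(y, x)\<in>S j \<times> PiE {..<j} S. p j y * ((\<Prod>k<j. p k (x k)) * G (%k. if k < j then x k else (s(j := y)) k)))"
 proof (intro sum.cong refl, clarify)
  fix y x
  have "(%k. if k < Suc j then (x(j := y)) k else s k) = (%k. if k < j then x k else (s(j := y)) k)" by (auto simp: fun_eq_iff)
  then show "(\<Prod>k<Suc j. p k ((x(j := y)) k)) * G (%k. if k < Suc j then (x(j := y)) k else s k)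
   = p j y * ((\<Prod>k<j. p k (x k)) * G (%k. if k < j then x k else (s(j := y)) k))"
   by (simp add: mult_ac)
 qed
 also have "... = av j (avs j G) s"
  by (simp add: av_def Suc.IH sum.cartesian_product[symmetric] sum_distrib_left)
 finally show ?case by simp
qed simp

end

definition model_states :: "'a measure => (nat => 'a => 's) => nat => 's set" where
 "model_states M Z k = Z k ` space M"

definition model_weight :: "'a measure => (nat => 'a => 's) => nat => 's => real" where
 "model_weight M Z k x = measure M {r\<in>space M. Z k r = x}"

context prob_space
begin

lemma expectation_finite_valued:
 fixes g :: "'s => 'b :: {banach, second_countable_topology}"
 assumes fin: "finite (Z ` space M)" and meas: "!!x. {r\<in>space M. Z r = x} \<in> events"
 shows "has_bochner_integral M (%r. g (Z r)) (\<Sum>x\<in>Z ` space M. prob {r\<in>space M. Z r = x} *\<^sub>R g x)"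
proof -
 have "has_bochner_integral M (%r. \<Sum>x\<in>Z ` space M. indicator {r\<in>space M. Z r = x} r *\<^sub>R g x) (\<Sum>x\<in>Z ` space M. prob {r\<in>space M. Z r = x} *\<^sub>R g x)"
  by (intro has_bochner_integral_sum has_bochner_integral_scaleR_left has_bochner_integral_real_indicator meas) (simp add: emeasure_eq_measure)
 moreover have "(\<Sum>x\<in>Z ` space M. indicator {r\<in>space M. Z r = x} r *\<^sub>R g x) = g (Z r)" if "r \<in> space M" for r
 proof -
  have "(\<Sum>x\<in>Z ` space M. indicator {r\<in>space M. Z r = x} r *\<^sub>R g x) = (\<Sum>x\<in>Z ` space M. if x = Z r then g x else 0)"
   using that by (intro sum.cong refl) (auto split: split_indicator)
  then show ?thesis using that fin by (simp add: sum.delta)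
 qed
 ultimately show "has_bochner_integral M (%r. g (Z r)) (\<Sum>x\<in>Z ` space M. prob {r\<in>space M. Z r = x} *\<^sub>R g x)"
  by (subst has_bochner_integral_cong[OF refl _ refl]) auto
qed

lemma independent_blocks_model:
 fixes Z :: "nat => 'a => 's" and G :: "(nat => 's) => real"
 assumes fin: "!!k. finite (Z k ` space M)" and meas: "!!k x. {r\<in>space M. Z k r = x} \<in> events"
  and ind: "!!x. prob {r\<in>space M. \<forall>k<m. Z k r = x k} = (\<Prod>k<m. prob {r\<in>space M. Z k r = x k})"
 shows "finite_model (model_states M Z) (model_weight M Z)"
  "(!!s s'. (!!k. k < m ==> s k = s' k) ==> G s = G s') ==>
   finite_model.EE m (model_states M Z) (model_weight M Z) G = expectation (%r. G (%k. Z k r))"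
  "(!!s s'. (!!k. k < m ==> s k = s' k) ==> G s = G s') ==> integrable M (%r. G (%k. Z k r))"
proof -
 interpret F: finite_model m "model_states M Z" "model_weight M Z"
 proof
  show "0 <= model_weight M Z k x" for k x by (simp add: model_weight_def)
  show "(\<Sum>x\<in>model_states M Z k. model_weight M Z k x) = 1" for k
   using expectation_finite_valued[OF fin[of k] meas[of k], of "%_. 1 :: real"]
   by (simp add: model_weight_def model_states_def has_bochner_integral_iff prob_space)
 qed
 show "finite_model (model_states M Z) (model_weight M Z)" by (rule F.finite_model_axioms)
 define R where "R r = (\<lambda>k\<in>{..<m}. Z k r)" for r
 let ?P = "PiE {..<m} (model_states M Z)"
 have RP: "R ` space M \<subseteq> ?P" by (simp only: image_subset_iff R_def restrict_PiE_iff model_states_def) auto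
 have finP: "finite ?P" by (intro finite_PiE) (auto simp: model_states_def fin)
 have Req: "{r\<in>space M. R r = x} = (if x \<in> extensional {..<m} then {r\<in>space M. \<forall>k<m. Z k r = x k} else {})" for x
 proof (cases "x \<in> extensional {..<m}")
  case True
  then have "R r = x \<longleftrightarrow> (\<forall>k<m. Z k r = x k)" for r
   unfolding R_def by (auto simp: fun_eq_iff extensional_def restrict_def)
  then show ?thesis using True by simp
 next
  case False
  then have "R r \<noteq> x" for r unfolding R_def by (metis restrict_extensional)
  then show ?thesis using False by simp
 qed
 have "(\<Inter>k\<in>{..<m}. {r\<in>space M. Z k r = x k}) \<inter> space M \<in> events" for x
  using meas by (cases "m = 0") (auto intro!: sets.finite_INT sets.Int)
 moreover have "(\<Inter>k\<in>{..<m}. {r\<in>space M. Z k r = x k}) \<inter> space M = {r\<in>space M. \<forall>k<m. Z k r = x k}" for x by auto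
 ultimately have Em: "{r\<in>space M. \<forall>k<m. Z k r = x k} \<in> events" for x by (simp only:)
 have Rm: "{r\<in>space M. R r = x} \<in> events" for x
  using Em[of x] Req[of x] by (cases "x \<in> extensional {..<m}") (simp_all only: if_True if_False sets.empty_sets)
 have GR: "G (%k. Z k r) = G (R r)" if G: "!!s s'. (!!k. k < m ==> s k = s' k) ==> G s = G s'" for r
  by (rule G[of "%k. Z k r" "R r"]) (simp add: R_def)
 have bochner: "has_bochner_integral M (%r. G (R r)) (\<Sum>x\<in>R ` space M. prob {r\<in>space M. R r = x} *\<^sub>R G x)"
  by (rule expectation_finite_valued[OF finite_subset[OF RP finP] Rm])
 show "integrable M (%r. G (%k. Z k r))" if G: "!!s s'. (!!k. k < m ==> s k = s' k) ==> G s = G s'"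
 proof -
  have "(%r. G (%k. Z k r)) = (%r. G (R r))" by (intro ext GR) (rule G)
  then show ?thesis using bochner by (simp add: has_bochner_integral_iff)
 qed
 assume G: "!!s s'. (!!k. k < m ==> s k = s' k) ==> G s = G s'"
 have "expectation (%r. G (%k. Z k r)) = expectation (%r. G (R r))"
  by (intro bintegral_cong refl GR) (rule G)
 also have "... = (\<Sum>x\<in>R ` space M. prob {r\<in>space M. R r = x} *\<^sub>R G x)"
  using bochner by (simp add: has_bochner_integral_iff)
 also have "... = (\<Sum>x\<in>?P. prob {r\<in>space M. R r = x} *\<^sub>R G x)"
 proof (rule sum.mono_neutral_left[OF finP RP], intro ballI)
  fix x assume "x \<in> ?P - R ` space M"
  then have "{r\<in>space M. R r = x} = {}" by auto
  then show "prob {r\<in>space M. R r = x} *\<^sub>R G x = 0" by (simp only: measure_empty scaleR_zero_left)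
 qed
 also have "... = (\<Sum>x\<in>?P. (\<Prod>k<m. model_weight M Z k (x k)) * G (%k. if k < m then x k else undefined k))"
 proof (intro sum.cong refl)
  fix x assume x: "x \<in> ?P"
  then have "x \<in> extensional {..<m}" by (simp add: PiE_def)
  moreover have "G x = G (%k. if k < m then x k else undefined k)" by (rule G[of x "%k. if k < m then x k else undefined k"]) simp
  ultimately show "prob {r\<in>space M. R r = x} *\<^sub>R G x = (\<Prod>k<m. model_weight M Z k (x k)) * G (%k. if k < m then x k else undefined k)"
   unfolding Req using ind[of x] by (simp add: model_weight_def)
 qed
 also have "... = F.EE G" unfolding F.EE_def by (rule F.avs_eq_sum[symmetric])
 finally show "F.EE G = expectation (%r. G (%k. Z k r))" by simp
qed

end

lemma one_minus_cos_average:
 fixes z :: real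
 shows "min 1 (z^2) <= 3 * (LINT v|gauss. 1 - cos (v * z))"
proof -
 interpret N: real_distribution gauss by (rule real_dist_normal_dist)
 have i: "integrable gauss (%v. iexp (z * v))" by (rule N.integrable_iexp) simp_all
 have "(LINT v|gauss. cos (v * z)) = Re (char gauss z)"
  unfolding char_def using integral_Re[OF i] by (simp add: Re_exp mult.commute)
 also have "... = exp (- z\<^sup>2 / 2)" by (simp add: char_std_normal_distribution Re_exp exp_of_real flip: of_real_exp)
 finally have "(LINT v|gauss. 1 - cos (v * z)) = 1 - exp (- z\<^sup>2 / 2)"
  using N.prob_space by (subst bintegral_diff) (auto intro!: N.integrable_const_bound[where B = 1])
 then show ?thesis using N.one_minus_exp_lower[of z] by simp
qed

lemma double_sum_cos:
 fixes q y :: "'s => real"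
 shows "(\<Sum>a\<in>S. q a * (\<Sum>b\<in>S. q b * cos (v * (y a - y b)))) = (norm (\<Sum>a\<in>S. q a *\<^sub>R iexp (v * y a)))^2"
proof -
 let ?c = "\<Sum>a\<in>S. q a * cos (v * y a)" and ?s = "\<Sum>a\<in>S. q a * sin (v * y a)"
 have "Re (\<Sum>a\<in>S. q a *\<^sub>R iexp (v * y a)) = ?c" "Im (\<Sum>a\<in>S. q a *\<^sub>R iexp (v * y a)) = ?s"
  by (simp_all add: Re_exp Im_exp)
 then have "(norm (\<Sum>a\<in>S. q a *\<^sub>R iexp (v * y a)))^2 = ?c^2 + ?s^2" by (simp only: cmod_power2)
 also have "... = (\<Sum>a\<in>S. q a * (\<Sum>b\<in>S. q b * cos (v * (y a - y b))))"
  by (simp add: power2_eq_square sum_product right_diff_distrib cos_diff sum_distrib_left sum.distrib distrib_left mult_ac)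
 finally show ?thesis by simp
qed

context finite_model
begin

lemma E2_truncated_square:
 fixes y :: "'s => real"
 shows "E2 k (%a b. (min 1 \<bar>y a - y b\<bar>)^2)
  <= 3 * (LINT v|gauss. 1 - (norm (\<Sum>a\<in>S k. p k a *\<^sub>R iexp (v * y a)))^2)"
proof -
 interpret N: real_distribution gauss by (rule real_dist_normal_dist)
 have sq: "(min 1 \<bar>z\<bar>)^2 <= min 1 (z^2)" for z :: real
  using abs_square_le_1[of z] by (cases "\<bar>z\<bar> <= 1") (auto simp: min_def)
 have i: "integrable gauss (%v. cos (v * z))" for z
  by (rule N.integrable_const_bound[where B = 1]) auto
 have i1: "integrable gauss (%v. 1 - cos (v * z))" for z using i by simp
 have "E2 k (%a b. (min 1 \<bar>y a - y b\<bar>)^2) <= E2 k (%a b. 3 * (LINT v|gauss. 1 - cos (v * (y a - y b))))"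
  by (intro E2_mono order_trans[OF sq one_minus_cos_average])
 also have "... = 3 * (LINT v|gauss. E2 k (%a b. 1 - cos (v * (y a - y b))))"
  by (simp add: E2_cmult E2_def i1 integrable_sum)
 also have "(LINT v|gauss. E2 k (%a b. 1 - cos (v * (y a - y b)))) =
  (LINT v|gauss. 1 - (norm (\<Sum>a\<in>S k. p k a *\<^sub>R iexp (v * y a)))^2)"
 proof (intro bintegral_cong refl)
  fix v
  have "E2 k (%a b. 1 - cos (v * (y a - y b))) = 1 - (\<Sum>a\<in>S k. p k a * (\<Sum>b\<in>S k. p k b * cos (v * (y a - y b))))"
   by (simp add: E2_def right_diff_distrib sum_subtractf p_sum)
  then show "E2 k (%a b. 1 - cos (v * (y a - y b))) = 1 - (norm (\<Sum>a\<in>S k. p k a *\<^sub>R iexp (v * y a)))^2"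
   by (simp only: double_sum_cos)
 qed
 finally show ?thesis .
qed

end

context prob_space
begin

text \<open>The difference of two independent copies has the characteristic function \<open>(norm (chf Y v))^2\<close>.\<close>
lemma model_increment_bound:
 fixes Z :: "nat => 'a => 'i => real"
 assumes fin: "!!k. finite (Z k ` space M)" and meas: "!!k x. {r\<in>space M. Z k r = x} \<in> events"
  and F: "finite_model (model_states M Z) (model_weight M Z)" and Zt: "(%r. Z k r t) \<in> borel_measurable M"
 shows "finite_model.E2 (model_states M Z) (model_weight M Z) k (%x y. (min 1 \<bar>x t - y t\<bar>)^2)
  <= 3 * (LINT v|gauss. 1 - (norm (chf (%r. Z k r t) v))^2)"
proof -
 interpret F: finite_model 0 "model_states M Z" "model_weight M Z" by (rule F)
 have "(\<Sum>x\<in>model_states M Z k. model_weight M Z k x *\<^sub>R iexp (v * x t)) = chf (%r. Z k r t) v" for v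
  using expectation_finite_valued[OF fin[of k] meas[of k], of "%x. iexp (v * x t)"]
  by (simp add: chf_eq[OF Zt] model_states_def model_weight_def has_bochner_integral_iff del: of_real_mult)
 then show ?thesis using F.E2_truncated_square[of k "%x. x t"] by simp
qed

end

section \<open>Finite models of the moving average\<close>

lemma norm_one_minus: "0 <= a ==> a <= 1 ==> norm (1 - a :: real) <= 1" by auto

context prob_space
begin

lemma independent_blocks_product:
 fixes \<xi> :: "nat \<times> 'v => 'a => real" and h :: "nat => 'i => (nat \<times> 'v => real) => real"
 assumes ind: "indep_vars (%_. borel) \<xi> ({..<m} \<times> V)" and T: "finite T"
  and h: "!!k t. k < m ==> t \<in> T ==> h k t \<in> borel_measurable (PiM ({k} \<times> V) (%_. borel))"
 defines "Z \<equiv> %k r t. if k < m \<and> t \<in> T then h k t (restrict (%i. \<xi> i r) ({k} \<times> V)) else 0"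
 shows "{r\<in>space M. Z k r = x} \<in> events"
  "prob {r\<in>space M. \<forall>k<m. Z k r = y k} = (\<Prod>k<m. prob {r\<in>space M. Z k r = y k})"
proof -
 define W where "W k r = restrict (%i. \<xi> i r) ({k} \<times> V)" for k r
 have W: "indep_vars (%k. PiM ({k} \<times> V) (%_. borel)) W {..<m}"
  unfolding W_def[abs_def] by (rule indep_vars_restrict[OF ind]) (auto simp: disjoint_family_on_def)
 have Wm: "W k \<in> measurable M (PiM ({k} \<times> V) (%_. borel))" if "k < m" for k
  using W that by (auto simp: indep_vars_def)
 define A where "A k x = (if \<forall>t. t \<notin> T --> x t = 0 then {u\<in>space (PiM ({k} \<times> V) (%_. borel)). \<forall>t\<in>T. h k t u = x t} else {})" for k and x :: "'i => real"
 have A: "A k x \<in> sets (PiM ({k} \<times> V) (%_. borel))" if k: "k < m" for k x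
 proof -
  have "{u\<in>space (PiM ({k} \<times> V) (%_. borel)). \<forall>t\<in>T. h k t u = x t} \<in> sets (PiM ({k} \<times> V) (%_. borel))"
   using T
  proof (rule sets.sets_Collect_finite_All[rotated])
   fix t assume "t \<in> T"
   note [measurable] = h[OF k this]
   show "{u\<in>space (PiM ({k} \<times> V) (%_. borel)). h k t u = x t} \<in> sets (PiM ({k} \<times> V) (%_. borel))" by measurable
  qed
  then show ?thesis by (simp add: A_def)
 qed
 have ZA: "{r\<in>space M. Z k r = x} = W k -` A k x \<inter> space M" if k: "k < m" for k x
 proof -
  have "Z k r = x \<longleftrightarrow> W k r \<in> A k x" if "r \<in> space M" for r
  proof -
   have "W k r \<in> space (PiM ({k} \<times> V) (%_. borel))" by (rule measurable_space[OF Wm[OF k] that])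
   then show ?thesis using k by (auto simp: A_def Z_def W_def[symmetric] fun_eq_iff)
  qed
  then show ?thesis by auto
 qed
 show "{r\<in>space M. Z k r = x} \<in> events"
 proof (cases "k < m")
  case True then show ?thesis using measurable_sets[OF Wm[OF True] A[OF True]] by (simp add: ZA)
 next
  case False
  then have "Z k r = (%t. 0)" for r by (simp add: Z_def)
  then show ?thesis by (cases "x = (%t. 0)") auto
 qed
 show "prob {r\<in>space M. \<forall>k<m. Z k r = y k} = (\<Prod>k<m. prob {r\<in>space M. Z k r = y k})"
 proof (cases "m = 0")
  case True then show ?thesis by (simp add: prob_space)
 next
  case False
  have "prob (\<Inter>k\<in>{..<m}. W k -` A k (y k) \<inter> space M) = (\<Prod>k\<in>{..<m}. prob (W k -` A k (y k) \<inter> space M))"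
   using False A by (intro indep_varsD_finite[OF W]) auto
  moreover have "(\<Inter>k\<in>{..<m}. W k -` A k (y k) \<inter> space M) = {r\<in>space M. \<forall>k<m. Z k r = y k}"
  proof -
   have "(\<Inter>k\<in>{..<m}. W k -` A k (y k) \<inter> space M) = (\<Inter>k\<in>{..<m}. {r\<in>space M. Z k r = y k})"
    using ZA by (intro INF_cong refl) simp
   then show ?thesis using False by auto
  qed
  ultimately show ?thesis by (simp add: ZA)
 qed
qed

lemma pn_tendsto_AE:
 assumes [measurable]: "!!n::nat. X n \<in> borel_measurable M" and lim: "AE r in M. (%n. X n r) \<longlonglongrightarrow> 0"
 shows "(%n. pn (X n)) \<longlonglongrightarrow> 0"
proof -
 have "(%n. pn (X n)) \<longlonglongrightarrow> expectation (%_. 0)"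
  unfolding pn_def
 proof (rule integral_dominated_convergence[where w = "%_. 1"])
  show "AE r in M. (%n. min 1 \<bar>X n r\<bar>) \<longlonglongrightarrow> 0"
   using lim
  proof eventually_elim
   case (elim r)
   have "(%n. min 1 \<bar>X n r\<bar>) \<longlonglongrightarrow> min 1 \<bar>0\<bar>" by (intro tendsto_min tendsto_const tendsto_rabs elim)
   then show ?case by simp
  qed
 qed auto
 then show ?thesis by simp
qed

text \<open>An upper bound for \<open>E (min 1 \<bar>Y - Y'\<bar>)^2\<close> with \<open>Y'\<close> an independent copy of
\<open>Y\<close>. It depends on the characteristic function only and is continuous under almost sure convergence.\<close>
definition spread :: "('a => real) => real" where
 "spread Y = 3 * (LINT v|gauss. 1 - (norm (chf Y v))^2)"

lemma spread_tendsto: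
 assumes [measurable]: "!!n::nat. X n \<in> borel_measurable M" "Y \<in> borel_measurable M" and lim: "AE r in M. (%n. X n r) \<longlonglongrightarrow> Y r"
 shows "(%n. spread (X n)) \<longlonglongrightarrow> spread Y"
proof -
 interpret N: real_distribution gauss by (rule real_dist_normal_dist)
 have cm [measurable]: "chf W \<in> borel_measurable borel" if "W \<in> borel_measurable M" for W
  by (rule real_distribution.char_measurable[OF real_distribution_distr'[OF that]])
 have b: "norm (chf W v) <= 1" if "W \<in> borel_measurable M" for W v
  by (rule real_distribution.cmod_char_le_1[OF real_distribution_distr'[OF that]])
 show ?thesis
  unfolding spread_def
 proof (intro tendsto_mult_left integral_dominated_convergence[where w = "%_. 1"])
  show "AE v in gauss. (%n. 1 - (norm (chf (X n) v))^2) \<longlonglongrightarrow> 1 - (norm (chf Y v))^2"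
   by (intro AE_I2 tendsto_intros chf_tendsto_AE lim) auto
  show "AE v in gauss. norm (1 - (norm (chf (X n) v))^2) <= 1" for n
   by (intro AE_I2 norm_one_minus power_le_one b) auto
 qed (use N.prob_space in \<open>auto simp: N.integrable_const\<close>)
qed

lemma spread_eq_0:
 assumes [measurable]: "Y \<in> borel_measurable M" and Y: "AE r in M. Y r = c"
 shows "spread Y = 0"
proof -
 have "chf Y v = iexp (v * c)" for v
 proof -
  have "chf Y v = chf (%_. c) v" by (rule chf_cong_AE) (use Y in auto)
  also have "... = iexp (v * c)" by (subst chf_eq) (auto simp: prob_space)
  finally show ?thesis .
 qed
 then show ?thesis by (simp add: spread_def)
qed

end

locale moving_average = levy_noise M L \<Lambda> for M :: "'a measure" and L \<Lambda> +
 fixes G :: "real => real" and X :: "real => 'a => real" and \<eta> \<alpha> \<beta> K :: real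
 assumes G_meas: "G \<in> borel_measurable borel"
  and X_int: "!!t. has_levy_integral M L (%s. G (t - s)) (X t)"
  and exponent: "!!v. - Re (w v) <= \<eta> * \<bar>v\<bar> powr \<beta>" "0 <= \<eta>"
  and \<beta>: "0 < \<beta>" "\<beta> <= 2" and \<alpha>: "0 < \<alpha>" and K: "0 < K"
  and G_past: "!!u. u < 0 ==> G u = 0"
  and G_le: "!!u. 1 <= u ==> \<bar>G u\<bar> <= K * u powr (- \<alpha>)"
begin

lemma X_measurable [measurable]: "X t \<in> borel_measurable M" using X_int[of t] by (simp add: has_levy_integral_def)

text \<open>\<open>1 - (norm (chf v))^2 \<le> - 2 \<integral> Re (w (v \<psi>)) \<le> 2 \<eta> \<bar>v\<bar> powr \<beta>
\<integral> (2 \<bar>G\<bar>) powr \<beta>\<close>, where \<open>\<bar>G u\<bar> \<le> K u powr (- \<alpha>)\<close> on the block;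
the constant 12 is 3 times 2 times a bound 2 for the Gaussian moment of order \<open>\<beta>\<close>.\<close>
lemma block_spread:
 fixes k t :: int
 assumes \<psi>: "simple_integrand \<psi>" and b: "!!u. \<bar>\<psi> u\<bar> <= 2 * \<bar>G u\<bar>" and t: "k < t"
 defines "A \<equiv> {real_of_int k - 1<..real_of_int k}"
 shows "spread (U A (%s. \<psi> (of_int t - s))) <= 12 * \<eta> * (2 * K) powr \<beta> * real_of_int (t - k) powr (- (\<alpha> * \<beta>))"
proof -
 define c where "c = \<eta> * ((2 * K) powr \<beta> * real_of_int (t - k) powr (- (\<alpha> * \<beta>)))"
 have c0: "0 <= c" unfolding c_def using exponent(2) by simp
 have A: "A \<in> sets borel" by (simp add: A_def)
 let ?g = "%s. \<psi> (of_int t - s)"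
 note g = simple_integrand_reflect[OF \<psi>, of "real_of_int t"]
 have bound: "1 - (norm (chf (U A ?g) v))^2 <= 2 * c * \<bar>v\<bar> powr \<beta>" for v
 proof -
  let ?I = "LINT x|lborel. indicator A x *\<^sub>R w (v * ?g x)"
  have i: "integrable lborel (%x. indicator A x *\<^sub>R w (v * ?g x))"
   using integral_simple_levels[OF g A, of "%y. w (v * y)"] by (simp add: w(3) has_bochner_integral_iff)
  have "- Re ?I = (LINT x|lborel. indicator A x * (- Re (w (v * ?g x))))"
   using integral_Re[OF i] by simp
  also have "... <= (LINT x|lborel. indicator A x * (c * \<bar>v\<bar> powr \<beta>))"
  proof (rule integral_mono)
   show "integrable lborel (%x. indicator A x * - Re (w (v * ?g x)))" using integrable_Re[OF i] by simp
   show "integrable lborel (%x. indicator A x * (c * \<bar>v\<bar> powr \<beta>))"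
    by (intro integrable_mult_left integrable_real_indicator) (auto simp: A_def)
   fix x
   show "indicator A x * - Re (w (v * ?g x)) <= indicator A x * (c * \<bar>v\<bar> powr \<beta>)"
   proof (cases "x \<in> A")
    case True
    have u: "real_of_int (t - k) <= real_of_int t - x" "1 <= real_of_int (t - k)" using True t by (auto simp: A_def)
    then have u1: "1 <= real_of_int t - x" by simp
    have "\<bar>?g x\<bar> <= 2 * (K * (real_of_int t - x) powr (- \<alpha>))" using b[of "real_of_int t - x"] G_le[OF u1] by simp
    also have "... <= 2 * (K * real_of_int (t - k) powr (- \<alpha>))"
     using u K \<alpha> by (intro mult_left_mono powr_mono2') auto
    finally have "\<bar>?g x\<bar> powr \<beta> <= (2 * K * real_of_int (t - k) powr (- \<alpha>)) powr \<beta>"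
     using \<beta> by (intro powr_mono2) auto
    also have "... = (2 * K) powr \<beta> * real_of_int (t - k) powr (- (\<alpha> * \<beta>))"
     using K t by (simp add: powr_mult powr_powr)
    finally have "\<eta> * (\<bar>v\<bar> powr \<beta> * \<bar>?g x\<bar> powr \<beta>) <= \<eta> * (\<bar>v\<bar> powr \<beta> * ((2 * K) powr \<beta> * real_of_int (t - k) powr (- (\<alpha> * \<beta>))))"
     using exponent(2) by (intro mult_left_mono) auto
    then have "\<eta> * \<bar>v * ?g x\<bar> powr \<beta> <= c * \<bar>v\<bar> powr \<beta>"
     by (simp add: c_def abs_mult powr_mult mult_ac)
    then show ?thesis using True exponent(1)[of "v * ?g x"] by simp
   qed simp
  qed
  also have "... = c * \<bar>v\<bar> powr \<beta>" by (simp add: A_def)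
  finally have "- Re ?I <= c * \<bar>v\<bar> powr \<beta>" .
  moreover have "(norm (chf (U A ?g) v))^2 = exp (2 * Re ?I)"
   unfolding chf_U[OF g A] by (simp add: exp_double)
  moreover have "1 + 2 * Re ?I <= exp (2 * Re ?I)" by (rule exp_ge_add_one_self)
  ultimately show ?thesis by linarith
 qed
 interpret N: real_distribution gauss by (rule real_dist_normal_dist)
 have "(LINT v|gauss. 1 - (norm (chf (U A ?g) v))^2) <= (LINT v|gauss. 2 * c * \<bar>v\<bar> powr \<beta>)"
 proof (rule integral_mono)
  have m: "U A ?g \<in> borel_measurable M" by (rule U_measurable[OF g A])
  have [measurable]: "chf (U A ?g) \<in> borel_measurable borel"
   by (rule real_distribution.char_measurable[OF real_distribution_distr'[OF m]])
  have b: "norm (chf (U A ?g) v) <= 1" for v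
   by (rule real_distribution.cmod_char_le_1[OF real_distribution_distr'[OF m]])
  show "integrable gauss (%v. 1 - (norm (chf (U A ?g) v))^2)"
   by (rule N.integrable_const_bound[where B = 1]) (auto intro!: AE_I2 norm_one_minus[unfolded real_norm_def] power_le_one b)
  show "integrable gauss (%v. 2 * c * \<bar>v\<bar> powr \<beta>)"
   using std_normal_abs_powr_moment(1)[of \<beta>] \<beta> by simp
 qed (rule bound)
 also have "... <= 2 * c * 2"
  using mult_left_mono[OF std_normal_abs_powr_moment(2)[of \<beta>], of "2 * c"] \<beta> c0 by simp
 finally show ?thesis by (simp add: spread_def c_def)
qed

lemma future_block_zero:
 fixes k t :: int
 assumes \<psi>: "simple_integrand \<psi>" and b: "!!u. \<bar>\<psi> u\<bar> <= 2 * \<bar>G u\<bar>" and t: "t < k"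
 shows "AE r in M. U {real_of_int k - 1<..real_of_int k} (%s. \<psi> (of_int t - s)) r = 0"
proof -
 have "AE r in M. U {real_of_int k - 1<..real_of_int k} (%s. \<psi> (of_int t - s)) r = (\<Sum>j\<in>({} :: nat set). 0 * \<Lambda> {} r)"
 proof (rule U_eq_sum[OF simple_integrand_reflect[OF \<psi>]])
  fix x assume x: "x \<in> {real_of_int k - 1<..real_of_int k}" "\<psi> (of_int t - x) \<noteq> 0"
  have "real_of_int t <= real_of_int k - 1" using t by linarith
  then have "G (real_of_int t - x) = 0" using x(1) by (intro G_past) auto
  then show "x \<in> (\<Union>j\<in>{}. {})" using b[of "real_of_int t - x"] x(2) by simp
 qed (auto simp: disjoint_family_on_def)
 then show ?thesis by simp
qed

end

abbreviation (input) gap :: "int set => (int => real) => (int => real) => real" where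
 "gap T x y \<equiv> \<Sum>t\<in>T. min 1 \<bar>x t - y t\<bar>"
abbreviation (input) block :: "int => real set" where "block k \<equiv> {real_of_int k - 1<..real_of_int k}"

context moving_average
begin

text \<open>For finitely many times, a simple kernel takes finitely many vectors of values; \<open>D (k, v)\<close> is the part of
block \<open>k\<close> where the vector is \<open>v\<close>.\<close>
lemma block_decomposition:
 fixes T :: "int set"
 assumes \<psi>: "simple_integrand \<psi>" and T: "finite T"
 obtains m :: nat and lo :: int and V :: "(int => real) set" and D :: "nat \<times> (int => real) => real set" where
  "finite V" "disjoint_family_on D ({..<m} \<times> V)" "!!i. i \<in> {..<m} \<times> V ==> D i \<in> bounded_borel"
  "!!t. t \<in> T ==> AE r in M. U UNIV (%s. \<psi> (of_int t - s)) r = (\<Sum>k<m. \<Sum>v\<in>V. v t * \<Lambda> (D (k, v)) r)"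
  "!!k t. k < m ==> t \<in> T ==> AE r in M. U (block (lo + int k)) (%s. \<psi> (of_int t - s)) r = (\<Sum>v\<in>V. v t * \<Lambda> (D (k, v)) r)"
proof -
 obtain R where R: "!!u. \<psi> u \<noteq> 0 ==> \<bar>u\<bar> <= R"
  using \<psi> unfolding simple_integrand_def by (auto simp: bounded_iff)
 define B where "B = \<bar>R\<bar> + (\<Sum>t\<in>T. \<bar>real_of_int t\<bar>)"
 have supp: "\<bar>x\<bar> <= B" if "t \<in> T" "\<psi> (of_int t - x) \<noteq> 0" for t x
 proof -
  have "\<bar>real_of_int t\<bar> <= (\<Sum>t\<in>T. \<bar>real_of_int t\<bar>)" using that(1) T by (intro member_le_sum) auto
  then show ?thesis using R[OF that(2)] unfolding B_def by linarith
 qed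
 define q where "q = nat \<lceil>B\<rceil>"
 define lo where "lo = - int q"
 define m where "m = 2 * q + 1"
 define \<Phi> where "\<Phi> x t = (if t \<in> T then \<psi> (of_int t - x) else 0)" for x t
 define V where "V = range \<Phi>"
 define I where "I k = (block (lo + int k))" for k
 define D where "D i = I (fst i) \<inter> \<Phi> -` {snd i}" for i
 have finV: "finite V"
 proof (rule finite_subset)
  show "V \<subseteq> {f. \<forall>t. (t \<in> T --> f t \<in> range \<psi>) \<and> (t \<notin> T --> f t = 0)}" by (auto simp: V_def \<Phi>_def)
  show "finite {f. \<forall>t. (t \<in> T --> f t \<in> range \<psi>) \<and> (t \<notin> T --> f t = (0::real))}"
   by (intro finite_set_of_finite_funs T simple_integrandD(1)[OF \<psi>])
 qed
 have \<Phi>m: "\<Phi> -` {v} \<in> sets borel" for v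
 proof -
  note [measurable] = simple_integrandD(2)[OF \<psi>]
  have "\<Phi> -` {v} = (if \<forall>t. t \<notin> T --> v t = 0 then {x\<in>space borel. \<forall>t\<in>T. \<psi> (of_int t - x) = v t} else {})"
   by (auto simp: \<Phi>_def fun_eq_iff)
  moreover have "{x\<in>space borel. \<forall>t\<in>T. \<psi> (of_int t - x) = v t} \<in> sets borel"
   using T by (intro sets.sets_Collect_finite_All) measurable
  ultimately show ?thesis by simp
 qed
 have I_iff: "x \<in> I k \<longleftrightarrow> \<lceil>x\<rceil> = lo + int k" for x k
  unfolding I_def by (auto simp: ceiling_eq_iff)
 have D: "D i \<in> bounded_borel" for i
  unfolding D_def I_def by (intro bounded_borel_Int \<Phi>m) simp
 have dis: "disjoint_family_on D J" for J
  unfolding disjoint_family_on_def D_def by (auto simp: I_iff prod_eq_iff)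
 show ?thesis
 proof (rule that[OF finV dis D])
  fix t assume t: "t \<in> T"
  have "AE r in M. U UNIV (%s. \<psi> (of_int t - s)) r = (\<Sum>i\<in>{..<m} \<times> V. snd i t * \<Lambda> (D i) r)"
  proof (rule U_eq_sum[OF simple_integrand_reflect[OF \<psi>] _ dis D])
   show "finite ({..<m} \<times> V)" using finV by simp
   show "\<psi> (of_int t - x) = snd i t" if "x \<in> D i" for i x
   proof -
    have "\<Phi> x = snd i" using that by (simp add: D_def)
    then have "\<Phi> x t = snd i t" by simp
    then show ?thesis using t by (simp add: \<Phi>_def)
   qed
   fix x assume "\<psi> (of_int t - x) \<noteq> 0"
   then have "\<bar>x\<bar> <= B" by (rule supp[OF t])
   then have "- int q <= \<lceil>x\<rceil>" "\<lceil>x\<rceil> <= int q" unfolding q_def by linarith+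
   then have "x \<in> D (nat (\<lceil>x\<rceil> + int q), \<Phi> x)" "nat (\<lceil>x\<rceil> + int q) < m" by (auto simp: D_def I_iff lo_def m_def)
   then show "x \<in> (\<Union>i\<in>{..<m} \<times> V. D i)" unfolding V_def by blast
  qed simp
  then show "AE r in M. U UNIV (%s. \<psi> (of_int t - s)) r = (\<Sum>k<m. \<Sum>v\<in>V. v t * \<Lambda> (D (k, v)) r)"
   by (simp add: sum.cartesian_product split_def)
  fix k assume "k < m"
  show "AE r in M. U (block (lo + int k)) (%s. \<psi> (of_int t - s)) r = (\<Sum>v\<in>V. v t * \<Lambda> (D (k, v)) r)"
  proof (rule U_eq_sum[OF simple_integrand_reflect[OF \<psi>] finV _ D])
   show "disjoint_family_on (%v. D (k, v)) V" by (auto simp: disjoint_family_on_def D_def)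
   show "\<psi> (of_int t - x) = v t" if "x \<in> D (k, v)" for v x
   proof -
    have "\<Phi> x = v" using that by (simp add: D_def)
    then have "\<Phi> x t = v t" by simp
    then show ?thesis using t by (simp add: \<Phi>_def)
   qed
  qed (auto simp: D_def V_def I_def)
 qed
qed

lemma powr_shift_le:
 fixes j :: int assumes "0 < j" "0 < a"
 shows "real_of_int j powr (- a) <= 2 powr a * (1 + real_of_int j) powr (- a)"
proof -
 have "(2 * real_of_int j) powr (- a) <= (1 + real_of_int j) powr (- a)"
  using assms by (intro powr_mono2') auto
 then have "2 powr a * (2 * real_of_int j) powr (- a) <= 2 powr a * (1 + real_of_int j) powr (- a)"
  by (rule mult_left_mono) simp
 moreover have "2 powr a * (2 * real_of_int j) powr (- a) = real_of_int j powr (- a)"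
  using assms by (simp add: powr_mult powr_minus field_simps)
 ultimately show ?thesis by simp
qed

definition decay_const :: real where
 "decay_const = 1 + 12 * \<eta> * (2 * K) powr \<beta> * 2 powr (\<alpha> * \<beta>)"

abbreviation (input) "block_decay lo k t \<equiv> decay_const * decay (\<alpha> * \<beta> / 2) (t - (lo + int k))"

lemma decay_const_ge: "1 <= decay_const" using exponent(2) by (simp add: decay_const_def)

lemma block_spread_decay:
 fixes k t :: int
 assumes \<psi>: "simple_integrand \<psi>" and b: "!!u. \<bar>\<psi> u\<bar> <= 2 * \<bar>G u\<bar>" and t: "k < t"
 shows "spread (U (block k) (%s. \<psi> (of_int t - s))) < (decay_const * decay (\<alpha> * \<beta> / 2) (t - k))^2"
proof -
 define e where "e = (1 + real_of_int (t - k)) powr (- (\<alpha> * \<beta>))"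
 define c where "c = 12 * \<eta> * (2 * K) powr \<beta> * 2 powr (\<alpha> * \<beta>)"
 have e: "0 < e" using t by (simp add: e_def)
 have c: "0 <= c" using exponent(2) by (simp add: c_def)
 have "spread (U (block k) (%s. \<psi> (of_int t - s))) <= 12 * \<eta> * (2 * K) powr \<beta> * real_of_int (t - k) powr (- (\<alpha> * \<beta>))"
  by (rule block_spread[OF \<psi> b t])
 also have "... <= 12 * \<eta> * (2 * K) powr \<beta> * (2 powr (\<alpha> * \<beta>) * e)"
  unfolding e_def using exponent(2) t \<alpha> \<beta> by (intro mult_left_mono powr_shift_le) auto
 also have "... = c * e" by (simp add: c_def)
 also have "... < (1 + c)^2 * e"
  using e c by (intro mult_strict_right_mono) (auto simp: power2_eq_square algebra_simps add_pos_nonneg)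
 also have "... = (decay_const * decay (\<alpha> * \<beta> / 2) (t - k))^2"
 proof -
  have "(decay (\<alpha> * \<beta> / 2) (t - k))^2 = e"
   using t by (simp add: decay_def e_def power2_eq_square flip: powr_add)
  then show ?thesis by (simp add: power_mult_distrib decay_const_def c_def)
 qed
 finally show ?thesis .
qed

text \<open>The coordinate of block \<open>k\<close> is the vector of its contributions to \<open>X t\<close>, \<open>t \<in> T\<close>.\<close>
definition approximating_model :: "int set => real => nat => (nat => (int => real) set) => (nat => (int => real) => real) => int => bool" where
 "approximating_model T ep m S p lo \<longleftrightarrow> finite_model S p \<and>
  (\<forall>k<m. \<forall>t\<in>T. finite_model.E2 S p k (%x y. (min 1 \<bar>x t - y t\<bar>)^2) <= (block_decay lo k t)^2) \<and>
  (\<forall>H c. 0 <= c --> (\<forall>x y. \<bar>H x - H y\<bar> <= c * gap T x y) -->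
   (%r. H (%t. X (of_int t) r)) \<in> borel_measurable M -->
   \<bar>expectation (%r. H (%t. X (of_int t) r)) - finite_model.EE m S p (%s. H (%t. \<Sum>k<m. s k t))\<bar> <= c * ep)"

text \<open>For \<open>t\<close> before the block the contribution is constant, since \<open>G\<close> vanishes on the negative
axis; for \<open>t\<close> at its end the bound 1 suffices; later, the strict inequality of \<open>block_spread_decay\<close>
survives a fine rounding.\<close>
theorem finite_model_approximation:
 fixes T :: "int set"
 assumes T: "finite T" and ep: "0 < ep"
 obtains m S p lo where "approximating_model T ep m S p lo"
proof -
 define \<delta> where "\<delta> = ep / (2 * (real (card T) + 1))"
 have \<delta>: "0 < \<delta>" using ep by (simp add: \<delta>_def)
 obtain \<psi>s where \<psi>s: "!!i::nat. simple_integrand (\<psi>s i)" "!!i u. \<bar>\<psi>s i u\<bar> <= 2 * \<bar>G u\<bar>"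
  "!!t. t \<in> real_of_int ` T ==> (%i. pn (%r. U UNIV (%s. \<psi>s i (t - s)) r - X t r)) \<longlonglongrightarrow> 0"
  using kernel_approximation[of "real_of_int ` T" G X] T G_meas X_int by blast
 have "eventually (%i. \<forall>t\<in>real_of_int ` T. pn (%r. U UNIV (%s. \<psi>s i (t - s)) r - X t r) < \<delta>) sequentially"
  using T \<delta> by (intro eventually_ball_finite ballI order_tendstoD(2)[OF \<psi>s(3)]) auto
 then obtain i where i: "!!t. t \<in> T ==> pn (%r. U UNIV (%s. \<psi>s i (real_of_int t - s)) r - X (of_int t) r) < \<delta>"
  by (auto simp: eventually_sequentially)
 define \<psi> where "\<psi> = \<psi>s i"
 have \<psi>: "simple_integrand \<psi>" "!!u. \<bar>\<psi> u\<bar> <= 2 * \<bar>G u\<bar>" using \<psi>s by (auto simp: \<psi>_def)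
 obtain m :: nat and lo :: int and V :: "(int => real) set" and D :: "nat \<times> (int => real) => real set" where
  V: "finite V" and D: "disjoint_family_on D ({..<m} \<times> V)" "!!i. i \<in> {..<m} \<times> V ==> D i \<in> bounded_borel"
  and dec: "!!t. t \<in> T ==> AE r in M. U UNIV (%s. \<psi> (of_int t - s)) r = (\<Sum>k<m. \<Sum>v\<in>V. v t * \<Lambda> (D (k, v)) r)"
  and dec1: "!!k t. k < m ==> t \<in> T ==> AE r in M. U (block (lo + int k)) (%s. \<psi> (of_int t - s)) r = (\<Sum>v\<in>V. v t * \<Lambda> (D (k, v)) r)"
  by (rule block_decomposition[OF \<psi>(1) T]) (rule that)
 define Y where "Y k t r = (\<Sum>v\<in>V. v t * \<Lambda> (D (k, v)) r)" for k t r
 have Ym [measurable]: "Y k t \<in> borel_measurable M" if "k < m" for k t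
  unfolding Y_def[abs_def] using that D(2) by (intro borel_measurable_sum borel_measurable_times borel_measurable_const \<Lambda>_measurable) auto
 \<comment> \<open>Rounding makes the block variables finitely valued and keeps the blocks independent.\<close>
 obtain e where e: "!!n::nat. simple_function borel (e n)" "!!x::real. (%n. e n x) \<longlonglongrightarrow> x"
  using borel_measurable_implies_sequence_metric[of "%x::real. x" borel 0] by auto
 have rm [measurable]: "e n \<in> borel_measurable borel" for n using e(1) by (rule borel_measurable_simple_function)
 define Z where "Z n k r t = (if k < m \<and> t \<in> T then e n (Y k t r) else 0)" for n k r t
 have ind: "indep_vars (%_. borel) (%i. \<Lambda> (D i)) ({..<m} \<times> V)" using V D by (intro \<Lambda>_indep) auto
 have Zeq: "Z n = (%k r t. if k < m \<and> t \<in> T then e n (\<Sum>v\<in>V. v t * (restrict (%i. \<Lambda> (D i) r) ({k} \<times> V)) (k, v)) else 0)" for n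
  by (auto simp: fun_eq_iff Z_def Y_def intro!: arg_cong[of _ _ "e n"] sum.cong)
 have hm: "(%u. e n (\<Sum>v\<in>V. v t * u (k, v))) \<in> borel_measurable (PiM ({k} \<times> V) (%_. borel))" for n t and k :: nat
  by measurable
 have Zev: "{r\<in>space M. Z n k r = x} \<in> events" for n k x
  unfolding Zeq by (rule independent_blocks_product(1)[OF ind T, where h = "%k t u. e n (\<Sum>v\<in>V. v t * u (k, v))"]) (rule hm)
 have Zind: "prob {r\<in>space M. \<forall>k<m. Z n k r = x k} = (\<Prod>k<m. prob {r\<in>space M. Z n k r = x k})" for n x
  unfolding Zeq by (rule independent_blocks_product(2)[OF ind T, where h = "%k t u. e n (\<Sum>v\<in>V. v t * u (k, v))"]) (rule hm)
 have Zfin: "finite (Z n k ` space M)" for n k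
 proof (rule finite_subset)
  show "Z n k ` space M \<subseteq> {f. \<forall>t. (t \<in> T --> f t \<in> insert 0 (range (e n))) \<and> (t \<notin> T --> f t = 0)}" by (auto simp: Z_def)
  show "finite {f. \<forall>t. (t \<in> T --> f t \<in> insert 0 (range (e n))) \<and> (t \<notin> T --> f t = (0::real))}"
   using e(1)[of n] by (intro finite_set_of_finite_funs T) (auto simp: simple_function_def)
 qed
 have Ztm [measurable]: "(%r. Z n k r t) \<in> borel_measurable M" for n k t
  unfolding Z_def by (cases "k < m") auto
 let ?S = "%n. model_states M (Z n)" and ?p = "%n. model_weight M (Z n)"
 note model = independent_blocks_model[OF Zfin Zev Zind]
 have inc: "eventually (%n. finite_model.E2 (?S n) (?p n) k (%x y. (min 1 \<bar>x t - y t\<bar>)^2) <= (block_decay lo k t)^2) sequentially"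
  if k: "k < m" and t: "t \<in> T" for k t
 proof -
  have le: "finite_model.E2 (?S n) (?p n) k (%x y. (min 1 \<bar>x t - y t\<bar>)^2) <= spread (%r. e n (Y k t r))" for n
  proof -
   have "(%r. Z n k r t) = (%r. e n (Y k t r))" using k t by (simp add: Z_def)
   then show ?thesis using model_increment_bound[OF Zfin Zev model(1) Ztm, of n k t] unfolding spread_def by (simp only:)
  qed
  have Yk [measurable]: "Y k t \<in> borel_measurable M" using k by (rule Ym)
  let ?U = "U (block (lo + int k)) (%s. \<psi> (of_int t - s))"
  have Um: "?U \<in> borel_measurable M" by (intro U_measurable simple_integrand_reflect \<psi>(1)) simp
  have UY: "AE r in M. ?U r = Y k t r" using dec1[OF k t] by (simp only: Y_def)
  consider "t < lo + int k" | "t = lo + int k" | "lo + int k < t" by linarith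
  then show ?thesis
  proof cases
   case 1
   have "AE r in M. e n (Y k t r) = e n 0" for n
    using UY future_block_zero[OF \<psi> 1] by eventually_elim simp
   then have "spread (%r. e n (Y k t r)) = 0" for n by (intro spread_eq_0) auto
   then show ?thesis using le by (intro always_eventually allI order_trans[OF le]) simp
  next
   case 2
   have "finite_model.E2 (?S n) (?p n) k (%x y. (min 1 \<bar>x t - y t\<bar>)^2) <= 1" for n
   proof -
    interpret F: finite_model m "?S n" "?p n" by (rule model(1))
    have "F.E2 k (%x y. (min 1 \<bar>x t - y t\<bar>)^2) <= F.E2 k (%x y. 1)"
     by (intro F.E2_mono power_le_one) auto
    also have "... = 1" using F.E2_const1[of k "%_. 1"] by (simp add: F.p_sum)
    finally show ?thesis .
   qed
   moreover have "1 <= (block_decay lo k t)^2"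
    using decay_const_ge 2 by (simp add: decay_def one_le_power)
   ultimately show ?thesis by (intro always_eventually allI) (rule order_trans)
  next
   case 3
   have "spread ?U = spread (Y k t)"
    unfolding spread_def using chf_cong_AE[OF Um Yk UY] by simp
   then have "spread (Y k t) < (block_decay lo k t)^2"
    using block_spread_decay[OF \<psi> 3] by simp
   moreover have "(%n. spread (%r. e n (Y k t r))) \<longlonglongrightarrow> spread (Y k t)"
    by (intro spread_tendsto) (auto simp: e(2))
   ultimately have "eventually (%n. spread (%r. e n (Y k t r)) < (block_decay lo k t)^2) sequentially"
    by (intro order_tendstoD(2))
   then show ?thesis by eventually_elim (use le in \<open>meson le_less_trans less_imp_le\<close>)
  qed
 qed
 have dist: "eventually (%n. pn (%r. (\<Sum>k<m. Y k t r) - (\<Sum>k<m. Z n k r t)) < \<delta>) sequentially" if t: "t \<in> T" for t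
 proof (rule order_tendstoD(2)[OF pn_tendsto_AE \<delta>])
  show "AE r in M. (%n. (\<Sum>k<m. Y k t r) - (\<Sum>k<m. Z n k r t)) \<longlonglongrightarrow> 0"
  proof (rule AE_I2)
   fix r
   have "(%n. (\<Sum>k<m. Y k t r) - (\<Sum>k<m. Z n k r t)) \<longlonglongrightarrow> (\<Sum>k<m. Y k t r) - (\<Sum>k<m. Y k t r)"
    using t by (intro tendsto_diff tendsto_const tendsto_sum) (auto simp: Z_def e(2))
   then show "(%n. (\<Sum>k<m. Y k t r) - (\<Sum>k<m. Z n k r t)) \<longlonglongrightarrow> 0" by simp
  qed
 qed (auto intro!: borel_measurable_diff borel_measurable_sum Ym Ztm)
 have "eventually (%n. (\<forall>k\<in>{..<m}. \<forall>t\<in>T. finite_model.E2 (?S n) (?p n) k (%x y. (min 1 \<bar>x t - y t\<bar>)^2) <= (block_decay lo k t)^2) \<and>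
   (\<forall>t\<in>T. pn (%r. (\<Sum>k<m. Y k t r) - (\<Sum>k<m. Z n k r t)) < \<delta>)) sequentially"
  using T by (intro eventually_conj eventually_ball_finite ballI inc dist) auto
 from eventually_happens'[OF sequentially_bot this] obtain n where n': "\<forall>k\<in>{..<m}. \<forall>t\<in>T. finite_model.E2 (?S n) (?p n) k (%x y. (min 1 \<bar>x t - y t\<bar>)^2) <= (block_decay lo k t)^2"
  "\<forall>t\<in>T. pn (%r. (\<Sum>k<m. Y k t r) - (\<Sum>k<m. Z n k r t)) < \<delta>" by blast
 note n = n'[rule_format]
 show ?thesis
 proof (rule that[of m "?S n" "?p n" lo], unfold approximating_model_def, intro conjI allI impI ballI model(1))
  show "finite_model.E2 (?S n) (?p n) k (%x y. (min 1 \<bar>x t - y t\<bar>)^2) <= (block_decay lo k t)^2"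
   if "k < m" "t \<in> T" for k t by (rule n(1)) (use that in auto)
  fix H :: "(int => real) => real" and c
  assume c: "0 <= c" and H': "\<forall>x y. \<bar>H x - H y\<bar> <= c * gap T x y"
   and Hm [measurable]: "(%r. H (%t. X (of_int t) r)) \<in> borel_measurable M"
  note H = H'[rule_format]
  define Q where "Q r t = (\<Sum>k<m. Z n k r t)" for r t
  have dep: "H (%t. \<Sum>k<m. s k t) = H (%t. \<Sum>k<m. s' k t)" if "!!k. k < m ==> s k = s' k" for s s' :: "nat => int => real"
   using that by (intro arg_cong[of _ _ H] ext sum.cong) auto
  have EE: "finite_model.EE m (?S n) (?p n) (%s. H (%t. \<Sum>k<m. s k t)) = expectation (%r. H (Q r))"
   unfolding Q_def[abs_def] by (rule model(2)[where G = "%s. H (%t. \<Sum>k<m. s k t)"]) (rule dep)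
  have iQ: "integrable M (%r. H (Q r))"
   unfolding Q_def[abs_def] by (rule model(3)[where G = "%s. H (%t. \<Sum>k<m. s k t)"]) (rule dep)
  have iX: "integrable M (%r. H (%t. X (of_int t) r))"
  proof (rule integrable_const_bound[where B = "\<bar>H (%_. 0)\<bar> + c * real (card T)"])
   have "\<bar>H x\<bar> <= \<bar>H (%_. 0)\<bar> + c * real (card T)" for x
   proof -
    have "\<bar>H x - H (%_. 0)\<bar> <= c * (\<Sum>t\<in>T. min 1 \<bar>x t - 0\<bar>)" by (rule H)
    also have "... <= c * (\<Sum>t\<in>T. 1)" using c by (intro mult_left_mono sum_mono) auto
    finally show ?thesis by simp
   qed
   then show "AE r in M. norm (H (%t. X (of_int t) r)) <= \<bar>H (%_. 0)\<bar> + c * real (card T)" by simp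
  qed measurable
  have Qm [measurable]: "(%r. Q r t) \<in> borel_measurable M" for t unfolding Q_def by measurable
  have pX: "pn (%r. X (of_int t) r - Q r t) <= 2 * \<delta>" if t: "t \<in> T" for t
  proof -
   let ?W = "U UNIV (%s. \<psi> (of_int t - s))"
   have [measurable]: "?W \<in> borel_measurable M" by (intro U_measurable simple_integrand_reflect \<psi>(1)) simp
   have "pn (%r. X (of_int t) r - Q r t) <= pn (%r. X (of_int t) r - ?W r) + pn (%r. ?W r - Q r t)"
    by (rule pn_diff_triangle) auto
   moreover have "pn (%r. ?W r - Q r t) = pn (%r. (\<Sum>k<m. Y k t r) - (\<Sum>k<m. Z n k r t))"
    by (rule pn_cong_AE) (use dec[OF t] in \<open>auto simp: Q_def Y_def intro!: borel_measurable_diff borel_measurable_sum Ym[unfolded Y_def[abs_def]] Ztm\<close>)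
   moreover have "pn (%r. X (of_int t) r - ?W r) < \<delta>"
    using i[OF t] pn_minus_commute[of "X (of_int t)" ?W] by (simp add: \<psi>_def)
   ultimately show ?thesis using n(2)[OF t] by linarith
  qed
  have "\<bar>expectation (%r. H (%t. X (of_int t) r)) - expectation (%r. H (Q r))\<bar> = \<bar>expectation (%r. H (%t. X (of_int t) r) - H (Q r))\<bar>"
   using iX iQ by simp
  also have "... <= expectation (%r. \<bar>H (%t. X (of_int t) r) - H (Q r)\<bar>)" by (rule integral_abs_bound)
  also have "... <= expectation (%r. c * (\<Sum>t\<in>T. min 1 \<bar>X (of_int t) r - Q r t\<bar>))"
   using iX iQ H by (intro integral_mono integrable_abs bintegrable_diff integrable_mult_right integrable_sum pn_integrable) auto
  also have "... = c * (\<Sum>t\<in>T. pn (%r. X (of_int t) r - Q r t))" by (simp add: pn_def)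
  also have "... <= c * (\<Sum>t\<in>T. 2 * \<delta>)" using c pX by (intro mult_left_mono sum_mono) auto
  also have "... <= c * ep"
  proof (rule mult_left_mono[OF _ c])
   have "(\<Sum>t\<in>T. 2 * \<delta>) = real (card T) / (real (card T) + 1) * ep" by (simp add: \<delta>_def divide_simps)
   also have "... <= 1 * ep" using ep by (intro mult_right_mono) auto
   finally show "(\<Sum>t\<in>T. 2 * \<delta>) <= ep" by simp
  qed
  finally show "\<bar>expectation (%r. H (%t. X (of_int t) r)) - finite_model.EE m (?S n) (?p n) (%s. H (%t. \<Sum>k<m. s k t))\<bar> <= c * ep"
   by (simp only: EE)
 qed
qed

end

section \<open>Stationarity\<close>

lemma emeasure_lborel_shift:
 assumes A: "A \<in> sets borel" shows "emeasure lborel {x. x - h \<in> A} = emeasure lborel (A :: real set)"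
proof -
 have "emeasure lborel A = emeasure (distr lborel borel ((+) (- h))) A" by (simp add: lborel_distr_plus)
 also have "... = emeasure lborel ((+) (- h) -` A \<inter> space lborel)" using A by (subst emeasure_distr) auto
 also have "(+) (- h) -` A \<inter> space lborel = {x. x - h \<in> A}" by (auto simp: algebra_simps)
 finally show ?thesis by simp
qed

context levy_noise
begin

lemma equal_measure_equal_law:
 assumes V: "finite V" and D: "disjoint_family_on D V" "!!v. v \<in> V ==> D v \<in> bounded_borel"
  and D': "disjoint_family_on D' V" "!!v. v \<in> V ==> D' v \<in> bounded_borel"
  and eq: "!!v. v \<in> V ==> measure lborel (D v) = measure lborel (D' v)"
  and h [measurable]: "h \<in> borel_measurable (PiM V (%_. borel :: real measure))"
 shows "expectation (%r. h (\<lambda>v\<in>V. \<Lambda> (D v) r)) = (expectation (%r. h (\<lambda>v\<in>V. \<Lambda> (D' v) r)) :: real)"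
proof (cases "V = {}")
 case False
 have "distr M (PiM V (%_. borel)) (%r. \<lambda>v\<in>V. \<Lambda> (D v) r) = PiM V (%v. distr M borel (\<Lambda> (D v)))"
  using indep_vars_iff_distr_eq_PiM'[OF False, where M' = "%_. borel" and X = "%v. \<Lambda> (D v)"] \<Lambda>_indep[OF V D] D(2) by simp
 also have "... = PiM V (%v. distr M borel (\<Lambda> (D' v)))"
 proof (rule PiM_cong[OF refl])
  fix v assume v: "v \<in> V"
  show "distr M borel (\<Lambda> (D v)) = distr M borel (\<Lambda> (D' v))"
   using D(2)[OF v] D'(2)[OF v] by (intro Levy_uniqueness real_distribution_distr') (auto simp: fun_eq_iff chf_\<Lambda> eq[OF v])
 qed
 also have "... = distr M (PiM V (%_. borel)) (%r. \<lambda>v\<in>V. \<Lambda> (D' v) r)"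
  using indep_vars_iff_distr_eq_PiM'[OF False, where M' = "%_. borel" and X = "%v. \<Lambda> (D' v)"] \<Lambda>_indep[OF V D'] D'(2) by simp
 finally have e: "distr M (PiM V (%_. borel)) (%r. \<lambda>v\<in>V. \<Lambda> (D v) r) = distr M (PiM V (%_. borel)) (%r. \<lambda>v\<in>V. \<Lambda> (D' v) r)" .
 have m: "(%r. \<lambda>v\<in>V. \<Lambda> (D v) r) \<in> measurable M (PiM V (%_. borel))" "(%r. \<lambda>v\<in>V. \<Lambda> (D' v) r) \<in> measurable M (PiM V (%_. borel))"
  using D(2) D'(2) by (auto intro!: measurable_restrict)
 show ?thesis using integral_distr[OF m(1) h] integral_distr[OF m(2) h] e by simp
next
 case True
 have "(\<lambda>v\<in>V. \<Lambda> (D v) r) = (\<lambda>v\<in>V. \<Lambda> (D' v) r)" for r by (rule restrict_ext) (simp add: True)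
 then show ?thesis by simp
qed

lemma simple_integral_pair_stationary:
 assumes \<psi>: "simple_integrand \<psi>" and F [measurable]: "(%z. F (fst z) (snd z)) \<in> borel_measurable (borel \<Otimes>\<^sub>M borel)"
 shows "expectation (%r. F (U UNIV (%x. \<psi> (s - x)) r) (U UNIV (%x. \<psi> (t - x)) r)) =
  (expectation (%r. F (U UNIV (%x. \<psi> (s + h - x)) r) (U UNIV (%x. \<psi> (t + h - x)) r)) :: real)"
proof -
 obtain R where R: "!!u. \<psi> u \<noteq> 0 ==> \<bar>u\<bar> <= R"
  using \<psi> unfolding simple_integrand_def by (auto simp: bounded_iff)
 define q where "q = \<bar>R\<bar> + \<bar>s\<bar> + \<bar>t\<bar> + 1"
 define \<Phi> where "\<Phi> x = (\<psi> (s - x), \<psi> (t - x))" for x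
 define V where "V = range \<Phi>"
 define D where "D v = {- q<..q} \<inter> \<Phi> -` {v}" for v
 define D' where "D' v = {x. x - h \<in> D v}" for v
 have V: "finite V"
 proof (rule finite_subset)
  show "V \<subseteq> range \<psi> \<times> range \<psi>" by (auto simp: V_def \<Phi>_def)
  show "finite (range \<psi> \<times> range \<psi>)" using simple_integrandD(1)[OF \<psi>] by simp
 qed
 have \<Phi>m: "\<Phi> -` {v} \<in> sets borel" for v
 proof -
  have "\<Phi> -` {v} = (%x. \<psi> (s - x)) -` {fst v} \<inter> (%x. \<psi> (t - x)) -` {snd v}" by (auto simp: \<Phi>_def)
  then show ?thesis using simple_integrandD(5)[OF simple_integrand_reflect[OF \<psi>]] by auto
 qed
 have D: "D v \<in> bounded_borel" for v unfolding D_def by (intro bounded_borel_Int \<Phi>m) simp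
 have D': "D' v \<in> bounded_borel" for v
 proof -
  have [measurable]: "D v \<in> sets borel" by (rule bounded_borel_sets[OF D])
  have "D' v = (%x. x - h) -` D v \<inter> space borel" by (auto simp: D'_def)
  also have "... \<in> sets borel" by (rule measurable_sets) measurable
  finally have "D' v \<in> sets borel" .
  moreover have "\<bar>x\<bar> <= q + \<bar>h\<bar>" if "x \<in> D' v" for x using that by (auto simp: D'_def D_def)
  ultimately show ?thesis by (auto simp: bounded_borel_def bounded_iff)
 qed
 have dis: "disjoint_family_on D V" "disjoint_family_on D' V" by (auto simp: disjoint_family_on_def D_def D'_def)
 have eq: "measure lborel (D v) = measure lborel (D' v)" for v
  unfolding D'_def measure_def by (subst emeasure_lborel_shift) (auto intro: bounded_borel_sets D)
 have U: "AE r in M. U UNIV (%x. \<psi> (u + e - x)) r = (\<Sum>v\<in>V. c v * \<Lambda> (E v) r)"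
  if u: "\<bar>u\<bar> <= \<bar>s\<bar> + \<bar>t\<bar>" and c: "!!x. \<psi> (u - x) = c (\<Phi> x)" and E: "!!v. E v = {x. x - e \<in> D v}" "disjoint_family_on E V" "!!v. E v \<in> bounded_borel" for u e c E
 proof (rule U_eq_sum[OF simple_integrand_reflect[OF \<psi>] V E(2,3)])
  show "\<psi> (u + e - x) = c v" if "v \<in> V" "x \<in> E v" for v x
   using that c[of "x - e"] by (auto simp: E D_def algebra_simps)
  fix x assume x: "\<psi> (u + e - x) \<noteq> 0"
  then have "x - e \<in> {- q<..q}" using R[OF x] u by (auto simp: q_def)
  then show "x \<in> (\<Union>v\<in>V. E v)" by (auto simp: E D_def V_def)
 qed simp
 define H where "H y = F (\<Sum>v\<in>V. fst v * y v) (\<Sum>v\<in>V. snd v * y v)" for y :: "real \<times> real => real"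
 have pm: "(%y. (\<Sum>v\<in>V. fst v * y v, \<Sum>v\<in>V. snd v * y v)) \<in> measurable (PiM V (%_. borel)) (borel \<Otimes>\<^sub>M borel)" by measurable
 have H: "H \<in> borel_measurable (PiM V (%_. borel))"
  using measurable_compose[OF pm F] by (simp add: H_def[abs_def])
 have pair: "expectation (%r. F (U UNIV (%x. \<psi> (s + e - x)) r) (U UNIV (%x. \<psi> (t + e - x)) r)) = expectation (%r. H (\<lambda>v\<in>V. \<Lambda> (E v) r))"
  if E: "!!v. E v = {x. x - e \<in> D v}" "disjoint_family_on E V" "!!v. E v \<in> bounded_borel" for e E
 proof (rule integral_cong_AE)
  have 1: "AE r in M. U UNIV (%x. \<psi> (s + e - x)) r = (\<Sum>v\<in>V. fst v * \<Lambda> (E v) r)" by (rule U[OF _ _ E]) (auto simp: \<Phi>_def)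
  have 2: "AE r in M. U UNIV (%x. \<psi> (t + e - x)) r = (\<Sum>v\<in>V. snd v * \<Lambda> (E v) r)" by (rule U[OF _ _ E]) (auto simp: \<Phi>_def)
  show "AE r in M. F (U UNIV (%x. \<psi> (s + e - x)) r) (U UNIV (%x. \<psi> (t + e - x)) r) = H (\<lambda>v\<in>V. \<Lambda> (E v) r)"
   using 1 2 by eventually_elim (simp add: H_def)
  have [measurable]: "U UNIV (%x. \<psi> (s + e - x)) \<in> borel_measurable M" "U UNIV (%x. \<psi> (t + e - x)) \<in> borel_measurable M"
   by (intro U_measurable simple_integrand_reflect \<psi>; simp)+
  show "(%r. F (U UNIV (%x. \<psi> (s + e - x)) r) (U UNIV (%x. \<psi> (t + e - x)) r)) \<in> borel_measurable M"
   using measurable_compose[OF measurable_Pair[OF \<open>U UNIV (%x. \<psi> (s + e - x)) \<in> borel_measurable M\<close> \<open>U UNIV (%x. \<psi> (t + e - x)) \<in> borel_measurable M\<close>] F] by simp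
  show "(%r. H (\<lambda>v\<in>V. \<Lambda> (E v) r)) \<in> borel_measurable M"
   by (rule measurable_compose[OF measurable_restrict[OF \<Lambda>_measurable[OF E(3)]] H])
 qed
 have "expectation (%r. H (\<lambda>v\<in>V. \<Lambda> (D v) r)) = expectation (%r. H (\<lambda>v\<in>V. \<Lambda> (D' v) r))"
  by (rule equal_measure_equal_law[OF V dis(1) D dis(2) D' eq H])
 then show ?thesis using pair[of D 0] pair[of D' h] dis D D' by (simp add: D'_def)
qed

end

context moving_average
begin

text \<open>A translated kernel is integrated against noise on translated sets of the same measure, which has the same joint law;
one kernel approximates all four variables.\<close>
theorem stationary_products:
 fixes f1 f2 :: "real => real"
 assumes [measurable]: "f1 \<in> borel_measurable borel" "f2 \<in> borel_measurable borel"
  and b: "!!x. \<bar>f1 x\<bar> <= B" "!!x. \<bar>f2 x\<bar> <= B" and C: "0 <= C"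
  and l: "!!x y. \<bar>f1 x - f1 y\<bar> <= C * min 1 \<bar>x - y\<bar>" "!!x y. \<bar>f2 x - f2 y\<bar> <= C * min 1 \<bar>x - y\<bar>"
 shows "expectation (%r. f1 (X s r) * f2 (X t r)) = expectation (%r. f1 (X (s + h) r) * f2 (X (t + h) r))"
proof -
 obtain \<psi> where \<psi>: "!!i::nat. simple_integrand (\<psi> i)" "!!i u. \<bar>\<psi> i u\<bar> <= 2 * \<bar>G u\<bar>"
  "!!t'. t' \<in> {s, t, s + h, t + h} ==> (%i. pn (%r. U UNIV (%x. \<psi> i (t' - x)) r - X t' r)) \<longlonglongrightarrow> 0"
  using kernel_approximation[of "{s, t, s + h, t + h}" G X] G_meas X_int by blast
 define W where "W i t = U UNIV (%x. \<psi> i (t - x))" for i t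
 have [measurable]: "W i t \<in> borel_measurable M" for i t unfolding W_def by (intro U_measurable simple_integrand_reflect \<psi>(1)) simp
 have B: "0 <= B" using b(1)[of 0] by simp
 have int: "integrable M (%r. f1 (Y r) * f2 (Y' r))" if [measurable]: "Y \<in> borel_measurable M" "Y' \<in> borel_measurable M" for Y Y'
  by (rule integrable_const_bound[where B = "B * B"]) (auto simp: abs_mult intro!: mult_mono b B)
 have lim: "(%i. expectation (%r. f1 (W i a r) * f2 (W i c r))) \<longlonglongrightarrow> expectation (%r. f1 (X a r) * f2 (X c r))"
  if a: "a \<in> {s, t, s + h, t + h}" and c: "c \<in> {s, t, s + h, t + h}" for a c
 proof -
  have "(%i. B * C * (pn (%r. W i a r - X a r) + pn (%r. W i c r - X c r))) \<longlonglongrightarrow> B * C * (0 + 0)"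
   unfolding W_def by (intro tendsto_mult tendsto_const tendsto_add \<psi>(3) a c)
  then have z: "(%i. B * C * (pn (%r. W i a r - X a r) + pn (%r. W i c r - X c r))) \<longlonglongrightarrow> 0" by simp
  have "\<bar>expectation (%r. f1 (W i a r) * f2 (W i c r)) - expectation (%r. f1 (X a r) * f2 (X c r))\<bar>
   <= B * C * (pn (%r. W i a r - X a r) + pn (%r. W i c r - X c r))" for i
  proof -
   have pt: "\<bar>f1 x * f2 y - f1 x' * f2 y'\<bar> <= B * C * (min 1 \<bar>x - x'\<bar> + min 1 \<bar>y - y'\<bar>)" for x y x' y'
   proof -
    have "f1 x * f2 y - f1 x' * f2 y' = (f1 x - f1 x') * f2 y + f1 x' * (f2 y - f2 y')" by (simp add: algebra_simps)
    then have "\<bar>f1 x * f2 y - f1 x' * f2 y'\<bar> <= \<bar>f1 x - f1 x'\<bar> * \<bar>f2 y\<bar> + \<bar>f1 x'\<bar> * \<bar>f2 y - f2 y'\<bar>"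
     by (metis abs_mult abs_triangle_ineq)
    also have "... <= (C * min 1 \<bar>x - x'\<bar>) * B + B * (C * min 1 \<bar>y - y'\<bar>)"
     using C B by (intro add_mono mult_mono l b) auto
    finally show ?thesis by (simp add: algebra_simps)
   qed
   have "\<bar>expectation (%r. f1 (W i a r) * f2 (W i c r)) - expectation (%r. f1 (X a r) * f2 (X c r))\<bar>
    = \<bar>expectation (%r. f1 (W i a r) * f2 (W i c r) - f1 (X a r) * f2 (X c r))\<bar>" by (subst bintegral_diff) (auto intro: int)
   also have "... <= expectation (%r. \<bar>f1 (W i a r) * f2 (W i c r) - f1 (X a r) * f2 (X c r)\<bar>)" by (rule integral_abs_bound)
   also have "... <= expectation (%r. B * C * (min 1 \<bar>W i a r - X a r\<bar> + min 1 \<bar>W i c r - X c r\<bar>))"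
    by (intro integral_mono pt integrable_abs bintegrable_diff int integrable_mult_right Bochner_Integration.integrable_add pn_integrable) auto
   also have "... = B * C * (pn (%r. W i a r - X a r) + pn (%r. W i c r - X c r))"
    by (simp add: pn_def)
   finally show ?thesis .
  qed
  then have "(%i. expectation (%r. f1 (W i a r) * f2 (W i c r)) - expectation (%r. f1 (X a r) * f2 (X c r))) \<longlonglongrightarrow> 0"
   by (intro Lim_null_comparison[OF _ z] always_eventually allI) simp
  then show ?thesis by (simp add: LIM_zero_iff)
 qed
 have eq: "expectation (%r. f1 (W i s r) * f2 (W i t r)) = expectation (%r. f1 (W i (s + h) r) * f2 (W i (t + h) r))" for i
  unfolding W_def by (rule simple_integral_pair_stationary[OF \<psi>(1), of "%x y. f1 x * f2 y"]) measurable
 show ?thesis using lim[of s t] lim[of "s + h" "t + h"] unfolding eq by (intro LIMSEQ_unique) auto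
qed

end

section \<open>Covariances and the limiting variance\<close>

lemma tendsto_arithmetic_mean:
 fixes a :: "nat => real"
 assumes a: "a \<longlonglongrightarrow> l"
 shows "(%n. (\<Sum>k<n. a k) / real n) \<longlonglongrightarrow> l"
proof (rule LIMSEQ_I)
 fix e :: real assume e: "0 < e"
 obtain N where N: "!!k. N <= k ==> \<bar>a k - l\<bar> < e / 2" using LIMSEQ_D[OF a, of "e / 2"] e by auto
 define c where "c = (\<Sum>k<N. \<bar>a k - l\<bar>)"
 have c: "0 <= c" unfolding c_def by (intro sum_nonneg) auto
 show "\<exists>n0. \<forall>n\<ge>n0. norm ((\<Sum>k<n. a k) / real n - l) < e"
 proof (intro exI allI impI)
  fix n assume n: "nat \<lceil>2 * c / e\<rceil> + N + 1 <= n"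
  then have n0: "0 < real n" by simp
  have cn: "c < e / 2 * real n"
  proof -
   have "2 * c / e < real n" using n by linarith
   then show ?thesis using e by (simp add: field_simps)
  qed
  have "\<bar>\<Sum>k<n. a k - l\<bar> <= (\<Sum>k<n. \<bar>a k - l\<bar>)" by (rule sum_abs)
  also have "... = (\<Sum>k<N. \<bar>a k - l\<bar>) + (\<Sum>k=N..<n. \<bar>a k - l\<bar>)"
   using n by (simp add: lessThan_atLeast0 sum.atLeastLessThan_concat)
  also have "(\<Sum>k=N..<n. \<bar>a k - l\<bar>) <= (\<Sum>k=N..<n. e / 2)" using N by (intro sum_mono less_imp_le) auto
  also have "... <= e / 2 * real n" using e by (simp add: mult.commute)
  finally have "\<bar>\<Sum>k<n. a k - l\<bar> < e * real n" using cn by (simp add: c_def)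
  moreover have "(\<Sum>k<n. a k) / real n - l = (\<Sum>k<n. a k - l) / real n"
   using n0 by (simp add: sum_subtractf field_simps)
  ultimately show "norm ((\<Sum>k<n. a k) / real n - l) < e" using n0 by (simp add: divide_less_eq)
 qed
qed

locale moving_average_functional = moving_average M L \<Lambda> G X \<eta> \<alpha> \<beta> K
 for M :: "'a measure" and L \<Lambda> G X \<eta> \<alpha> \<beta> K +
 fixes f :: "real => real" and C\<^sub>f :: real
 assumes \<alpha>\<beta>: "2 < \<alpha> * \<beta>" and f_meas [measurable]: "f \<in> borel_measurable borel" and C\<^sub>f: "0 < C\<^sub>f"
  and f_inc: "!!x y. \<bar>f x - f y\<bar> <= C\<^sub>f * min 1 \<bar>x - y\<bar>"
   "!!x a b. \<bar>(f (x + a + b) - f (x + a)) - (f (x + b) - f x)\<bar> <= C\<^sub>f * (min 1 \<bar>a\<bar> * min 1 \<bar>b\<bar>)"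
begin

definition B\<^sub>f where "B\<^sub>f = \<bar>f 0\<bar> + C\<^sub>f"

lemma f_bound: "\<bar>f x\<bar> <= B\<^sub>f"
proof -
 have "\<bar>f x - f 0\<bar> <= C\<^sub>f * min 1 \<bar>x - 0\<bar>" by (rule f_inc)
 also have "... <= C\<^sub>f * 1" using C\<^sub>f by (intro mult_left_mono) auto
 finally show ?thesis unfolding B\<^sub>f_def by linarith
qed

lemma B\<^sub>f: "0 < B\<^sub>f" using C\<^sub>f by (simp add: B\<^sub>f_def add_nonneg_pos)

lemma integrable_f [simp]: "integrable M (%r. f (X t r))"
 by (rule integrable_const_bound[where B = B\<^sub>f]) (auto simp: f_bound)

lemma integrable_ff [simp]: "integrable M (%r. f (X s r) * f (X t r))"
 using B\<^sub>f by (intro integrable_const_bound[where B = "B\<^sub>f * B\<^sub>f"]) (auto simp: abs_mult intro!: mult_mono f_bound)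

definition \<mu> where "\<mu> = expectation (%r. f (X 1 r))"

lemma mean: "expectation (%r. f (X t r)) = \<mu>"
proof -
 have "expectation (%r. f (X 1 r) * (%_. 1) (X 1 r)) = expectation (%r. f (X (1 + (t - 1)) r) * (%_. 1) (X (1 + (t - 1)) r))"
  by (rule stationary_products[of f "%_. 1" "max 1 B\<^sub>f" C\<^sub>f])
   (use f_inc(1) C\<^sub>f f_bound in \<open>auto simp: le_max_iff_disj\<close>)
 then show ?thesis by (simp add: \<mu>_def)
qed

lemma approximating_modelD:
 assumes "approximating_model T ep m S p lo"
 shows "k < m ==> t \<in> T ==> finite_model.E2 S p k (%x y. (min 1 \<bar>x t - y t\<bar>)^2) <= (block_decay lo k t)^2"
  "0 <= c ==> (!!x y. \<bar>H x - H y\<bar> <= c * gap T x y) ==> (%r. H (%t. X (of_int t) r)) \<in> borel_measurable M ==>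
   \<bar>expectation (%r. H (%t. X (of_int t) r)) - finite_model.EE m S p (%s. H (%t. \<Sum>k<m. s k t))\<bar> <= c * ep"
 using assms unfolding approximating_model_def by blast+

lemma model_mean:
 assumes am: "approximating_model T ep m S p lo" and T: "finite T" "t \<in> T"
 shows "\<bar>\<mu> - finite_model.EE m S p (%s. f (\<Sum>k<m. s k t))\<bar> <= C\<^sub>f * ep"
proof -
 have "\<bar>f (x t) - f (y t)\<bar> <= C\<^sub>f * gap T x y" for x y
 proof -
  have "\<bar>f (x t) - f (y t)\<bar> <= C\<^sub>f * min 1 \<bar>x t - y t\<bar>" by (rule f_inc)
  also have "... <= C\<^sub>f * gap T x y"
   using C\<^sub>f T by (intro mult_left_mono member_le_sum[where f = "%t. min 1 \<bar>x t - y t\<bar>"]) auto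
  finally show ?thesis .
 qed
 from approximating_modelD(2)[OF am less_imp_le[OF C\<^sub>f] this] show ?thesis by (simp add: mean)
qed

abbreviation ac :: "int => real" where "ac \<equiv> autocov M f X"

lemma centered_product:
 "expectation (%r. (f (X s r) - \<mu>) * (f (X t r) - \<mu>)) = expectation (%r. f (X s r) * f (X t r)) - \<mu>^2"
proof -
 have "expectation (%r. (f (X s r) - \<mu>) * (f (X t r) - \<mu>)) = expectation (%r. f (X s r) * f (X t r) - \<mu> * f (X s r) - \<mu> * f (X t r) + \<mu>^2)"
  by (intro bintegral_cong refl) (simp add: algebra_simps power2_eq_square)
 also have "... = expectation (%r. f (X s r) * f (X t r)) - \<mu> * \<mu> - \<mu> * \<mu> + \<mu>^2"
  by (simp add: mean prob_space)
 finally show ?thesis by (simp add: power2_eq_square)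
qed

lemma ac_eq: "ac j = expectation (%r. f (X 0 r) * f (X (of_int j) r)) - \<mu>^2"
 unfolding autocov_def covariance_def mean by (rule centered_product)

lemma shifted_product:
 "expectation (%r. (f (X (of_int s) r) - \<mu>) * (f (X (of_int t) r) - \<mu>)) = ac (t - s)"
proof -
 have "expectation (%r. f (X (of_int s) r) * f (X (of_int t) r)) =
  expectation (%r. f (X (of_int s + - real_of_int s) r) * f (X (of_int t + - real_of_int s) r))"
  by (rule stationary_products[of f f B\<^sub>f C\<^sub>f]) (use f_inc(1) C\<^sub>f f_bound in auto)
 then show ?thesis by (simp add: centered_product ac_eq)
qed

lemma ac_sym: "ac (- j) = ac j"
proof -
 have "ac j = expectation (%r. (f (X (of_int j) r) - \<mu>) * (f (X (of_int 0) r) - \<mu>))"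
  using shifted_product[of 0 j] by (simp add: mult.commute)
 also have "... = ac (- j)" using shifted_product[of j 0] by simp
 finally show ?thesis by simp
qed

definition hexp where "hexp = \<alpha> * \<beta> / 2"

lemma s1: "1 < hexp" using \<alpha>\<beta> by (simp add: hexp_def)

text \<open>Only blocks up to time 0 reach both variables; for them \<open>\<rho>\<^sub>k\<^sub>j\<close> is at most its value at
block 0, and the other factor is summed.\<close>
lemma ac_bound_nonneg:
 assumes j: "0 <= j"
 shows "\<bar>ac j\<bar> <= (C\<^sub>f * decay_const)^2 * (hexp / (hexp - 1)) * decay hexp j"
proof -
 define R where "R = (C\<^sub>f * decay_const)^2 * (hexp / (hexp - 1)) * decay hexp j"
 define e1 where "e1 = 2 * B\<^sub>f * C\<^sub>f + 2 * B\<^sub>f * C\<^sub>f"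
 have cd: "0 <= C\<^sub>f * decay_const" using C\<^sub>f decay_const_ge by simp
 have "\<bar>ac j\<bar> <= R + ep * e1" if ep: "0 < ep" for ep
 proof -
  let ?T = "{0, j}"
  obtain m S p lo where am: "approximating_model ?T ep m S p lo"
   by (rule finite_model_approximation[of ?T ep]) (use ep in auto)
  interpret F: finite_model m S p using am by (simp add: approximating_model_def)
  note inc = approximating_modelD(1)[OF am] and app = approximating_modelD(2)[OF am]
  let ?Y = "%(k::nat) (t::int) (x::int => real). x t"
  let ?F = "%t s. f (F.XX ?Y t s)"
  have XX: "F.XX ?Y t s = (\<Sum>k<m. s k t)" for t s by (simp add: F.XX_def)
  have incY: "F.inc ?Y k t x y = min 1 \<bar>x t - y t\<bar>" for k t x y by (simp add: F.inc_def)
  have mean': "\<bar>\<mu> - F.EE (?F t)\<bar> <= C\<^sub>f * ep" if t: "t \<in> ?T" for t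
   unfolding XX by (rule model_mean[OF am _ t]) simp
  have prod': "\<bar>expectation (%r. f (X 0 r) * f (X (of_int j) r)) - F.EE (%s. ?F 0 s * ?F j s)\<bar> <= 2 * B\<^sub>f * C\<^sub>f * ep"
  proof -
   have "\<bar>f (x 0) * f (x j) - f (y 0) * f (y j)\<bar> <= 2 * B\<^sub>f * C\<^sub>f * gap ?T x y" for x y
   proof -
    have "f (x 0) * f (x j) - f (y 0) * f (y j) = (f (x 0) - f (y 0)) * f (x j) + f (y 0) * (f (x j) - f (y j))" by (simp add: algebra_simps)
    then have "\<bar>f (x 0) * f (x j) - f (y 0) * f (y j)\<bar> <= \<bar>f (x 0) - f (y 0)\<bar> * \<bar>f (x j)\<bar> + \<bar>f (y 0)\<bar> * \<bar>f (x j) - f (y j)\<bar>"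
     using abs_triangle_ineq[of "(f (x 0) - f (y 0)) * f (x j)" "f (y 0) * (f (x j) - f (y j))"] by (simp only: abs_mult)
    also have "... <= (C\<^sub>f * min 1 \<bar>x 0 - y 0\<bar>) * B\<^sub>f + B\<^sub>f * (C\<^sub>f * min 1 \<bar>x j - y j\<bar>)"
     using C\<^sub>f B\<^sub>f by (intro add_mono mult_mono f_inc f_bound) auto
    also have "... = B\<^sub>f * C\<^sub>f * (min 1 \<bar>x 0 - y 0\<bar> + min 1 \<bar>x j - y j\<bar>)" by (simp add: algebra_simps)
    also have "... <= B\<^sub>f * C\<^sub>f * (gap ?T x y + gap ?T x y)"
    proof -
     have "min 1 \<bar>x t - y t\<bar> <= gap ?T x y" if "t \<in> ?T" for t
      using that by (intro member_le_sum[where f = "%t. min 1 \<bar>x t - y t\<bar>"]) auto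
     from this[of 0] this[of j] show ?thesis using C\<^sub>f B\<^sub>f by (intro mult_left_mono add_mono) auto
    qed
    finally show ?thesis by (simp add: algebra_simps)
   qed
   from app[OF _ this] show ?thesis using C\<^sub>f B\<^sub>f by (simp add: XX)
  qed
  have cov: "\<bar>F.EE (%s. ?F 0 s * ?F j s) - F.EE (?F 0) * F.EE (?F j)\<bar> <= R"
  proof -
   have E2b: "F.E2 k (%x y. (C\<^sub>f * F.inc ?Y k t x y)^2) <= (C\<^sub>f * decay_const * decay hexp (t - (lo + int k)))^2" if "k < m" "t \<in> ?T" for k t
   proof -
    have "F.E2 k (%x y. (C\<^sub>f * F.inc ?Y k t x y)^2) = C\<^sub>f^2 * F.E2 k (%x y. (min 1 \<bar>x t - y t\<bar>)^2)"
     by (simp add: incY power_mult_distrib F.E2_cmult)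
    also have "... <= C\<^sub>f^2 * (block_decay lo k t)^2"
     by (intro mult_left_mono inc that) auto
    finally show ?thesis by (simp add: hexp_def power_mult_distrib)
   qed
   have "\<bar>F.EE (%s. ?F 0 s * ?F j s) - F.EE (?F 0) * F.EE (?F j)\<bar>
    <= (\<Sum>k<m. (C\<^sub>f * decay_const * decay hexp (0 - (lo + int k))) * (C\<^sub>f * decay_const * decay hexp (j - (lo + int k))))"
   proof (rule F.covariance_bound[OF F.lip1_single[OF f_inc(1) less_imp_le[OF C\<^sub>f], of ?Y 0] F.lip1_single[OF f_inc(1) less_imp_le[OF C\<^sub>f], of ?Y j]])
    fix k assume k: "k < m"
    show "F.E2 k (%x y. (C\<^sub>f * F.inc ?Y k 0 x y)^2) <= (C\<^sub>f * decay_const * decay hexp (0 - (lo + int k)))^2" by (rule E2b[OF k]) simp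
    show "F.E2 k (%x y. (C\<^sub>f * F.inc ?Y k j x y)^2) <= (C\<^sub>f * decay_const * decay hexp (j - (lo + int k)))^2" by (rule E2b[OF k]) simp
   qed (intro mult_nonneg_nonneg cd decay_nonneg)+
   also have "... <= (\<Sum>k<m. (C\<^sub>f * decay_const)^2 * (decay hexp (0 - (lo + int k)) * decay hexp j))"
   proof (rule sum_mono)
    fix k
    have "decay hexp (0 - (lo + int k)) * decay hexp (j - (lo + int k)) <= decay hexp (0 - (lo + int k)) * decay hexp j"
    proof (cases "lo + int k <= 0")
     case True
     then have "decay hexp (j - (lo + int k)) <= decay hexp j"
      using j s1 by (auto simp: decay_def intro!: powr_mono2')
     then show ?thesis by (intro mult_left_mono decay_nonneg)
    next
     case False then show ?thesis by (simp add: decay_def)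
    qed
    then have "(C\<^sub>f * decay_const)^2 * (decay hexp (0 - (lo + int k)) * decay hexp (j - (lo + int k))) <= (C\<^sub>f * decay_const)^2 * (decay hexp (0 - (lo + int k)) * decay hexp j)"
     by (rule mult_left_mono) simp
    then show "(C\<^sub>f * decay_const * decay hexp (0 - (lo + int k))) * (C\<^sub>f * decay_const * decay hexp (j - (lo + int k))) <= (C\<^sub>f * decay_const)^2 * (decay hexp (0 - (lo + int k)) * decay hexp j)"
     by (simp add: power2_eq_square mult_ac)
   qed
   also have "... = (C\<^sub>f * decay_const)^2 * (\<Sum>j\<in>(%k. 0 - (lo + int k)) ` {..<m}. decay hexp j) * decay hexp j"
    by (subst sum.reindex) (auto simp: inj_on_def sum_distrib_left sum_distrib_right mult_ac)
   also have "... <= (C\<^sub>f * decay_const)^2 * (hexp / (hexp - 1)) * decay hexp j"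
    using decay_row_sum[OF s1, of "(%k. 0 - (lo + int k)) ` {..<m}" 0] by (intro mult_right_mono mult_left_mono decay_nonneg) auto
   finally show ?thesis by (simp add: R_def)
  qed
  have b: "\<bar>F.EE (?F t)\<bar> <= B\<^sub>f" for t
  proof -
   have "\<bar>F.EE (?F t)\<bar> <= F.EE (%s. \<bar>?F t s\<bar>)" by (rule F.EE_abs)
   also have "... <= F.EE (%s. B\<^sub>f)" by (intro F.EE_mono f_bound)
   finally show ?thesis by (simp add: F.EE_const)
  qed
  have mb: "\<bar>\<mu>\<bar> <= B\<^sub>f"
  proof -
   have "\<bar>\<mu>\<bar> <= expectation (%r. \<bar>f (X 1 r)\<bar>)" unfolding \<mu>_def by (rule integral_abs_bound)
   also have "... <= expectation (%r. B\<^sub>f)" by (intro integral_mono f_bound) auto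
   finally show ?thesis by (simp add: prob_space)
  qed
  have "\<mu>^2 - F.EE (?F 0) * F.EE (?F j) = \<mu> * (\<mu> - F.EE (?F j)) + (\<mu> - F.EE (?F 0)) * F.EE (?F j)"
   by (simp add: algebra_simps power2_eq_square)
  then have "\<bar>\<mu>^2 - F.EE (?F 0) * F.EE (?F j)\<bar> <= \<bar>\<mu>\<bar> * \<bar>\<mu> - F.EE (?F j)\<bar> + \<bar>\<mu> - F.EE (?F 0)\<bar> * \<bar>F.EE (?F j)\<bar>"
   using abs_triangle_ineq[of "\<mu> * (\<mu> - F.EE (?F j))" "(\<mu> - F.EE (?F 0)) * F.EE (?F j)"] by (simp only: abs_mult)
  also have "... <= B\<^sub>f * (C\<^sub>f * ep) + (C\<^sub>f * ep) * B\<^sub>f"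
   using C\<^sub>f B\<^sub>f ep by (intro add_mono mult_mono mb b mean') auto
  finally have "\<bar>\<mu>^2 - F.EE (?F 0) * F.EE (?F j)\<bar> <= 2 * B\<^sub>f * C\<^sub>f * ep" by (simp add: algebra_simps)
  moreover have "\<bar>a - d\<bar> <= y + (x + z)" if "\<bar>a - b\<bar> <= x" "\<bar>b - c\<bar> <= y" "\<bar>d - c\<bar> <= z" for a b c d x y z :: real
   using that by linarith
  ultimately have "\<bar>ac j\<bar> <= R + (2 * B\<^sub>f * C\<^sub>f * ep + 2 * B\<^sub>f * C\<^sub>f * ep)"
   using prod' cov unfolding ac_eq by blast
  then show ?thesis by (simp add: e1_def algebra_simps)
 qed
 moreover have "0 < e1" using C\<^sub>f B\<^sub>f by (simp add: e1_def)
 ultimately have "\<bar>ac j\<bar> <= R + ep / e1 * e1" if "0 < ep" for ep using that divide_pos_pos by blast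
 then have "\<bar>ac j\<bar> <= R + ep" if "0 < ep" for ep using that \<open>0 < e1\<close> by simp
 then show ?thesis unfolding R_def[symmetric] by (rule field_le_epsilon)
qed

definition ac_const where "ac_const = (C\<^sub>f * decay_const)^2 * (hexp / (hexp - 1))"

lemma ac_bound: "\<bar>ac j\<bar> <= ac_const * decay hexp \<bar>j\<bar>"
 using ac_bound_nonneg[of "\<bar>j\<bar>"] ac_sym[of j] by (cases "0 <= j") (auto simp: ac_const_def)

lemma ac_const_nonneg: "0 <= ac_const" using s1 by (simp add: ac_const_def)

lemma ac_summable: "(%j. \<bar>ac j\<bar>) summable_on UNIV"
proof (rule nonneg_bdd_above_summable_on)
 show "bdd_above (sum (%j. \<bar>ac j\<bar>) ` {F. F \<subseteq> UNIV \<and> finite F})"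
 proof (rule bdd_aboveI2)
  fix F :: "int set" assume "F \<in> {F. F \<subseteq> UNIV \<and> finite F}"
  then have F: "finite F" by simp
  have "(\<Sum>j\<in>F. \<bar>ac j\<bar>) <= (\<Sum>j\<in>F. ac_const * (decay hexp j + decay hexp (- j)))"
  proof (rule sum_mono)
   fix j
   have "decay hexp \<bar>j\<bar> <= decay hexp j + decay hexp (- j)"
    using decay_nonneg by (cases "0 <= j") (simp_all add: add_increasing add_increasing2)
   then show "\<bar>ac j\<bar> <= ac_const * (decay hexp j + decay hexp (- j))"
    using ac_bound[of j] ac_const_nonneg by (meson mult_left_mono order_trans)
  qed
  also have "... = ac_const * ((\<Sum>j\<in>F. decay hexp j) + (\<Sum>j\<in>uminus ` F. decay hexp j))"
  proof -
   have "(\<Sum>j\<in>uminus ` F. decay hexp j) = (\<Sum>j\<in>F. decay hexp (- j))" by (subst sum.reindex) auto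
   then show ?thesis by (simp add: sum_distrib_left sum.distrib distrib_left)
  qed
  also have "... <= ac_const * (hexp / (hexp - 1) + hexp / (hexp - 1))"
   using decay_row_sum[OF s1, of F 0] decay_row_sum[OF s1, of "uminus ` F" 0] F ac_const_nonneg
   by (intro mult_left_mono add_mono) auto
  finally show "(\<Sum>j\<in>F. \<bar>ac j\<bar>) <= ac_const * (hexp / (hexp - 1) + hexp / (hexp - 1))" .
 qed
qed auto

abbreviation V :: "nat => 'a => real" where "V \<equiv> partial_sum M f X"
abbreviation vn :: "nat => real" where "vn \<equiv> partial_sum_sd M f X"

lemma V_eq: "V n r = 1 / sqrt n * (\<Sum>t\<in>{1..int n}. f (X (of_int t) r) - \<mu>)"
proof -
 have "(\<Sum>t=1..n. f (X (real t) r) - \<mu>) = (\<Sum>t\<in>int ` {1..n}. f (X (of_int t) r) - \<mu>)"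
  by (subst sum.reindex) auto
 also have "int ` {1..n} = {1..int n}" by (simp add: image_int_atLeastAtMost)
 finally show ?thesis by (simp add: partial_sum_def \<mu>_def)
qed

lemma V_measurable [measurable]: "V n \<in> borel_measurable M" unfolding V_eq[abs_def] by measurable

lemma V_bound: "\<bar>V n r\<bar> <= 1 / sqrt n * (real n * (B\<^sub>f + \<bar>\<mu>\<bar>))"
proof -
 have "\<bar>\<Sum>t\<in>{1..int n}. f (X (of_int t) r) - \<mu>\<bar> <= (\<Sum>t\<in>{1..int n}. B\<^sub>f + \<bar>\<mu>\<bar>)"
 proof (rule order_trans[OF sum_abs sum_mono])
  fix t show "\<bar>f (X (of_int t) r) - \<mu>\<bar> <= B\<^sub>f + \<bar>\<mu>\<bar>"
   using abs_triangle_ineq4[of "f (X (of_int t) r)" \<mu>] f_bound[of "X (of_int t) r"] by simp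
 qed
 then show ?thesis unfolding V_eq by (simp add: abs_mult divide_right_mono)
qed

lemma integrable_V [simp]: "integrable M (V n)"
 by (rule integrable_const_bound[OF _ V_measurable]) (use V_bound in auto)

lemma integrable_V2 [simp]: "integrable M (%r. (V n r)^2)"
proof (rule integrable_const_bound)
 show "AE r in M. norm ((V n r)^2) <= (1 / sqrt n * (real n * (B\<^sub>f + \<bar>\<mu>\<bar>)))^2"
 proof (rule AE_I2)
  fix r
  show "norm ((V n r)^2) <= (1 / sqrt n * (real n * (B\<^sub>f + \<bar>\<mu>\<bar>)))^2"
   using power_mono[OF V_bound[of n r] abs_ge_zero, of 2] by simp
 qed
qed measurable

lemma V_mean: "expectation (V n) = 0"
 unfolding V_eq[abs_def] by (simp add: mean prob_space)

lemma V_second_moment: "expectation (%r. (V n r)^2) = 1 / real n * (\<Sum>s\<in>{1..int n}. \<Sum>t\<in>{1..int n}. ac (t - s))"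
proof -
 have i: "integrable M (%r. (f (X (of_int s) r) - \<mu>) * (f (X (of_int t) r) - \<mu>))" for s t
  by (simp add: algebra_simps integrable_mult_left)
 have "(V n r)^2 = 1 / real n * (\<Sum>s\<in>{1..int n}. \<Sum>t\<in>{1..int n}. (f (X (of_int s) r) - \<mu>) * (f (X (of_int t) r) - \<mu>))" for r
  unfolding V_eq power_mult_distrib by (simp add: power2_eq_square sum_product power_divide)
 then have "expectation (%r. (V n r)^2) = 1 / real n * (\<Sum>s\<in>{1..int n}. \<Sum>t\<in>{1..int n}. expectation (%r. (f (X (of_int s) r) - \<mu>) * (f (X (of_int t) r) - \<mu>)))"
  by (simp only: integral_mult_right_zero) (simp add: i integrable_sum)
 then show ?thesis by (simp add: shifted_product)
qed

lemma vn_eq: "vn n = sqrt (expectation (%r. (V n r)^2))"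
 unfolding partial_sum_sd_def by (simp add: V_mean)

text \<open>This exhibits \<open>v\<^sub>n^2\<close> as an arithmetic mean of symmetric partial sums.\<close>
lemma double_sum_ac:
 "(\<Sum>s\<in>{1..int n}. \<Sum>t\<in>{1..int n}. ac (t - s)) = (\<Sum>k<n. \<Sum>j\<in>{- int k..int k}. ac j)"
proof (induction n)
 case (Suc n)
 have e: "{1..int (Suc n)} = insert (int (Suc n)) {1..int n}" by auto
 have 1: "(\<Sum>t\<in>{1..int n}. ac (t - int (Suc n))) = (\<Sum>j\<in>{- int n..- 1}. ac j)"
  by (rule sum.reindex_bij_witness[of _ "%j. j + int (Suc n)" "%t. t - int (Suc n)"]) auto
 have 2: "(\<Sum>s\<in>{1..int n}. ac (int (Suc n) - s)) = (\<Sum>j\<in>{1..int n}. ac j)"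
  by (rule sum.reindex_bij_witness[of _ "%j. int (Suc n) - j" "%t. int (Suc n) - t"]) auto
 have split: "{- int n..int n} = {- int n..- 1} \<union> insert 0 {1..int n}" by auto
 have "(\<Sum>j\<in>{- int n..int n}. ac j) = (\<Sum>j\<in>{- int n..- 1}. ac j) + (ac 0 + (\<Sum>j\<in>{1..int n}. ac j))"
  unfolding split by (subst sum.union_disjoint) auto
 then show ?case unfolding e using Suc.IH 1 2 by (simp add: sum.distrib)
qed simp

lemma vn_limit: "0 <= (\<Sum>\<^sub>\<infinity>j\<in>UNIV. ac j)" "vn \<longlonglongrightarrow> sqrt (\<Sum>\<^sub>\<infinity>j\<in>UNIV. ac j)"
proof -
 have "ac summable_on UNIV" using ac_summable abs_summable_summable[of ac UNIV] by simp
 then have hs: "(ac has_sum (\<Sum>\<^sub>\<infinity>j\<in>UNIV. ac j)) UNIV" by (rule has_sum_infsum)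
 have fl: "filterlim (%k. {- int k..int k}) (finite_subsets_at_top UNIV) sequentially"
  unfolding filterlim_finite_subsets_at_top
 proof (intro allI impI)
  fix F :: "int set" assume F: "finite F \<and> F \<subseteq> UNIV"
  show "eventually (%k. finite {- int k..int k} \<and> F \<subseteq> {- int k..int k} \<and> {- int k..int k} \<subseteq> UNIV) sequentially"
  proof (rule eventually_sequentiallyI[of "nat (\<Sum>j\<in>F. \<bar>j\<bar>)"])
   fix k assume k: "nat (\<Sum>j\<in>F. \<bar>j\<bar>) <= k"
   have "\<bar>j\<bar> <= int k" if "j \<in> F" for j
   proof -
    have "\<bar>j\<bar> <= (\<Sum>j\<in>F. \<bar>j\<bar>)" using that F by (intro member_le_sum) auto
    then show ?thesis using k by linarith
   qed
   then show "finite {- int k..int k} \<and> F \<subseteq> {- int k..int k} \<and> {- int k..int k} \<subseteq> UNIV" by (auto simp: abs_le_iff) (metis minus_le_iff)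
  qed
 qed
 have "(%k. \<Sum>j\<in>{- int k..int k}. ac j) \<longlonglongrightarrow> (\<Sum>\<^sub>\<infinity>j\<in>UNIV. ac j)"
  using filterlim_compose[OF hs[unfolded has_sum_def] fl] by simp
 from tendsto_arithmetic_mean[OF this]
 have l: "(%n. expectation (%r. (V n r)^2)) \<longlonglongrightarrow> (\<Sum>\<^sub>\<infinity>j\<in>UNIV. ac j)"
  unfolding V_second_moment double_sum_ac by simp
 show "0 <= (\<Sum>\<^sub>\<infinity>j\<in>UNIV. ac j)" by (rule LIMSEQ_le_const[OF l]) auto
 show "vn \<longlonglongrightarrow> sqrt (\<Sum>\<^sub>\<infinity>j\<in>UNIV. ac j)" unfolding vn_eq[abs_def] by (intro tendsto_real_sqrt l)
qed

lemma vn_lower_bound: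
 assumes "0 < (\<Sum>\<^sub>\<infinity>j\<in>UNIV. ac j)"
 obtains \<sigma> where "0 < \<sigma>" "!!n. 0 < vn n ==> \<sigma> <= vn n" "\<sigma> <= sqrt (\<Sum>\<^sub>\<infinity>j\<in>UNIV. ac j)"
proof -
 let ?v = "sqrt (\<Sum>\<^sub>\<infinity>j\<in>UNIV. ac j)"
 have v: "0 < ?v" using assms by simp
 have "eventually (%n. ?v / 2 < vn n) sequentially" using v by (intro order_tendstoD(1)[OF vn_limit(2)]) simp
 then obtain N where N: "!!n. N <= n ==> ?v / 2 < vn n" by (auto simp: eventually_sequentially)
 define \<sigma> where "\<sigma> = Min (insert (?v / 2) (vn ` {n. n < N \<and> 0 < vn n}))"
 have fin: "finite (insert (?v / 2) (vn ` {n. n < N \<and> 0 < vn n}))" by simp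
 show ?thesis
 proof (rule that[of \<sigma>])
  show "0 < \<sigma>" unfolding \<sigma>_def using v by (subst Min_gr_iff) auto
  have le: "\<sigma> <= ?v / 2" unfolding \<sigma>_def by (rule Min_le[OF fin]) simp
  then show "\<sigma> <= ?v" using v by linarith
  show "\<sigma> <= vn n" if "0 < vn n" for n
  proof (cases "n < N")
   case True then show ?thesis unfolding \<sigma>_def using that by (intro Min_le[OF fin]) auto
  next
   case False then show ?thesis using N[of n] le by linarith
  qed
 qed
qed

end

section \<open>Normal approximation of the normalised sums\<close>

context moving_average_functional
begin

abbreviation (input) "mean_of h n \<equiv> expectation (%r. h (V n r / vn n))"

lemma limit_of_bounds:
 assumes "0 <= (k::real)" "!!ep. 0 < ep ==> ep <= 1 ==> a <= z + k * ep"
 shows "a <= z"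
proof (rule field_le_epsilon)
 fix e :: real assume e: "0 < e"
 define ep where "ep = min 1 (e / (k + 1))"
 have ep: "0 < ep" "ep <= 1" using e assms(1) by (auto simp: ep_def)
 have "k * ep <= (k + 1) * ep" using ep by (simp add: mult_right_mono)
 also have "... <= (k + 1) * (e / (k + 1))" using assms(1) by (intro mult_left_mono) (auto simp: ep_def)
 also have "... = e" using assms(1) by simp
 finally show "a <= z + e" using assms(2)[OF ep] by simp
qed

lemma combine_bounds:
 assumes "\<bar>b - d\<bar> <= c * u + z" "u <= k" "\<bar>a - b\<bar> <= k" "0 <= c"
 shows "\<bar>a - d\<bar> <= z + (c + 1) * (k :: real)"
proof -
 have "c * u <= c * k" using assms by (intro mult_left_mono)
 then have "\<bar>a - b\<bar> + \<bar>b - d\<bar> <= z + (c + 1) * k" using assms(1,3) by (simp add: distrib_right)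
 then show ?thesis by linarith
qed

definition model_sum :: "nat => nat => (int => real) => (nat => int => real) => real" where
 "model_sum n m mu s = 1 / (sqrt n * vn n) * (\<Sum>t\<in>{1..int n}. f (finite_model.XX m (%k t x. x t) t s) - mu t)"

text \<open>The model sum is centred with the means of the model, so it differs from \<open>V n / vn n\<close> by a shift and by
the approximation; both tend to 0 with the accuracy \<open>ep\<close> for fixed \<open>n\<close>, however large the
constant \<open>Kc\<close>.\<close>
lemma normal_bound_from_models:
 fixes h :: "real => real"
 assumes n: "1 <= n" and v: "0 < vn n" and h: "!!x y. \<bar>h x - h y\<bar> <= l * \<bar>x - y\<bar>" and l: "0 <= l" and b: "0 <= b"
  and model: "!!m S p lo mu. block_model m S p (%k t x. x t) n lo hexp decay_const ==>
   finite_model.EE m S p (model_sum n m mu) = 0 ==>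
   \<bar>finite_model.EE m S p (%s. h (model_sum n m mu s)) - d\<bar> <= b * \<bar>1 - finite_model.EE m S p (%s. (model_sum n m mu s)^2)\<bar> + R"
 shows "\<bar>mean_of h n - d\<bar> <= R"
proof -
 define c where "c = 1 / (sqrt n * vn n)"
 have c: "0 < c" using n v by (simp add: c_def)
 define D where "D = c * (real n * (2 * B\<^sub>f))"
 define Kc where "Kc = l * (c * real n * C\<^sub>f) + l * (c * C\<^sub>f) + 2 * D * (c * C\<^sub>f) + (c * real n * C\<^sub>f)^2"
 have D: "0 <= D" using c B\<^sub>f by (simp add: D_def)
 have Kc: "0 <= l * (c * real n * C\<^sub>f) + l * (c * C\<^sub>f)" "0 <= 2 * D * (c * C\<^sub>f) + (c * real n * C\<^sub>f)^2"
  using l c C\<^sub>f D by simp_all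
 let ?T = "{1..int n}" and ?Y = "%(k::nat) (t::int) (x::int => real). x t"
 show ?thesis
 proof (rule limit_of_bounds[of "(b + 1) * Kc"])
  show "0 <= (b + 1) * Kc" using Kc b by (simp add: Kc_def)
  fix ep :: real assume ep: "0 < ep" "ep <= 1"
  obtain m S p lo where am: "approximating_model ?T ep m S p lo"
   by (rule finite_model_approximation[of ?T ep]) (use ep in auto)
  interpret F: finite_model m S p using am by (simp add: approximating_model_def)
  note inc = approximating_modelD(1)[OF am] and app = approximating_modelD(2)[OF am]
  have XX: "F.XX ?Y t s = (\<Sum>k<m. s k t)" for t s by (simp add: F.XX_def)
  have incY: "F.inc ?Y k t x y = min 1 \<bar>x t - y t\<bar>" for k t x y by (simp add: F.inc_def)
  have bm: "block_model m S p ?Y n lo hexp decay_const"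
  proof unfold_locales
   show "F.E2 k (%x y. (F.inc ?Y k t x y)^2) <= (decay_const * decay hexp (t - (lo + int k)))^2" if "k < m" "t \<in> ?T" for k t
    unfolding incY hexp_def using that by (rule inc)
  qed (use n s1 decay_const_ge in auto)
  define mu where "mu t = F.EE (%s. f (F.XX ?Y t s))" for t
  define W where "W s = c * (\<Sum>t\<in>?T. f (F.XX ?Y t s) - mu t)" for s
  define w where "w x = c * (\<Sum>t\<in>?T. f (x t) - mu t)" for x :: "int => real"
  have Ww: "W s = w (%t. \<Sum>k<m. s k t)" for s by (simp add: W_def w_def XX)
  have EW: "F.EE W = 0" unfolding W_def[abs_def] by (simp add: F.EE_cmult F.EE_sum F.EE_diff F.EE_const mu_def)
  have mub: "\<bar>mu t\<bar> <= B\<^sub>f" for t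
  proof -
   have "\<bar>mu t\<bar> <= F.EE (%s. \<bar>f (F.XX ?Y t s)\<bar>)" unfolding mu_def by (rule F.EE_abs)
   also have "... <= F.EE (%s. B\<^sub>f)" by (intro F.EE_mono f_bound)
   finally show ?thesis by (simp add: F.EE_const)
  qed
  have muclose: "\<bar>\<mu> - mu t\<bar> <= C\<^sub>f * ep" if t: "t \<in> ?T" for t
   unfolding mu_def XX by (rule model_mean[OF am _ t]) simp
  have wl: "\<bar>w x - w y\<bar> <= c * C\<^sub>f * gap ?T x y" for x y
  proof -
   have "w x - w y = c * (\<Sum>t\<in>?T. f (x t) - f (y t))" by (simp add: w_def sum_subtractf algebra_simps)
   then have "\<bar>w x - w y\<bar> = c * \<bar>\<Sum>t\<in>?T. f (x t) - f (y t)\<bar>" using c by (simp add: abs_mult)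
   also have "... <= c * (\<Sum>t\<in>?T. C\<^sub>f * min 1 \<bar>x t - y t\<bar>)"
    using c by (intro mult_left_mono order_trans[OF sum_abs sum_mono] f_inc) auto
   finally show ?thesis by (simp add: sum_distrib_left mult.assoc)
  qed
  have wb: "\<bar>w x\<bar> <= D" for x
  proof -
   have "\<bar>\<Sum>t\<in>?T. f (x t) - mu t\<bar> <= (\<Sum>t\<in>?T. 2 * B\<^sub>f)"
   proof (rule order_trans[OF sum_abs sum_mono])
    fix t show "\<bar>f (x t) - mu t\<bar> <= 2 * B\<^sub>f" using abs_triangle_ineq4[of "f (x t)" "mu t"] f_bound[of "x t"] mub[of t] by simp
   qed
   then have "c * \<bar>\<Sum>t\<in>?T. f (x t) - mu t\<bar> <= c * (real n * (2 * B\<^sub>f))" using c by (intro mult_left_mono) auto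
   then show ?thesis using c by (simp add: w_def D_def abs_mult)
  qed
  define shift where "shift = c * (\<Sum>t\<in>?T. \<mu> - mu t)"
  have sh: "\<bar>shift\<bar> <= c * real n * C\<^sub>f * ep"
  proof -
   have "\<bar>\<Sum>t\<in>?T. \<mu> - mu t\<bar> <= (\<Sum>t\<in>?T. C\<^sub>f * ep)" by (rule order_trans[OF sum_abs sum_mono]) (rule muclose)
   then have "c * \<bar>\<Sum>t\<in>?T. \<mu> - mu t\<bar> <= c * (real n * (C\<^sub>f * ep))" using c by (intro mult_left_mono) auto
   then show ?thesis using c by (simp add: shift_def abs_mult mult_ac)
  qed
  have wX: "w (%t. X (of_int t) r) = V n r / vn n + shift" for r
  proof -
   have "V n r / vn n = c * (\<Sum>t\<in>?T. f (X (of_int t) r) - \<mu>)" by (simp add: V_eq c_def)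
   then show ?thesis by (simp add: w_def shift_def sum_subtractf algebra_simps)
  qed
  have [measurable]: "h \<in> borel_measurable borel"
  proof (rule borel_measurable_continuous_onI)
   have "l-lipschitz_on UNIV h" using h l by (intro lipschitz_onI) (auto simp: dist_real_def)
   then show "continuous_on UNIV h" by (rule lipschitz_on_continuous_on)
  qed
  have E2: "\<bar>1 - F.EE (%s. (W s)^2)\<bar> <= Kc * ep"
  proof -
   have lip: "\<bar>(w x)^2 - (w y)^2\<bar> <= 2 * D * (c * C\<^sub>f) * gap ?T x y" for x y
   proof -
    have "\<bar>(w x)^2 - (w y)^2\<bar> = \<bar>w x + w y\<bar> * \<bar>w x - w y\<bar>"
     by (simp add: abs_mult[symmetric] power2_eq_square algebra_simps)
    also have "... <= (2 * D) * (c * C\<^sub>f * gap ?T x y)"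
     using abs_triangle_ineq[of "w x" "w y"] wb[of x] wb[of y] D by (intro mult_mono wl) auto
    finally show ?thesis by (simp add: mult.assoc)
   qed
   have "\<bar>expectation (%r. (w (%t. X (of_int t) r))^2) - F.EE (%s. (w (%t. \<Sum>k<m. s k t))^2)\<bar> <= 2 * D * (c * C\<^sub>f) * ep"
    by (rule app[OF _ lip]) (use D c C\<^sub>f in \<open>auto simp: wX\<close>)
   moreover have "expectation (%r. (w (%t. X (of_int t) r))^2) = 1 + shift^2"
   proof -
    have "(V n r / vn n + shift)^2 = (V n r)^2 / (vn n)^2 + (2 * shift / vn n) * V n r + shift^2" for r
     by (simp add: power2_sum power_divide algebra_simps)
    then have "expectation (%r. (V n r / vn n + shift)^2) = expectation (%r. (V n r)^2) / (vn n)^2 + shift^2"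
     by (simp add: V_mean prob_space)
    moreover have "expectation (%r. (V n r)^2) = (vn n)^2" unfolding vn_eq by simp
    ultimately show ?thesis using v by (simp add: wX)
   qed
   moreover have "shift^2 <= (c * real n * C\<^sub>f)^2 * ep"
   proof -
    have "shift^2 <= (c * real n * C\<^sub>f * ep)^2" using power_mono[OF sh abs_ge_zero, of 2] by simp
    also have "... = (c * real n * C\<^sub>f)^2 * (ep * ep)" by (simp add: power_mult_distrib power2_eq_square)
    also have "... <= (c * real n * C\<^sub>f)^2 * (ep * 1)" using ep by (intro mult_left_mono) auto
    finally show ?thesis by simp
   qed
   moreover have "\<bar>1 - e\<bar> <= x + y" if "\<bar>g - e\<bar> <= x" "g = 1 + shift^2" "shift^2 <= y" for e g x y
    using that zero_le_power2[of shift] by linarith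
   ultimately have "\<bar>1 - F.EE (%s. (W s)^2)\<bar> <= (2 * D * (c * C\<^sub>f) + (c * real n * C\<^sub>f)^2) * ep"
    unfolding Ww distrib_right by blast
   also have "... <= Kc * ep" unfolding Kc_def using Kc ep by (intro mult_right_mono) auto
   finally show ?thesis .
  qed
  have Eh: "\<bar>mean_of h n - F.EE (%s. h (W s))\<bar> <= Kc * ep"
  proof -
   have lip: "\<bar>h (w x) - h (w y)\<bar> <= l * (c * C\<^sub>f) * gap ?T x y" for x y
    using h[of "w x" "w y"] mult_left_mono[OF wl[of x y] l] by (simp add: mult.assoc)
   have 1: "\<bar>expectation (%r. h (w (%t. X (of_int t) r))) - F.EE (%s. h (w (%t. \<Sum>k<m. s k t)))\<bar> <= l * (c * C\<^sub>f) * ep"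
    by (rule app[OF _ lip]) (use l c C\<^sub>f in \<open>auto simp: wX\<close>)
   have ih: "integrable M (%r. h (V n r / vn n + a))" for a
   proof (rule bintegrable_bound[where f = "%r. \<bar>h 0\<bar> + l * (\<bar>V n r\<bar> / vn n + \<bar>a\<bar>)"])
    show "integrable M (%r. \<bar>h 0\<bar> + l * (\<bar>V n r\<bar> / vn n + \<bar>a\<bar>))" by simp
    have "\<bar>h (V n r / vn n + a)\<bar> <= \<bar>h 0\<bar> + l * (\<bar>V n r\<bar> / vn n + \<bar>a\<bar>)" for r
    proof -
     have "\<bar>h (V n r / vn n + a) - h 0\<bar> <= l * \<bar>V n r / vn n + a\<bar>" using h[of "V n r / vn n + a" 0] by simp
     also have "... <= l * (\<bar>V n r\<bar> / vn n + \<bar>a\<bar>)"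
      using l abs_triangle_ineq[of "V n r / vn n" a] v by (intro mult_left_mono) auto
     finally show ?thesis using abs_triangle_ineq2[of "h (V n r / vn n + a)" "h 0"] by linarith
    qed
    then show "AE r in M. norm (h (V n r / vn n + a)) <= norm (\<bar>h 0\<bar> + l * (\<bar>V n r\<bar> / vn n + \<bar>a\<bar>))"
     using l v by (intro AE_I2) (simp add: abs_of_nonneg)
   qed measurable
   have "\<bar>mean_of h n - expectation (%r. h (V n r / vn n + shift))\<bar> = \<bar>expectation (%r. h (V n r / vn n) - h (V n r / vn n + shift))\<bar>"
    using ih[of 0] ih[of shift] by simp
   also have "... <= expectation (%r. \<bar>h (V n r / vn n) - h (V n r / vn n + shift)\<bar>)" by (rule integral_abs_bound)
   also have "... <= expectation (%r. l * (c * real n * C\<^sub>f * ep))"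
   proof (rule integral_mono)
    show "integrable M (%r. \<bar>h (V n r / vn n) - h (V n r / vn n + shift)\<bar>)" using ih[of 0] ih[of shift] by simp
    show "\<bar>h (V n r / vn n) - h (V n r / vn n + shift)\<bar> <= l * (c * real n * C\<^sub>f * ep)" for r
     using h[of "V n r / vn n" "V n r / vn n + shift"] mult_left_mono[OF sh l] by simp
   qed simp
   also have "... = l * (c * real n * C\<^sub>f) * ep" by (simp add: prob_space)
   finally have 2: "\<bar>mean_of h n - expectation (%r. h (V n r / vn n + shift))\<bar> <= l * (c * real n * C\<^sub>f) * ep" .
   have tri: "\<bar>a - d\<bar> <= x + y" if "\<bar>a - b\<bar> <= x" "\<bar>b - d\<bar> <= y" for a b d x y :: real using that by linarith
   have "\<bar>mean_of h n - F.EE (%s. h (W s))\<bar> <= l * (c * real n * C\<^sub>f) * ep + l * (c * C\<^sub>f) * ep"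
    using 2 1 unfolding wX Ww by (rule tri)
   also have "... = (l * (c * real n * C\<^sub>f) + l * (c * C\<^sub>f)) * ep" by (simp only: distrib_right)
   also have "... <= Kc * ep" unfolding Kc_def using Kc ep by (intro mult_right_mono) auto
   finally show ?thesis .
  qed
  have W: "W = model_sum n m mu" by (simp add: fun_eq_iff W_def c_def model_sum_def)
  show "\<bar>mean_of h n - d\<bar> <= R + (b + 1) * Kc * ep"
   using combine_bounds[OF model[OF bm EW[unfolded W]] E2[unfolded W] Eh[unfolded W] b] by (simp add: mult.assoc)
 qed
qed

definition A\<^sub>0 where "A\<^sub>0 = decay_const * (hexp / (hexp - 1))"
definition Q\<^sub>0 where "Q\<^sub>0 = 4 * (A\<^sub>0^2 * 2 powr (2 * hexp - 2))"

lemma A\<^sub>0_nonneg: "0 <= A\<^sub>0" using s1 decay_const_ge by (simp add: A\<^sub>0_def)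
lemma Q\<^sub>0_nonneg: "0 <= Q\<^sub>0" by (simp add: Q\<^sub>0_def)

lemma scale_bound:
 assumes "1 <= n" "0 < \<sigma>" "\<sigma> <= vn n"
 shows "1 / (sqrt n * vn n) * C\<^sub>f <= C\<^sub>f / \<sigma> / sqrt n" "0 <= 1 / (sqrt n * vn n)" "0 <= C\<^sub>f / \<sigma>"
proof -
 have "C\<^sub>f / vn n <= C\<^sub>f / \<sigma>" using assms C\<^sub>f by (intro divide_left_mono) auto
 then have "C\<^sub>f / vn n / sqrt n <= C\<^sub>f / \<sigma> / sqrt n" by (rule divide_right_mono) simp
 then show "1 / (sqrt n * vn n) * C\<^sub>f <= C\<^sub>f / \<sigma> / sqrt n" by (simp add: mult.commute)
qed (use assms C\<^sub>f in auto)

theorem lipschitz_normal_bound: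
 assumes n: "1 <= n" and \<sigma>: "0 < \<sigma>" "\<sigma> <= vn n" and h: "!!x y. \<bar>h x - h y\<bar> <= \<bar>x - y\<bar>"
 defines "q \<equiv> C\<^sub>f / \<sigma>"
 shows "\<bar>mean_of h n - normal_mean h\<bar>
  <= 11 * q^2 * A\<^sub>0 ^ 3 * (1 / sqrt n) + 44 * (q^2 * (1 + q) * Q\<^sub>0) * G3 hexp n"
proof -
 let ?R = "11 * q^2 * A\<^sub>0 ^ 3 * (1 / sqrt n) + 44 * (q^2 * (1 + q) * Q\<^sub>0) * G3 hexp n"
 have v: "0 < vn n" using \<sigma> by simp
 show ?thesis
 proof (rule normal_bound_from_models[OF n v _ zero_le_one])
  fix m S p lo mu
  assume bm: "block_model m S p (%k t x. x t) n lo hexp decay_const" and b: "finite_model.EE m S p (model_sum n m mu) = 0"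
  interpret F: block_model m S p "%k t x. x t" n lo hexp decay_const by (rule bm)
  have AQ: "F.A = A\<^sub>0" "F.Q = Q\<^sub>0" by (simp_all add: F.A_def F.Q_def A\<^sub>0_def Q\<^sub>0_def)
  show "\<bar>F.EE (%s. h (model_sum n m mu s)) - normal_mean h\<bar> <= 11 * \<bar>1 - F.EE (%s. (model_sum n m mu s)^2)\<bar> + ?R"
   unfolding model_sum_def AQ[symmetric]
   by (rule F.partial_sum_lipschitz_bound[OF f_inc scale_bound(2)[OF n \<sigma>] less_imp_le[OF C\<^sub>f] scale_bound(1)[OF n \<sigma>, folded q_def] scale_bound(3)[OF n \<sigma>, folded q_def] h b[unfolded model_sum_def[abs_def]]])
 qed (use h in simp_all)
qed

theorem monotone_normal_bound:
 assumes n: "1 <= n" and \<sigma>: "0 < \<sigma>" "\<sigma> <= vn n" and hl: "!!x y. \<bar>h x - h y\<bar> <= l * \<bar>x - y\<bar>" and l: "0 <= l"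
  and h: "!!x. 0 <= h x" "!!x. h x <= 1" "antimono h"
 defines "q \<equiv> C\<^sub>f / \<sigma>"
 shows "\<bar>mean_of h n - normal_mean h\<bar>
  <= 6 * q^2 * A\<^sub>0 ^ 3 * (1 / sqrt n) + (22 + 4 * (q * A\<^sub>0)) * (q^2 * (1 + q) * Q\<^sub>0) * G3 hexp n
   + sqrt (40 * (q^2 * (1 + q^2) * (2 * Q\<^sub>0))) * sqrt (G4 hexp n)"
proof -
 let ?R = "6 * q^2 * A\<^sub>0 ^ 3 * (1 / sqrt n) + (22 + 4 * (q * A\<^sub>0)) * (q^2 * (1 + q) * Q\<^sub>0) * G3 hexp n
   + sqrt (40 * (q^2 * (1 + q^2) * (2 * Q\<^sub>0))) * sqrt (G4 hexp n)"
 have v: "0 < vn n" using \<sigma> by simp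
 have hc: "continuous_on UNIV h"
 proof -
  have "l-lipschitz_on UNIV h" using hl l by (intro lipschitz_onI) (auto simp: dist_real_def)
  then show ?thesis by (rule lipschitz_on_continuous_on)
 qed
 show ?thesis
 proof (rule normal_bound_from_models[OF n v hl l])
  fix m S p lo mu
  assume bm: "block_model m S p (%k t x. x t) n lo hexp decay_const" and b: "finite_model.EE m S p (model_sum n m mu) = 0"
  interpret F: block_model m S p "%k t x. x t" n lo hexp decay_const by (rule bm)
  have AQ: "F.A = A\<^sub>0" "F.Q = Q\<^sub>0" by (simp_all add: F.A_def F.Q_def A\<^sub>0_def Q\<^sub>0_def)
  show "\<bar>F.EE (%s. h (model_sum n m mu s)) - normal_mean h\<bar> <= 2 * \<bar>1 - F.EE (%s. (model_sum n m mu s)^2)\<bar> + ?R"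
   unfolding model_sum_def AQ[symmetric]
   by (rule F.partial_sum_monotone_bound[OF f_inc scale_bound(2)[OF n \<sigma>] less_imp_le[OF C\<^sub>f] scale_bound(1)[OF n \<sigma>, folded q_def] scale_bound(3)[OF n \<sigma>, folded q_def] hc h b[unfolded model_sum_def[abs_def]]])
 qed simp
qed

end

section \<open>The central limit theorem with rates\<close>

text \<open>A decreasing Lipschitz approximation from above of the indicator of \<open>{..x}\<close>. The bound for monotone
functions does not involve the slope.\<close>
definition ramp :: "real => real => real => real" where
 "ramp x \<delta> y = min 1 (max 0 (1 - (y - x) / \<delta>))"

lemma ramp_props:
 assumes "0 < \<delta>"
 shows "0 <= ramp x \<delta> y" "ramp x \<delta> y <= 1" "antimono (ramp x \<delta>)" "\<bar>ramp x \<delta> y - ramp x \<delta> z\<bar> <= 1 / \<delta> * \<bar>y - z\<bar>"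
  "y <= x ==> ramp x \<delta> y = 1" "x + \<delta> < y ==> ramp x \<delta> y = 0" "ramp x \<delta> \<in> borel_measurable borel"
proof -
 show "0 <= ramp x \<delta> y" "ramp x \<delta> y <= 1" by (auto simp: ramp_def)
 show "antimono (ramp x \<delta>)"
 proof (rule antimonoI)
  fix y z :: real assume "y <= z"
  then have "(y - x) / \<delta> <= (z - x) / \<delta>" using assms by (intro divide_right_mono) auto
  then show "ramp x \<delta> z <= ramp x \<delta> y" by (auto simp: ramp_def)
 qed
 have "\<bar>ramp x \<delta> y - ramp x \<delta> z\<bar> <= \<bar>(y - x) / \<delta> - (z - x) / \<delta>\<bar>" by (auto simp: ramp_def)
 also have "... = \<bar>(y - z) / \<delta>\<bar>" by (simp add: diff_divide_distrib)
 also have "... = 1 / \<delta> * \<bar>y - z\<bar>" using assms by simp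
 finally show "\<bar>ramp x \<delta> y - ramp x \<delta> z\<bar> <= 1 / \<delta> * \<bar>y - z\<bar>" .
 show "ramp x \<delta> y = 1" if "y <= x"
 proof -
  have "(y - x) / \<delta> <= 0" using that assms by (simp add: divide_le_0_iff)
  then show ?thesis by (simp add: ramp_def)
 qed
 show "ramp x \<delta> y = 0" if "x + \<delta> < y"
 proof -
  have "1 <= (y - x) / \<delta>" using that assms by (simp add: le_divide_eq)
  then show ?thesis by (simp add: ramp_def)
 qed
 show "ramp x \<delta> \<in> borel_measurable borel" unfolding ramp_def by measurable
qed

lemma (in prob_space) cdf_ramp:
 assumes [measurable]: "F \<in> borel_measurable M" and \<delta>: "0 < \<delta>"
 shows "prob {r\<in>space M. F r <= x} <= expectation (%r. ramp x \<delta> (F r))"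
  "expectation (%r. ramp x \<delta> (F r)) <= prob {r\<in>space M. F r <= x + \<delta>}"
proof -
 note [measurable] = ramp_props(7)[OF \<delta>, of x]
 note p = ramp_props[OF \<delta>]
 have i: "integrable M (%r. ramp x \<delta> (F r))"
  by (rule integrable_const_bound[where B = 1]) (use p(1,2) in auto)
 have e: "prob {r\<in>space M. F r <= y} = expectation (indicator {r\<in>space M. F r <= y})" for y by simp
 have ii: "integrable M (indicator {r\<in>space M. F r <= y} :: 'a => real)" for y
  by (rule integrable_const_bound[where B = 1]) auto
 show "prob {r\<in>space M. F r <= x} <= expectation (%r. ramp x \<delta> (F r))"
  unfolding e by (intro integral_mono i ii) (use p(1,5) in \<open>auto split: split_indicator\<close>)
 show "expectation (%r. ramp x \<delta> (F r)) <= prob {r\<in>space M. F r <= x + \<delta>}"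
  unfolding e
 proof (intro integral_mono i ii)
  fix r assume "r \<in> space M"
  then show "ramp x \<delta> (F r) <= indicator {r\<in>space M. F r <= x + \<delta>} r"
   using p(2)[of x "F r"] p(6)[of x "F r"] by (auto split: split_indicator)
 qed
qed

lemma normal_cdf_lipschitz:
 assumes "0 <= \<delta>" shows "measure gauss {..x + \<delta>} <= measure gauss {..x} + \<delta>"
proof -
 interpret N: real_distribution gauss by (rule real_dist_normal_dist)
 have b: "phi y <= 1" for y
 proof -
  have "1 <= sqrt (2 * pi)" using pi_ge_two by (intro real_le_rsqrt) simp
  then have "1 / sqrt (2 * pi) <= 1" by simp
  then have "1 / sqrt (2 * pi) * exp (- y\<^sup>2 / 2) <= 1 * 1" by (intro mult_mono) auto
  then show ?thesis by (simp add: std_normal_density_def)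
 qed
 have "emeasure gauss {x<..x + \<delta>} = (\<integral>\<^sup>+ y. ennreal (phi y) * indicator {x<..x + \<delta>} y \<partial>lborel)"
  by (rule emeasure_density) auto
 also have "... <= (\<integral>\<^sup>+ y. indicator {x<..x + \<delta>} y \<partial>lborel)"
  using b by (intro nn_integral_mono) (auto split: split_indicator)
 also have "... = ennreal \<delta>" using assms by simp
 finally have "measure gauss {x<..x + \<delta>} <= \<delta>" using assms by (simp add: N.emeasure_eq_measure)
 moreover have "measure gauss {..x + \<delta>} = measure gauss {..x} + measure gauss {x<..x + \<delta>}"
 proof -
  have "{..x + \<delta>} = {..x} \<union> {x<..x + \<delta>}" using assms by auto
  moreover have "measure gauss ({..x} \<union> {x<..x + \<delta>}) = measure gauss {..x} + measure gauss {x<..x + \<delta>}"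
   by (rule N.finite_measure_Union) auto
  ultimately show ?thesis by simp
 qed
 ultimately show ?thesis by simp
qed

lemma (in prob_space) cdf_distance_le:
 assumes F [measurable]: "F \<in> borel_measurable M"
  and R: "!!x \<delta>. 0 < \<delta> ==> \<bar>expectation (%r. ramp x \<delta> (F r)) - (LINT y|lborel. ramp x \<delta> y * phi y)\<bar> <= R"
 shows "\<bar>prob {r\<in>space M. F r <= x} - measure gauss {..x}\<bar> <= R"
proof (rule field_le_epsilon)
 fix e :: real assume e: "0 < e"
 interpret N: real_distribution gauss by (rule real_dist_normal_dist)
 have I: "(LINT y|lborel. ramp z e y * phi y) = N.expectation (%y. ramp z e y)" for z
  using ramp_props(7)[OF e, of z] by (subst integral_density) (auto simp: mult.commute)
 have S: "{y. y <= z} = {..z}" for z :: real by auto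
 have n: "measure gauss {..z} <= (LINT y|lborel. ramp z e y * phi y)"
  "(LINT y|lborel. ramp z e y * phi y) <= measure gauss {..z + e}" for z
  unfolding I using N.cdf_ramp[OF _ e, of "%y. y" z] by (simp_all add: S)
 have "prob {r\<in>space M. F r <= x} <= measure gauss {..x} + (R + e)"
  using cdf_ramp(1)[OF F e, of x] R[OF e, of x] n(2)[of x] normal_cdf_lipschitz[of e x] e by (simp add: abs_le_iff)
 moreover have "measure gauss {..x} <= prob {r\<in>space M. F r <= x} + (R + e)"
  using cdf_ramp(2)[OF F e, of "x - e"] R[OF e, of "x - e"] n(1)[of "x - e"] normal_cdf_lipschitz[of e "x - e"] e by (simp add: abs_le_iff)
 ultimately show "\<bar>prob {r\<in>space M. F r <= x} - measure gauss {..x}\<bar> <= R + e" by (simp add: abs_le_iff)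
qed

lemma rateK_nonneg: "1 <= n ==> 0 <= rateK q n" by (auto simp: rateK_def)
lemma rateW_nonneg: "1 <= n ==> 0 <= rateW q n" by (auto simp: rateW_def)

lemma rateK_tendsto: assumes "2 < q" shows "rateK q \<longlonglongrightarrow> 0"
proof -
 consider "4 < q" | "q = 4" | "q < 4" by linarith
 then show ?thesis
 proof cases
  case 1
  have "(%n. real n powr (- 1 / 2)) \<longlonglongrightarrow> 0" by real_asymp
  then show ?thesis using 1 by (simp add: rateK_def[abs_def])
 next
  case 2
  have "(%n. real n powr (- 1 / 2) * ln (real n)) \<longlonglongrightarrow> 0" by real_asymp
  then show ?thesis using 2 by (simp add: rateK_def[abs_def])
 next
  case 3
  have "(%n. real n powr ((2 - q) / 4)) \<longlonglongrightarrow> 0"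
   using assms by (intro tendsto_neg_powr filterlim_real_sequentially) auto
  then show ?thesis using 3 by (simp add: rateK_def[abs_def])
 qed
qed

context moving_average_functional
begin

definition normal_rates :: "real => bool" where
 "normal_rates C \<longleftrightarrow>
  (\<forall>n h. 1 <= n --> 0 < vn n --> (\<alpha> * \<beta> = 3 --> 2 <= n) --> (\<forall>x y. \<bar>h x - h y\<bar> <= \<bar>x - y\<bar>) -->
   \<bar>mean_of h n - normal_mean h\<bar> <= C * rateW (\<alpha> * \<beta>) n) \<and>
  (\<forall>n x. 1 <= n --> 0 < vn n --> (\<alpha> * \<beta> = 4 --> 2 <= n) -->
   \<bar>prob {r\<in>space M. V n r / vn n <= x} - measure gauss {..x}\<bar> <= C * rateK (\<alpha> * \<beta>) n)"

text \<open>The second rate is stated for \<open>\<alpha>\<beta> = 3\<close> and \<open>n = 1\<close> too, where the logarithm in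
the first one vanishes; the summand \<open>\<bar>G3 hexp 1\<bar> + 1\<close> of \<open>C6\<close> covers this case.\<close>
lemma rates:
 assumes pos: "0 < (\<Sum>\<^sub>\<infinity>j\<in>UNIV. ac j)"
 obtains C where "0 < C" "normal_rates C"
proof -
 obtain \<sigma> where \<sigma>: "0 < \<sigma>" "!!n. 0 < vn n ==> \<sigma> <= vn n" using vn_lower_bound[OF pos] by blast
 have s2: "2 * hexp = \<alpha> * \<beta>" by (simp add: hexp_def)
 define \<kappa> where "\<kappa> = C\<^sub>f / \<sigma>"
 have \<kappa>: "0 <= \<kappa>" using C\<^sub>f \<sigma> by (simp add: \<kappa>_def)
 obtain C3 where C3: "0 < C3" "!!n. 1 <= n ==> (\<alpha> * \<beta> = 3 --> 2 <= n) ==> G3 hexp n <= C3 * rateW (\<alpha> * \<beta>) n \<and> 1 / sqrt n <= C3 * rateW (\<alpha> * \<beta>) n"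
  using G3_rate[of hexp] unfolding s2 by blast
 obtain C4 where C4: "0 < C4" "!!n. 1 <= n ==> (\<alpha> * \<beta> = 4 --> 2 <= n) ==> sqrt (G4 hexp n) <= C4 * rateK (\<alpha> * \<beta>) n"
  using G4_rate[of hexp] unfolding s2 by blast
 obtain C5 where C5: "0 < C5" "!!n. 1 <= n ==> (\<alpha> * \<beta> = 4 --> 2 <= n) ==> rateW (\<alpha> * \<beta>) n <= C5 * rateK (\<alpha> * \<beta>) n"
  using rateW_le_rateK[OF \<alpha>\<beta>] by blast
 define C6 where "C6 = C3 * C5 + \<bar>G3 hexp 1\<bar> + 1"
 have C6: "G3 hexp n <= C6 * rateK (\<alpha> * \<beta>) n \<and> 1 / sqrt n <= C6 * rateK (\<alpha> * \<beta>) n" if n: "1 <= n" "\<alpha> * \<beta> = 4 --> 2 <= n" for n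
 proof (cases "\<alpha> * \<beta> = 3 --> 2 <= n")
  case True
  have "C3 * rateW (\<alpha> * \<beta>) n <= C3 * (C5 * rateK (\<alpha> * \<beta>) n)" using C3(1) C5(2)[OF n] by (intro mult_left_mono) auto
  also have "... <= C6 * rateK (\<alpha> * \<beta>) n"
   using rateK_nonneg[OF n(1), of "\<alpha> * \<beta>"] by (simp add: C6_def distrib_right)
  finally show ?thesis using C3(2)[OF n(1) True] by linarith
 next
  case False
  then have n1: "n = 1" using n by auto
  have r1: "rateK (\<alpha> * \<beta>) 1 = 1" using False by (simp add: rateK_def)
  have "0 <= C3 * C5" using C3(1) C5(1) by simp
  then have "\<bar>G3 hexp 1\<bar> <= C6" "1 <= C6" unfolding C6_def by linarith+
  then show ?thesis unfolding n1 r1 by simp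
 qed
 define a1 a2 where "a1 = 11 * \<kappa>^2 * A\<^sub>0 ^ 3" and "a2 = 44 * (\<kappa>^2 * (1 + \<kappa>) * Q\<^sub>0)"
 define b1 b2 b3 where "b1 = 6 * \<kappa>^2 * A\<^sub>0 ^ 3" and "b2 = (22 + 4 * (\<kappa> * A\<^sub>0)) * (\<kappa>^2 * (1 + \<kappa>) * Q\<^sub>0)"
  and "b3 = sqrt (40 * (\<kappa>^2 * (1 + \<kappa>^2) * (2 * Q\<^sub>0)))"
 have nn: "0 <= a1" "0 <= a2" "0 <= b1" "0 <= b2" "0 <= b3"
  using \<kappa> A\<^sub>0_nonneg Q\<^sub>0_nonneg by (auto simp: a1_def a2_def b1_def b2_def b3_def)
 define CW CK where "CW = a1 * C3 + a2 * C3" and "CK = b1 * C6 + b2 * C6 + b3 * C4"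
 have C6p: "0 <= C6" using C3(1) C5(1) by (simp add: C6_def)
 have CWK: "0 <= CW" "0 <= CK" using nn C3(1) C4(1) C6p by (simp_all add: CW_def CK_def)
 show ?thesis
 proof (rule that)
  show "0 < CW + CK + 1" using CWK by linarith
  show "normal_rates (CW + CK + 1)"
   unfolding normal_rates_def
  proof (intro conjI allI impI)
   fix n :: nat and h :: "real => real"
   assume n: "1 <= n" and v: "0 < vn n" and q: "\<alpha> * \<beta> = 3 --> 2 <= n" and h': "\<forall>x y. \<bar>h x - h y\<bar> <= \<bar>x - y\<bar>"
   have h: "\<bar>h x - h y\<bar> <= \<bar>x - y\<bar>" for x y using h' by blast
   have "\<bar>mean_of h n - normal_mean h\<bar> <= a1 * (1 / sqrt n) + a2 * G3 hexp n"
    unfolding a1_def a2_def \<kappa>_def by (rule lipschitz_normal_bound[OF n \<sigma>(1) \<sigma>(2)[OF v] h])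
   also have "... <= a1 * (C3 * rateW (\<alpha> * \<beta>) n) + a2 * (C3 * rateW (\<alpha> * \<beta>) n)"
    using C3(2)[OF n q] nn by (intro add_mono mult_left_mono) auto
   also have "... = CW * rateW (\<alpha> * \<beta>) n" by (simp add: CW_def algebra_simps)
   also have "... <= (CW + CK + 1) * rateW (\<alpha> * \<beta>) n" using CWK rateW_nonneg[OF n] by (intro mult_right_mono) auto
   finally show "\<bar>mean_of h n - normal_mean h\<bar> <= (CW + CK + 1) * rateW (\<alpha> * \<beta>) n" .
  next
   fix n :: nat and x :: real
   assume n: "1 <= n" and v: "0 < vn n" and q: "\<alpha> * \<beta> = 4 --> 2 <= n"
   have "\<bar>prob {r\<in>space M. V n r / vn n <= x} - measure gauss {..x}\<bar>
    <= b1 * (1 / sqrt n) + b2 * G3 hexp n + b3 * sqrt (G4 hexp n)"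
   proof (rule cdf_distance_le)
    fix x \<delta> :: real assume \<delta>: "0 < \<delta>"
    show "\<bar>expectation (%r. ramp x \<delta> (V n r / vn n)) - (LINT y|lborel. ramp x \<delta> y * phi y)\<bar>
     <= b1 * (1 / sqrt n) + b2 * G3 hexp n + b3 * sqrt (G4 hexp n)"
     unfolding b1_def b2_def b3_def \<kappa>_def
     by (rule monotone_normal_bound[OF n \<sigma>(1) \<sigma>(2)[OF v] ramp_props(4)[OF \<delta>]]) (use \<delta> ramp_props(1-3)[OF \<delta>] in auto)
   qed measurable
   also have "... <= b1 * (C6 * rateK (\<alpha> * \<beta>) n) + b2 * (C6 * rateK (\<alpha> * \<beta>) n) + b3 * (C4 * rateK (\<alpha> * \<beta>) n)"
    using C6[OF n q] C4(2)[OF n q] nn by (intro add_mono mult_left_mono) auto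
   also have "... = CK * rateK (\<alpha> * \<beta>) n" by (simp add: CK_def algebra_simps)
   also have "... <= (CW + CK + 1) * rateK (\<alpha> * \<beta>) n" using CWK rateK_nonneg[OF n] by (intro mult_right_mono) auto
   finally show "\<bar>prob {r\<in>space M. V n r / vn n <= x} - measure gauss {..x}\<bar> <= (CW + CK + 1) * rateK (\<alpha> * \<beta>) n" .
  qed
 qed
qed

lemma clt:
 assumes pos: "0 < (\<Sum>\<^sub>\<infinity>j\<in>UNIV. ac j)"
 shows "weak_conv_m (%n. distr M borel (%r. V n r / vn n)) gauss"
proof -
 obtain C where C: "0 < C" "normal_rates C" by (rule rates[OF pos])
 note C = C(1) C(2)[unfolded normal_rates_def, THEN conjunct1] C(2)[unfolded normal_rates_def, THEN conjunct2]
 show ?thesis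
  unfolding weak_conv_m_def weak_conv_def
 proof (intro allI impI)
  fix x
  have cdf: "cdf (distr M borel (%r. V n r / vn n)) x = prob {r\<in>space M. V n r / vn n <= x}" for n
   unfolding cdf_def by (subst measure_distr) (auto intro!: arg_cong[of _ _ prob])
  have "eventually (%n. 0 < vn n) sequentially" using pos by (intro order_tendstoD(1)[OF vn_limit(2)]) simp
  then have "eventually (%n. norm (prob {r\<in>space M. V n r / vn n <= x} - measure gauss {..x}) <= C * rateK (\<alpha> * \<beta>) n) sequentially"
   using eventually_ge_at_top[of 2] by eventually_elim (use C(3) in auto)
  moreover have "(%n. C * rateK (\<alpha> * \<beta>) n) \<longlonglongrightarrow> 0" by (intro tendsto_mult_right_zero rateK_tendsto \<alpha>\<beta>)
  ultimately have "(%n. prob {r\<in>space M. V n r / vn n <= x} - measure gauss {..x}) \<longlonglongrightarrow> 0"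
   by (rule Lim_null_comparison)
  then show "(%n. cdf (distr M borel (%r. V n r / vn n)) x) \<longlonglongrightarrow> cdf gauss x"
   unfolding cdf by (simp add: LIM_zero_iff cdf_def)
 qed
qed

end

theorem theorem1p1:
  fixes M :: "'a measure" and N :: "'b measure" and Z :: "'b \<Rightarrow> real"
    and L X :: "real \<Rightarrow> 'a \<Rightarrow> real"
    and \<nu> :: "real measure" and \<kappa> g f :: "real \<Rightarrow> real"
    and \<alpha> \<beta> \<gamma> C\<^sub>0 K :: real
  assumes M: "prob_space M"
    and \<beta>: "0 < \<beta>" "\<beta> < 2" and \<alpha>: "0 < \<alpha>"
    and \<alpha>\<beta>: "2 < \<alpha> * \<beta>" and \<gamma>: "- 1 / \<beta> < \<gamma>"
    and L: "two_sided_levy_process M L"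
    and \<nu>: "no_gaussian_with_levy_measure M L \<nu>"
    and \<kappa>: "\<kappa> \<in> borel_measurable borel" "\<And>x. 0 \<le> \<kappa> x" "\<nu> = density lborel (\<lambda>x. ennreal (\<kappa> x))"
    and C\<^sub>0: "0 < C\<^sub>0" and \<kappa>_le: "\<And>x. x \<noteq> 0 \<Longrightarrow> \<kappa> x \<le> C\<^sub>0 * \<bar>x\<bar> powr (- 1 - \<beta>)"
    and g: "g \<in> borel_measurable borel"
    and X: "\<And>t. has_levy_integral M L (\<lambda>s. indicator {..t} s * g (t - s)) (X t)"
    and K: "0 < K"
    and g_le: "\<And>x. 0 < x \<Longrightarrow> \<bar>g x\<bar> \<le>
      K * (x powr \<gamma> * indicator {0<..<1} x + x powr (- \<alpha>) * indicator {1..} x)"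
    and f: "C2_bounded f"
    and N: "prob_space N" and Z: "distributed N lborel Z std_normal_density"
  defines "V \<equiv> partial_sum M f X"
    and "v\<^sub>n \<equiv> partial_sum_sd M f X"
    and "v2 \<equiv> (\<Sum>\<^sub>\<infinity>j\<in>UNIV. autocov M f X j)"
  shows "(\<lambda>j. \<bar>autocov M f X j\<bar>) summable_on UNIV \<and> 0 \<le> v2 \<and> v\<^sub>n \<longlonglongrightarrow> sqrt v2 \<and>
    (0 < sqrt v2 \<longrightarrow>
       weak_conv_m (\<lambda>n. distr M borel (\<lambda>\<omega>. V n \<omega> / v\<^sub>n n)) std_normal_distribution \<and>
       (\<exists>C>0. \<forall>n\<ge>1. 0 < v\<^sub>n n \<longrightarrow>
          ((\<alpha> * \<beta> = 3 \<longrightarrow> 2 \<le> n) \<longrightarrow>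
             wasserstein_dist M (\<lambda>\<omega>. V n \<omega> / v\<^sub>n n) N Z \<le> ereal (C *
               (if \<alpha> * \<beta> > 3 then real n powr (- 1 / 2)
                else if \<alpha> * \<beta> = 3 then real n powr (- 1 / 2) * ln (real n)
                else real n powr ((2 - \<alpha> * \<beta>) / 2)))) \<and>
          ((\<alpha> * \<beta> = 4 \<longrightarrow> 2 \<le> n) \<longrightarrow>
             kolmogorov_dist M (\<lambda>\<omega>. V n \<omega> / v\<^sub>n n) N Z \<le> C *
               (if \<alpha> * \<beta> > 4 then real n powr (- 1 / 2)
                else if \<alpha> * \<beta> = 4 then real n powr (- 1 / 2) * ln (real n)
                else real n powr ((2 - \<alpha> * \<beta>) / 4)))))"
proof -
 interpret prob_space M by (rule M)
 interpret levy_space M L by unfold_locales (rule L)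
 obtain \<Lambda> where \<Lambda>: "levy_random_measure M L \<Lambda>" using X[of 0] unfolding has_levy_integral_def by blast
 interpret levy_noise M L \<Lambda> by unfold_locales (rule \<Lambda>)
 define G where "G u = indicator {0..} u * g u" for u :: real
 obtain C\<^sub>f where Cf: "0 < C\<^sub>f" "!!x y. \<bar>f x - f y\<bar> <= C\<^sub>f * min 1 \<bar>x - y\<bar>"
  "!!x a b. \<bar>(f (x + a + b) - f (x + a)) - (f (x + b) - f x)\<bar> <= C\<^sub>f * (min 1 \<bar>a\<bar> * min 1 \<bar>b\<bar>)"
  using C2_bounded_increments[OF f] by blast
 have fm: "f \<in> borel_measurable borel"
 proof (intro borel_measurable_continuous_onI lipschitz_on_continuous_on[of C\<^sub>f] lipschitz_onI)
  show "dist (f x) (f y) <= C\<^sub>f * dist x y" for x y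
  proof -
   have "\<bar>f x - f y\<bar> <= C\<^sub>f * min 1 \<bar>x - y\<bar>" by (rule Cf)
   also have "... <= C\<^sub>f * \<bar>x - y\<bar>" using Cf(1) by (intro mult_left_mono) auto
   finally show ?thesis by (simp add: dist_real_def)
  qed
 qed (use Cf(1) in auto)
 interpret moving_average_functional M L \<Lambda> G X "C\<^sub>0 * (1 / (2 - \<beta>) + 4 / \<beta>)" \<alpha> \<beta> K f C\<^sub>f
 proof unfold_locales
  show "G \<in> borel_measurable borel" unfolding G_def using g by measurable
  have "(%s. G (t - s)) = (%s. indicator {..t} s * g (t - s))" for t
   by (auto simp: G_def fun_eq_iff split: split_indicator)
  then show "has_levy_integral M L (%s. G (t - s)) (X t)" for t using X[of t] by simp
  show "- Re (w \<theta>) <= C\<^sub>0 * (1 / (2 - \<beta>) + 4 / \<beta>) * \<bar>\<theta>\<bar> powr \<beta>" for \<theta>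
   by (rule levy_exponent_bound[OF \<nu> \<kappa> \<kappa>_le C\<^sub>0 \<beta>])
  show "0 <= C\<^sub>0 * (1 / (2 - \<beta>) + 4 / \<beta>)" using C\<^sub>0 \<beta> by simp
  show "G u = 0" if "u < 0" for u using that by (simp add: G_def)
  show "\<bar>G u\<bar> <= K * u powr - \<alpha>" if "1 <= u" for u using that g_le[of u] by (simp add: G_def)
 qed (use \<beta> \<alpha> \<alpha>\<beta> K Cf fm in auto)
 note defs = V_def v\<^sub>n_def v2_def
 have Zm [measurable]: "Z \<in> borel_measurable N" using distributed_measurable[OF Z] by simp
 have Zd: "distr N lborel Z = gauss" by (rule distributed_distr_eq_density[OF Z])
 have Zcdf: "measure N {\<omega>\<in>space N. Z \<omega> <= x} = measure gauss {..x}" for x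
  unfolding Zd[symmetric] by (subst measure_distr) (auto intro!: arg_cong[of _ _ "measure N"])
 have ZE: "prob_space.expectation N (%\<omega>. h (Z \<omega>)) = normal_mean h" if "h \<in> borel_measurable borel" for h
  using distributed_integral[OF Z, of h] that by (simp add: mult.commute)
 show ?thesis
 proof (intro conjI impI)
  show "(%j. \<bar>autocov M f X j\<bar>) summable_on UNIV" by (rule ac_summable)
  show "0 <= v2" unfolding defs by (rule vn_limit(1))
  show "v\<^sub>n \<longlonglongrightarrow> sqrt v2" unfolding defs by (rule vn_limit(2))
  assume "0 < sqrt v2"
  then have pos: "0 < (\<Sum>\<^sub>\<infinity>j\<in>UNIV. autocov M f X j)" by (simp add: defs)
  show "weak_conv_m (%n. distr M borel (%\<omega>. V n \<omega> / v\<^sub>n n)) gauss"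
   unfolding defs by (rule clt[OF pos])
  obtain C where C: "0 < C" "normal_rates C" by (rule rates[OF pos])
  note C = C(1) C(2)[unfolded normal_rates_def, THEN conjunct1] C(2)[unfolded normal_rates_def, THEN conjunct2]
  have W: "wasserstein_dist M (%\<omega>. V n \<omega> / v\<^sub>n n) N Z <= ereal (C * rateW (\<alpha> * \<beta>) n)"
   if n: "1 <= n" "0 < v\<^sub>n n" "\<alpha> * \<beta> = 3 --> 2 <= n" for n
   unfolding wasserstein_dist_def
  proof (rule SUP_least)
   fix h :: "real => real" assume "h \<in> {h. 1-lipschitz_on UNIV h}"
   then have lip: "1-lipschitz_on UNIV h" by simp
   then have h: "\<bar>h x - h y\<bar> <= \<bar>x - y\<bar>" for x y using lipschitz_onD[OF lip, of x y] by (simp add: dist_real_def)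
   have hm: "h \<in> borel_measurable borel" by (intro borel_measurable_continuous_onI lipschitz_on_continuous_on[OF lip])
   show "ereal \<bar>expectation (%\<omega>. h (V n \<omega> / v\<^sub>n n)) - prob_space.expectation N (%\<omega>. h (Z \<omega>))\<bar> <= ereal (C * rateW (\<alpha> * \<beta>) n)"
    unfolding ZE[OF hm] defs using C(2)[rule_format, of n h] n h by (simp add: defs)
  qed
  have Kol: "kolmogorov_dist M (%\<omega>. V n \<omega> / v\<^sub>n n) N Z <= C * rateK (\<alpha> * \<beta>) n"
   if n: "1 <= n" "0 < v\<^sub>n n" "\<alpha> * \<beta> = 4 --> 2 <= n" for n
   unfolding kolmogorov_dist_def by (rule cSUP_least) (use C(3)[rule_format, of n] n in \<open>simp_all add: Zcdf defs\<close>)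
  show "\<exists>C>0. \<forall>n\<ge>1. 0 < v\<^sub>n n -->
     ((\<alpha> * \<beta> = 3 --> 2 <= n) -->
       wasserstein_dist M (%\<omega>. V n \<omega> / v\<^sub>n n) N Z <= ereal (C *
        (if \<alpha> * \<beta> > 3 then real n powr (- 1 / 2)
        else if \<alpha> * \<beta> = 3 then real n powr (- 1 / 2) * ln (real n)
        else real n powr ((2 - \<alpha> * \<beta>) / 2)))) \<and>
     ((\<alpha> * \<beta> = 4 --> 2 <= n) -->
       kolmogorov_dist M (%\<omega>. V n \<omega> / v\<^sub>n n) N Z <= C *
        (if \<alpha> * \<beta> > 4 then real n powr (- 1 / 2)
        else if \<alpha> * \<beta> = 4 then real n powr (- 1 / 2) * ln (real n)
        else real n powr ((2 - \<alpha> * \<beta>) / 4)))"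
   using C(1) W[unfolded rateW_def] Kol[unfolded rateK_def] by blast
 qed
qed

end
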